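(* Let $s\ge 3$ be an integer and let $\mathcal F\in C^{s+1}(\mathbb R^{3\times 3}_{0,\mathrm{sym}};\mathbb R)$ satisfy: (i) (isotropy) $\mathcal F(\mathbb Q)=\mathcal F(\mathbb R\mathbb Q\mathbb R^t)$ for all $\mathbb R\in O(3)$ and all $\mathbb Q\in\mathbb R^{3\times3}_{0,\mathrm{sym}}$; (ii) ($\Lambda$-convexity) there exists $\Lambda\ge 0$ such that $\mathcal G(\mathbb Q):=\mathcal F(\mathbb Q)+\Lambda|\mathbb Q|^2$ is strictly convex and non-negative; (iii) (growth) there exist a constant $\bar C>0$ and an exponent $q<5$ such that $|\partial\mathcal F(\mathbb Q)|\le \bar C(1+|\mathbb Q|^q)$ for all $\mathbb Q$. Let $T>0$ and let $[\mathbf v,\mathbb P,\mathbb Q]$ be a dissipative solution in $(0,T)\times\mathcal T^3$ of the inviscid Qian–Sheng system $$\begin{aligned}&\mathrm{div}_x\mathbf v=0,\\ &\partial_t\mathbf v+\mathbf v\cdot\nabla_x\mathbf v+\nabla_x\Pi=-\mathrm{div}_x(\nabla_x\mathbb Q\odot\nabla_x\mathbb Q),\\ &\partial_t\mathbb Q+\mathbf v\cdot\nabla_x\mathbb Q=\mathbb P,\\ &\partial_t\mathbb P+\mathbf v\cdot\nabla_x\mathbb P=-\frac{\partial\mathcal F}{\partial\mathbb Q}(\mathbb Q)+\Delta\mathbb Q-\lambda\mathbb I,\end{aligned}$$ with associated dissipation defect $\mathcal D$ and defect measures $\mathbb R^1,\mathbb R^2$, enjoying the regularity $$\mathbf v\in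 C([0,T];W^{s,2}(\mathcal T^3;\mathbb R^3)),\quad \mathbb P\in C([0,T];W^{s,2}(\mathcal T^3;\mathbb R^{3\times3}_{0,\mathrm{sym}})),\quad \mathbb Q\in C([0,T];W^{s+1,2}(\mathcal T^3;\mathbb R^{3\times3}_{0,\mathrm{sym}})).$$ Then $[\mathbf v,\mathbb P,\mathbb Q]$ is a strong solution of the system; in particular, the dissipation defect $\mathcal D$ as well as the defect measures $\mathbb R^1$, $\mathbb R^2$ vanish identically in $[0,T]\times\mathcal T^3$.
   Context: $\mathcal T^3=([-\pi,\pi]|_{\{-\pi,\pi\}})^3$ is the flat $3$-torus. $\mathbb R^{3\times3}_{0,\mathrm{sym}}$ is the space of real symmetric traceless $3\times3$ matrices, with inner product $A:B=\mathrm{tr}(AB)$ and Frobenius norm $|A|$. $\partial\mathcal F(\mathbb Q)=\frac{\partial\mathcal F}{\partial\mathbb Q}(\mathbb Q)$ is the gradient of $\mathcal F$. $\nabla_x\mathbb Q\odot\nabla_x\mathbb Q$ is the matrix with $(i,j)$ entry $\partial_i\mathbb Q:\partial_j\mathbb Q$. For a vector $\mathbf v$ and matrices $\mathbb Q,\varphi$, $(\mathbf v\otimes\mathbb Q):\nabla_x\varphi=\sum_{i,j,k}v_kQ_{ij}\,\partial_{x_k}\varphi_{ij}$; similarly $:$ between tensors of equal order is full contraction. $\mathcal M(\mathcal T^3)$ denotes finite signed Radon measures with total variation norm, and $C_{\rm weak}([0,T];X)$ functions continuous in time for the weak topology of $X$. The scalar functions $\Pi$ and $\lambda$ are Lagrange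 multipliers for the divergence-free and zero-trace constraints; $\mathbb I$ is the identity matrix. A strong solution is a triple in the regularity class stated in the claim which satisfies the equations (for suitable $\Pi,\lambda$) almost everywhere. **Dissipative solution.** Fix $\Lambda$ and $\mathcal G=\mathcal F+\Lambda|\cdot|^2$ as in assumption (ii) on $\mathcal F$. A triple $[\mathbf v,\mathbb P,\mathbb Q]$, with $\mathbb P,\mathbb Q$ taking values in $\mathbb R^{3\times3}_{0,\mathrm{sym}}$, is a dissipative solution in $(0,T)\times\mathcal T^3$ if $$\mathbf v\in C_{\rm weak}([0,T];L^2(\mathcal T^3;\mathbb R^3)),\quad \mathbb P\in C_{\rm weak}([0,T];L^2(\mathcal T^3;\mathbb R^{3\times3})),$$ $$\mathbb Q\in C_{\rm weak}([0,T];W^{1,2}(\mathcal T^3;\mathbb R^{3\times3}))\cap C([0,T];L^2(\mathcal T^3;\mathbb R^{3\times3})),$$ and there exist tensor-valued measures (the defect measures) $\mathbb R^1\in L^\infty(0,T;\mathcal M(\mathcal T^3;\mathbb R^{3\times3}))$, $\mathbb R^2\in L^\infty(0,T;\mathcal M(\mathcal T^3;\mathbb R^{3\times3\times3}))$ (weakly-( * ) measurable in time), a function (the dissipation defect) $\mathcal D\in L^\infty(0,T)$, $\mathcal D\ge0$, and a constant $c>0$ such that for every $\tau\in[0,T]$: (1) $\int_{\mathcal T^3}\mathbf v(\tau,\cdot)\cdot\nabla_x\varphi\,dx=0$ for any $\varphi\in C^\infty(\mathcal T^3)$; (2) for any $\varphi\in C^\infty([0,T]\times\mathcal T^3;\mathbb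 R^3)$ with $\mathrm{div}_x\varphi=0$, $$\Big[\int_{\mathcal T^3}\mathbf v\cdot\varphi\,dx\Big]_{t=0}^{t=\tau}=\int_0^\tau\!\!\int_{\mathcal T^3}\big[\mathbf v\cdot\partial_t\varphi+(\mathbf v\otimes\mathbf v):\nabla_x\varphi+(\nabla_x\mathbb Q\odot\nabla_x\mathbb Q):\nabla_x\varphi\big]dx\,dt+\int_0^\tau\langle\mathbb R^1;\nabla_x\varphi\rangle\,dt;$$ (3) for any $\varphi\in C^\infty([0,T]\times\mathcal T^3;\mathbb R^{3\times3})$, $$\Big[\int_{\mathcal T^3}\mathbb Q:\varphi\,dx\Big]_{t=0}^{t=\tau}=\int_0^\tau\!\!\int_{\mathcal T^3}\big[\mathbb Q:\partial_t\varphi+(\mathbf v\otimes\mathbb Q):\nabla_x\varphi+\mathbb P:\varphi\big]dx\,dt;$$ (4) for any $\varphi\in C^\infty([0,T]\times\mathcal T^3;\mathbb R^{3\times3}_{0,\mathrm{sym}})$, $$\Big[\int_{\mathcal T^3}\mathbb P:\varphi\,dx\Big]_{t=0}^{t=\tau}=\int_0^\tau\!\!\int_{\mathcal T^3}\Big[\mathbb P:\partial_t\varphi+(\mathbf v\otimes\mathbb P):\nabla_x\varphi-\frac{\partial\mathcal F(\mathbb Q)}{\partial\mathbb Q}:\varphi-\nabla_x\mathbb Q:\nabla_x\varphi\Big]dx\,dt+\int_0^\tau\langle\mathbb R^2;\nabla_x\varphi\rangle\,dt;$$ (5) (energy balance) $$\Big[\int_{\mathcal T^3}\big(\tfrac12|\mathbf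 v|^2+\tfrac12|\mathbb P|^2+\tfrac12|\nabla_x\mathbb Q|^2+\mathcal G(\mathbb Q)\big)dx\Big]_{t=0}^{t=\tau}+\mathcal D(\tau)=2\Lambda\int_0^\tau\!\!\int_{\mathcal T^3}\mathbb Q:\mathbb P\,dx\,dt;$$ (6) (defect domination) $$\int_0^\tau\big[\|\mathbb R^1(t,\cdot)\|_{\mathcal M(\mathcal T^3)}+\|\mathbb R^2(t,\cdot)\|_{\mathcal M(\mathcal T^3)}\big]dt\le c\int_0^\tau\mathcal D(t)\,dt.$$ "Vanish identically" for $\mathcal D$, $\mathbb R^1$, $\mathbb R^2$ is understood as elements of the respective spaces. *)

theory Defs
  imports "HOL-Analysis.Analysis"
begin

section \<open>Differentiability classes\<close>

text \<open>
  \<open>Ck_on k S f\<close>: \<open>f\<close> is of class \<open>C^k\<close> on the convex set \<open>S\<close>, with derivatives up to the boundary.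
  A derivative within \<open>S\<close> is determined only on the directions tangent to the affine hull of \<open>S\<close>,
  hence the restriction of \<open>h\<close>.  This covers both a linear subspace and \<open>[0,T] \<times> \<real>\<^sup>3\<close>.
\<close>

fun Ck_on :: "nat \<Rightarrow> 'a::euclidean_space set \<Rightarrow> ('a \<Rightarrow> 'b::euclidean_space) \<Rightarrow> bool" where
  "Ck_on 0 S f \<longleftrightarrow> continuous_on S f"
| "Ck_on (Suc k) S f \<longleftrightarrow>
     (\<exists>f'. (\<forall>x\<in>S. (f has_derivative f' x) (at x within S)) \<and>
           (\<forall>h\<in>span {x - y | x y. x \<in> S \<and> y \<in> S}. Ck_on k S (\<lambda>x. f' x h)))"

definition smooth_on :: "'a::euclidean_space set \<Rightarrow> ('a \<Rightarrow> 'b::euclidean_space) \<Rightarrow> bool" where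
  "smooth_on S f \<longleftrightarrow> (\<forall>k. Ck_on k S f)"

definition strictly_convex_on :: "'a::real_vector set \<Rightarrow> ('a \<Rightarrow> real) \<Rightarrow> bool" where
  "strictly_convex_on S f \<longleftrightarrow> convex S \<and>
     (\<forall>x\<in>S. \<forall>y\<in>S. \<forall>u. x \<noteq> y \<longrightarrow> 0 < u \<longrightarrow> u < 1 \<longrightarrow>
        f ((1 - u) *\<^sub>R x + u *\<^sub>R y) < (1 - u) * f x + u * f y)"

section \<open>Symmetric traceless matrices\<close>

text \<open>
  On \<open>real^3^3\<close> the inner product \<open>A \<bullet> B\<close> is the full contraction \<open>A : B\<close> and \<open>norm\<close> is the
  Frobenius norm; likewise on \<open>real^3^3^3\<close>.
\<close>

definition Sym0 :: "(real^3^3) set" where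
  "Sym0 = {A. transpose A = A \<and> trace A = 0}"

text \<open>The gradient of a function on \<open>Sym0\<close>, itself an element of \<open>Sym0\<close>.\<close>

definition grad_Sym0 :: "(real^3^3 \<Rightarrow> real) \<Rightarrow> real^3^3 \<Rightarrow> real^3^3" where
  "grad_Sym0 F A = (THE G. G \<in> Sym0 \<and> (F has_derivative (\<lambda>H. G \<bullet> H)) (at A within Sym0))"

section \<open>The torus\<close>

text \<open>
  The flat torus is represented by its half-open fundamental cell.  Lebesgue classes of functions
  and Borel measures on the torus are those on the cell (the quotient map restricted to the cell is
  a measure-preserving Borel isomorphism), and values outside the cell are irrelevant for them;
  continuous and smooth functions on the torus are periodic functions on \<open>\<real>\<^sup>3\<close>.
\<close>

definition cell :: "(real^3) set" where
  "cell = {x. \<forall>i. - pi \<le> x $ i \<and> x $ i < pi}"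

abbreviation torus :: "(real^3) measure" where
  "torus \<equiv> lebesgue_on cell"

definition periodic :: "(real^3 \<Rightarrow> 'b) \<Rightarrow> bool" where
  "periodic f \<longleftrightarrow> (\<forall>x k. f (x + (2 * pi) *\<^sub>R axis k 1) = f x)"

definition torus_smooth :: "(real^3 \<Rightarrow> 'b::euclidean_space) \<Rightarrow> bool" where
  "torus_smooth f \<longleftrightarrow> periodic f \<and> smooth_on UNIV f"

text \<open>\<open>C\<^sup>\<infinity>([0,T] \<times> T\<^sup>3)\<close>\<close>

definition test_fun :: "real \<Rightarrow> (real \<Rightarrow> real^3 \<Rightarrow> 'b::euclidean_space) \<Rightarrow> bool" where
  "test_fun T \<phi> \<longleftrightarrow> (\<forall>t\<in>{0..T}. periodic (\<phi> t)) \<and>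
     smooth_on ({0..T} \<times> UNIV) (\<lambda>(t, x). \<phi> t x)"

definition pd :: "3 \<Rightarrow> (real^3 \<Rightarrow> 'b::euclidean_space) \<Rightarrow> real^3 \<Rightarrow> 'b" where
  "pd k f x = frechet_derivative f (at x) (axis k 1)"

definition pd_t :: "real \<Rightarrow> (real \<Rightarrow> real^3 \<Rightarrow> 'b::euclidean_space) \<Rightarrow> real \<Rightarrow> real^3 \<Rightarrow> 'b" where
  "pd_t T \<phi> t x = vector_derivative (\<lambda>r. \<phi> r x) (at t within {0..T})"

text \<open>In the gradients below the last index is the one of the derivative.\<close>

definition grad_s :: "(real^3 \<Rightarrow> real) \<Rightarrow> real^3 \<Rightarrow> real^3" where
  "grad_s \<phi> x = (\<chi> k. pd k \<phi> x)"

definition grad_v :: "(real^3 \<Rightarrow> real^3) \<Rightarrow> real^3 \<Rightarrow> real^3^3" where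
  "grad_v \<phi> x = (\<chi> i k. pd k \<phi> x $ i)"

definition grad_m :: "(real^3 \<Rightarrow> real^3^3) \<Rightarrow> real^3 \<Rightarrow> real^3^3^3" where
  "grad_m \<phi> x = (\<chi> i j k. pd k \<phi> x $ i $ j)"

definition div_v :: "(real^3 \<Rightarrow> real^3) \<Rightarrow> real^3 \<Rightarrow> real" where
  "div_v \<phi> x = (\<Sum>k\<in>UNIV. pd k \<phi> x $ k)"

section \<open>Sobolev spaces on the torus\<close>

text \<open>Multi-indices are elements of \<open>nat^3\<close>.\<close>

definition mi_order :: "nat^3 \<Rightarrow> nat" where
  "mi_order \<alpha> = (\<Sum>i\<in>UNIV. \<alpha> $ i)"

definition pd_multi :: "nat^3 \<Rightarrow> (real^3 \<Rightarrow> 'b::euclidean_space) \<Rightarrow> real^3 \<Rightarrow> 'b" where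
  "pd_multi \<alpha> f = (pd 1 ^^ (\<alpha> $ 1)) ((pd 2 ^^ (\<alpha> $ 2)) ((pd 3 ^^ (\<alpha> $ 3)) f))"

definition L2 :: "(real^3 \<Rightarrow> 'b::euclidean_space) \<Rightarrow> bool" where
  "L2 f \<longleftrightarrow> f \<in> borel_measurable torus \<and> integrable torus (\<lambda>x. (norm (f x))\<^sup>2)"

definition has_weak_deriv ::
    "nat^3 \<Rightarrow> (real^3 \<Rightarrow> 'b::euclidean_space) \<Rightarrow> (real^3 \<Rightarrow> 'b) \<Rightarrow> bool" where
  "has_weak_deriv \<alpha> f g \<longleftrightarrow>
     (\<forall>\<phi>::real^3 \<Rightarrow> real. torus_smooth \<phi> \<longrightarrow>
        (\<integral>x. pd_multi \<alpha> \<phi> x *\<^sub>R f x \<partial>torus)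
          = (- 1) ^ mi_order \<alpha> *\<^sub>R (\<integral>x. \<phi> x *\<^sub>R g x \<partial>torus))"

text \<open>A representative of the square-integrable weak derivative, unique almost everywhere.\<close>

definition wD :: "nat^3 \<Rightarrow> (real^3 \<Rightarrow> 'b::euclidean_space) \<Rightarrow> real^3 \<Rightarrow> 'b" where
  "wD \<alpha> f = (if \<alpha> = 0 then f else (SOME g. L2 g \<and> has_weak_deriv \<alpha> f g))"

abbreviation wd :: "3 \<Rightarrow> (real^3 \<Rightarrow> 'b::euclidean_space) \<Rightarrow> real^3 \<Rightarrow> 'b" where
  "wd k \<equiv> wD (axis k 1)"

text \<open>The space \<open>W\<^sup>m\<^sup>,\<^sup>2(T\<^sup>3)\<close>; \<open>m = 0\<close> is \<open>L\<^sup>2(T\<^sup>3)\<close>.\<close>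

definition sob :: "nat \<Rightarrow> (real^3 \<Rightarrow> 'b::euclidean_space) \<Rightarrow> bool" where
  "sob m f \<longleftrightarrow> L2 f \<and> (\<forall>\<alpha>. mi_order \<alpha> \<le> m \<longrightarrow> (\<exists>g. L2 g \<and> has_weak_deriv \<alpha> f g))"

definition sob_inner ::
    "nat \<Rightarrow> (real^3 \<Rightarrow> 'b::euclidean_space) \<Rightarrow> (real^3 \<Rightarrow> 'b) \<Rightarrow> real" where
  "sob_inner m f g = (\<Sum>\<alpha> | mi_order \<alpha> \<le> m. \<integral>x. wD \<alpha> f x \<bullet> wD \<alpha> g x \<partial>torus)"

definition sob_norm :: "nat \<Rightarrow> (real^3 \<Rightarrow> 'b::euclidean_space) \<Rightarrow> real" where
  "sob_norm m f = sqrt (sob_inner m f f)"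

text \<open>\<open>C([0,T]; W\<^sup>m\<^sup>,\<^sup>2)\<close>\<close>

definition C_sob :: "real \<Rightarrow> nat \<Rightarrow> (real \<Rightarrow> real^3 \<Rightarrow> 'b::euclidean_space) \<Rightarrow> bool" where
  "C_sob T m u \<longleftrightarrow> (\<forall>t\<in>{0..T}. sob m (u t)) \<and>
     (\<forall>t\<in>{0..T}. ((\<lambda>r. sob_norm m (\<lambda>x. u r x - u t x)) \<longlongrightarrow> 0) (at t within {0..T}))"

text \<open>
  \<open>C\<^sub>w\<^sub>e\<^sub>a\<^sub>k([0,T]; W\<^sup>m\<^sup>,\<^sup>2)\<close>: the continuous functionals of this Hilbert space are the inner products
  with its elements.
\<close>

definition C_weak_sob :: "real \<Rightarrow> nat \<Rightarrow> (real \<Rightarrow> real^3 \<Rightarrow> 'b::euclidean_space) \<Rightarrow> bool" where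
  "C_weak_sob T m u \<longleftrightarrow> (\<forall>t\<in>{0..T}. sob m (u t)) \<and>
     (\<forall>\<psi>. sob m \<psi> \<longrightarrow> continuous_on {0..T} (\<lambda>t. sob_inner m (u t) \<psi>))"

text \<open>
  The Bochner space \<open>L\<^sup>1(0,T; W\<^sup>m\<^sup>,\<^sup>2)\<close>; by separability weak measurability is strong measurability.
\<close>

definition L1_sob :: "real \<Rightarrow> nat \<Rightarrow> (real \<Rightarrow> real^3 \<Rightarrow> 'b::euclidean_space) \<Rightarrow> bool" where
  "L1_sob T m u \<longleftrightarrow> (AE t in lebesgue_on {0<..<T}. sob m (u t)) \<and>
     (\<forall>\<psi>. sob m \<psi> \<longrightarrow> (\<lambda>t. sob_inner m (u t) \<psi>) \<in> borel_measurable (lebesgue_on {0<..<T})) \<and>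
     integrable (lebesgue_on {0<..<T}) (\<lambda>t. sob_norm m (u t))"

text \<open>\<open>w = \<partial>\<^sub>t u\<close> in the sense of distributions on \<open>(0,T) \<times> T\<^sup>3\<close>\<close>

definition has_weak_time_deriv ::
    "real \<Rightarrow> (real \<Rightarrow> real^3 \<Rightarrow> 'b::euclidean_space) \<Rightarrow> (real \<Rightarrow> real^3 \<Rightarrow> 'b) \<Rightarrow> bool" where
  "has_weak_time_deriv T u w \<longleftrightarrow> L1_sob T 0 w \<and>
     (\<forall>\<phi>::real \<Rightarrow> real^3 \<Rightarrow> real.
        test_fun T \<phi> \<and>
        (\<exists>\<epsilon>>0. \<forall>t\<in>{0..T}. t < \<epsilon> \<or> T - \<epsilon> < t \<longrightarrow> (\<forall>x. \<phi> t x = 0)) \<longrightarrow>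
        (\<integral>t. (\<integral>x. pd_t T \<phi> t x *\<^sub>R u t x \<partial>torus) \<partial>lebesgue_on {0..T})
          = - (\<integral>t. (\<integral>x. \<phi> t x *\<^sub>R w t x \<partial>torus) \<partial>lebesgue_on {0..T}))"

section \<open>Tensor-valued measures on the torus\<close>

text \<open>
  All finite signed Borel measures on the compact metric space \<open>T\<^sup>3\<close> are Radon.
\<close>

definition cell_sets :: "(real^3) set set" where
  "cell_sets = sets (restrict_space borel cell)"

definition tensor_measure :: "((real^3) set \<Rightarrow> 'b::euclidean_space) \<Rightarrow> bool" where
  "tensor_measure \<mu> \<longleftrightarrow>
     (\<forall>A::nat \<Rightarrow> (real^3) set. range A \<subseteq> cell_sets \<and> disjoint_family A \<longrightarrow>
        (\<lambda>n. \<mu> (A n)) sums \<mu> (\<Union>n. A n))"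

text \<open>The total variation norm of \<open>M(T\<^sup>3)\<close>\<close>

definition tv_norm :: "((real^3) set \<Rightarrow> 'b::euclidean_space) \<Rightarrow> ennreal" where
  "tv_norm \<mu> = (SUP \<P>\<in>{\<P>. finite \<P> \<and> \<P> \<subseteq> cell_sets \<and> disjoint \<P> \<and> \<Union>\<P> = cell}.
                  \<Sum>A\<in>\<P>. ennreal (norm (\<mu> A)))"

text \<open>
  The upper variation of a signed measure (\<open>ennreal\<close> truncates negative values to \<open>0\<close>), and the
  integral with respect to the signed measure through the Jordan decomposition.
\<close>

definition upper_variation :: "((real^3) set \<Rightarrow> real) \<Rightarrow> (real^3) measure" where
  "upper_variation \<nu> =
     measure_of cell cell_sets (\<lambda>A. SUP B\<in>{B \<in> cell_sets. B \<subseteq> A}. ennreal (\<nu> B))"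

definition signed_integral :: "((real^3) set \<Rightarrow> real) \<Rightarrow> (real^3 \<Rightarrow> real) \<Rightarrow> real" where
  "signed_integral \<nu> f =
     (\<integral>x. f x \<partial>upper_variation \<nu>) - (\<integral>x. f x \<partial>upper_variation (\<lambda>A. - \<nu> A))"

text \<open>The duality pairing \<open>\<langle>\<mu>; f\<rangle>\<close>, summed over the tensor components\<close>

definition pairing ::
    "((real^3) set \<Rightarrow> 'b::euclidean_space) \<Rightarrow> (real^3 \<Rightarrow> 'b) \<Rightarrow> real" where
  "pairing \<mu> f = (\<Sum>b\<in>Basis. signed_integral (\<lambda>A. \<mu> A \<bullet> b) (\<lambda>x. f x \<bullet> b))"

text \<open>\<open>L\<^sup>\<infinity>(0,T; M(T\<^sup>3))\<close>, weakly-(*) measurable\<close>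

definition Linf_measure :: "real \<Rightarrow> (real \<Rightarrow> (real^3) set \<Rightarrow> 'b::euclidean_space) \<Rightarrow> bool" where
  "Linf_measure T R \<longleftrightarrow>
     (AE t in lebesgue_on {0<..<T}. tensor_measure (R t)) \<and>
     (\<forall>\<psi>. periodic \<psi> \<and> continuous_on UNIV \<psi> \<longrightarrow>
        (\<lambda>t. pairing (R t) \<psi>) \<in> borel_measurable (lebesgue_on {0<..<T})) \<and>
     (\<exists>C::real. AE t in lebesgue_on {0<..<T}. tv_norm (R t) \<le> ennreal C)"

definition Linf :: "real \<Rightarrow> (real \<Rightarrow> real) \<Rightarrow> bool" where
  "Linf T D \<longleftrightarrow> D \<in> borel_measurable (lebesgue_on {0<..<T}) \<and>
     (\<exists>C. AE t in lebesgue_on {0<..<T}. \<bar>D t\<bar> \<le> C)"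

section \<open>The inviscid Qian--Sheng system\<close>

definition wgrad_m :: "(real^3 \<Rightarrow> real^3^3) \<Rightarrow> real^3 \<Rightarrow> real^3^3^3" where
  "wgrad_m Q x = (\<chi> i j k. wd k Q x $ i $ j)"

text \<open>\<open>\<nabla>Q \<odot> \<nabla>Q\<close>\<close>

definition grad_odot :: "(real^3 \<Rightarrow> real^3^3) \<Rightarrow> real^3 \<Rightarrow> real^3^3" where
  "grad_odot Q x = (\<chi> i j. wd i Q x \<bullet> wd j Q x)"

definition tensor_vv :: "real^3 \<Rightarrow> real^3 \<Rightarrow> real^3^3" where
  "tensor_vv v w = (\<chi> i k. v $ k * w $ i)"

definition tensor_vm :: "real^3 \<Rightarrow> real^3^3 \<Rightarrow> real^3^3^3" where
  "tensor_vm v A = (\<chi> i j k. v $ k * A $ i $ j)"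

definition total_energy ::
    "(real^3^3 \<Rightarrow> real) \<Rightarrow> (real^3 \<Rightarrow> real^3) \<Rightarrow> (real^3 \<Rightarrow> real^3^3) \<Rightarrow> (real^3 \<Rightarrow> real^3^3) \<Rightarrow> real"
  where
  "total_energy G v P Q =
     (\<integral>x. (norm (v x))\<^sup>2 / 2 + (norm (P x))\<^sup>2 / 2 + (norm (wgrad_m Q x))\<^sup>2 / 2 + G (Q x) \<partial>torus)"

definition dissipative_solution ::
    "real \<Rightarrow> (real^3^3 \<Rightarrow> real) \<Rightarrow> real \<Rightarrow>
     (real \<Rightarrow> real^3 \<Rightarrow> real^3) \<Rightarrow> (real \<Rightarrow> real^3 \<Rightarrow> real^3^3) \<Rightarrow> (real \<Rightarrow> real^3 \<Rightarrow> real^3^3) \<Rightarrow>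
     (real \<Rightarrow> real) \<Rightarrow> (real \<Rightarrow> (real^3) set \<Rightarrow> real^3^3) \<Rightarrow> (real \<Rightarrow> (real^3) set \<Rightarrow> real^3^3^3) \<Rightarrow> bool"
  where
  "dissipative_solution T F \<Lambda> v P Q D R1 R2 \<longleftrightarrow>
     C_weak_sob T 0 v \<and> C_weak_sob T 0 P \<and> C_weak_sob T 1 Q \<and> C_sob T 0 Q \<and>
     (\<forall>t\<in>{0..T}. AE x in torus. P t x \<in> Sym0 \<and> Q t x \<in> Sym0) \<and>
     Linf_measure T R1 \<and> Linf_measure T R2 \<and>
     Linf T D \<and> (AE t in lebesgue_on {0<..<T}. 0 \<le> D t) \<and>
     (\<forall>\<tau>\<in>{0..T}.
        (\<forall>\<phi>. torus_smooth \<phi> \<longrightarrow> (\<integral>x. v \<tau> x \<bullet> grad_s \<phi> x \<partial>torus) = 0) \<and>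
        (\<forall>\<phi>. test_fun T \<phi> \<and> (\<forall>t\<in>{0..T}. \<forall>x. div_v (\<phi> t) x = 0) \<longrightarrow>
           (\<integral>x. v \<tau> x \<bullet> \<phi> \<tau> x \<partial>torus) - (\<integral>x. v 0 x \<bullet> \<phi> 0 x \<partial>torus)
           = (\<integral>t. (\<integral>x. v t x \<bullet> pd_t T \<phi> t x
                       + tensor_vv (v t x) (v t x) \<bullet> grad_v (\<phi> t) x
                       + grad_odot (Q t) x \<bullet> grad_v (\<phi> t) x \<partial>torus) \<partial>lebesgue_on {0..\<tau>})
             + (\<integral>t. pairing (R1 t) (grad_v (\<phi> t)) \<partial>lebesgue_on {0..\<tau>})) \<and>
        (\<forall>\<phi>. test_fun T \<phi> \<longrightarrow>
           (\<integral>x. Q \<tau> x \<bullet> \<phi> \<tau> x \<partial>torus) - (\<integral>x. Q 0 x \<bullet> \<phi> 0 x \<partial>torus)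
           = (\<integral>t. (\<integral>x. Q t x \<bullet> pd_t T \<phi> t x
                       + tensor_vm (v t x) (Q t x) \<bullet> grad_m (\<phi> t) x
                       + P t x \<bullet> \<phi> t x \<partial>torus) \<partial>lebesgue_on {0..\<tau>})) \<and>
        (\<forall>\<phi>. test_fun T \<phi> \<and> (\<forall>t\<in>{0..T}. \<forall>x. \<phi> t x \<in> Sym0) \<longrightarrow>
           (\<integral>x. P \<tau> x \<bullet> \<phi> \<tau> x \<partial>torus) - (\<integral>x. P 0 x \<bullet> \<phi> 0 x \<partial>torus)
           = (\<integral>t. (\<integral>x. P t x \<bullet> pd_t T \<phi> t x
                       + tensor_vm (v t x) (P t x) \<bullet> grad_m (\<phi> t) x
                       - grad_Sym0 F (Q t x) \<bullet> \<phi> t x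
                       - wgrad_m (Q t) x \<bullet> grad_m (\<phi> t) x \<partial>torus) \<partial>lebesgue_on {0..\<tau>})
             + (\<integral>t. pairing (R2 t) (grad_m (\<phi> t)) \<partial>lebesgue_on {0..\<tau>})) \<and>
        (let G = (\<lambda>A. F A + \<Lambda> * (norm A)\<^sup>2) in
           total_energy G (v \<tau>) (P \<tau>) (Q \<tau>) - total_energy G (v 0) (P 0) (Q 0) + D \<tau>
           = 2 * \<Lambda> * (\<integral>t. (\<integral>x. Q t x \<bullet> P t x \<partial>torus) \<partial>lebesgue_on {0..\<tau>}))) \<and>
     (\<exists>c>0. \<forall>\<tau>\<in>{0..T}.
        (\<integral>\<^sup>+t. tv_norm (R1 t) + tv_norm (R2 t) \<partial>lebesgue_on {0..\<tau>})
          \<le> ennreal (c * (\<integral>t. D t \<partial>lebesgue_on {0..\<tau>})))"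

definition regular ::
    "real \<Rightarrow> nat \<Rightarrow>
     (real \<Rightarrow> real^3 \<Rightarrow> real^3) \<Rightarrow> (real \<Rightarrow> real^3 \<Rightarrow> real^3^3) \<Rightarrow> (real \<Rightarrow> real^3 \<Rightarrow> real^3^3) \<Rightarrow> bool"
  where
  "regular T s v P Q \<longleftrightarrow> C_sob T s v \<and> C_sob T s P \<and> C_sob T (s + 1) Q \<and>
     (\<forall>t\<in>{0..T}. AE x in torus. P t x \<in> Sym0 \<and> Q t x \<in> Sym0)"

text \<open>The transport term \<open>v \<cdot> \<nabla>u\<close>\<close>

definition transport ::
    "(real^3 \<Rightarrow> real^3) \<Rightarrow> (real^3 \<Rightarrow> 'b::euclidean_space) \<Rightarrow> real^3 \<Rightarrow> 'b" where
  "transport v u x = (\<Sum>k\<in>UNIV. v x $ k *\<^sub>R wd k u x)"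

definition wdiv_v :: "(real^3 \<Rightarrow> real^3) \<Rightarrow> real^3 \<Rightarrow> real" where
  "wdiv_v v x = (\<Sum>k\<in>UNIV. wd k v x $ k)"

definition wdiv_m :: "(real^3 \<Rightarrow> real^3^3) \<Rightarrow> real^3 \<Rightarrow> real^3" where
  "wdiv_m M x = (\<chi> i. \<Sum>j\<in>UNIV. wd j (\<lambda>y. M y $ i $ j) x)"

definition wgrad_s :: "(real^3 \<Rightarrow> real) \<Rightarrow> real^3 \<Rightarrow> real^3" where
  "wgrad_s f x = (\<chi> k. wd k f x)"

definition wlaplace :: "(real^3 \<Rightarrow> 'b::euclidean_space) \<Rightarrow> real^3 \<Rightarrow> 'b" where
  "wlaplace f x = (\<Sum>k\<in>UNIV. wD (axis k 2) f x)"

text \<open>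
  ``Almost everywhere'' is for almost every \<open>t\<close> and then almost every \<open>x\<close>, so that the notion does
  not depend on the representatives chosen, time by time, for the spatial classes.
  The multipliers \<open>p\<close> and \<open>lam\<close> are those of the constraints \<open>div v = 0\<close> and \<open>tr Q = 0\<close>.
\<close>

definition strong_solution ::
    "real \<Rightarrow> (real^3^3 \<Rightarrow> real) \<Rightarrow> nat \<Rightarrow>
     (real \<Rightarrow> real^3 \<Rightarrow> real^3) \<Rightarrow> (real \<Rightarrow> real^3 \<Rightarrow> real^3^3) \<Rightarrow> (real \<Rightarrow> real^3 \<Rightarrow> real^3^3) \<Rightarrow> bool"
  where
  "strong_solution T F s v P Q \<longleftrightarrow> regular T s v P Q \<and>
     (\<exists>v' P' Q' p lam.
        has_weak_time_deriv T v v' \<and> has_weak_time_deriv T P P' \<and> has_weak_time_deriv T Q Q' \<and>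
        L1_sob T 1 p \<and> L1_sob T 0 lam \<and>
        (AE t in lebesgue_on {0<..<T}. AE x in torus.
           wdiv_v (v t) x = 0 \<and>
           v' t x + transport (v t) (v t) x + wgrad_s (p t) x = - wdiv_m (grad_odot (Q t)) x \<and>
           Q' t x + transport (v t) (Q t) x = P t x \<and>
           P' t x + transport (v t) (P t) x
             = - grad_Sym0 F (Q t x) + wlaplace (Q t) x - lam t x *\<^sub>R mat 1))"

end

theory Submission
  imports Defs "HOL-Analysis.Analysis"
begin

text \<open>
  By Sobolev embedding the fields of the regularity class have continuous representatives that can be
  inserted, after truncation of their Fourier series, as test functions into their own weak
  equations.  On a short interval \<open>[a, b]\<close> this gives the increment of the energy up to
  \<open>o(b - a)\<close> and up to a multiple of the mass of \<open>R1\<close>, \<open>R2\<close> on \<open>[a, b]\<close>, and the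
  terms of order \<open>b - a\<close> cancel as they do for smooth solutions.  Summation over fine partitions and
  the domination of the defect measures yield \<open>D \<tau> \<le> K \<integral>\<^sub>0\<^sup>\<tau> D\<close>, so \<open>D = 0\<close> by Gronwall's
  argument and the defect measures vanish.  The weak equations then hold without defects, and the
  pressure is recovered by projecting onto gradients mode by mode.
\<close>

text \<open>With defects present the fields need not have a time derivative in \<open>L2\<close>, so
  the energy law cannot be obtained by differentiation; available are increments over
  \<open>[a, b]\<close> against test functions constant in time. Truncated Hartley series are
  admissible there because truncation respects zero divergence and values in \<open>Sym0\<close>
  coefficient by coefficient. Three derivatives in \<open>L2\<close> make the differentiated series
  of \<open>v\<close> and \<open>P\<close> absolutely convergent in dimension three, which bounds
  the gradients independently of the truncation: the defect pairing is estimated by the mass before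
  the limit, and no limit is taken inside a measure. The fourth derivative of \<open>Q\<close> makes
  its Laplacian a continuous test function. The other obstacle is measurability: in time only the
  pairings with the defect measures are known to be measurable, not the total variation. The mass is
  therefore a lower integral, for which superadditivity suffices, and the measures are shown to
  vanish through countably many pairings. The trace multiplier comes out as 0 because the gradient
  of \<open>F\<close> is taken inside \<open>Sym0\<close>.\<close>

section \<open>Integration over the torus\<close>

lemma cell_subset: "cell \<subseteq> cbox (\<chi> i. - pi) (\<chi> i. pi)"
  by (auto simp: cell_def mem_box_cart less_imp_le)

lemma cell_borel [measurable]: "cell \<in> sets borel"
proof -
  have "{x::real^3. - pi \<le> x $ i \<and> x $ i < pi} \<in> sets borel" for i :: 3
    by measurable
  then have "(\<Inter>i. {x::real^3. - pi \<le> x $ i \<and> x $ i < pi}) \<in> sets borel"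
    by (intro sets.finite_INT) auto
  moreover have "cell = (\<Inter>i. {x::real^3. - pi \<le> x $ i \<and> x $ i < pi})"
    by (auto simp: cell_def)
  ultimately show ?thesis by simp
qed

lemma cell_lebesgue [measurable, simp]: "cell \<in> sets lebesgue"
  using cell_borel by (simp add: sets_completionI_sets)

lemma cell_lmeasurable: "cell \<in> lmeasurable"
  by (rule bounded_set_imp_lmeasurable) (auto intro: bounded_subset[OF bounded_cbox cell_subset])

interpretation torus: finite_measure torus
  by (rule finite_measure_lebesgue_on[OF cell_lmeasurable])

lemma box_subset_cell: "box (\<chi> i. - pi) (\<chi> i. pi) \<subseteq> cell"
  by (auto simp: cell_def mem_box_cart less_imp_le)

abbreviation vol :: real where "vol \<equiv> measure torus cell"

lemma vol_pos: "vol > 0"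
proof -
  have "0 \<in> box (\<chi> i. - pi) (\<chi> i. pi :: real^3)" by (simp add: mem_box_cart)
  then have "\<not> negligible (box (\<chi> i. - pi) (\<chi> i. pi) :: (real^3) set)"
    by (intro open_not_negligible) auto
  then have "\<not> negligible cell" using box_subset_cell negligible_subset by blast
  then have "measure lebesgue cell \<noteq> 0"
    using cell_lmeasurable negligible_iff_measure by blast
  moreover have "measure lebesgue cell = vol" by (simp add: measure_restrict_space)
  ultimately show ?thesis by (metis measure_nonneg less_le)
qed

lemma continuous_torus_measurable:
  fixes f :: "real^3 \<Rightarrow> 'b::euclidean_space"
  assumes "continuous_on UNIV f"
  shows "f \<in> borel_measurable torus"
proof -
  have "f \<in> borel_measurable lborel"
    using borel_measurable_continuous_onI[OF assms] by simp
  then show ?thesis by (intro measurable_restrict_space1 measurable_completion)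
qed

text \<open>The half-open cell is not compact, so the bound is taken on the closed cube around
  it.\<close>

lemma bounded_on_cell:
  fixes f :: "real^3 \<Rightarrow> 'b::euclidean_space"
  assumes "continuous_on UNIV f"
  obtains B where "B > 0" "\<And>x. x \<in> cell \<Longrightarrow> norm (f x) \<le> B"
proof -
  have "compact (f ` cbox (\<chi> i. - pi) (\<chi> i. pi))"
    by (intro compact_continuous_image) (auto intro: continuous_on_subset[OF assms])
  then obtain B where "B > 0" "\<forall>y\<in>f ` cbox (\<chi> i. - pi) (\<chi> i. pi). norm y \<le> B"
    using compact_imp_bounded bounded_pos by blast
  then show ?thesis using that cell_subset by blast
qed

lemma AE_torus_I: "(\<And>x. x \<in> cell \<Longrightarrow> P x) \<Longrightarrow> AE x in torus. P x"
  by (rule AE_I2) simp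

lemma integrable_torus_bounded:
  fixes f :: "real^3 \<Rightarrow> 'b::euclidean_space"
  assumes "f \<in> borel_measurable torus" "AE x in torus. norm (f x) \<le> B"
  shows "integrable torus f"
  by (rule torus.integrable_const_bound[OF assms(2,1)])

lemma continuous_torus_integrable:
  fixes f :: "real^3 \<Rightarrow> 'b::euclidean_space"
  assumes "continuous_on UNIV f"
  shows "integrable torus f"
proof -
  obtain B where "\<And>x. x \<in> cell \<Longrightarrow> norm (f x) \<le> B"
    using bounded_on_cell[OF assms] by blast
  then show ?thesis
    by (intro integrable_torus_bounded[where B=B] continuous_torus_measurable assms AE_torus_I)
qed

text \<open>The shift argument below uses translation invariance of \<open>lborel\<close>; Borel
  measurability of \<open>f\<close> is what allows the completion to be dropped.\<close>

lemma integral_torus_eq_lborel: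
  fixes f :: "real^3 \<Rightarrow> 'b::euclidean_space"
  assumes "f \<in> borel_measurable borel"
  shows "(\<integral>x. f x \<partial>torus) = (\<integral>x. indicator cell x *\<^sub>R f x \<partial>lborel)"
  using assms by (subst integral_restrict_space) (auto intro!: integral_completion)

lemma lborel_integral_shift:
  fixes f :: "real^3 \<Rightarrow> 'b::euclidean_space"
  assumes "f \<in> borel_measurable borel"
  shows "(\<integral>x. f (c + x) \<partial>lborel) = (\<integral>x. f x \<partial>lborel)"
  using assms by (subst (2) lborel_distr_plus[of c, symmetric], subst integral_distr) auto

lemma integrable_lborel_bounded_set:
  fixes f :: "real^3 \<Rightarrow> 'b::euclidean_space"
  assumes "continuous_on UNIV f" "A \<in> sets borel" "bounded A"
  shows "integrable lborel (\<lambda>x. indicator A x *\<^sub>R f x)"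
proof -
  obtain a where a: "A \<subseteq> cbox (- a) a"
    using bounded_subset_cbox_symmetric[OF assms(3)] by blast
  have "set_integrable lborel (cbox (-a) a) f"
    unfolding set_integrable_def
    by (rule borel_integrable_compact) (auto intro: continuous_on_subset[OF assms(1)])
  then have "set_integrable lborel A f"
    by (rule set_integrable_subset) (use assms a in auto)
  then show ?thesis by (simp add: set_integrable_def)
qed

text \<open>The translated cell is the original one with the strip \<open>A\<close> at the left face
  cut off and attached, one period further, at the right face as \<open>B2\<close>; periodicity
  makes the integrals over both strips equal.\<close>

lemma torus_integral_shift:
  fixes f :: "real^3 \<Rightarrow> 'b::euclidean_space"
  assumes cont: "continuous_on UNIV f" and per: "periodic f" and h: "0 \<le> h" "h < 2 * pi"
  shows "(\<integral>x. f (x + h *\<^sub>R axis k 1) \<partial>torus) = (\<integral>x. f x \<partial>torus)"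
proof -
  let ?e = "axis k 1 :: real^3"
  have meas [measurable]: "f \<in> borel_measurable borel"
    by (rule borel_measurable_continuous_onI[OF cont])
  define A where "A = {x\<in>cell. x $ k < - pi + h}"
  define B1 where "B1 = {x\<in>cell. - pi + h \<le> x $ k}"
  define B2 where "B2 = (\<lambda>x. - (2 * pi) *\<^sub>R ?e + x) -` A"
  have A [measurable]: "A \<in> sets borel" unfolding A_def by measurable
  have B1 [measurable]: "B1 \<in> sets borel" unfolding B1_def by measurable
  have B2 [measurable]: "B2 \<in> sets borel"
    unfolding B2_def by (rule measurable_sets_borel[OF _ A]) measurable
  have bdc: "bounded cell" by (auto intro: bounded_subset[OF bounded_cbox cell_subset])
  have "bounded A" "bounded B1" by (auto intro: bounded_subset[OF bdc] simp: A_def B1_def)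
  have "B2 = (+) ((2 * pi) *\<^sub>R ?e) ` A"
  proof (intro set_eqI iffI)
    fix x assume "x \<in> B2"
    then show "x \<in> (+) ((2 * pi) *\<^sub>R ?e) ` A"
      by (intro image_eqI[where x="- (2 * pi) *\<^sub>R ?e + x"]) (auto simp: B2_def)
  qed (auto simp: B2_def)
  then have "bounded B2" using bounded_translation[OF \<open>bounded A\<close>] by simp
  have ind: "indicator cell (- h *\<^sub>R ?e + x) = (indicator B1 x + indicator B2 x :: real)" for x
  proof -
    have nth: "(- c *\<^sub>R ?e + x) $ i = (if i = k then x $ i - c else x $ i)" for i c
      by (auto simp: axis_def)
    let ?R = "\<forall>i. i \<noteq> k \<longrightarrow> - pi \<le> x $ i \<and> x $ i < pi"
    have split: "(\<forall>i. P i) \<longleftrightarrow> (\<forall>i. i \<noteq> k \<longrightarrow> P i) \<and> P k" for P by metis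
    have 0: "y \<in> cell \<longleftrightarrow> (\<forall>i. i \<noteq> k \<longrightarrow> - pi \<le> y $ i \<and> y $ i < pi) \<and> - pi \<le> y $ k \<and> y $ k < pi" for y
      unfolding cell_def mem_Collect_eq by (rule split)
    have 1: "- h *\<^sub>R ?e + x \<in> cell \<longleftrightarrow> ?R \<and> - pi + h \<le> x $ k \<and> x $ k < pi + h"
      unfolding 0 nth by (simp add: algebra_simps cong: imp_cong)
    have 2: "x \<in> B1 \<longleftrightarrow> ?R \<and> - pi + h \<le> x $ k \<and> x $ k < pi"
      unfolding B1_def mem_Collect_eq 0 using h by (auto cong: imp_cong)
    have 3: "x \<in> B2 \<longleftrightarrow> ?R \<and> pi \<le> x $ k \<and> x $ k < pi + h"
      unfolding B2_def A_def vimage_def mem_Collect_eq 0 nth using h by (auto cong: imp_cong)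
    show ?thesis using 1 2 3 h by (auto simp: indicator_def)
  qed
  have ind2: "indicator A x + indicator B1 x = (indicator cell x :: real)" for x
    by (auto simp: A_def B1_def indicator_def)
  have iA: "integrable lborel (\<lambda>x. indicator A x *\<^sub>R f x)"
    and iB1: "integrable lborel (\<lambda>x. indicator B1 x *\<^sub>R f x)"
    and iB2: "integrable lborel (\<lambda>x. indicator B2 x *\<^sub>R f x)"
    using integrable_lborel_bounded_set[OF cont] A B1 B2 \<open>bounded A\<close> \<open>bounded B1\<close> \<open>bounded B2\<close> by blast+
  have "(\<integral>x. f (x + h *\<^sub>R ?e) \<partial>torus) = (\<integral>x. indicator cell x *\<^sub>R f (x + h *\<^sub>R ?e) \<partial>lborel)"
    by (rule integral_torus_eq_lborel) measurable
  also have "\<dots> = (\<integral>x. indicator cell (- h *\<^sub>R ?e + x) *\<^sub>R f (- h *\<^sub>R ?e + x + h *\<^sub>R ?e) \<partial>lborel)"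
    by (rule lborel_integral_shift[symmetric, of "\<lambda>x. indicator cell x *\<^sub>R f (x + h *\<^sub>R ?e)"]) measurable
  also have "\<dots> = (\<integral>x. indicator B1 x *\<^sub>R f x + indicator B2 x *\<^sub>R f x \<partial>lborel)"
    unfolding ind by (simp add: scaleR_add_left)
  also have "\<dots> = (\<integral>x. indicator B1 x *\<^sub>R f x \<partial>lborel) + (\<integral>x. indicator B2 x *\<^sub>R f x \<partial>lborel)"
    by (rule Bochner_Integration.integral_add[OF iB1 iB2])
  also have "(\<integral>x. indicator B2 x *\<^sub>R f x \<partial>lborel)
      = (\<integral>x. indicator B2 ((2 * pi) *\<^sub>R ?e + x) *\<^sub>R f ((2 * pi) *\<^sub>R ?e + x) \<partial>lborel)"
    by (rule lborel_integral_shift[symmetric, of "\<lambda>x. indicator B2 x *\<^sub>R f x"]) measurable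
  also have "\<dots> = (\<integral>x. indicator A x *\<^sub>R f x \<partial>lborel)"
  proof (rule Bochner_Integration.integral_cong[OF refl])
    fix x :: "real^3"
    have "f ((2 * pi) *\<^sub>R ?e + x) = f x"
      using per by (simp add: periodic_def add.commute)
    then show "indicator B2 ((2 * pi) *\<^sub>R ?e + x) *\<^sub>R f ((2 * pi) *\<^sub>R ?e + x) = indicator A x *\<^sub>R f x"
      by (simp add: B2_def indicator_def)
  qed
  also have "(\<integral>x. indicator B1 x *\<^sub>R f x \<partial>lborel) + (\<integral>x. indicator A x *\<^sub>R f x \<partial>lborel)
      = (\<integral>x. indicator A x *\<^sub>R f x + indicator B1 x *\<^sub>R f x \<partial>lborel)"
    by (subst Bochner_Integration.integral_add[OF iA iB1]) simp
  also have "\<dots> = (\<integral>x. indicator cell x *\<^sub>R f x \<partial>lborel)"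
    by (simp add: scaleR_add_left[symmetric] ind2)
  also have "\<dots> = (\<integral>x. f x \<partial>torus)"
    by (rule integral_torus_eq_lborel[symmetric]) measurable
  finally show ?thesis .
qed

text \<open>Only the derivative along one coordinate line is asked for: this is what termwise
  differentiation of a series yields, and it is enough for integration by parts.\<close>

definition has_partial :: "3 \<Rightarrow> (real^3 \<Rightarrow> 'b::real_normed_vector) \<Rightarrow> (real^3 \<Rightarrow> 'b) \<Rightarrow> bool" where
  "has_partial k f g \<longleftrightarrow> (\<forall>x. ((\<lambda>s. f (x + s *\<^sub>R axis k 1)) has_vector_derivative g x) (at 0))"

lemma has_partial_at:
  assumes "has_partial k f g"
  shows "((\<lambda>s. f (x + s *\<^sub>R axis k 1)) has_vector_derivative g (x + s *\<^sub>R axis k 1)) (at s)"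
proof -
  have "((\<lambda>r. f ((x + s *\<^sub>R axis k 1) + r *\<^sub>R axis k 1)) has_vector_derivative g (x + s *\<^sub>R axis k 1)) (at (s - s))"
    using assms by (simp add: has_partial_def)
  then have "((\<lambda>r. f ((x + s *\<^sub>R axis k 1) + (r - s) *\<^sub>R axis k 1)) has_vector_derivative 1 *\<^sub>R g (x + s *\<^sub>R axis k 1)) (at s)"
    by (intro vector_diff_chain_at[of "\<lambda>r. r - s" 1 s "\<lambda>r. f ((x + s *\<^sub>R axis k 1) + r *\<^sub>R axis k 1)", unfolded o_def])
      (auto intro!: derivative_eq_intros)
  then show ?thesis by (simp add: scaleR_diff_left)
qed

text \<open>Integrals of difference quotients vanish by translation invariance, and dominated
  convergence carries this over to the derivative. The majorant comes from the mean value
  inequality.\<close>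

lemma torus_integral_partial:
  fixes f g :: "real^3 \<Rightarrow> 'b::euclidean_space"
  assumes f: "continuous_on UNIV f" "periodic f" and g: "continuous_on UNIV g"
    and d: "has_partial k f g"
  shows "(\<integral>x. g x \<partial>torus) = 0"
proof -
  let ?e = "axis k 1 :: real^3"
  \<comment> \<open>The extra 1 leaves room for the shifts \<open>h n\<close>, which are at most
    1.\<close>
  let ?K = "cbox (\<chi> i. - pi) (\<chi> i. pi + 1) :: (real^3) set"
  have "compact (g ` ?K)"
    by (intro compact_continuous_image) (auto intro: continuous_on_subset[OF g])
  then obtain B where B: "\<forall>y\<in>g ` ?K. norm y \<le> B"
    using compact_imp_bounded bounded_pos by blast
  define h where "h n = inverse (real (Suc n))" for n
  have h: "0 < h n" "h n \<le> 1" for n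
    by (auto simp: h_def inverse_le_1_iff)
  have h0: "h \<longlonglongrightarrow> 0" unfolding h_def by (rule LIMSEQ_inverse_real_of_nat)
  define q where "q n x = (f (x + h n *\<^sub>R ?e) - f x) /\<^sub>R h n" for n x
  have contq: "continuous_on UNIV (q n)" for n
    unfolding q_def by (intro continuous_intros continuous_on_compose2[OF f(1)]) auto
  have lim: "(\<lambda>n. q n x) \<longlonglongrightarrow> g x" for x
  proof -
    have "((\<lambda>s. f (x + s *\<^sub>R ?e)) has_vector_derivative g x) (at 0)"
      using d by (simp add: has_partial_def)
    then have "((\<lambda>s. norm (f (x + s *\<^sub>R ?e) - f x - s *\<^sub>R g x) / norm s) \<longlongrightarrow> 0) (at 0)"
      unfolding has_vector_derivative_def has_derivative_iff_norm by simp
    moreover have "filterlim h (at 0) sequentially"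
      using h0 h by (auto simp: filterlim_at intro!: always_eventually) (metis less_irrefl)
    ultimately have "(\<lambda>n. norm (f (x + h n *\<^sub>R ?e) - f x - h n *\<^sub>R g x) / norm (h n)) \<longlonglongrightarrow> 0"
      by (rule filterlim_compose)
    also have "(\<lambda>n. norm (f (x + h n *\<^sub>R ?e) - f x - h n *\<^sub>R g x) / norm (h n)) = (\<lambda>n. norm (q n x - g x))"
    proof
      fix n
      have "q n x - g x = (f (x + h n *\<^sub>R ?e) - f x - h n *\<^sub>R g x) /\<^sub>R h n"
        using h(1)[of n] by (simp add: q_def scaleR_diff_right)
      then show "norm (f (x + h n *\<^sub>R ?e) - f x - h n *\<^sub>R g x) / norm (h n) = norm (q n x - g x)"
        using h(1)[of n] by (simp add: divide_inverse mult.commute)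
    qed
    finally show ?thesis by (metis LIM_zero_iff tendsto_norm_zero_iff)
  qed
  have bnd: "norm (q n x) \<le> B" if x: "x \<in> cell" for n x
  proof -
    have in_K: "x + s *\<^sub>R ?e \<in> ?K" if "0 \<le> s" "s \<le> 1" for s
    proof -
      have "- pi \<le> x $ i + s * (if i = k then 1 else 0)" "x $ i + s * (if i = k then 1 else 0) \<le> pi + 1" for i
        using x that by (auto simp: cell_def dest!: spec[where x=i])
      then show ?thesis by (simp add: mem_box_cart axis_def eq_commute[of _ k])
    qed
    have "norm (f (x + h n *\<^sub>R ?e) - f (x + 0 *\<^sub>R ?e)) \<le> B * norm (h n - 0)"
    proof (rule differentiable_bound[where S="{0..1}" and f="\<lambda>s. f (x + s *\<^sub>R ?e)" and f'="\<lambda>s r. r *\<^sub>R g (x + s *\<^sub>R ?e)"])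
      fix s :: real assume s: "s \<in> {0..1}"
      show "((\<lambda>s. f (x + s *\<^sub>R ?e)) has_derivative (\<lambda>r. r *\<^sub>R g (x + s *\<^sub>R ?e))) (at s within {0..1})"
        using has_partial_at[OF d, of x s] by (auto simp: has_vector_derivative_def intro: has_derivative_at_withinI)
      have "norm (g (x + s *\<^sub>R ?e)) \<le> B" using B in_K s by auto
      then show "onorm (\<lambda>r. r *\<^sub>R g (x + s *\<^sub>R ?e)) \<le> B"
        by (intro onorm_bound)
          (auto simp: mult.commute[of B] intro!: mult_left_mono intro: order_trans[OF norm_ge_zero])
    qed (use h[of n] in auto)
    moreover have "norm (q n x) = norm (f (x + h n *\<^sub>R ?e) - f x) / h n"
      using h[of n] by (simp add: q_def divide_inverse mult.commute)
    ultimately show ?thesis using h[of n] by (simp add: pos_divide_le_eq)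
  qed
  have "(\<lambda>n. \<integral>x. q n x \<partial>torus) \<longlonglongrightarrow> (\<integral>x. g x \<partial>torus)"
    by (rule integral_dominated_convergence[where w="\<lambda>_. B"])
      (auto intro!: continuous_torus_measurable g contq AE_torus_I lim bnd)
  moreover have "(\<integral>x. q n x \<partial>torus) = 0" for n
  proof -
    have "continuous_on UNIV (\<lambda>x. f (x + h n *\<^sub>R ?e))"
      by (intro continuous_intros continuous_on_compose2[OF f(1)]) auto
    then have "(\<integral>x. f (x + h n *\<^sub>R ?e) - f x \<partial>torus) = (\<integral>x. f (x + h n *\<^sub>R ?e) \<partial>torus) - (\<integral>x. f x \<partial>torus)"
      by (intro Bochner_Integration.integral_diff continuous_torus_integrable f)
    also have "\<dots> = 0"
      using torus_integral_shift[OF f, of "h n" k] h[of n] pi_gt3 by simp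
    finally show ?thesis by (simp add: q_def)
  qed
  ultimately show ?thesis by (simp add: LIMSEQ_const_iff)
qed

section \<open>Hartley functions and their orthogonality\<close>

definition freq :: "int^3 \<Rightarrow> real^3" where
  "freq k = (\<chi> i. real_of_int (k $ i))"

text \<open>The Hartley functions \<open>cas k\<close>, \<open>k \<in> \<int>\<^sup>3\<close>, are an orthogonal basis of the real \<open>L\<^sup>2\<close> space, so that no complexification is needed.\<close>

definition cas :: "int^3 \<Rightarrow> real^3 \<Rightarrow> real" where
  "cas k x = cos (freq k \<bullet> x) + sin (freq k \<bullet> x)"

lemma freq_nth [simp]: "freq k $ i = real_of_int (k $ i)" by (simp add: freq_def)
lemma freq_minus [simp]: "freq (- k) = - freq k" by (simp add: freq_def vec_eq_iff)
lemma freq_add: "freq (k + l) = freq k + freq l" by (simp add: freq_def vec_eq_iff)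
lemma freq_diff: "freq (k - l) = freq k - freq l" by (simp add: freq_def vec_eq_iff)
lemma freq_0 [simp]: "freq 0 = 0" by (simp add: freq_def vec_eq_iff)

lemma freq_eq_0 [simp]: "freq k = 0 \<longleftrightarrow> k = 0" by (simp add: freq_def vec_eq_iff)

lemma inner_freq_axis [simp]: "freq k \<bullet> axis j 1 = real_of_int (k $ j)"
  by (simp add: inner_axis)

lemma cas_0 [simp]: "cas 0 x = 1" by (simp add: cas_def)

lemma cas_minus: "cas (- k) x = cos (freq k \<bullet> x) - sin (freq k \<bullet> x)"
  by (simp add: cas_def)

text \<open>That only Hartley functions occur on the right gives both the orthogonality relations
  and the closure of trigonometric polynomials under products.\<close>

lemma cas_mult: "cas k x * cas l x = (cas (k - l) x + cas (l - k) x + cas (k + l) x - cas (- (k + l)) x) / 2"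
  by (simp add: cas_def freq_add freq_diff inner_add_left inner_diff_left cos_add sin_add cos_diff sin_diff field_simps)

lemma abs_cas_le: "\<bar>cas k x\<bar> \<le> 2"
proof -
  have "\<bar>cos (freq k \<bullet> x)\<bar> \<le> 1" "\<bar>sin (freq k \<bullet> x)\<bar> \<le> 1" by auto
  then show ?thesis unfolding cas_def by linarith
qed

lemma continuous_on_cas [continuous_intros]:
  fixes f :: "'a::t2_space \<Rightarrow> real^3"
  shows "continuous_on S f \<Longrightarrow> continuous_on S (\<lambda>x. cas k (f x))"
  unfolding cas_def by (intro continuous_intros) auto

lemma cas_shift: "cas k (x + (2 * pi) *\<^sub>R axis j 1) = cas k x"
proof -
  have "freq k \<bullet> (x + (2 * pi) *\<^sub>R axis j 1) = freq k \<bullet> x + 2 * pi * real_of_int (k $ j)"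
    by (simp add: inner_add_right)
  then show ?thesis
    by (simp add: cas_def cos_add sin_add cos_integer_2pi sin_integer_2pi del: mult.assoc)
qed

lemma periodic_cas: "periodic (cas k)"
  by (simp add: periodic_def cas_shift)

lemma has_partial_cas: "has_partial j (cas k) (\<lambda>x. real_of_int (k $ j) * cas (- k) x)"
  unfolding has_partial_def
proof
  fix x
  have "((\<lambda>s. cos (freq k \<bullet> x + s * real_of_int (k $ j)) + sin (freq k \<bullet> x + s * real_of_int (k $ j)))
      has_real_derivative real_of_int (k $ j) * cas (- k) x) (at 0)"
    by (auto intro!: derivative_eq_intros simp: cas_minus algebra_simps)
  then show "((\<lambda>s. cas k (x + s *\<^sub>R axis j 1)) has_vector_derivative real_of_int (k $ j) * cas (- k) x) (at 0)"
    by (simp add: has_real_derivative_iff_has_vector_derivative cas_def inner_add_right)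
qed

text \<open>For k \<noteq> 0 some component of the frequency is nonzero, and along it the function
  is a multiple of a partial derivative of \<open>cas (- k)\<close>.\<close>

lemma integral_cas: "(\<integral>x. cas k x \<partial>torus) = (if k = 0 then vol else 0)"
proof (cases "k = 0")
  case False
  then obtain j where j: "k $ j \<noteq> 0" by (auto simp: vec_eq_iff)
  have "(\<integral>x. real_of_int ((- k) $ j) * cas (- (- k)) x \<partial>torus) = 0"
    by (rule torus_integral_partial[OF _ _ _ has_partial_cas])
      (auto intro!: continuous_intros simp: periodic_cas)
  then show ?thesis using j False by simp
qed simp

lemma integrable_cas [simp]: "integrable torus (cas k)"
  by (intro continuous_torus_integrable continuous_intros)

lemma integral_cas_mult: "(\<integral>x. cas k x * cas l x \<partial>torus) = (if k = l then vol else 0)"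
proof -
  have "(\<integral>x. cas k x * cas l x \<partial>torus)
    = ((\<integral>x. cas (k - l) x \<partial>torus) + (\<integral>x. cas (l - k) x \<partial>torus) + (\<integral>x. cas (k + l) x \<partial>torus) - (\<integral>x. cas (- (k + l)) x \<partial>torus)) / 2"
    unfolding cas_mult by simp
  also have "\<dots> = (if k = l then vol else 0)"
    unfolding integral_cas neg_equal_0_iff_equal by auto
  finally show ?thesis .
qed

section \<open>Trigonometric polynomials and the embedding of the torus\<close>

inductive trig_poly :: "(real^3 \<Rightarrow> real) \<Rightarrow> bool" where
  cas: "trig_poly (cas k)"
| add: "trig_poly f \<Longrightarrow> trig_poly g \<Longrightarrow> trig_poly (\<lambda>x. f x + g x)"
| scale: "trig_poly f \<Longrightarrow> trig_poly (\<lambda>x. c * f x)"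

lemma trig_poly_const: "trig_poly (\<lambda>x. c)"
  using trig_poly.scale[OF trig_poly.cas[of 0], of c] by simp

lemma trig_poly_sum:
  assumes "finite I" "\<And>i. i \<in> I \<Longrightarrow> trig_poly (f i)"
  shows "trig_poly (\<lambda>x. \<Sum>i\<in>I. f i x)"
  using assms by (induction I rule: finite_induct) (auto intro: trig_poly_const trig_poly.add)

lemma trig_poly_mult:
  assumes "trig_poly f" "trig_poly g"
  shows "trig_poly (\<lambda>x. f x * g x)"
  using assms(1)
proof induction
  case (cas k)
  show ?case using assms(2)
  proof induction
    case (cas l)
    have "trig_poly (\<lambda>x. 1/2 * (((cas (k - l) x + cas (l - k) x) + cas (k + l) x) + (-1) * cas (- (k + l)) x))"
      by (intro trig_poly.intros)
    then show ?case by (simp add: cas_mult)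
  next
    case (add f g)
    then show ?case using trig_poly.add by (simp add: distrib_left)
  next
    case (scale f c)
    then show ?case using trig_poly.scale[of _ c] by (simp add: mult.left_commute)
  qed
next
  case (add f g)
  then show ?case using trig_poly.add by (simp add: distrib_right)
next
  case (scale f c)
  then show ?case using trig_poly.scale[of _ c] by (simp add: mult.assoc)
qed

lemma trig_poly_cos: "trig_poly (\<lambda>x. cos (x $ i))" and trig_poly_sin: "trig_poly (\<lambda>x. sin (x $ i))"
proof -
  have f: "freq (axis i 1) \<bullet> x = x $ i" for x
  proof -
    have "freq (axis i 1) = axis i 1" by (simp add: vec_eq_iff axis_def)
    then show ?thesis by (simp add: inner_axis')
  qed
  have "trig_poly (\<lambda>x. 1/2 * cas (axis i 1) x + 1/2 * cas (- axis i 1) x)"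
    by (intro trig_poly.intros)
  then show "trig_poly (\<lambda>x. cos (x $ i))" by (simp add: cas_minus cas_def f field_simps)
  have "trig_poly (\<lambda>x. 1/2 * cas (axis i 1) x + (-1/2) * cas (- axis i 1) x)"
    by (intro trig_poly.intros)
  then show "trig_poly (\<lambda>x. sin (x $ i))" by (simp add: cas_minus cas_def f field_simps)
qed

lemma continuous_trig_poly: "trig_poly f \<Longrightarrow> continuous_on UNIV f"
  by (induction rule: trig_poly.induct) (auto intro!: continuous_intros)

text \<open>The embedding of the torus as a compact subset of \<open>\<real>\<^sup>6\<close>, to which Stone--Weierstrass applies.\<close>

definition emb :: "real^3 \<Rightarrow> (real^3) \<times> (real^3)" where
  "emb x = ((\<chi> i. cos (x $ i)), (\<chi> i. sin (x $ i)))"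

lemma continuous_emb: "continuous_on S emb"
  unfolding emb_def by (intro continuous_intros)

text \<open>This turns the Stone-Weierstrass approximants on the image of \<open>emb\<close> into
  combinations of Hartley functions.\<close>

lemma trig_poly_polynomial_emb:
  assumes "real_polynomial_function g"
  shows "trig_poly (\<lambda>x. g (emb x))"
  using assms
proof induction
  case (linear h)
  then interpret bounded_linear h .
  have "emb x = (\<Sum>i\<in>UNIV. cos (x $ i) *\<^sub>R (axis i 1, 0) + sin (x $ i) *\<^sub>R (0, axis i 1))" for x
    by (simp add: emb_def prod_eq_iff fst_sum snd_sum vec_eq_iff axis_def if_distrib cong: if_cong)
  then have "h (emb x) = (\<Sum>i\<in>UNIV. h (axis i 1, 0) * cos (x $ i) + h (0, axis i 1) * sin (x $ i))" for x
    by (simp add: sum add scaleR mult.commute del: scaleR_Pair add_Pair)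
  then show ?case
    by (auto intro!: trig_poly_sum trig_poly.add trig_poly.scale trig_poly_cos trig_poly_sin)
next
  case (mult f g)
  then show ?case by (intro trig_poly_mult)
qed (auto intro: trig_poly_const trig_poly.add)

text \<open>A measurable inverse of \<open>emb\<close> on the cell. A vanishing sine selects the
  negative branch, so that the cosine value - 1 is sent to the left end \<open>- pi\<close>, which
  belongs to the cell, and not to \<open>pi\<close>. Clamping the cosine keeps \<open>arccos\<close>
  inside its domain everywhere.\<close>

definition unemb :: "(real^3) \<times> (real^3) \<Rightarrow> real^3" where
  "unemb y = (\<chi> i. (if snd y $ i \<le> 0 then - 1 else 1) * arccos (max (- 1) (min 1 (fst y $ i))))"

lemma unemb_emb:
  assumes "x \<in> cell"
  shows "unemb (emb x) = x"
proof -
  have "(if sin (x $ i) \<le> 0 then - 1 else 1) * arccos (max (- 1) (min 1 (cos (x $ i)))) = x $ i" for i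
  proof (cases "x $ i \<le> 0")
    case True
    have "- pi \<le> x $ i" using assms by (auto simp: cell_def)
    then have "sin (- (x $ i)) \<ge> 0" using True by (intro sin_ge_zero) auto
    then have "sin (x $ i) \<le> 0" by simp
    moreover have "arccos (cos (- (x $ i))) = - (x $ i)"
      using True \<open>- pi \<le> x $ i\<close> by (intro arccos_cos) auto
    ultimately show ?thesis by simp
  next
    case False
    have "x $ i < pi" using assms by (auto simp: cell_def)
    then have "sin (x $ i) > 0" using False by (intro sin_gt_zero) auto
    moreover have "arccos (cos (x $ i)) = x $ i"
      using False \<open>x $ i < pi\<close> by (intro arccos_cos) auto
    ultimately show ?thesis by simp
  qed
  then show ?thesis by (simp add: unemb_def emb_def vec_eq_iff)
qed

lemma borel_measurable_unemb [measurable]: "unemb \<in> borel_measurable borel"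
proof (rule borel_measurable_euclidean_space[THEN iffD2], rule ballI)
  fix b :: "real^3" assume "b \<in> Basis"
  then obtain i where b: "b = axis i 1" by (auto simp: Basis_vec_def)
  have ac: "(\<lambda>r. arccos (max (- 1) (min 1 r))) \<in> borel_measurable borel"
    by (intro borel_measurable_continuous_onI continuous_intros) auto
  have sg: "(\<lambda>r::real. if r \<le> 0 then - 1 else 1 :: real) \<in> borel_measurable borel"
    by measurable
  have "(\<lambda>y::(real^3) \<times> (real^3). fst y $ i) \<in> borel_measurable borel"
    "(\<lambda>y::(real^3) \<times> (real^3). snd y $ i) \<in> borel_measurable borel"
    by (intro borel_measurable_continuous_onI continuous_intros)+
  from measurable_compose[OF this(1) ac] measurable_compose[OF this(2) sg]
  have "(\<lambda>y::(real^3) \<times> (real^3). (if snd y $ i \<le> 0 then - 1 else 1) * arccos (max (- 1) (min 1 (fst y $ i))))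
      \<in> borel_measurable borel"
    by (intro borel_measurable_times)
  then show "(\<lambda>y. unemb y \<bullet> b) \<in> borel_measurable borel"
    by (simp add: unemb_def b inner_axis)
qed

section \<open>Finite Borel measures are determined by their Hartley coefficients\<close>

lemma cell_sets_iff: "A \<in> cell_sets \<longleftrightarrow> A \<in> sets borel \<and> A \<subseteq> cell"
  unfolding cell_sets_def by (subst sets_restrict_space_iff) auto

text \<open>Common setting for the variations of the defect measures and for densities with respect
  to Lebesgue measure; both are compared through Hartley coefficients.\<close>

locale cell_measure = finite_measure M for M :: "(real^3) measure" +
  assumes sets_M: "sets M = cell_sets"
begin

lemma space_M: "space M = cell"
  using sets_eq_imp_space_eq[of M "restrict_space borel cell"] sets_M
  by (simp add: cell_sets_def space_restrict_space)

lemma measurable_M: "f \<in> borel_measurable borel \<Longrightarrow> f \<in> borel_measurable M"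
  using sets_M measurable_cong_sets[of M "restrict_space borel cell"]
  by (metis cell_sets_def measurable_restrict_space1)

lemma continuous_integrable:
  fixes f :: "real^3 \<Rightarrow> 'b::euclidean_space"
  assumes "continuous_on UNIV f"
  shows "integrable M f"
proof -
  obtain B where "\<And>x. x \<in> cell \<Longrightarrow> norm (f x) \<le> B"
    using bounded_on_cell[OF assms] by blast
  then show ?thesis
    by (intro integrable_const_bound[where B=B] measurable_M borel_measurable_continuous_onI assms AE_I2)
      (auto simp: space_M)
qed

end

text \<open>Equality on trigonometric polynomials extends by Stone-Weierstrass to continuous
  functions of \<open>emb x\<close>, then to preimages of closed sets, hence to the image measures,
  and \<open>unemb\<close> brings the equality back to the cell. The detour through the image
  handles the identification of opposite faces.\<close>

lemma cell_measure_eqI: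
  assumes "cell_measure M" "cell_measure N"
    and eq: "\<And>k. (\<integral>x. cas k x \<partial>M) = (\<integral>x. cas k x \<partial>N)"
  shows "M = N"
proof -
  interpret M: cell_measure M by fact
  interpret N: cell_measure N by fact
  have emb_meas [measurable]: "emb \<in> borel_measurable M" "emb \<in> borel_measurable N"
    by (auto intro!: M.measurable_M N.measurable_M borel_measurable_continuous_onI continuous_emb)
  have trig: "(\<integral>x. f x \<partial>M) = (\<integral>x. f x \<partial>N)" if "trig_poly f" for f
    using that
  proof induction
    case (add f g)
    then show ?case
      by (simp add: continuous_trig_poly M.continuous_integrable N.continuous_integrable)
  qed (simp_all add: eq)
  have cont: "(\<integral>x. g (emb x) \<partial>M) = (\<integral>x. g (emb x) \<partial>N)" if g: "continuous_on UNIV g" for g :: "_ \<Rightarrow> real"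
  proof -
    let ?K = "emb ` cbox (\<chi> i. - pi) (\<chi> i. pi)"
    have K: "compact ?K" by (intro compact_continuous_image continuous_emb compact_cbox)
    have gc: "continuous_on UNIV (\<lambda>x. g (emb x))"
      by (rule continuous_on_compose2[OF g continuous_emb]) auto
    have bound: "\<bar>(\<integral>x. g (emb x) \<partial>M) - (\<integral>x. g (emb x) \<partial>N)\<bar> \<le> e * (measure M cell + measure N cell)" if e: "e > 0" for e
    proof -
      obtain p where p: "real_polynomial_function p" "\<And>y. y \<in> ?K \<Longrightarrow> \<bar>g y - p y\<bar> < e"
        using Stone_Weierstrass_real_polynomial_function[OF K continuous_on_subset[OF g] e] by auto
      have le: "\<bar>g (emb x) - p (emb x)\<bar> \<le> e" if "x \<in> cell" for x
        using p(2)[of "emb x"] that cell_subset by force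
      have tp: "trig_poly (\<lambda>x. p (emb x))" by (rule trig_poly_polynomial_emb[OF p(1)])
      have pc: "continuous_on UNIV (\<lambda>x. p (emb x))" by (rule continuous_trig_poly[OF tp])
      have *: "\<bar>(\<integral>x. g (emb x) \<partial>L) - (\<integral>x. p (emb x) \<partial>L)\<bar> \<le> e * measure L cell" if "cell_measure L" for L
      proof -
        interpret L: cell_measure L by fact
        have "\<bar>(\<integral>x. g (emb x) \<partial>L) - (\<integral>x. p (emb x) \<partial>L)\<bar> = \<bar>\<integral>x. g (emb x) - p (emb x) \<partial>L\<bar>"
          by (simp add: L.continuous_integrable gc pc)
        also have "\<dots> \<le> (\<integral>x. \<bar>g (emb x) - p (emb x)\<bar> \<partial>L)" by (rule integral_abs_bound)
        also have "\<dots> \<le> (\<integral>x. e \<partial>L)"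
          by (intro integral_mono L.continuous_integrable continuous_intros gc pc)
            (auto simp: L.space_M le)
        finally show ?thesis by (simp add: L.space_M mult.commute)
      qed
      show ?thesis using *[OF assms(1)] *[OF assms(2)] trig[OF tp] by (simp add: distrib_left)
    qed
    show ?thesis
    proof (rule ccontr)
      let ?d = "\<bar>(\<integral>x. g (emb x) \<partial>M) - (\<integral>x. g (emb x) \<partial>N)\<bar>" and ?m = "measure M cell + measure N cell"
      assume "(\<integral>x. g (emb x) \<partial>M) \<noteq> (\<integral>x. g (emb x) \<partial>N)"
      then have d: "?d > 0" by simp
      have m: "?m \<ge> 0" by simp
      \<comment> \<open>The added 1 keeps the divisor positive when both measures are zero.\<close>
      have "0 < ?d / (2 * (?m + 1))" by (rule divide_pos_pos[OF d]) (smt (verit) measure_nonneg)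
      then have "?d \<le> ?d / (2 * (?m + 1)) * ?m" by (rule bound)
      also have "\<dots> = ?d * ?m / (2 * (?m + 1))" by simp
      also have "\<dots> < ?d"
      proof (subst pos_divide_less_eq)
        show "?d * ?m < ?d * (2 * (?m + 1))"
          by (rule mult_strict_left_mono[OF _ d]) (use m in \<open>smt (verit) measure_nonneg\<close>)
      qed (smt (verit) measure_nonneg)
      finally show False by simp
    qed
  qed
  have closed: "measure M (emb -` C \<inter> cell) = measure N (emb -` C \<inter> cell)" if C: "closed C" for C
  proof (cases "C = {}")
    case False
    \<comment> \<open>Continuous functions decreasing to the indicator of the closed set
      \<open>C\<close>.\<close>
    define g where "g n y = max 0 (1 - real n * infdist y C)" for n y
    have g01: "0 \<le> g n y" "g n y \<le> 1" for n y
      by (auto simp: g_def infdist_nonneg)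
    have gc: "continuous_on UNIV (g n)" for n
      unfolding g_def by (intro continuous_intros)
    have lim: "(\<lambda>n. g n y) \<longlonglongrightarrow> indicator C y" for y
    proof (cases "y \<in> C")
      case True
      then show ?thesis by (simp add: g_def)
    next
      case nin: False
      then have d: "infdist y C > 0"
        using C False infdist_pos_not_in_closed by blast
      then obtain n0 where n0: "1 / infdist y C < real n0" using reals_Archimedean2 by blast
      have "g n y = 0" if "n \<ge> n0" for n
      proof -
        have "1 / infdist y C < real n" using n0 that by linarith
        then show ?thesis using d by (simp add: g_def field_simps)
      qed
      then have "eventually (\<lambda>n. g n y = indicator C y) sequentially"
        using nin by (auto simp: eventually_sequentially)
      then show ?thesis by (rule tendsto_eventually)
    qed
    have *: "(\<lambda>n. \<integral>x. g n (emb x) \<partial>L) \<longlonglongrightarrow> measure L (emb -` C \<inter> cell)" if "cell_measure L" for L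
    proof -
      interpret L: cell_measure L by fact
      have eL: "emb \<in> borel_measurable L"
        by (auto intro!: L.measurable_M borel_measurable_continuous_onI continuous_emb)
      have gL: "(\<lambda>x. g n (emb x)) \<in> borel_measurable L" for n
        by (rule measurable_compose[OF eL borel_measurable_continuous_onI[OF gc]])
      have CL: "emb -` C \<inter> cell \<in> sets L"
        using measurable_sets[OF eL, of C] C by (simp add: L.space_M)
      have "(\<lambda>n. \<integral>x. g n (emb x) \<partial>L) \<longlonglongrightarrow> (\<integral>x. indicator C (emb x) \<partial>L)"
        by (rule integral_dominated_convergence[where w="\<lambda>_. 1"])
          (use eL gL C g01 lim in \<open>auto intro!: measurable_compose[OF eL]\<close>)
      also have "(\<integral>x. indicator C (emb x) \<partial>L) = (\<integral>x. indicator (emb -` C \<inter> cell) x \<partial>L)"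
        by (intro Bochner_Integration.integral_cong) (auto simp: indicator_def L.space_M)
      also have "\<dots> = measure L (emb -` C \<inter> cell)"
        using CL L.space_M by simp
      finally show ?thesis .
    qed
    show ?thesis
      using *[OF assms(1)] *[OF assms(2)] cont[OF gc] by (simp add: LIMSEQ_unique)
  qed simp
  \<comment> \<open>Closed sets are an intersection-stable generator of the Borel sets, so equality
    of the finite measures on them suffices.\<close>
  have "distr M borel emb = distr N borel emb"
  proof (rule measure_eqI_generator_eq[where E="Collect closed" and \<Omega>=UNIV and A="\<lambda>_. UNIV"])
    fix C :: "((real^3) \<times> (real^3)) set" assume "C \<in> Collect closed"
    then show "emeasure (distr M borel emb) C = emeasure (distr N borel emb) C"
      using closed[of C]
      by (simp add: emeasure_distr M.space_M N.space_M M.emeasure_eq_measure N.emeasure_eq_measure)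
  next
    show "sets (distr M borel emb) = sigma_sets UNIV (Collect closed)"
      "sets (distr N borel emb) = sigma_sets UNIV (Collect closed)"
      by (simp_all add: borel_eq_closed)
    show "emeasure (distr M borel emb) UNIV \<noteq> \<infinity>"
      by (simp add: emeasure_distr)
  qed (auto simp: Int_stable_def)
  show "M = N"
  proof (rule measure_eqI)
    show "sets M = sets N" by (simp add: M.sets_M N.sets_M)
    fix A assume "A \<in> sets M"
    then have A: "A \<in> sets borel" "A \<subseteq> cell" by (auto simp: M.sets_M cell_sets_iff)
    have "x \<in> A \<longleftrightarrow> x \<in> emb -` (unemb -` A) \<inter> cell" for x
      using A(2) by (cases "x \<in> cell") (auto simp: unemb_emb)
    \<comment> \<open>It is not necessary to know that \<open>emb\<close> maps Borel sets to Borel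
      sets: \<open>A\<close> is pulled back from the Borel set of points that \<open>unemb\<close>
      sends into \<open>A\<close>.\<close>
    then have Aeq: "A = emb -` (unemb -` A) \<inter> cell" by blast
    have S: "unemb -` A \<in> sets borel" using measurable_sets_borel[OF borel_measurable_unemb A(1)] .
    have "emeasure M A = emeasure (distr M borel emb) (unemb -` A)"
      using S Aeq by (simp add: emeasure_distr M.space_M)
    also have "\<dots> = emeasure N A"
      using S Aeq \<open>distr M borel emb = distr N borel emb\<close> by (simp add: emeasure_distr N.space_M)
    finally show "emeasure M A = emeasure N A" .
  qed
qed

text \<open>Completeness of Lebesgue measure.\<close>

lemma torus_measurable_cong_AE:
  fixes f g :: "real^3 \<Rightarrow> 'b::euclidean_space"
  assumes "f \<in> borel_measurable torus" "AE x in torus. f x = g x"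
  shows "g \<in> borel_measurable torus"
proof -
  have "(\<lambda>x. if x \<in> cell then f x else 0) \<in> borel_measurable lebesgue"
    using assms(1) by (simp add: borel_measurable_if)
  moreover have "AE x in lebesgue. (if x \<in> cell then f x else 0) = (if x \<in> cell then g x else 0)"
    using assms(2) by (simp add: AE_restrict_space_iff)
  ultimately have "(\<lambda>x. if x \<in> cell then g x else 0) \<in> borel_measurable lebesgue"
    by (rule borel_measurable_AE)
  then show ?thesis by (simp add: borel_measurable_if)
qed

text \<open>The positive and the negative part of \<open>g\<close>, taken as densities, have the
  same Hartley coefficients, so they define the same measure and agree almost everywhere.\<close>

lemma AE_zero_if_orthogonal_cas:
  fixes g :: "real^3 \<Rightarrow> real"
  assumes g: "integrable torus g" and orth: "\<And>k. (\<integral>x. cas k x * g x \<partial>torus) = 0"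
  shows "AE x in torus. g x = 0"
proof -
  \<comment> \<open>\<open>distr\<close> by the identity only restricts the density measure to the
    Borel subsets of the cell, as \<open>cell_measure\<close> demands.\<close>
  define M where "M p = distr (density torus (\<lambda>x. ennreal (p x))) (restrict_space borel cell) (\<lambda>x. x)"
    for p :: "real^3 \<Rightarrow> real"
  have id_meas: "(\<lambda>x. x) \<in> measurable torus (restrict_space borel cell)"
    by (intro measurable_restrict_space2) (auto intro!: continuous_torus_measurable continuous_intros)
  define p where "p x = max 0 (g x)" for x
  define m where "m x = max 0 (- g x)" for x
  have p: "integrable torus p" "\<And>x. 0 \<le> p x" and m: "integrable torus m" "\<And>x. 0 \<le> m x"
    unfolding p_def m_def using g by (auto intro!: integrable_max)
  have gpm: "g x = p x - m x" for x by (auto simp: p_def m_def)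
  have emM: "emeasure (M q) B = ennreal (\<integral>x. indicator B x * q x \<partial>torus)"
    if q: "integrable torus q" "\<And>x. 0 \<le> q x" and B: "B \<in> cell_sets" for q B
  proof -
    have Bt: "B \<in> sets torus"
      using measurable_sets[OF id_meas, of B] B
      by (simp add: cell_sets_def) (metis Int_absorb2 cell_sets_def cell_sets_iff)
    have "emeasure (M q) B = emeasure (density torus (\<lambda>x. ennreal (q x))) B"
      unfolding M_def using B id_meas
      by (subst emeasure_distr) (auto simp: cell_sets_def cell_sets_iff[unfolded cell_sets_def] Int_absorb2)
    also have "\<dots> = (\<integral>\<^sup>+x. ennreal (q x) * indicator B x \<partial>torus)"
      using q Bt by (intro emeasure_density) auto
    also have "\<dots> = (\<integral>\<^sup>+x. ennreal (indicator B x * q x) \<partial>torus)"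
      by (intro nn_integral_cong) (auto simp: indicator_def)
    also have "\<dots> = ennreal (\<integral>x. indicator B x * q x \<partial>torus)"
      using q Bt integrable_real_mult_indicator[OF Bt q(1)]
      by (intro nn_integral_eq_integral) (auto simp: mult.commute)
    finally show ?thesis .
  qed
  have cM: "cell_measure (M q)" if q: "integrable torus q" "\<And>x. 0 \<le> q x" for q
  proof (intro cell_measure.intro finite_measureI cell_measure_axioms.intro)
    show "sets (M q) = cell_sets" by (simp add: M_def cell_sets_def)
    have "space (M q) = cell" by (simp add: M_def space_restrict_space)
    then show "emeasure (M q) (space (M q)) \<noteq> \<infinity>"
      using emM[OF q, of cell] by (simp add: cell_sets_iff)
  qed
  have iM: "(\<integral>x. cas k x \<partial>M q) = (\<integral>x. cas k x * q x \<partial>torus)"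
    if q: "integrable torus q" "\<And>x. 0 \<le> q x" for q k
  proof -
    have ck: "cas k \<in> borel_measurable borel"
      by (intro borel_measurable_continuous_onI continuous_intros)
    have "(\<integral>x. cas k x \<partial>M q) = (\<integral>x. cas k x \<partial>density torus (\<lambda>x. ennreal (q x)))"
      unfolding M_def using id_meas ck by (subst integral_distr) (auto intro: measurable_restrict_space1)
    also have "\<dots> = (\<integral>x. q x *\<^sub>R cas k x \<partial>torus)"
      using q by (subst integral_density) (auto intro!: continuous_torus_measurable continuous_intros)
    finally show ?thesis by (simp add: mult.commute)
  qed
  have int_cas: "integrable torus (\<lambda>x. cas k x * q x)" if "integrable torus q" for q k
  proof (rule Bochner_Integration.integrable_bound[of _ "\<lambda>x. 2 * q x"])
    show "AE x in torus. norm (cas k x * q x) \<le> norm (2 * q x)"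
      by (intro AE_I2) (auto simp: abs_mult intro!: mult_right_mono abs_cas_le)
  next
    have "cas k \<in> borel_measurable torus"
      by (intro continuous_torus_measurable continuous_intros)
    then show "(\<lambda>x. cas k x * q x) \<in> borel_measurable torus" using that by simp
  qed (use that in simp)
  have MM: "M p = M m"
  proof (rule cell_measure_eqI[OF cM[OF p] cM[OF m]])
    fix k
    have "(\<integral>x. cas k x * p x \<partial>torus) - (\<integral>x. cas k x * m x \<partial>torus) = (\<integral>x. cas k x * g x \<partial>torus)"
      by (simp add: gpm right_diff_distrib int_cas p m)
    then show "(\<integral>x. cas k x \<partial>M p) = (\<integral>x. cas k x \<partial>M m)"
      using orth by (simp add: iM p m)
  qed
  have "AE x in torus. p x = m x"
  proof (rule density_unique_real[OF p(1) m(1)])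
    fix A assume A: "A \<in> sets torus"
    then have Al: "A \<in> sets lebesgue" "A \<subseteq> cell" by (auto simp: sets_restrict_space_iff)
    \<comment> \<open>A Lebesgue set is a Borel set \<open>S\<close> up to a null set; the equality
      of the measures is known on Borel sets only.\<close>
    obtain S N N' where S: "A = S \<union> N" "N \<subseteq> N'" "N' \<in> null_sets lborel" "S \<in> sets lborel"
      using Al(1) unfolding sets_completion by blast
    have B: "S \<in> cell_sets" using S Al by (auto simp: cell_sets_iff)
    have "AE x in lebesgue. x \<notin> N'"
      using S(3) by (intro AE_not_in) (auto simp: null_sets_completionI)
    then have "AE x in torus. x \<notin> N'" by (subst AE_restrict_space_iff) auto
    then have ae: "AE x in torus. indicator A x = (indicator S x :: real)"
      by eventually_elim (use S in \<open>auto simp: indicator_def\<close>)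
    have St: "S \<in> sets torus" using S(4) B by (auto simp: sets_restrict_space_iff cell_sets_iff)
    have *: "(\<integral>x\<in>A. q x \<partial>torus) = (\<integral>x. indicator S x * q x \<partial>torus)" if "integrable torus q" for q :: "real^3 \<Rightarrow> real"
    proof -
      note [measurable] = A St borel_measurable_integrable[OF that]
      have "(\<lambda>x. indicator A x *\<^sub>R q x) \<in> borel_measurable torus" "(\<lambda>x. indicator S x * q x) \<in> borel_measurable torus"
        by measurable
      then show ?thesis
        unfolding set_lebesgue_integral_def using ae
        by (intro integral_cong_AE) (auto elim: eventually_mono)
    qed
    have nn: "0 \<le> (\<integral>x. indicator S x * q x \<partial>torus)" if "\<And>x. 0 \<le> q x" for q :: "real^3 \<Rightarrow> real"
      by (rule integral_nonneg_AE) (auto simp: that)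
    show "(\<integral>x\<in>A. p x \<partial>torus) = (\<integral>x\<in>A. m x \<partial>torus)"
      unfolding *[OF p(1)] *[OF m(1)]
      using emM[OF p B] emM[OF m B] MM nn[OF p(2)] nn[OF m(2)] by (simp add: ennreal_inj)
  qed
  then show ?thesis by eventually_elim (simp add: gpm)
qed

section \<open>Square-integrable functions\<close>

definition ip :: "(real^3 \<Rightarrow> 'b::euclidean_space) \<Rightarrow> (real^3 \<Rightarrow> 'b) \<Rightarrow> real" where
  "ip f g = (\<integral>x. f x \<bullet> g x \<partial>torus)"

definition n2 :: "(real^3 \<Rightarrow> 'b::euclidean_space) \<Rightarrow> real" where
  "n2 f = sqrt (ip f f)"

lemma L2_measurable [measurable_dest]: "L2 f \<Longrightarrow> f \<in> borel_measurable torus"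
  by (simp add: L2_def)

lemma L2_power2: "L2 f \<Longrightarrow> integrable torus (\<lambda>x. (norm (f x))\<^sup>2)"
  by (simp add: L2_def)

lemma L2_cong_AE:
  assumes "L2 f" "AE x in torus. f x = g x"
  shows "L2 g"
proof -
  have g: "g \<in> borel_measurable torus"
    using torus_measurable_cong_AE[OF L2_measurable[OF assms(1)] assms(2)] .
  have "integrable torus (\<lambda>x. (norm (g x))\<^sup>2)"
    by (rule integrable_cong_AE_imp[OF L2_power2[OF assms(1)]]) (use g assms(2) in auto)
  with g show ?thesis by (simp add: L2_def)
qed

lemma L2_inner_integrable [simp]:
  assumes "L2 f" "L2 g"
  shows "integrable torus (\<lambda>x. f x \<bullet> g x)"
proof (rule Bochner_Integration.integrable_bound)
  show "integrable torus (\<lambda>x. (norm (f x))\<^sup>2 + (norm (g x))\<^sup>2)"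
    using assms by (simp add: L2_power2)
  show "(\<lambda>x. f x \<bullet> g x) \<in> borel_measurable torus"
    using assms[THEN L2_measurable] by simp
  show "AE x in torus. norm (f x \<bullet> g x) \<le> norm ((norm (f x))\<^sup>2 + (norm (g x))\<^sup>2)"
  proof (rule AE_I2)
    fix x
    have "\<bar>f x \<bullet> g x\<bar> \<le> norm (f x) * norm (g x)" by (rule Cauchy_Schwarz_ineq2)
    also have "\<dots> \<le> (norm (f x))\<^sup>2 + (norm (g x))\<^sup>2"
      using sum_squares_bound[of "norm (f x)" "norm (g x)"]
        mult_nonneg_nonneg[OF norm_ge_zero[of "f x"] norm_ge_zero[of "g x"]] by linarith
    finally show "norm (f x \<bullet> g x) \<le> norm ((norm (f x))\<^sup>2 + (norm (g x))\<^sup>2)" by simp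
  qed
qed

lemma L2_I:
  assumes "f \<in> borel_measurable torus" "g \<in> borel_measurable torus" "integrable torus g"
    "AE x in torus. (norm (f x))\<^sup>2 \<le> g x"
  shows "L2 f"
  unfolding L2_def
proof
  show "integrable torus (\<lambda>x. (norm (f x))\<^sup>2)"
    by (rule Bochner_Integration.integrable_bound[OF assms(3)]) (use assms in auto)
qed fact

lemma L2_bounded:
  assumes "f \<in> borel_measurable torus" "AE x in torus. norm (f x) \<le> B"
  shows "L2 f"
proof (rule L2_I[OF assms(1)])
  show "AE x in torus. (norm (f x))\<^sup>2 \<le> B\<^sup>2"
    using assms(2) by eventually_elim (simp add: power_mono)
qed auto

lemma L2_continuous:
  fixes f :: "real^3 \<Rightarrow> 'b::euclidean_space"
  assumes "continuous_on UNIV f"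
  shows "L2 f"
proof -
  obtain B where "\<And>x. x \<in> cell \<Longrightarrow> norm (f x) \<le> B" using bounded_on_cell[OF assms] by blast
  then show ?thesis by (intro L2_bounded[where B=B] continuous_torus_measurable assms AE_torus_I)
qed

lemma L2_const [simp]: "L2 (\<lambda>x. c)" by (intro L2_continuous continuous_intros)

lemma L2_scaleR [simp]: "L2 f \<Longrightarrow> L2 (\<lambda>x. c *\<^sub>R f x)"
  unfolding L2_def by (auto simp: power_mult_distrib)

lemma L2_uminus [simp]: "L2 f \<Longrightarrow> L2 (\<lambda>x. - f x)"
  unfolding L2_def by auto

lemma L2_add [simp]:
  assumes "L2 f" "L2 g" shows "L2 (\<lambda>x. f x + g x)"
proof (rule L2_I)
  show "AE x in torus. (norm (f x + g x))\<^sup>2 \<le> 2 * (norm (f x))\<^sup>2 + 2 * (norm (g x))\<^sup>2"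
  proof (rule AE_I2)
    fix x
    have "(norm (f x + g x))\<^sup>2 \<le> (norm (f x) + norm (g x))\<^sup>2"
      by (intro power_mono norm_triangle_ineq) auto
    also have "\<dots> \<le> 2 * (norm (f x))\<^sup>2 + 2 * (norm (g x))\<^sup>2"
      using sum_squares_bound[of "norm (f x)" "norm (g x)"] by (simp add: power2_sum)
    finally show "(norm (f x + g x))\<^sup>2 \<le> 2 * (norm (f x))\<^sup>2 + 2 * (norm (g x))\<^sup>2" .
  qed
qed (use assms[THEN L2_measurable] assms[THEN L2_power2] in auto)

lemma L2_diff [simp]: "L2 f \<Longrightarrow> L2 g \<Longrightarrow> L2 (\<lambda>x. f x - g x)"
  using L2_add[OF _ L2_uminus] by (simp only: diff_conv_add_uminus)

lemma L2_sum [simp]: "(\<And>i. i \<in> I \<Longrightarrow> L2 (f i)) \<Longrightarrow> L2 (\<lambda>x. \<Sum>i\<in>I. f i x)"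
  by (induction I rule: infinite_finite_induct) auto

lemma L2_continuous_scaleR [simp]:
  assumes c: "continuous_on UNIV c" and f: "L2 f"
  shows "L2 (\<lambda>x. c x *\<^sub>R f x)"
proof -
  obtain B where B: "\<And>x. x \<in> cell \<Longrightarrow> norm (c x) \<le> B" using bounded_on_cell[OF c] by blast
  show ?thesis
  proof (rule L2_I)
    show "AE x in torus. (norm (c x *\<^sub>R f x))\<^sup>2 \<le> B\<^sup>2 * (norm (f x))\<^sup>2"
      using B by (intro AE_torus_I) (auto simp: power_mult_distrib abs_le_square_iff[symmetric]
        intro!: mult_right_mono power2_le_iff_abs_le[THEN iffD2] intro: order_trans[OF abs_ge_zero])
  qed (use f[THEN L2_measurable] f[THEN L2_power2] continuous_torus_measurable[OF c] in auto)
qed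

lemma L2_integrable [simp]:
  assumes "L2 (f :: real^3 \<Rightarrow> 'b::euclidean_space)" shows "integrable torus f"
proof (rule Bochner_Integration.integrable_bound)
  show "integrable torus (\<lambda>x. 1 + (norm (f x))\<^sup>2)" using assms by (simp add: L2_power2)
  show "AE x in torus. norm (f x) \<le> norm (1 + (norm (f x))\<^sup>2)"
  proof (rule AE_I2)
    fix x show "norm (f x) \<le> norm (1 + (norm (f x))\<^sup>2)"
      using sum_squares_bound[of "norm (f x)" 1] norm_ge_zero[of "f x"] unfolding real_norm_def
      by (simp, linarith)
  qed
qed (use assms[THEN L2_measurable] in auto)

lemma L2_inner_const [simp]: "L2 f \<Longrightarrow> L2 (\<lambda>x. f x \<bullet> b)"
  by (rule L2_I[where g="\<lambda>x. (norm b)\<^sup>2 * (norm (f x))\<^sup>2"])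
    (auto simp: L2_power2 L2_measurable power2_norm_eq_inner mult.commute
      intro!: AE_I2 order_trans[OF Cauchy_Schwarz_ineq])

lemma L2_nth [simp]: "L2 f \<Longrightarrow> L2 (\<lambda>x. f x $ i)"
proof -
  assume f: "L2 f"
  have b: "bounded_linear (\<lambda>y::'a^'b. y $ i)" by (rule bounded_linear_vec_nth)
  show "L2 (\<lambda>x. f x $ i)"
    by (rule L2_I[where g="\<lambda>x. (norm (f x))\<^sup>2"])
      (use f in \<open>auto intro!: L2_power2 L2_measurable AE_I2 power_mono Finite_Cartesian_Product.norm_nth_le
        borel_measurable_continuous_on[OF linear_continuous_on[OF b]]\<close>)
qed

lemma ip_commute: "ip f g = ip g f" by (simp add: ip_def inner_commute)

lemma ip_cong_AE:
  assumes "L2 f" "L2 g" "AE x in torus. f x = f' x" "AE x in torus. g x = g' x"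
  shows "ip f g = ip f' g'"
proof -
  have "f' \<in> borel_measurable torus" "g' \<in> borel_measurable torus"
    using assms L2_cong_AE L2_measurable by blast+
  moreover have "AE x in torus. f x \<bullet> g x = f' x \<bullet> g' x"
    using assms(3,4) by eventually_elim simp
  ultimately show ?thesis
    unfolding ip_def using assms(1,2)[THEN L2_measurable] by (intro integral_cong_AE) auto
qed

lemma ip_add_left: "L2 f \<Longrightarrow> L2 g \<Longrightarrow> L2 h \<Longrightarrow> ip (\<lambda>x. f x + g x) h = ip f h + ip g h"
  by (simp add: ip_def inner_add_left)

lemma ip_diff_left: "L2 f \<Longrightarrow> L2 g \<Longrightarrow> L2 h \<Longrightarrow> ip (\<lambda>x. f x - g x) h = ip f h - ip g h"
  by (simp add: ip_def inner_diff_left)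

lemma ip_scale_left: "ip (\<lambda>x. c *\<^sub>R f x) h = c * ip f h"
  by (simp add: ip_def)

lemma ip_add_right: "L2 f \<Longrightarrow> L2 g \<Longrightarrow> L2 h \<Longrightarrow> ip h (\<lambda>x. f x + g x) = ip h f + ip h g"
  by (simp add: ip_def inner_add_right)

lemma ip_diff_right: "L2 f \<Longrightarrow> L2 g \<Longrightarrow> L2 h \<Longrightarrow> ip h (\<lambda>x. f x - g x) = ip h f - ip h g"
  by (simp add: ip_def inner_diff_right)

lemma ip_scale_right: "ip h (\<lambda>x. c *\<^sub>R f x) = c * ip h f"
  by (simp add: ip_def)

lemma ip_sum_left: "(\<And>i. i \<in> I \<Longrightarrow> L2 (f i)) \<Longrightarrow> L2 h \<Longrightarrow> ip (\<lambda>x. \<Sum>i\<in>I. f i x) h = (\<Sum>i\<in>I. ip (f i) h)"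
  by (simp add: ip_def inner_sum_left)

lemma ip_sum_right: "(\<And>i. i \<in> I \<Longrightarrow> L2 (f i)) \<Longrightarrow> L2 h \<Longrightarrow> ip h (\<lambda>x. \<Sum>i\<in>I. f i x) = (\<Sum>i\<in>I. ip h (f i))"
  by (simp add: ip_def inner_sum_right)

lemma ip_self_nonneg [simp]: "0 \<le> ip f f"
  by (auto simp: ip_def intro!: integral_nonneg_AE)

lemma n2_nonneg [simp]: "0 \<le> n2 f" by (simp add: n2_def)

lemma n2_power2: "(n2 f)\<^sup>2 = ip f f" by (simp add: n2_def)

lemma ip_self: "ip f f = (\<integral>x. (norm (f x))\<^sup>2 \<partial>torus)"
  by (simp add: ip_def power2_norm_eq_inner)

lemma n2_cong_AE: "L2 f \<Longrightarrow> AE x in torus. f x = g x \<Longrightarrow> n2 f = n2 g"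
  unfolding n2_def by (simp add: ip_cong_AE)

lemma n2_minus_commute: "n2 (\<lambda>x. f x - g x) = n2 (\<lambda>x. g x - f x)"
  by (simp add: n2_def ip_self norm_minus_commute)

lemma AE_eq_zero_if_n2_zero:
  assumes "L2 f" "n2 f = 0" shows "AE x in torus. f x = 0"
proof -
  have "(\<integral>x. (norm (f x))\<^sup>2 \<partial>torus) = 0" using assms(2) by (simp add: n2_def ip_self)
  then have "AE x in torus. (norm (f x))\<^sup>2 = 0"
    by (subst (asm) integral_nonneg_eq_0_iff_AE) (auto intro: L2_power2[OF assms(1)])
  then show ?thesis by eventually_elim simp
qed

lemma ip_Cauchy_Schwarz:
  assumes "L2 f" "L2 g" shows "\<bar>ip f g\<bar> \<le> n2 f * n2 g"
proof -
  have q: "0 \<le> ip f f * (s * s) - 2 * s * ip f g + ip g g" for s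
  proof -
    have "0 \<le> ip (\<lambda>x. s *\<^sub>R f x - g x) (\<lambda>x. s *\<^sub>R f x - g x)" by simp
    also have "\<dots> = ip f f * (s * s) - 2 * s * ip f g + ip g g"
      using assms by (simp add: ip_diff_left ip_diff_right ip_scale_left ip_scale_right ip_commute[of g f] algebra_simps)
    finally show ?thesis .
  qed
  have "(ip f g)\<^sup>2 \<le> ip f f * ip g g"
  proof (cases "ip f f = 0")
    case True
    have "ip f g = 0"
    proof (rule ccontr)
      assume n: "ip f g \<noteq> 0"
      \<comment> \<open>With vanishing leading coefficient the quadratic is affine, and this
        argument gives it the value - 1.\<close>
      then show False using q[of "(ip g g + 1) / ip f g / 2"] True by simp
    qed
    then show ?thesis using True by simp
  next
    case False
    then have pos: "ip f f > 0" using ip_self_nonneg[of f] by linarith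
    have "0 \<le> ip f f * (ip f g / ip f f * (ip f g / ip f f)) - 2 * (ip f g / ip f f) * ip f g + ip g g"
      by (rule q)
    also have "\<dots> = ip g g - (ip f g)\<^sup>2 / ip f f"
      using pos by (simp add: power2_eq_square field_simps)
    finally show ?thesis using pos by (simp add: field_simps)
  qed
  then have "sqrt ((ip f g)\<^sup>2) \<le> sqrt (ip f f * ip g g)" by (rule real_sqrt_le_mono)
  then show ?thesis by (simp add: n2_def real_sqrt_mult)
qed

lemma n2_triangle:
  assumes "L2 f" "L2 g" shows "n2 (\<lambda>x. f x + g x) \<le> n2 f + n2 g"
proof (rule power2_le_imp_le)
  have "(n2 (\<lambda>x. f x + g x))\<^sup>2 = ip f f + 2 * ip f g + ip g g"
    using assms by (simp add: n2_power2 ip_add_left ip_add_right ip_commute[of g f])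
  also have "\<dots> \<le> (n2 f + n2 g)\<^sup>2"
    using ip_Cauchy_Schwarz[OF assms] by (simp add: power2_sum n2_power2)
  finally show "(n2 (\<lambda>x. f x + g x))\<^sup>2 \<le> (n2 f + n2 g)\<^sup>2" .
qed simp

lemma n2_triangle_diff:
  assumes "L2 f" "L2 g" "L2 h"
  shows "n2 (\<lambda>x. f x - h x) \<le> n2 (\<lambda>x. f x - g x) + n2 (\<lambda>x. g x - h x)"
  using n2_triangle[of "\<lambda>x. f x - g x" "\<lambda>x. g x - h x"] assms by simp

lemma n2_le_bound:
  assumes "f \<in> borel_measurable torus" "AE x in torus. norm (f x) \<le> B" "0 \<le> B"
  shows "n2 f \<le> sqrt vol * B"
proof -
  have "L2 f" by (rule L2_bounded[OF assms(1,2)])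
  have "ip f f \<le> (\<integral>x. B\<^sup>2 \<partial>torus)"
    unfolding ip_self
    by (rule integral_mono_AE[OF L2_power2[OF \<open>L2 f\<close>]]) (use assms(2) in \<open>auto elim!: eventually_mono intro!: power_mono\<close>)
  also have "\<dots> = vol * B\<^sup>2" by simp
  finally have "sqrt (ip f f) \<le> sqrt (vol * B\<^sup>2)" by (rule real_sqrt_le_mono)
  then show ?thesis using assms(3) by (simp add: n2_def real_sqrt_mult)
qed

section \<open>Hartley series\<close>

text \<open>Every \<open>cas k\<close> has squared norm \<open>vol\<close>, whence the factor;
  \<open>hat f k\<close> is the coefficient in the expansion of \<open>f\<close>.\<close>

definition hat :: "(real^3 \<Rightarrow> 'b::euclidean_space) \<Rightarrow> int^3 \<Rightarrow> 'b" where
  "hat f k = (1 / vol) *\<^sub>R (\<integral>x. cas k x *\<^sub>R f x \<partial>torus)"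

text \<open>An arbitrary order of the frequencies. The series below converge by orthogonality or
  absolutely, so the order has no influence on their sums.\<close>

definition enum :: "nat \<Rightarrow> int^3" where "enum = from_nat_into UNIV"

text \<open>The frequencies are a parameter besides the coefficients because differentiation negates
  them.\<close>

definition tpoly :: "(nat \<Rightarrow> int^3) \<Rightarrow> (nat \<Rightarrow> 'b::euclidean_space) \<Rightarrow> nat \<Rightarrow> real^3 \<Rightarrow> 'b" where
  "tpoly \<kappa> a n x = (\<Sum>i<n. cas (\<kappa> i) x *\<^sub>R a i)"

abbreviation trunc :: "nat \<Rightarrow> (real^3 \<Rightarrow> 'b::euclidean_space) \<Rightarrow> real^3 \<Rightarrow> 'b" where
  "trunc n f \<equiv> tpoly enum (\<lambda>i. hat f (enum i)) n"

lemma bij_enum: "bij enum"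
proof -
  have "inj (axis 1 :: int \<Rightarrow> int^3)" by (auto simp: inj_def axis_eq_axis)
  then have "infinite (UNIV :: (int^3) set)"
    using infinite_UNIV_int finite_subset[OF subset_UNIV] finite_imageD by blast
  then show ?thesis unfolding enum_def by (intro bij_betw_from_nat_into) auto
qed

lemma inj_enum: "inj enum" using bij_enum by (rule bij_is_inj)

lemma enum_eq_iff [simp]: "enum i = enum j \<longleftrightarrow> i = j" using inj_enum by (auto simp: inj_eq)

lemma finite_subset_enum:
  assumes "finite K" obtains n where "K \<subseteq> enum ` {..<n}"
proof -
  have "finite (inv enum ` K)" using assms by simp
  then obtain n where "inv enum ` K \<subseteq> {..<n}" by (meson finite_nat_iff_bounded)
  moreover have "K = enum ` (inv enum ` K)"
    using bij_enum by (simp add: image_image bij_is_surj surj_f_inv_f)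
  ultimately have "K \<subseteq> enum ` {..<n}" by (metis image_mono)
  then show ?thesis by (rule that)
qed

lemma L2_cas [simp]: "L2 f \<Longrightarrow> L2 (\<lambda>x. cas k x *\<^sub>R f x)"
  by (intro L2_continuous_scaleR continuous_intros)

lemma continuous_tpoly: "continuous_on S (tpoly \<kappa> a n)"
  unfolding tpoly_def by (intro continuous_intros)

lemma L2_tpoly [simp]: "L2 (tpoly \<kappa> a n)" by (intro L2_continuous continuous_tpoly)

lemma hat_inner: "L2 f \<Longrightarrow> hat f k \<bullet> a = ip f (\<lambda>x. cas k x *\<^sub>R a) / vol"
  using integral_inner_left[of a torus "\<lambda>x. cas k x *\<^sub>R f x"] by (simp add: hat_def ip_def)

lemma hat_cong_AE:
  assumes "L2 f" "AE x in torus. f x = g x" shows "hat f k = hat g k"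
proof -
  have "L2 g" using L2_cong_AE[OF assms] .
  have "(\<integral>x. cas k x *\<^sub>R f x \<partial>torus) = (\<integral>x. cas k x *\<^sub>R g x \<partial>torus)"
  proof (rule integral_cong_AE)
    show "AE x in torus. cas k x *\<^sub>R f x = cas k x *\<^sub>R g x" using assms(2) by eventually_elim simp
  qed (rule L2_measurable[OF L2_cas[OF assms(1)]], rule L2_measurable[OF L2_cas[OF \<open>L2 g\<close>]])
  then show ?thesis by (simp add: hat_def)
qed

lemma hat_add: "L2 f \<Longrightarrow> L2 g \<Longrightarrow> hat (\<lambda>x. f x + g x) k = hat f k + hat g k"
  by (simp add: hat_def scaleR_add_right)

lemma hat_diff: "L2 f \<Longrightarrow> L2 g \<Longrightarrow> hat (\<lambda>x. f x - g x) k = hat f k - hat g k"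
  by (simp add: hat_def scaleR_diff_right)

lemma hat_inner_const: "L2 f \<Longrightarrow> hat (\<lambda>x. f x \<bullet> b) k = hat f k \<bullet> b"
  using integral_inner_left[of b torus "\<lambda>x. cas k x *\<^sub>R f x"] by (simp add: hat_def)

lemma hat_nth: "L2 f \<Longrightarrow> hat (\<lambda>x. f x $ i) k = hat f k $ i"
  unfolding hat_def
  using integral_bounded_linear[OF bounded_linear_vec_nth[of i], of torus "\<lambda>x. cas k x *\<^sub>R f x"] by simp

lemma ip_cas_cas: "ip (\<lambda>x. cas k x *\<^sub>R a) (\<lambda>x. cas l x *\<^sub>R b) = (if k = l then vol * (a \<bullet> b) else 0)"
proof -
  have "ip (\<lambda>x. cas k x *\<^sub>R a) (\<lambda>x. cas l x *\<^sub>R b) = (\<integral>x. (cas k x * cas l x) * (a \<bullet> b) \<partial>torus)"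
    by (simp add: ip_def mult_ac)
  also have "\<dots> = (\<integral>x. cas k x * cas l x \<partial>torus) * (a \<bullet> b)" by simp
  finally show ?thesis by (simp add: integral_cas_mult)
qed

lemma ip_tpoly: "L2 f \<Longrightarrow> ip f (tpoly enum a n) = vol * (\<Sum>i<n. hat f (enum i) \<bullet> a i)"
  unfolding tpoly_def using vol_pos by (simp add: ip_sum_right hat_inner sum_distrib_left)

lemma hat_cas: "hat (\<lambda>x. cas k x *\<^sub>R a) l = (if k = l then a else 0)"
proof (rule euclidean_eqI)
  fix b :: 'a assume "b \<in> Basis"
  show "hat (\<lambda>x. cas k x *\<^sub>R a) l \<bullet> b = (if k = l then a else 0) \<bullet> b"
    using vol_pos by (simp add: hat_inner ip_cas_cas)
qed

lemma hat_sum: "(\<And>i. i \<in> I \<Longrightarrow> L2 (f i)) \<Longrightarrow> hat (\<lambda>x. \<Sum>i\<in>I. f i x) k = (\<Sum>i\<in>I. hat (f i) k)"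
proof (induction I rule: infinite_finite_induct)
  case (insert i I)
  then show ?case by (simp add: hat_add)
qed (auto simp: hat_def)

lemma hat_tpoly: "hat (tpoly enum a n) (enum j) = (if j < n then a j else 0)"
proof -
  have "hat (tpoly enum a n) (enum j) = (\<Sum>i<n. if i = j then a i else 0)"
    unfolding tpoly_def by (subst hat_sum) (auto simp: hat_cas)
  then show ?thesis by simp
qed

lemma ip_tpoly_tpoly: "ip (tpoly enum a n) (tpoly enum b n) = vol * (\<Sum>i<n. a i \<bullet> b i)"
  by (simp add: ip_tpoly hat_tpoly)

text \<open>Pythagoras, the truncation being the orthogonal projection onto the first
  \<open>n\<close> modes.\<close>

lemma n2_trunc_diff: 
  assumes "L2 f" shows "(n2 (\<lambda>x. f x - trunc n f x))\<^sup>2 = ip f f - vol * (\<Sum>i<n. (norm (hat f (enum i)))\<^sup>2)"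
proof -
  have "ip (trunc n f) f = ip f (trunc n f)" by (rule ip_commute)
  then show ?thesis using assms
    by (simp add: n2_power2 ip_diff_left ip_diff_right ip_tpoly ip_tpoly_tpoly power2_norm_eq_inner)
qed

lemma Bessel_enum:
  assumes "L2 f" shows "(\<Sum>i<n. (norm (hat f (enum i)))\<^sup>2) \<le> ip f f / vol"
proof -
  have "vol * (\<Sum>i<n. (norm (hat f (enum i)))\<^sup>2) \<le> ip f f"
    using n2_trunc_diff[OF assms, of n] zero_le_power2[of "n2 (\<lambda>x. f x - trunc n f x)"] by linarith
  then show ?thesis using vol_pos by (simp add: pos_le_divide_eq mult.commute)
qed

lemma Bessel:
  assumes "L2 f" "finite K" shows "(\<Sum>k\<in>K. (norm (hat f k))\<^sup>2) \<le> ip f f / vol"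
proof -
  obtain n where n: "K \<subseteq> enum ` {..<n}" using finite_subset_enum[OF assms(2)] .
  have "(\<Sum>k\<in>K. (norm (hat f k))\<^sup>2) \<le> (\<Sum>k\<in>enum ` {..<n}. (norm (hat f k))\<^sup>2)"
    by (intro sum_mono2 n) auto
  also have "\<dots> = (\<Sum>i<n. (norm (hat f (enum i)))\<^sup>2)"
    by (subst sum.reindex) (auto intro: inj_on_subset[OF inj_enum])
  finally show ?thesis using Bessel_enum[OF assms(1), of n] by linarith
qed

lemma Bessel_summable:
  assumes "L2 f" shows "summable (\<lambda>i. (norm (hat f (enum i)))\<^sup>2)"
  by (rule summableI_nonneg_bounded[OF _ Bessel_enum[OF assms]]) simp

text \<open>Completeness of \<open>L2\<close>, carried out on Hartley sums: a subsequence with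
  geometrically decreasing increments converges almost everywhere, and Fatou's lemma along it bounds
  the distance of the limit to every partial sum by the tail of the series.\<close>

theorem Riesz_Fischer:
  fixes a :: "nat \<Rightarrow> 'b::euclidean_space"
  assumes sm: "summable (\<lambda>i. (norm (a i))\<^sup>2)"
  obtains f where "L2 f" "\<And>i. hat f (enum i) = a i" "(\<lambda>n. n2 (\<lambda>x. f x - tpoly enum a n x)) \<longlonglongrightarrow> 0"
proof -
  define tail where "tail n = vol * (\<Sum>i. (norm (a (i + n)))\<^sup>2)" for n
  have tail0: "tail \<longlonglongrightarrow> 0"
    unfolding tail_def by (rule tendsto_mult_right_zero[OF suminf_exist_split2[OF sm]])
  have tail_nn: "0 \<le> tail n" for n
    unfolding tail_def using vol_pos summable_ignore_initial_segment[OF sm, of n]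
    by (intro mult_nonneg_nonneg suminf_nonneg) auto
  have diff_le: "(n2 (\<lambda>x. tpoly enum a m x - tpoly enum a n x))\<^sup>2 \<le> tail n" if "n \<le> m" for m n
  proof -
    have "tpoly enum a m x - tpoly enum a n x = (\<Sum>i=n..<m. cas (enum i) x *\<^sub>R a i)" for x
      using sum.atLeastLessThan_concat[of 0 n m "\<lambda>i. cas (enum i) x *\<^sub>R a i"] that
      by (simp add: tpoly_def lessThan_atLeast0 algebra_simps)
    then have "(n2 (\<lambda>x. tpoly enum a m x - tpoly enum a n x))\<^sup>2
        = ip (\<lambda>x. \<Sum>i=n..<m. cas (enum i) x *\<^sub>R a i) (\<lambda>x. \<Sum>i=n..<m. cas (enum i) x *\<^sub>R a i)"
      by (simp add: n2_power2)
    also have "\<dots> = (\<Sum>i=n..<m. \<Sum>j=n..<m. if i = j then vol * (a i \<bullet> a j) else 0)"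
      by (simp add: ip_sum_left ip_sum_right ip_cas_cas)
    also have "\<dots> = vol * (\<Sum>i=n..<m. (norm (a i))\<^sup>2)"
      by (simp add: sum_distrib_left power2_norm_eq_inner)
    also have "(\<Sum>i=n..<m. (norm (a i))\<^sup>2) = (\<Sum>i<m-n. (norm (a (i + n)))\<^sup>2)"
      using sum.shift_bounds_nat_ivl[of "\<lambda>i. (norm (a i))\<^sup>2" 0 n "m - n"] that by (simp add: lessThan_atLeast0)
    also have "vol * \<dots> \<le> tail n"
      unfolding tail_def using vol_pos sm
      using summable_ignore_initial_segment[OF sm, of n] by (intro mult_left_mono sum_le_suminf) auto
    finally show ?thesis .
  qed
  \<comment> \<open>\<open>tail\<close> bounds squared norms, so the rate 1/4 yields increments of
    rate 1/2.\<close>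
  have "\<exists>r. \<forall>j. j \<le> r j \<and> tail (r j) < (1/4)^j"
  proof (intro choice allI)
    fix j
    have "eventually (\<lambda>n. j \<le> n \<and> tail n < (1/4)^j) sequentially"
      by (intro eventually_conj eventually_ge_at_top order_tendstoD(2)[OF tail0]) simp
    then show "\<exists>n. j \<le> n \<and> tail n < (1/4)^j" by (auto dest: eventually_happens)
  qed
  then obtain r where r: "\<And>j. j \<le> r j" "\<And>j. tail (r j) < (1/4)^j" by blast
  define F where "F j = tpoly enum a (r j)" for j
  have F_L2 [simp]: "L2 (F j)" for j by (simp add: F_def)
  have step: "n2 (\<lambda>x. F (Suc j) x - F j x) \<le> (1/2)^j" for j
  proof (rule power2_le_imp_le)
    \<comment> \<open>The indices \<open>r j\<close> need not increase, so either of two successive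
      ones may be the smaller; hence the maximum.\<close>
    have "(n2 (\<lambda>x. F (Suc j) x - F j x))\<^sup>2 \<le> max (tail (r j)) (tail (r (Suc j)))"
    proof (cases "r j \<le> r (Suc j)")
      case True
      then show ?thesis using diff_le[OF True] by (simp add: F_def)
    next
      case False
      then show ?thesis using diff_le[of "r (Suc j)" "r j"] by (simp add: F_def n2_minus_commute)
    qed
    also have "\<dots> \<le> (1/4)^j"
      using r(2)[of j] r(2)[of "Suc j"] by (auto simp: field_simps)
    also have "\<dots> = ((1/2)^j)\<^sup>2" by (simp add: power_divide power2_eq_square flip: power_mult_distrib)
    finally show "(n2 (\<lambda>x. F (Suc j) x - F j x))\<^sup>2 \<le> ((1/2)^j)\<^sup>2" .
  qed simp
  have d_meas [measurable]: "(\<lambda>x. norm (F (Suc j) x - F j x)) \<in> borel_measurable torus" for j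
    using L2_measurable[OF F_L2] by simp
  \<comment> \<open>On a finite measure space L2 norms bound L1 norms; summability of the latter
    gives absolute convergence of the telescoping series almost everywhere.\<close>
  have L1: "(\<integral>x. norm (F (Suc j) x - F j x) \<partial>torus) \<le> sqrt vol * (1/2)^j" for j
  proof -
    have "L2 (\<lambda>x. norm (F (Suc j) x - F j x))"
      using L2_diff[OF F_L2 F_L2, of "Suc j" j] by (auto simp: L2_def)
    then have "\<bar>ip (\<lambda>x. norm (F (Suc j) x - F j x)) (\<lambda>x. 1)\<bar> \<le> n2 (\<lambda>x. norm (F (Suc j) x - F j x)) * n2 (\<lambda>x. 1::real)"
      by (intro ip_Cauchy_Schwarz) auto
    also have "n2 (\<lambda>x. norm (F (Suc j) x - F j x)) = n2 (\<lambda>x. F (Suc j) x - F j x)"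
      by (simp add: n2_def ip_self)
    also have "n2 (\<lambda>x. 1::real) = sqrt vol" by (simp add: n2_def ip_def)
    also have "n2 (\<lambda>x. F (Suc j) x - F j x) * sqrt vol \<le> (1/2)^j * sqrt vol"
      by (intro mult_right_mono step) simp
    finally show ?thesis by (simp add: ip_def mult.commute)
  qed
  have "(\<integral>\<^sup>+x. (\<Sum>j. ennreal (norm (F (Suc j) x - F j x))) \<partial>torus)
      = (\<Sum>j. \<integral>\<^sup>+x. ennreal (norm (F (Suc j) x - F j x)) \<partial>torus)"
    by (rule nn_integral_suminf) measurable
  also have "\<dots> = (\<Sum>j. ennreal (\<integral>x. norm (F (Suc j) x - F j x) \<partial>torus))"
    by (intro suminf_cong nn_integral_eq_integral) auto
  also have "\<dots> \<le> (\<Sum>j. ennreal (sqrt vol * (1/2)^j))"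
    by (intro suminf_le ennreal_leI L1) auto
  also have "\<dots> = ennreal (\<Sum>j. sqrt vol * (1/2)^j)"
    by (intro suminf_ennreal2) (auto intro!: summable_mult summable_geometric)
  also have "\<dots> < \<infinity>" by simp
  finally have "AE x in torus. (\<Sum>j. ennreal (norm (F (Suc j) x - F j x))) \<noteq> \<infinity>"
    by (intro nn_integral_PInf_AE) auto
  then have conv: "AE x in torus. convergent (\<lambda>j. F j x)"
  proof eventually_elim
    fix x assume "(\<Sum>j. ennreal (norm (F (Suc j) x - F j x))) \<noteq> \<infinity>"
    then have "summable (\<lambda>j. norm (F (Suc j) x - F j x))"
      by (intro summable_suminf_not_top) auto
    then have "summable (\<lambda>j. F (Suc j) x - F j x)" by (rule summable_norm_cancel)
    then have "convergent (\<lambda>n. \<Sum>j<n. F (Suc j) x - F j x)" by (simp add: summable_iff_convergent)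
    then have "convergent (\<lambda>n. F n x - F 0 x)" by (simp add: sum_lessThan_telescope[of "\<lambda>n. F n x"])
    then have "convergent (\<lambda>n. (F n x - F 0 x) + F 0 x)" by (intro convergent_add convergent_const)
    then show "convergent (\<lambda>j. F j x)" by simp
  qed
  define f where "f x = lim (\<lambda>j. F j x)" for x
  have f_meas [measurable]: "f \<in> borel_measurable torus"
    unfolding f_def by (rule borel_measurable_lim_metric) (simp add: L2_measurable)
  have lim: "AE x in torus. (\<lambda>j. F j x) \<longlonglongrightarrow> f x"
    using conv by eventually_elim (simp add: f_def convergent_LIMSEQ_iff)
  \<comment> \<open>Fatou along the subsequence: for \<open>j \<ge> m\<close> the distance of
    \<open>F j\<close> to the m-th sum is already controlled by \<open>tail m\<close>. The case
    \<open>m = 0\<close> gives square integrability of the limit.\<close>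
  have fm: "integrable torus (\<lambda>x. (norm (f x - tpoly enum a m x))\<^sup>2)
      \<and> (\<integral>x. (norm (f x - tpoly enum a m x))\<^sup>2 \<partial>torus) \<le> tail m" for m
  proof -
    have tm: "tpoly enum a m \<in> borel_measurable torus" by (rule L2_measurable) simp
    have Fm: "F j \<in> borel_measurable torus" for j by (rule L2_measurable) simp
    have "(\<integral>\<^sup>+x. ennreal ((norm (f x - tpoly enum a m x))\<^sup>2) \<partial>torus)
        = (\<integral>\<^sup>+x. liminf (\<lambda>j. ennreal ((norm (F j x - tpoly enum a m x))\<^sup>2)) \<partial>torus)"
    proof (rule nn_integral_cong_AE)
      show "AE x in torus. ennreal ((norm (f x - tpoly enum a m x))\<^sup>2)
          = liminf (\<lambda>j. ennreal ((norm (F j x - tpoly enum a m x))\<^sup>2))"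
        using lim
      proof eventually_elim
        fix x assume "(\<lambda>j. F j x) \<longlonglongrightarrow> f x"
        then have "(\<lambda>j. ennreal ((norm (F j x - tpoly enum a m x))\<^sup>2)) \<longlonglongrightarrow> ennreal ((norm (f x - tpoly enum a m x))\<^sup>2)"
          by (intro tendsto_intros)
        then show "ennreal ((norm (f x - tpoly enum a m x))\<^sup>2)
            = liminf (\<lambda>j. ennreal ((norm (F j x - tpoly enum a m x))\<^sup>2))"
          by (intro lim_imp_Liminf[symmetric]) auto
      qed
    qed
    also have "\<dots> \<le> liminf (\<lambda>j. \<integral>\<^sup>+x. ennreal ((norm (F j x - tpoly enum a m x))\<^sup>2) \<partial>torus)"
      using Fm tm by (intro nn_integral_liminf) auto
    also have "\<dots> \<le> ennreal (tail m)"
    proof (rule Liminf_le)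
      show "eventually (\<lambda>j. (\<integral>\<^sup>+x. ennreal ((norm (F j x - tpoly enum a m x))\<^sup>2) \<partial>torus) \<le> ennreal (tail m)) sequentially"
        using eventually_ge_at_top[of m]
      proof eventually_elim
        fix j assume "m \<le> j"
        then have "m \<le> r j" using r(1)[of j] by linarith
        have "(\<integral>\<^sup>+x. ennreal ((norm (F j x - tpoly enum a m x))\<^sup>2) \<partial>torus)
            = ennreal ((n2 (\<lambda>x. F j x - tpoly enum a m x))\<^sup>2)"
          unfolding n2_power2 ip_self by (intro nn_integral_eq_integral L2_power2) auto
        also have "\<dots> \<le> ennreal (tail m)"
          unfolding F_def by (intro ennreal_leI diff_le \<open>m \<le> r j\<close>)
        finally show "(\<integral>\<^sup>+x. ennreal ((norm (F j x - tpoly enum a m x))\<^sup>2) \<partial>torus) \<le> ennreal (tail m)" .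
      qed
    qed simp
    finally have le: "(\<integral>\<^sup>+x. ennreal ((norm (f x - tpoly enum a m x))\<^sup>2) \<partial>torus) \<le> ennreal (tail m)" .
    have I: "integrable torus (\<lambda>x. (norm (f x - tpoly enum a m x))\<^sup>2)"
    proof (rule integrableI_bounded)
      show "(\<integral>\<^sup>+x. ennreal (norm ((norm (f x - tpoly enum a m x))\<^sup>2)) \<partial>torus) < \<infinity>"
        using le by (auto intro: le_less_trans)
    qed (use tm in measurable)
    moreover have "(\<integral>x. (norm (f x - tpoly enum a m x))\<^sup>2 \<partial>torus) \<le> tail m"
      using le tail_nn by (subst (asm) nn_integral_eq_integral[OF I]) auto
    ultimately show ?thesis by blast
  qed
  have f: "L2 f" using fm[of 0] by (simp add: L2_def tpoly_def)
  have n2f: "(n2 (\<lambda>x. f x - tpoly enum a m x))\<^sup>2 \<le> tail m" for m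
    using fm[of m] by (simp add: n2_power2 ip_self)
  have "(\<lambda>m. (n2 (\<lambda>x. f x - tpoly enum a m x))\<^sup>2) \<longlonglongrightarrow> 0"
    by (rule tendsto_sandwich[OF _ _ tendsto_const tail0]) (auto simp: n2f)
  then have "(\<lambda>m. sqrt ((n2 (\<lambda>x. f x - tpoly enum a m x))\<^sup>2)) \<longlonglongrightarrow> sqrt 0"
    by (rule tendsto_real_sqrt)
  then have lim0: "(\<lambda>m. n2 (\<lambda>x. f x - tpoly enum a m x)) \<longlonglongrightarrow> 0" by simp
  have "hat f (enum i) = a i" for i
  proof (rule euclidean_eqI)
    fix b :: 'b assume b: "b \<in> Basis"
    let ?c = "n2 (\<lambda>x. cas (enum i) x *\<^sub>R b)"
    have lim': "(\<lambda>m. n2 (\<lambda>x. f x - tpoly enum a m x) * ?c / vol) \<longlonglongrightarrow> 0"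
      by (intro tendsto_divide_zero tendsto_mult_left_zero lim0)
    \<comment> \<open>As soon as \<open>i < m\<close> the coefficient of the partial sum is exactly
      \<open>a i\<close>, so the difference is a coefficient of a function of small norm.\<close>
    have "eventually (\<lambda>m. norm (hat f (enum i) \<bullet> b - a i \<bullet> b) \<le> n2 (\<lambda>x. f x - tpoly enum a m x) * ?c / vol) sequentially"
      using eventually_gt_at_top[of i]
    proof eventually_elim
      fix m assume "i < m"
      then have "hat f (enum i) \<bullet> b - a i \<bullet> b = hat (\<lambda>x. f x - tpoly enum a m x) (enum i) \<bullet> b"
        using f by (simp add: hat_diff hat_tpoly inner_diff_left)
      also have "\<dots> = ip (\<lambda>x. f x - tpoly enum a m x) (\<lambda>x. cas (enum i) x *\<^sub>R b) / vol"
        using f by (intro hat_inner) simp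
      finally show "norm (hat f (enum i) \<bullet> b - a i \<bullet> b) \<le> n2 (\<lambda>x. f x - tpoly enum a m x) * ?c / vol"
        using ip_Cauchy_Schwarz[of "\<lambda>x. f x - tpoly enum a m x" "\<lambda>x. cas (enum i) x *\<^sub>R b"] f vol_pos
        by (simp add: abs_divide divide_right_mono)
    qed
    then have "(\<lambda>m. hat f (enum i) \<bullet> b - a i \<bullet> b) \<longlonglongrightarrow> 0"
      by (rule Lim_null_comparison[OF _ lim'])
    then show "hat f (enum i) \<bullet> b = a i \<bullet> b" by (simp add: LIMSEQ_const_iff)
  qed
  then show ?thesis using that f lim0 by blast
qed

text \<open>Each component of the difference is orthogonal to all Hartley functions.\<close>

lemma AE_eq_if_hat_eq:
  fixes f g :: "real^3 \<Rightarrow> 'b::euclidean_space"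
  assumes f: "L2 f" and g: "L2 g" and eq: "\<And>k. hat f k = hat g k"
  shows "AE x in torus. f x = g x"
proof -
  have "AE x in torus. f x \<bullet> b - g x \<bullet> b = 0" for b
  proof (rule AE_zero_if_orthogonal_cas)
    fix k
    have "(\<integral>x. cas k x * (h x \<bullet> b) \<partial>torus) = vol * (hat h k \<bullet> b)" if "L2 h" for h :: "real^3 \<Rightarrow> 'b"
      using hat_inner_const[OF that, of b k] vol_pos by (simp add: hat_def)
    moreover have "integrable torus (\<lambda>x. cas k x * (h x \<bullet> b))" if "L2 h" for h :: "real^3 \<Rightarrow> 'b"
      using L2_integrable[OF L2_cas[OF L2_inner_const[OF that, of b], of k]] by simp
    ultimately show "(\<integral>x. cas k x * (f x \<bullet> b - g x \<bullet> b) \<partial>torus) = 0"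
      using eq f g by (simp add: right_diff_distrib)
  qed (use f g in simp)
  then have "AE x in torus. \<forall>b\<in>(Basis::'b set). f x \<bullet> b - g x \<bullet> b = 0"
    by (intro AE_ball_countable') (auto intro: countable_finite)
  then show ?thesis by eventually_elim (simp add: euclidean_eq_iff[where 'a='b])
qed

text \<open>The limit supplied by \<open>Riesz_Fischer\<close> has the coefficients of
  \<open>f\<close> and hence equals \<open>f\<close> almost everywhere: the Hartley system is
  complete.\<close>

theorem trunc_tendsto:
  assumes f: "L2 f" shows "(\<lambda>n. n2 (\<lambda>x. f x - trunc n f x)) \<longlonglongrightarrow> 0"
proof -
  obtain g where g: "L2 g" "\<And>i. hat g (enum i) = hat f (enum i)"
    and lim: "(\<lambda>n. n2 (\<lambda>x. g x - trunc n f x)) \<longlonglongrightarrow> 0"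
    using Riesz_Fischer[OF Bessel_summable[OF f]] by metis
  have "hat g k = hat f k" for k
    using g(2)[of "inv enum k"] bij_enum by (simp add: bij_is_surj surj_f_inv_f)
  then have ae: "AE x in torus. g x = f x" by (intro AE_eq_if_hat_eq g f)
  have "n2 (\<lambda>x. g x - trunc n f x) = n2 (\<lambda>x. f x - trunc n f x)" for n
    using ae g f by (intro n2_cong_AE) auto
  then show ?thesis using lim by simp
qed

lemma ip_trunc_tendsto:
  assumes f: "L2 f" and g: "L2 g" shows "(\<lambda>n. ip g (trunc n f)) \<longlonglongrightarrow> ip g f"
proof -
  have lim: "(\<lambda>n. n2 g * n2 (\<lambda>x. f x - trunc n f x)) \<longlonglongrightarrow> 0"
    by (intro tendsto_mult_right_zero trunc_tendsto f)
  have "norm (ip g f - ip g (trunc n f)) \<le> n2 g * n2 (\<lambda>x. f x - trunc n f x)" for n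
    using ip_Cauchy_Schwarz[OF g, of "\<lambda>x. f x - trunc n f x"] f g by (simp add: ip_diff_right)
  then have "(\<lambda>n. ip g f - ip g (trunc n f)) \<longlonglongrightarrow> 0"
    by (intro Lim_null_comparison[OF always_eventually lim]) blast
  then have "(\<lambda>n. ip g f - (ip g f - ip g (trunc n f))) \<longlonglongrightarrow> ip g f - 0" by (intro tendsto_intros)
  then show ?thesis by simp
qed

lemma Parseval_sums:
  assumes f: "L2 f" shows "(\<lambda>i. (norm (hat f (enum i)))\<^sup>2) sums (ip f f / vol)"
proof -
  have "(\<lambda>n. ip f (trunc n f) / vol) \<longlonglongrightarrow> ip f f / vol"
    by (intro tendsto_intros ip_trunc_tendsto f) (use vol_pos in simp)
  then show ?thesis
    using vol_pos f by (simp add: sums_def ip_tpoly power2_norm_eq_inner)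
qed

text \<open>The permutation \<open>\<sigma>\<close> of frequencies is needed because differentiation maps \<open>cas k\<close> to a multiple of \<open>cas (- k)\<close>.\<close>

lemma n2_le_if_hat_le:
  assumes f: "L2 f" and g: "L2 g" and \<sigma>: "inj \<sigma>" and C: "0 \<le> C"
    and le: "\<And>k. norm (hat f k) \<le> C * norm (hat g (\<sigma> k))"
  shows "n2 f \<le> C * n2 g"
proof (rule power2_le_imp_le)
  have "ip f f / vol \<le> C\<^sup>2 * (ip g g / vol)"
  proof (rule LIMSEQ_le_const2[OF Parseval_sums[OF f, unfolded sums_def]], intro exI allI impI)
    fix n
    have "(\<Sum>i<n. (norm (hat f (enum i)))\<^sup>2) \<le> (\<Sum>i<n. C\<^sup>2 * (norm (hat g (\<sigma> (enum i))))\<^sup>2)"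
      using le by (intro sum_mono) (auto simp flip: power_mult_distrib intro!: power_mono)
    also have "\<dots> = C\<^sup>2 * (\<Sum>k\<in>(\<sigma> \<circ> enum) ` {..<n}. (norm (hat g k))\<^sup>2)"
      using inj_on_subset[OF inj_compose[OF \<sigma> inj_enum] subset_UNIV]
      by (subst sum.reindex) (auto simp: sum_distrib_left)
    also have "\<dots> \<le> C\<^sup>2 * (ip g g / vol)"
      by (intro mult_left_mono Bessel g) auto
    finally show "(\<Sum>i<n. (norm (hat f (enum i)))\<^sup>2) \<le> C\<^sup>2 * (ip g g / vol)" .
  qed
  then show "(n2 f)\<^sup>2 \<le> (C * n2 g)\<^sup>2"
    using vol_pos by (simp add: power_mult_distrib n2_power2 field_simps)
qed (use C in simp)

section \<open>Smooth functions and weak derivatives\<close>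

text \<open>On the whole space the span in \<open>Ck_on\<close> imposes no restriction on
  directions.\<close>

lemma span_differences_UNIV: "span {x - y | x y. x \<in> UNIV \<and> y \<in> UNIV} = (UNIV :: 'a::euclidean_space set)"
proof -
  have "z \<in> {x - y | x y :: 'a. x \<in> UNIV \<and> y \<in> UNIV}" for z
    by (rule CollectI, rule exI[of _ z], rule exI[of _ 0]) simp
  then have "{x - y | x y :: 'a. x \<in> UNIV \<and> y \<in> UNIV} = UNIV" by blast
  then show ?thesis by simp
qed

lemma Ck_on_UNIV_Suc:
  assumes "Ck_on (Suc k) UNIV f"
  shows "f differentiable (at x)" "Ck_on k UNIV (\<lambda>x. frechet_derivative f (at x) h)"
proof -
  obtain f' where f': "\<And>x. (f has_derivative f' x) (at x)" "\<And>h. Ck_on k UNIV (\<lambda>x. f' x h)"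
    using assms unfolding Ck_on.simps span_differences_UNIV by auto
  then show "f differentiable (at x)" using differentiable_def by blast
  have "frechet_derivative f (at x) = f' x" for x
    using frechet_derivative_at[OF f'(1)[of x]] by simp
  then show "Ck_on k UNIV (\<lambda>x. frechet_derivative f (at x) h)" using f'(2) by simp
qed

lemma has_partial_if_differentiable:
  assumes "\<And>x. f differentiable (at x)"
  shows "has_partial j f (pd j f)"
  unfolding has_partial_def has_vector_derivative_def pd_def
proof
  fix x :: "real^3"
  let ?D = "frechet_derivative f (at x)"
  have D: "(f has_derivative ?D) (at x)" using assms frechet_derivative_works by blast
  have "((\<lambda>s. x + s *\<^sub>R axis j 1) has_derivative (\<lambda>s. s *\<^sub>R axis j 1)) (at 0)"
    by (auto intro!: derivative_eq_intros)
  moreover have "(f has_derivative ?D) (at (x + 0 *\<^sub>R axis j 1))" using D by simp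
  ultimately have "((\<lambda>s. f (x + s *\<^sub>R axis j 1)) has_derivative (\<lambda>s. ?D (s *\<^sub>R axis j 1))) (at 0)"
    by (rule has_derivative_compose)
  then show "((\<lambda>s. f (x + s *\<^sub>R axis j 1)) has_derivative (\<lambda>s. s *\<^sub>R ?D (axis j 1))) (at 0)"
    using linear_scale[OF has_derivative_linear[OF D]] by simp
qed

lemma periodic_partial:
  assumes "has_partial j f g" "periodic f" shows "periodic g"
  unfolding periodic_def
proof (intro allI)
  fix x :: "real^3" and k
  let ?p = "(2 * pi) *\<^sub>R axis k 1 :: real^3"
  have "f (x + ?p + s *\<^sub>R axis j 1) = f (x + s *\<^sub>R axis j 1)" for s
    using assms(2) unfolding periodic_def by (metis add.assoc add.commute)
  moreover have "((\<lambda>s. f (x + ?p + s *\<^sub>R axis j 1)) has_vector_derivative g (x + ?p)) (at 0)"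
    "((\<lambda>s. f (x + s *\<^sub>R axis j 1)) has_vector_derivative g x) (at 0)"
    using assms(1) unfolding has_partial_def by blast+
  ultimately show "g (x + ?p) = g x" by (auto intro: vector_derivative_unique_at)
qed

lemma torus_smooth_differentiable: "torus_smooth f \<Longrightarrow> f differentiable (at x)"
  using Ck_on_UNIV_Suc(1)[of 0 f x] by (simp only: torus_smooth_def smooth_on_def)

lemma torus_smooth_continuous: "torus_smooth f \<Longrightarrow> continuous_on UNIV f"
proof -
  assume "torus_smooth f"
  then have "Ck_on 0 UNIV f" by (simp only: torus_smooth_def smooth_on_def)
  then show ?thesis by simp
qed

lemma torus_smooth_periodic: "torus_smooth f \<Longrightarrow> periodic f"
  by (simp add: torus_smooth_def)

lemma torus_smooth_has_partial: "torus_smooth f \<Longrightarrow> has_partial j f (pd j f)"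
  by (rule has_partial_if_differentiable[OF torus_smooth_differentiable])

lemma torus_smooth_pd:
  assumes "torus_smooth f" shows "torus_smooth (pd j f)"
proof -
  have "periodic (pd j f)"
    by (rule periodic_partial[OF torus_smooth_has_partial[OF assms] torus_smooth_periodic[OF assms]])
  moreover have "Ck_on k UNIV (pd j f)" for k
  proof -
    have "Ck_on (Suc k) UNIV f" using assms by (simp only: torus_smooth_def smooth_on_def)
    from Ck_on_UNIV_Suc(2)[OF this, of "axis j 1"] show ?thesis by (simp add: pd_def[abs_def])
  qed
  ultimately show ?thesis by (simp add: torus_smooth_def smooth_on_def)
qed

lemma torus_smooth_funpow_pd: "torus_smooth f \<Longrightarrow> torus_smooth ((pd j ^^ n) f)"
  by (induction n) (auto intro: torus_smooth_pd)

lemma torus_smooth_pd_multi: "torus_smooth f \<Longrightarrow> torus_smooth (pd_multi \<alpha> f)"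
  unfolding pd_multi_def by (intro torus_smooth_funpow_pd)

lemma pd_multi_axis_1: "pd_multi (axis j 1) f = pd j f"
  using exhaust_3[of j] by (auto simp: pd_multi_def axis_def)

lemma pd_multi_axis_2: "pd_multi (axis j 2) f = pd j (pd j f)"
  using exhaust_3[of j] by (auto simp: pd_multi_def axis_def numeral_2_eq_2)

lemma pd_multi_0: "pd_multi 0 f = f"
  by (simp add: pd_multi_def)

lemma mi_order_axis [simp]: "mi_order (axis j n) = n"
  by (simp add: mi_order_def axis_def)

lemma mi_order_add: "mi_order (\<alpha> + \<beta>) = mi_order \<alpha> + mi_order \<beta>"
  by (simp add: mi_order_def sum.distrib)

lemma mi_order_0 [simp]: "mi_order 0 = 0" by (simp add: mi_order_def)

lemma finite_mi_order: "finite {\<alpha>. mi_order \<alpha> \<le> m}"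
proof (rule finite_subset)
  show "{\<alpha>. mi_order \<alpha> \<le> m} \<subseteq> {\<alpha>. \<forall>i. \<alpha> $ i \<in> {..m}}"
  proof
    fix \<alpha> assume "\<alpha> \<in> {\<alpha>. mi_order \<alpha> \<le> m}"
    moreover have "\<alpha> $ i \<le> mi_order \<alpha>" for i
      unfolding mi_order_def by (rule member_le_sum) auto
    ultimately show "\<alpha> \<in> {\<alpha>. \<forall>i. \<alpha> $ i \<in> {..m}}" by (auto intro: order_trans)
  qed
  have "{\<alpha> :: nat^3. \<forall>i. \<alpha> $ i \<in> {..m}} \<subseteq> (\<lambda>(a, b, c). vector [a, b, c]) ` ({..m} \<times> {..m} \<times> {..m})"
  proof
    fix \<alpha> :: "nat^3" assume "\<alpha> \<in> {\<alpha>. \<forall>i. \<alpha> $ i \<in> {..m}}"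
    then show "\<alpha> \<in> (\<lambda>(a, b, c). vector [a, b, c]) ` ({..m} \<times> {..m} \<times> {..m})"
      by (intro image_eqI[where x="(\<alpha> $ 1, \<alpha> $ 2, \<alpha> $ 3)"]) (auto simp: vec_eq_iff forall_3)
  qed
  then show "finite {\<alpha> :: nat^3. \<forall>i. \<alpha> $ i \<in> {..m}}" by (rule finite_subset) simp
qed

lemma cas_has_derivative: "(cas k has_derivative (\<lambda>h. (freq k \<bullet> h) * cas (- k) x)) (at x within S)"
proof -
  have "((\<lambda>x. freq k \<bullet> x) has_derivative (\<lambda>h. freq k \<bullet> h)) (at x within S)"
    by (intro bounded_linear_imp_has_derivative bounded_linear_inner_right)
  then have "((\<lambda>x. cos (freq k \<bullet> x) + sin (freq k \<bullet> x)) has_derivative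
      (\<lambda>h. (freq k \<bullet> h) * - sin (freq k \<bullet> x) + (freq k \<bullet> h) * cos (freq k \<bullet> x))) (at x within S)"
    by (intro has_derivative_add has_derivative_cos has_derivative_sin)
  then show ?thesis by (simp add: cas_def[abs_def] cas_minus algebra_simps)
qed

lemma tpoly_has_derivative:
  "(tpoly \<kappa> a n has_derivative (\<lambda>h. tpoly (\<lambda>i. - \<kappa> i) (\<lambda>i. (freq (\<kappa> i) \<bullet> h) *\<^sub>R a i) n x)) (at x within S)"
proof -
  have "((\<lambda>x. \<Sum>i<n. cas (\<kappa> i) x *\<^sub>R a i) has_derivative
      (\<lambda>h. \<Sum>i<n. ((freq (\<kappa> i) \<bullet> h) * cas (- \<kappa> i) x) *\<^sub>R a i)) (at x within S)"
    by (intro has_derivative_sum has_derivative_scaleR_left cas_has_derivative)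
  then show ?thesis by (simp add: tpoly_def[abs_def] mult.commute)
qed

lemma tpoly_differentiable: "tpoly \<kappa> a n differentiable (at x)"
  using tpoly_has_derivative differentiable_def by blast

lemma pd_tpoly: "pd j (tpoly \<kappa> a n) = tpoly (\<lambda>i. - \<kappa> i) (\<lambda>i. real_of_int (\<kappa> i $ j) *\<^sub>R a i) n"
proof
  fix x
  show "pd j (tpoly \<kappa> a n) x = tpoly (\<lambda>i. - \<kappa> i) (\<lambda>i. real_of_int (\<kappa> i $ j) *\<^sub>R a i) n x"
    unfolding pd_def by (simp flip: frechet_derivative_at[OF tpoly_has_derivative])
qed

text \<open>The induction closes because a directional derivative of a Hartley polynomial is again
  one, with other frequencies and coefficients; both are therefore arbitrary.\<close>

lemma Ck_on_tpoly: "Ck_on k S (tpoly \<kappa> a n)"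
proof (induction k arbitrary: \<kappa> a)
  case 0
  show ?case by (simp add: continuous_tpoly)
next
  case (Suc k)
  show ?case unfolding Ck_on.simps
    by (rule exI[of _ "\<lambda>x h. tpoly (\<lambda>i. - \<kappa> i) (\<lambda>i. (freq (\<kappa> i) \<bullet> h) *\<^sub>R a i) n x"])
      (intro conjI ballI tpoly_has_derivative Suc)
qed

lemma Ck_on_tpoly_snd: "Ck_on k S (\<lambda>(t::real, x). tpoly \<kappa> a n x)"
proof (induction k arbitrary: \<kappa> a)
  case 0
  have "continuous_on S (\<lambda>p. tpoly \<kappa> a n (snd p))"
    by (intro continuous_on_compose2[OF continuous_tpoly[of UNIV]] continuous_intros) auto
  then show ?case by (simp add: case_prod_beta')
next
  case (Suc k)
  let ?f' = "\<lambda>(t::real, x) (r::real, h). tpoly (\<lambda>i. - \<kappa> i) (\<lambda>i. (freq (\<kappa> i) \<bullet> h) *\<^sub>R a i) n x"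
  have d: "((\<lambda>(t, x). tpoly \<kappa> a n x) has_derivative ?f' p) (at p within S)" for p
  proof -
    have "((\<lambda>p. tpoly \<kappa> a n (snd p)) has_derivative (\<lambda>q. tpoly (\<lambda>i. - \<kappa> i) (\<lambda>i. (freq (\<kappa> i) \<bullet> snd q) *\<^sub>R a i) n (snd p))) (at p within S)"
      by (rule has_derivative_compose[OF _ tpoly_has_derivative]) (auto intro!: derivative_intros)
    then show ?thesis by (simp add: case_prod_beta')
  qed
  have c: "Ck_on k S (\<lambda>p. ?f' p h)" for h
    using Suc[of "\<lambda>i. - \<kappa> i" "\<lambda>i. (freq (\<kappa> i) \<bullet> snd h) *\<^sub>R a i"] by (simp add: case_prod_beta')
  show ?case unfolding Ck_on.simps
    by (rule exI[of _ ?f']) (intro conjI ballI d c)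
qed

lemma periodic_tpoly: "periodic (tpoly \<kappa> a n)"
  by (simp add: periodic_def tpoly_def cas_shift)

lemma torus_smooth_tpoly: "torus_smooth (tpoly \<kappa> a n)"
  by (simp add: torus_smooth_def smooth_on_def periodic_tpoly Ck_on_tpoly)

lemma test_fun_tpoly: "test_fun T (\<lambda>t. tpoly \<kappa> a n)"
  by (simp add: test_fun_def smooth_on_def periodic_tpoly Ck_on_tpoly_snd)

lemma cas_scale_eq_tpoly: "(\<lambda>x. cas k x *\<^sub>R a) = tpoly (\<lambda>_. k) (\<lambda>_. a) 1"
  by (simp add: tpoly_def fun_eq_iff)

lemma torus_smooth_cas: "torus_smooth (cas k)"
  using torus_smooth_tpoly[of "\<lambda>_. k" "\<lambda>_. 1::real" 1] by (simp add: tpoly_def[abs_def])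

lemma pd_cas: "pd j (\<lambda>x. c * cas k x) = (\<lambda>x. (real_of_int (k $ j) * c) * cas (- k) x)"
  using pd_tpoly[of j "\<lambda>_. k" "\<lambda>_. c" 1] by (simp add: tpoly_def[abs_def] mult.commute)

text \<open>The frequency reached after \<open>n\<close> differentiations; only the parity of
  \<open>n\<close> matters.\<close>

definition flip :: "nat \<Rightarrow> int^3 \<Rightarrow> int^3" where
  "flip n k = (if even n then k else - k)"

text \<open>The absolute value of the symbol of the derivative \<alpha>. Signs are left out because
  Bessel's inequality sees moduli only.\<close>

definition kpow :: "int^3 \<Rightarrow> nat^3 \<Rightarrow> real" where
  "kpow k \<alpha> = (\<Prod>i\<in>UNIV. \<bar>real_of_int (k $ i)\<bar> ^ (\<alpha> $ i))"

lemma inj_flip: "inj (flip n)" by (auto simp: flip_def inj_def)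
lemma flip_flip [simp]: "flip n (flip n k) = k" by (simp add: flip_def)
lemma kpow_uminus [simp]: "kpow (- k) \<alpha> = kpow k \<alpha>" by (simp add: kpow_def)
lemma kpow_flip [simp]: "kpow (flip n k) \<alpha> = kpow k \<alpha>" by (simp add: flip_def)
lemma kpow_0 [simp]: "kpow k 0 = 1" by (simp add: kpow_def)
lemma kpow_add: "kpow k (\<alpha> + \<beta>) = kpow k \<alpha> * kpow k \<beta>"
  by (simp add: kpow_def power_add prod.distrib)

lemma kpow_axis: "kpow k (axis j n) = \<bar>real_of_int (k $ j)\<bar> ^ n"
proof -
  have "kpow k (axis j n) = (\<Prod>i\<in>UNIV. if i = j then \<bar>real_of_int (k $ j)\<bar> ^ n else 1)"
    unfolding kpow_def by (intro prod.cong) (auto simp: axis_def)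
  then show ?thesis by simp
qed

lemma prod_UNIV_3: "prod f (UNIV :: 3 set) = f 1 * (f 2 * f 3)"
  unfolding UNIV_3 by (simp add: ac_simps)

lemma funpow_pd_cas:
  "\<exists>c'. (pd j ^^ n) (\<lambda>x. c * cas k x) = (\<lambda>x. c' * cas (flip n k) x) \<and> \<bar>c'\<bar> = \<bar>c\<bar> * \<bar>real_of_int (k $ j)\<bar> ^ n"
proof (induction n)
  case (Suc n)
  then obtain c' where c': "(pd j ^^ n) (\<lambda>x. c * cas k x) = (\<lambda>x. c' * cas (flip n k) x)"
    "\<bar>c'\<bar> = \<bar>c\<bar> * \<bar>real_of_int (k $ j)\<bar> ^ n" by blast
  show ?case
    by (rule exI[of _ "real_of_int (flip n k $ j) * c'"])
      (simp add: c' pd_cas abs_mult, auto simp: flip_def)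
qed (auto simp: flip_def)

text \<open>The three coordinate directions are treated in turn; the flips compose to one flip by
  the total order because parities add.\<close>

lemma pd_multi_cas:
  "\<exists>c. pd_multi \<alpha> (cas k) = (\<lambda>x. c * cas (flip (mi_order \<alpha>) k) x) \<and> \<bar>c\<bar> = kpow k \<alpha>"
proof -
  obtain c3 where c3: "(pd 3 ^^ (\<alpha> $ 3)) (\<lambda>x. 1 * cas k x) = (\<lambda>x. c3 * cas (flip (\<alpha> $ 3) k) x)"
    "\<bar>c3\<bar> = \<bar>1\<bar> * \<bar>real_of_int (k $ 3)\<bar> ^ (\<alpha> $ 3)" using funpow_pd_cas by blast
  obtain c2 where c2: "(pd 2 ^^ (\<alpha> $ 2)) (\<lambda>x. c3 * cas (flip (\<alpha> $ 3) k) x) = (\<lambda>x. c2 * cas (flip (\<alpha> $ 2) (flip (\<alpha> $ 3) k)) x)"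
    "\<bar>c2\<bar> = \<bar>c3\<bar> * \<bar>real_of_int (flip (\<alpha> $ 3) k $ 2)\<bar> ^ (\<alpha> $ 2)" using funpow_pd_cas by blast
  obtain c1 where c1: "(pd 1 ^^ (\<alpha> $ 1)) (\<lambda>x. c2 * cas (flip (\<alpha> $ 2) (flip (\<alpha> $ 3) k)) x)
      = (\<lambda>x. c1 * cas (flip (\<alpha> $ 1) (flip (\<alpha> $ 2) (flip (\<alpha> $ 3) k))) x)"
    "\<bar>c1\<bar> = \<bar>c2\<bar> * \<bar>real_of_int (flip (\<alpha> $ 2) (flip (\<alpha> $ 3) k) $ 1)\<bar> ^ (\<alpha> $ 1)" using funpow_pd_cas by blast
  have "flip (\<alpha> $ 1) (flip (\<alpha> $ 2) (flip (\<alpha> $ 3) k)) = flip (mi_order \<alpha>) k"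
    by (auto simp: flip_def mi_order_def sum_3)
  moreover have "\<bar>c1\<bar> = kpow k \<alpha>"
  proof -
    have "\<bar>real_of_int (flip n l $ i)\<bar> = \<bar>real_of_int (l $ i)\<bar>" for n l and i :: 3
      by (simp add: flip_def)
    then have "\<bar>c1\<bar> = \<bar>real_of_int (k $ 1)\<bar> ^ (\<alpha> $ 1) * (\<bar>real_of_int (k $ 2)\<bar> ^ (\<alpha> $ 2) * \<bar>real_of_int (k $ 3)\<bar> ^ (\<alpha> $ 3))"
      using c1(2) c2(2) c3(2) by simp
    then show ?thesis by (simp add: kpow_def prod_UNIV_3)
  qed
  ultimately show ?thesis
    by (intro exI[of _ c1]) (use c1(1) c2(1) c3(1) in \<open>simp add: pd_multi_def\<close>)
qed

lemma pd_multi_integrable: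
  assumes "torus_smooth \<phi>" "L2 f" shows "integrable torus (\<lambda>x. pd_multi \<alpha> \<phi> x *\<^sub>R f x)"
  by (intro L2_integrable L2_continuous_scaleR torus_smooth_continuous torus_smooth_pd_multi assms)

lemma torus_smooth_integrable:
  assumes "torus_smooth \<phi>" "L2 f" shows "integrable torus (\<lambda>x. \<phi> x *\<^sub>R f x)"
  by (intro L2_integrable L2_continuous_scaleR torus_smooth_continuous assms)

text \<open>The defining identity with \<open>cas k\<close> as test function.\<close>

lemma hat_weak_deriv:
  assumes "has_weak_deriv \<alpha> f g"
  shows "hat g k = ((- 1) ^ mi_order \<alpha> / vol) *\<^sub>R (\<integral>x. pd_multi \<alpha> (cas k) x *\<^sub>R f x \<partial>torus)"
  using assms torus_smooth_cas[of k] by (simp add: has_weak_deriv_def hat_def flip: power_mult_distrib)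

lemma hat_weak_deriv_cas:
  assumes "has_weak_deriv \<alpha> f g" "pd_multi \<alpha> (cas k) = (\<lambda>x. c * cas l x)"
  shows "hat g k = ((- 1) ^ mi_order \<alpha> * c) *\<^sub>R hat f l"
proof -
  have "(\<integral>x. (c * cas l x) *\<^sub>R f x \<partial>torus) = c *\<^sub>R (\<integral>x. cas l x *\<^sub>R f x \<partial>torus)"
    by (simp flip: scaleR_scaleR)
  then have "hat g k = ((- 1) ^ mi_order \<alpha> / vol) *\<^sub>R c *\<^sub>R (\<integral>x. cas l x *\<^sub>R f x \<partial>torus)"
    using hat_weak_deriv[OF assms(1), of k] unfolding assms(2) by simp
  then show ?thesis by (simp add: hat_def[of f])
qed

lemma norm_hat_weak_deriv:
  assumes "has_weak_deriv \<alpha> f g"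
  shows "norm (hat g k) = kpow k \<alpha> * norm (hat f (flip (mi_order \<alpha>) k))"
proof -
  obtain c where c: "pd_multi \<alpha> (cas k) = (\<lambda>x. c * cas (flip (mi_order \<alpha>) k) x)" "\<bar>c\<bar> = kpow k \<alpha>"
    using pd_multi_cas by blast
  show ?thesis
    unfolding hat_weak_deriv_cas[OF assms c(1)] by (simp add: abs_mult c power_abs)
qed

lemma hat_weak_deriv_1:
  assumes "has_weak_deriv (axis j 1) f g"
  shows "hat g k = - real_of_int (k $ j) *\<^sub>R hat f (- k)"
proof -
  have "pd_multi (axis j 1) (cas k) = (\<lambda>x. real_of_int (k $ j) * cas (- k) x)"
    using pd_cas[of j 1 k] by (simp add: pd_multi_axis_1[unfolded One_nat_def])
  from hat_weak_deriv_cas[OF assms this] show ?thesis by simp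
qed

lemma hat_weak_deriv_2:
  assumes "has_weak_deriv (axis j 2) f g"
  shows "hat g k = - (real_of_int (k $ j))\<^sup>2 *\<^sub>R hat f k"
proof -
  have "pd_multi (axis j 2) (cas k) = (\<lambda>x. - (real_of_int (k $ j))\<^sup>2 * cas k x)"
    using pd_cas[of j 1 k] pd_cas[of j "real_of_int (k $ j)" "- k"]
    by (simp add: power2_eq_square pd_multi_axis_2)
  from hat_weak_deriv_cas[OF assms this] show ?thesis by simp
qed

text \<open>The Hartley coefficients of a weak derivative are prescribed by
  \<open>f\<close>.\<close>

lemma weak_deriv_unique:
  assumes "L2 g" "L2 g'" "has_weak_deriv \<alpha> f g" "has_weak_deriv \<alpha> f g'"
  shows "AE x in torus. g x = g' x"
  by (rule AE_eq_if_hat_eq[OF assms(1,2)]) (simp add: hat_weak_deriv[OF assms(3)] hat_weak_deriv[OF assms(4)])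

lemma has_weak_deriv_0: "has_weak_deriv 0 f f"
  by (simp add: has_weak_deriv_def pd_multi_0)

lemma has_weak_deriv_diff:
  assumes "L2 f" "L2 g" "L2 f'" "L2 g'" "has_weak_deriv \<alpha> f g" "has_weak_deriv \<alpha> f' g'"
  shows "has_weak_deriv \<alpha> (\<lambda>x. f x - f' x) (\<lambda>x. g x - g' x)"
  unfolding has_weak_deriv_def
proof (intro allI impI)
  fix \<phi> :: "real^3 \<Rightarrow> real" assume p: "torus_smooth \<phi>"
  show "(\<integral>x. pd_multi \<alpha> \<phi> x *\<^sub>R (f x - f' x) \<partial>torus) = (- 1) ^ mi_order \<alpha> *\<^sub>R (\<integral>x. \<phi> x *\<^sub>R (g x - g' x) \<partial>torus)"
    using assms(5,6) p
    by (simp add: scaleR_diff_right pd_multi_integrable torus_smooth_integrable assms has_weak_deriv_def)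
qed

lemma has_weak_deriv_cong_AE:
  assumes "L2 f" "L2 g" "AE x in torus. f x = f' x" "AE x in torus. g x = g' x" "has_weak_deriv \<alpha> f g"
  shows "has_weak_deriv \<alpha> f' g'"
  unfolding has_weak_deriv_def
proof (intro allI impI)
  fix \<phi> :: "real^3 \<Rightarrow> real" assume p: "torus_smooth \<phi>"
  have L: "L2 f'" "L2 g'" using assms L2_cong_AE by blast+
  have "(\<integral>x. pd_multi \<alpha> \<phi> x *\<^sub>R f' x \<partial>torus) = (\<integral>x. pd_multi \<alpha> \<phi> x *\<^sub>R f x \<partial>torus)"
  proof (rule integral_cong_AE)
    show "AE x in torus. pd_multi \<alpha> \<phi> x *\<^sub>R f' x = pd_multi \<alpha> \<phi> x *\<^sub>R f x"
      using assms(3) by eventually_elim simp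
  qed (rule borel_measurable_integrable[OF pd_multi_integrable[OF p L(1)]],
      rule borel_measurable_integrable[OF pd_multi_integrable[OF p assms(1)]])
  moreover have "(\<integral>x. \<phi> x *\<^sub>R g' x \<partial>torus) = (\<integral>x. \<phi> x *\<^sub>R g x \<partial>torus)"
  proof (rule integral_cong_AE)
    show "AE x in torus. \<phi> x *\<^sub>R g' x = \<phi> x *\<^sub>R g x"
      using assms(4) by eventually_elim simp
  qed (rule borel_measurable_integrable[OF torus_smooth_integrable[OF p L(2)]],
      rule borel_measurable_integrable[OF torus_smooth_integrable[OF p assms(2)]])
  ultimately show "(\<integral>x. pd_multi \<alpha> \<phi> x *\<^sub>R f' x \<partial>torus) = (- 1) ^ mi_order \<alpha> *\<^sub>R (\<integral>x. \<phi> x *\<^sub>R g' x \<partial>torus)"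
    using assms(5) p by (simp add: has_weak_deriv_def)
qed

text \<open>The product of \<open>f\<close> with a test function is periodic, so its partial
  derivative has integral 0.\<close>

lemma has_weak_deriv_classical:
  fixes f g :: "real^3 \<Rightarrow> 'b::euclidean_space"
  assumes f: "continuous_on UNIV f" "periodic f" and g: "continuous_on UNIV g" and d: "has_partial j f g"
  shows "has_weak_deriv (axis j 1) f g"
  unfolding has_weak_deriv_def
proof (intro allI impI)
  fix \<phi> :: "real^3 \<Rightarrow> real" assume p: "torus_smooth \<phi>"
  have c: "continuous_on UNIV \<phi>" "continuous_on UNIV (pd j \<phi>)"
    using torus_smooth_continuous[OF p] torus_smooth_continuous[OF torus_smooth_pd[OF p]] by auto
  have "(\<integral>x. pd j \<phi> x *\<^sub>R f x + \<phi> x *\<^sub>R g x \<partial>torus) = 0"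
  proof (rule torus_integral_partial[where f="\<lambda>x. \<phi> x *\<^sub>R f x" and k=j])
    show "has_partial j (\<lambda>x. \<phi> x *\<^sub>R f x) (\<lambda>x. pd j \<phi> x *\<^sub>R f x + \<phi> x *\<^sub>R g x)"
      using torus_smooth_has_partial[OF p, of j] d unfolding has_partial_def has_real_derivative_iff_has_vector_derivative[symmetric]
      by (auto intro!: derivative_eq_intros)
    show "periodic (\<lambda>x. \<phi> x *\<^sub>R f x)"
      using f(2) torus_smooth_periodic[OF p] by (simp add: periodic_def)
  qed (intro continuous_intros c f g)+
  then have "(\<integral>x. pd j \<phi> x *\<^sub>R f x \<partial>torus) + (\<integral>x. \<phi> x *\<^sub>R g x \<partial>torus) = 0"
    using c f g by (simp add: continuous_torus_integrable continuous_intros)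
  then show "(\<integral>x. pd_multi (axis j 1) \<phi> x *\<^sub>R f x \<partial>torus) = (- 1) ^ mi_order (axis j 1) *\<^sub>R (\<integral>x. \<phi> x *\<^sub>R g x \<partial>torus)"
    by (simp add: pd_multi_axis_1[unfolded One_nat_def] eq_neg_iff_add_eq_0)
qed

text \<open>\<alpha> = 0 is excluded since \<open>wD 0 f\<close> is \<open>f\<close> itself and not
  a chosen representative.\<close>

lemma wD_if_weak_deriv:
  assumes "L2 g" "has_weak_deriv \<alpha> f g" "\<alpha> \<noteq> 0"
  shows "L2 (wD \<alpha> f)" "has_weak_deriv \<alpha> f (wD \<alpha> f)" "AE x in torus. wD \<alpha> f x = g x"
proof -
  have "L2 (wD \<alpha> f) \<and> has_weak_deriv \<alpha> f (wD \<alpha> f)"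
    unfolding wD_def using assms by (auto intro!: someI[of "\<lambda>g. L2 g \<and> has_weak_deriv \<alpha> f g" g])
  then show *: "L2 (wD \<alpha> f)" "has_weak_deriv \<alpha> f (wD \<alpha> f)" by auto
  show "AE x in torus. wD \<alpha> f x = g x" by (rule weak_deriv_unique[OF *(1) assms(1) *(2) assms(2)])
qed

lemma sob_L2: "sob m f \<Longrightarrow> L2 f" by (simp add: sob_def)

lemma sob_wD:
  assumes "sob m f" "mi_order \<alpha> \<le> m"
  shows "L2 (wD \<alpha> f)" "has_weak_deriv \<alpha> f (wD \<alpha> f)"
proof -
  have "L2 (wD \<alpha> f) \<and> has_weak_deriv \<alpha> f (wD \<alpha> f)"
  proof (cases "\<alpha> = 0")
    case True
    then show ?thesis using sob_L2[OF assms(1)] by (simp add: wD_def has_weak_deriv_0)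
  next
    case False
    obtain g where "L2 g" "has_weak_deriv \<alpha> f g" using assms unfolding sob_def by auto
    from wD_if_weak_deriv[OF this False] show ?thesis by simp
  qed
  then show "L2 (wD \<alpha> f)" "has_weak_deriv \<alpha> f (wD \<alpha> f)" by auto
qed

lemma sob_diff:
  assumes "sob m f" "sob m g"
  shows "sob m (\<lambda>x. f x - g x)"
    "mi_order \<alpha> \<le> m \<Longrightarrow> AE x in torus. wD \<alpha> (\<lambda>x. f x - g x) x = wD \<alpha> f x - wD \<alpha> g x"
proof -
  have d: "has_weak_deriv \<alpha> (\<lambda>x. f x - g x) (\<lambda>x. wD \<alpha> f x - wD \<alpha> g x)" if "mi_order \<alpha> \<le> m" for \<alpha>
    by (intro has_weak_deriv_diff sob_wD[OF assms(1) that] sob_wD[OF assms(2) that] sob_L2[OF assms(1)] sob_L2[OF assms(2)])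
  show s: "sob m (\<lambda>x. f x - g x)"
    unfolding sob_def
  proof (intro conjI allI impI exI)
    show "L2 (\<lambda>x. wD \<alpha> f x - wD \<alpha> g x)" if "mi_order \<alpha> \<le> m" for \<alpha>
      by (intro L2_diff sob_wD(1)[OF _ that] assms)
  qed (use d in \<open>auto intro: L2_diff sob_L2 assms\<close>)
  show "AE x in torus. wD \<alpha> (\<lambda>x. f x - g x) x = wD \<alpha> f x - wD \<alpha> g x" if "mi_order \<alpha> \<le> m"
    by (rule weak_deriv_unique[OF sob_wD(1)[OF s that] _ sob_wD(2)[OF s that] d[OF that]])
      (intro L2_diff sob_wD(1)[OF _ that] assms)
qed

lemma n2_wD_le_sob_norm:
  assumes "mi_order \<alpha> \<le> m"
  shows "n2 (wD \<alpha> f) \<le> sob_norm m f"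
proof -
  have "ip (wD \<alpha> f) (wD \<alpha> f) \<le> sob_inner m f f"
    unfolding sob_inner_def ip_def[symmetric]
    by (rule member_le_sum) (use assms finite_mi_order in auto)
  then show ?thesis unfolding n2_def sob_norm_def by (rule real_sqrt_le_mono)
qed

lemma sob_norm_nonneg [simp]: "0 \<le> sob_norm m f"
  by (rule order_trans[OF n2_nonneg n2_wD_le_sob_norm[of 0]]) simp

section \<open>Absolutely convergent Hartley series\<close>

text \<open>The modulus is injective on the nonnegative and on the negative integers, so each half
  is a partial sum of one convergent series.\<close>

lemma int_powr_sum_bounded:
  "\<exists>B. \<forall>I::int set. finite I \<longrightarrow> (\<Sum>n\<in>I. (1 + \<bar>real_of_int n\<bar>) powr (- 4/3)) \<le> B"
proof -
  define h where "h m = (1 + real m) powr (- 4/3)" for m :: nat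
  have "summable (\<lambda>n. of_nat n powr (- 4/3) :: real)" by (subst summable_real_powr_iff) simp
  then have "summable (\<lambda>n. of_nat (Suc n) powr (- 4/3) :: real)" by (subst summable_Suc_iff)
  then have sm: "summable h" by (simp add: h_def[abs_def] add.commute)
  have part: "(\<Sum>n\<in>J. (1 + \<bar>real_of_int n\<bar>) powr (- 4/3)) \<le> suminf h"
    if J: "finite J" "inj_on (nat \<circ> abs) J" for J :: "int set"
  proof -
    have "(\<Sum>n\<in>J. (1 + \<bar>real_of_int n\<bar>) powr (- 4/3)) = (\<Sum>n\<in>J. h ((nat \<circ> abs) n))"
      by (intro sum.cong) (auto simp: h_def)
    also have "\<dots> = (\<Sum>m\<in>(nat \<circ> abs) ` J. h m)" by (subst sum.reindex[OF J(2)]) simp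
    also have "\<dots> \<le> suminf h" by (rule sum_le_suminf[OF sm]) (use J in \<open>auto simp: h_def\<close>)
    finally show ?thesis .
  qed
  show ?thesis
  proof (intro exI allI impI)
    fix I :: "int set" assume I: "finite I"
    have "(\<Sum>n\<in>I. (1 + \<bar>real_of_int n\<bar>) powr (- 4/3))
        = (\<Sum>n\<in>I \<inter> {0..}. (1 + \<bar>real_of_int n\<bar>) powr (- 4/3)) + (\<Sum>n\<in>I - {0..}. (1 + \<bar>real_of_int n\<bar>) powr (- 4/3))"
      by (rule sum.Int_Diff[OF I])
    also have "\<dots> \<le> suminf h + suminf h"
      by (intro add_mono part) (use I in \<open>auto simp: inj_on_def\<close>)
    finally show "(\<Sum>n\<in>I. (1 + \<bar>real_of_int n\<bar>) powr (- 4/3)) \<le> suminf h + suminf h" .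
  qed
qed

lemma one_plus_pow4_le: "(1 + x) ^ 4 \<le> 8 * (1 + x ^ 4)" for x :: real
proof -
  have a: "(1 + x)\<^sup>2 \<le> 2 * (1 + x\<^sup>2)" using sum_squares_bound[of 1 x] by (simp add: power2_sum)
  have b: "(1 + x\<^sup>2)\<^sup>2 \<le> 2 * (1 + (x\<^sup>2)\<^sup>2)" using sum_squares_bound[of 1 "x\<^sup>2"] by (simp add: power2_sum)
  have "(1 + x) ^ 4 = ((1 + x)\<^sup>2)\<^sup>2" by simp
  also have "\<dots> \<le> (2 * (1 + x\<^sup>2))\<^sup>2" by (rule power_mono[OF a]) simp
  also have "\<dots> = 4 * (1 + x\<^sup>2)\<^sup>2" by (simp add: power2_eq_square algebra_simps)
  also have "\<dots> \<le> 8 * (1 + (x\<^sup>2)\<^sup>2)" using b by simp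
  finally show ?thesis by simp
qed

text \<open>This is where order 2 exceeds half of the dimension 3. Up to the factor 8 the weight
  dominates the product over the coordinates of \<open>(1 + |k_i|) powr (4/3)\<close>, because three
  exponents 4/3 add up to 4; the sum then factors into one-dimensional sums.\<close>

lemma lattice_sum_bounded:
  "\<exists>B\<ge>0. \<forall>K::(int^3) set. finite K \<longrightarrow> (\<Sum>k\<in>K. 1 / (1 + (\<Sum>i\<in>UNIV. \<bar>real_of_int (k $ i)\<bar> ^ 4))) \<le> B"
proof -
  define h where "h n = (1 + \<bar>real_of_int n\<bar>) powr (- 4/3)" for n
  have h0: "0 \<le> h n" for n by (simp add: h_def)
  obtain B where B: "\<And>I::int set. finite I \<Longrightarrow> (\<Sum>n\<in>I. h n) \<le> B"
    using int_powr_sum_bounded unfolding h_def by auto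
  have B0: "0 \<le> B" using B[of "{}"] by simp
  have le: "1 / (1 + (\<Sum>i\<in>UNIV. \<bar>real_of_int (k $ i)\<bar> ^ 4)) \<le> 8 * (h (k $ 1) * (h (k $ 2) * h (k $ 3)))" for k :: "int^3"
  proof -
    \<comment> \<open>The largest coordinate bounds all three factors, and its fourth power is one
      of the summands of the weight.\<close>
    define m where "m = Max (range (\<lambda>i. \<bar>real_of_int (k $ i)\<bar>))"
    have m: "\<bar>real_of_int (k $ i)\<bar> \<le> m" for i unfolding m_def by (rule Max_ge) auto
    have "m \<in> range (\<lambda>i. \<bar>real_of_int (k $ i)\<bar>)" unfolding m_def by (rule Max_in) auto
    then obtain i0 where i0: "m = \<bar>real_of_int (k $ i0)\<bar>" by auto
    then have m0: "0 \<le> m" by simp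
    have p: "(1 + \<bar>real_of_int (k $ i)\<bar>) powr (4/3) \<le> (1 + m) powr (4/3)" for i
      by (rule powr_mono2) (use m in auto)
    have "(1 + \<bar>real_of_int (k $ 1)\<bar>) powr (4/3) * ((1 + \<bar>real_of_int (k $ 2)\<bar>) powr (4/3) * (1 + \<bar>real_of_int (k $ 3)\<bar>) powr (4/3))
        \<le> (1 + m) powr (4/3) * ((1 + m) powr (4/3) * (1 + m) powr (4/3))"
      by (intro mult_mono p) auto
    also have "\<dots> = (1 + m) powr (real 4)" by (simp flip: powr_add)
    also have "\<dots> = (1 + m) ^ 4" using m0 by (subst powr_realpow) auto
    also have "\<dots> \<le> 8 * (1 + m ^ 4)" by (rule one_plus_pow4_le)
    also have "m ^ 4 \<le> (\<Sum>i\<in>UNIV. \<bar>real_of_int (k $ i)\<bar> ^ 4)"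
      unfolding i0 by (rule member_le_sum) auto
    finally have *: "(1 + \<bar>real_of_int (k $ 1)\<bar>) powr (4/3) * ((1 + \<bar>real_of_int (k $ 2)\<bar>) powr (4/3) * (1 + \<bar>real_of_int (k $ 3)\<bar>) powr (4/3))
        \<le> 8 * (1 + (\<Sum>i\<in>UNIV. \<bar>real_of_int (k $ i)\<bar> ^ 4))" by simp
    have hinv: "h n = 1 / (1 + \<bar>real_of_int n\<bar>) powr (4/3)" for n
      unfolding h_def using powr_minus_divide[of "1 + \<bar>real_of_int n\<bar>" "4/3"] by simp
    have pos: "0 < (1 + \<bar>real_of_int n\<bar>) powr (4/3)" for n by simp
    have wpos: "0 < 1 + (\<Sum>i\<in>UNIV. \<bar>real_of_int (k $ i)\<bar> ^ 4)"
      by (intro add_pos_nonneg sum_nonneg) auto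
    have ppos: "0 < (1 + \<bar>real_of_int (k $ 1)\<bar>) powr (4/3) * ((1 + \<bar>real_of_int (k $ 2)\<bar>) powr (4/3) * (1 + \<bar>real_of_int (k $ 3)\<bar>) powr (4/3))"
      by (intro mult_pos_pos pos)
    have "1 / (1 + (\<Sum>i\<in>UNIV. \<bar>real_of_int (k $ i)\<bar> ^ 4))
        \<le> 8 / ((1 + \<bar>real_of_int (k $ 1)\<bar>) powr (4/3) * ((1 + \<bar>real_of_int (k $ 2)\<bar>) powr (4/3) * (1 + \<bar>real_of_int (k $ 3)\<bar>) powr (4/3)))"
      unfolding pos_divide_le_eq[OF wpos] times_divide_eq_left pos_le_divide_eq[OF ppos] mult_1_left by (rule *)
    then show ?thesis by (simp add: hinv)
  qed
  show ?thesis
  proof (intro exI[of _ "8 * (B * (B * B))"] conjI allI impI)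
    show "0 \<le> 8 * (B * (B * B))" using B0 by simp
    fix K :: "(int^3) set" assume K: "finite K"
    define \<phi> where "\<phi> k = (k $ 1, k $ 2, k $ 3)" for k :: "int^3"
    have inj: "inj \<phi>" by (auto simp: inj_def \<phi>_def vec_eq_iff forall_3)
    define I where "I i = (\<lambda>k. k $ i) ` K" for i :: 3
    have I: "finite (I i)" for i using K by (simp add: I_def)
    have "(\<Sum>k\<in>K. 1 / (1 + (\<Sum>i\<in>UNIV. \<bar>real_of_int (k $ i)\<bar> ^ 4))) \<le> (\<Sum>k\<in>K. 8 * (h (k $ 1) * (h (k $ 2) * h (k $ 3))))"
      by (intro sum_mono le)
    also have "\<dots> = 8 * (\<Sum>k\<in>K. (\<lambda>(a, b, c). h a * (h b * h c)) (\<phi> k))"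
      by (simp add: sum_distrib_left \<phi>_def)
    also have "(\<Sum>k\<in>K. (\<lambda>(a, b, c). h a * (h b * h c)) (\<phi> k)) = (\<Sum>(a, b, c)\<in>\<phi> ` K. h a * (h b * h c))"
      by (subst sum.reindex[OF inj_on_subset[OF inj subset_UNIV]]) simp
    also have "\<dots> \<le> (\<Sum>(a, b, c)\<in>I 1 \<times> (I 2 \<times> I 3). h a * (h b * h c))"
      by (rule sum_mono2) (auto simp: I_def \<phi>_def h0 K)
    also have "\<dots> = (\<Sum>a\<in>I 1. \<Sum>b\<in>I 2. \<Sum>c\<in>I 3. h a * (h b * h c))"
      by (simp add: sum.cartesian_product)
    also have "\<dots> = (\<Sum>a\<in>I 1. h a) * ((\<Sum>b\<in>I 2. h b) * (\<Sum>c\<in>I 3. h c))"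
      by (simp only: sum_distrib_left[symmetric] sum_distrib_right[symmetric])
    also have "\<dots> \<le> B * (B * B)"
      by (intro mult_mono B I) (use B0 in \<open>auto intro!: sum_nonneg h0 mult_nonneg_nonneg\<close>)
    finally show "(\<Sum>k\<in>K. 1 / (1 + (\<Sum>i\<in>UNIV. \<bar>real_of_int (k $ i)\<bar> ^ 4))) \<le> 8 * (B * (B * B))" by simp
  qed
qed

text \<open>Fixing one bound by choice makes \<open>sobC\<close> a constant of the torus,
  independent of the function.\<close>

definition latB :: real where
  "latB = (SOME B. 0 \<le> B \<and> (\<forall>K::(int^3) set. finite K \<longrightarrow>
     (\<Sum>k\<in>K. 1 / (1 + (\<Sum>i\<in>UNIV. \<bar>real_of_int (k $ i)\<bar> ^ 4))) \<le> B))"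

lemma latB: fixes K :: "(int^3) set" shows "0 \<le> latB"
  and "finite K \<Longrightarrow> (\<Sum>k\<in>K. 1 / (1 + (\<Sum>i\<in>UNIV. \<bar>real_of_int (k $ i)\<bar> ^ 4))) \<le> latB"
proof -
  have *: "0 \<le> latB \<and> (\<forall>K::(int^3) set. finite K \<longrightarrow>
     (\<Sum>k\<in>K. 1 / (1 + (\<Sum>i\<in>UNIV. \<bar>real_of_int (k $ i)\<bar> ^ 4))) \<le> latB)"
    unfolding latB_def by (rule someI_ex) (use lattice_sum_bounded in simp)
  from *[THEN conjunct1] show "0 \<le> latB" .
  show "finite K \<Longrightarrow> (\<Sum>k\<in>K. 1 / (1 + (\<Sum>i\<in>UNIV. \<bar>real_of_int (k $ i)\<bar> ^ 4))) \<le> latB"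
    using *[THEN conjunct2, rule_format, of K] by simp
qed

text \<open>\<open>latB\<close> bounds the sums of inverse weights. The 4 counts the Bessel bounds
  in \<open>hat_sum_le_sob_norm\<close>: one for \<beta> itself and one for two more derivatives in
  each of the three directions. \<open>vol\<close> comes from Bessel's inequality.\<close>

definition sobC :: real where "sobC = sqrt (latB * (4 / vol))"

lemma sobC_nonneg: "0 \<le> sobC" using latB(1) vol_pos by (simp add: sobC_def)

text \<open>Cauchy-Schwarz with the summable weight \<open>1 / w\<close>: two derivatives beyond
  \<beta> pay for the growth of \<open>w\<close>, so square summability becomes absolute
  summability.\<close>

lemma hat_sum_le_sob_norm:
  assumes f: "sob m f" and \<beta>: "mi_order \<beta> + 2 \<le> m" and K: "finite K"
  shows "(\<Sum>k\<in>K. kpow k \<beta> * norm (hat f k)) \<le> sobC * sob_norm m f"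
proof -
  define w where "w k = 1 + (\<Sum>i\<in>UNIV. \<bar>real_of_int (k $ i)\<bar> ^ 4)" for k :: "int^3"
  have w: "0 < w k" for k unfolding w_def by (intro add_pos_nonneg sum_nonneg) auto
  define y where "y k = kpow k \<beta> * norm (hat f k)" for k
  have bnd: "(\<Sum>k\<in>K. (kpow k \<gamma> * norm (hat f k))\<^sup>2) \<le> (sob_norm m f)\<^sup>2 / vol" if \<gamma>: "mi_order \<gamma> \<le> m" for \<gamma>
  proof -
    let ?n = "mi_order \<gamma>" and ?g = "wD \<gamma> f"
    have "(\<Sum>k\<in>K. (kpow k \<gamma> * norm (hat f k))\<^sup>2) = (\<Sum>k\<in>K. (norm (hat ?g (flip ?n k)))\<^sup>2)"
      by (intro sum.cong refl) (simp add: norm_hat_weak_deriv[OF sob_wD(2)[OF f \<gamma>]])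
    also have "\<dots> = (\<Sum>k\<in>flip ?n ` K. (norm (hat ?g k))\<^sup>2)"
      by (subst sum.reindex[OF inj_on_subset[OF inj_flip subset_UNIV]]) simp
    also have "\<dots> \<le> ip ?g ?g / vol"
      by (rule Bessel[OF sob_wD(1)[OF f \<gamma>]]) (use K in simp)
    also have "\<dots> = (n2 ?g)\<^sup>2 / vol" by (simp add: n2_power2)
    also have "\<dots> \<le> (sob_norm m f)\<^sup>2 / vol"
      using vol_pos by (intro divide_right_mono power_mono n2_wD_le_sob_norm[OF \<gamma>]) auto
    finally show ?thesis .
  qed
  \<comment> \<open>Expanding \<open>w\<close> distributes the weighted sum over \<beta> and the
    three multi-indices \<open>\<beta> + axis i 2\<close>, to each of which Bessel's inequality
    applies.\<close>
  have "(\<Sum>k\<in>K. w k * (y k)\<^sup>2)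
      = (\<Sum>k\<in>K. (kpow k \<beta> * norm (hat f k))\<^sup>2) + (\<Sum>i\<in>UNIV. \<Sum>k\<in>K. (kpow k (\<beta> + axis i 2) * norm (hat f k))\<^sup>2)"
  proof -
    have "w k * (y k)\<^sup>2 = (kpow k \<beta> * norm (hat f k))\<^sup>2 + (\<Sum>i\<in>UNIV. (kpow k (\<beta> + axis i 2) * norm (hat f k))\<^sup>2)" for k
      unfolding w_def y_def kpow_add kpow_axis distrib_right sum_distrib_right
      by (simp add: power_mult_distrib mult_ac flip: power_mult)
    then have "(\<Sum>k\<in>K. w k * (y k)\<^sup>2) = (\<Sum>k\<in>K. (kpow k \<beta> * norm (hat f k))\<^sup>2)
        + (\<Sum>k\<in>K. \<Sum>i\<in>UNIV. (kpow k (\<beta> + axis i 2) * norm (hat f k))\<^sup>2)"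
      by (simp add: sum.distrib)
    then show ?thesis by (simp only: sum.swap[of _ _ K])
  qed
  also have "\<dots> \<le> (sob_norm m f)\<^sup>2 / vol + (\<Sum>i\<in>(UNIV::3 set). (sob_norm m f)\<^sup>2 / vol)"
    by (intro add_mono sum_mono bnd) (use \<beta> in \<open>auto simp: mi_order_add\<close>)
  also have "\<dots> = 4 / vol * (sob_norm m f)\<^sup>2" by simp
  finally have wy: "(\<Sum>k\<in>K. w k * (y k)\<^sup>2) \<le> 4 / vol * (sob_norm m f)\<^sup>2" .
  have "(\<Sum>k\<in>K. y k)\<^sup>2 = (\<Sum>k\<in>K. (1 / sqrt (w k)) * (sqrt (w k) * y k))\<^sup>2"
    using w by (intro arg_cong[where f="\<lambda>z. z\<^sup>2"] sum.cong) (auto simp: less_imp_neq[THEN not_sym])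
  also have "\<dots> \<le> (\<Sum>k\<in>K. (1 / sqrt (w k))\<^sup>2) * (\<Sum>k\<in>K. (sqrt (w k) * y k)\<^sup>2)"
    by (rule Cauchy_Schwarz_ineq_sum)
  also have "(\<Sum>k\<in>K. (1 / sqrt (w k))\<^sup>2) = (\<Sum>k\<in>K. 1 / w k)"
    using w by (intro sum.cong) (auto simp: power_divide less_imp_le)
  also have "(\<Sum>k\<in>K. (sqrt (w k) * y k)\<^sup>2) = (\<Sum>k\<in>K. w k * (y k)\<^sup>2)"
    using w by (intro sum.cong) (auto simp: power_mult_distrib less_imp_le)
  also have "(\<Sum>k\<in>K. 1 / w k) * (\<Sum>k\<in>K. w k * (y k)\<^sup>2) \<le> latB * (4 / vol * (sob_norm m f)\<^sup>2)"
    by (intro mult_mono wy sum_nonneg) (use latB(2)[OF K] latB(1) w in \<open>auto simp: w_def less_imp_le\<close>)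
  also have "\<dots> = (sobC * sob_norm m f)\<^sup>2"
    using latB(1) vol_pos by (simp add: sobC_def power_mult_distrib)
  finally have "(\<Sum>k\<in>K. y k) \<le> sobC * sob_norm m f"
    by (rule power2_le_imp_le) (intro mult_nonneg_nonneg sobC_nonneg sob_norm_nonneg)
  then show ?thesis by (simp add: y_def)
qed

text \<open>\<open>c\<close> is the signed monomial in the frequency that a derivative \<beta>
  produces; its size alone decides convergence.\<close>

lemma summable_hat:
  assumes f: "sob m f" and \<beta>: "mi_order \<beta> + 2 \<le> m" and c: "\<And>i. \<bar>c i\<bar> \<le> kpow (enum i) \<beta>"
  shows "summable (\<lambda>i. norm (c i *\<^sub>R hat f (enum i)))"
    "(\<Sum>i. norm (c i *\<^sub>R hat f (enum i))) \<le> sobC * sob_norm m f"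
proof -
  have le: "(\<Sum>i<n. norm (c i *\<^sub>R hat f (enum i))) \<le> sobC * sob_norm m f" for n
  proof -
    have "(\<Sum>i<n. norm (c i *\<^sub>R hat f (enum i))) \<le> (\<Sum>i<n. kpow (enum i) \<beta> * norm (hat f (enum i)))"
      using c by (intro sum_mono) (auto intro: mult_right_mono)
    also have "\<dots> = (\<Sum>k\<in>enum ` {..<n}. kpow k \<beta> * norm (hat f k))"
      by (subst sum.reindex) (auto intro: inj_on_subset[OF inj_enum])
    also have "\<dots> \<le> sobC * sob_norm m f" by (rule hat_sum_le_sob_norm[OF f \<beta>]) simp
    finally show ?thesis .
  qed
  show s: "summable (\<lambda>i. norm (c i *\<^sub>R hat f (enum i)))"
    by (rule summableI_nonneg_bounded[OF _ le]) simp
  show "(\<Sum>i. norm (c i *\<^sub>R hat f (enum i))) \<le> sobC * sob_norm m f"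
    by (rule suminf_le_const[OF s le])
qed

definition tser :: "(nat \<Rightarrow> int^3) \<Rightarrow> (nat \<Rightarrow> 'b::euclidean_space) \<Rightarrow> real^3 \<Rightarrow> 'b" where
  "tser \<kappa> a x = (\<Sum>i. cas (\<kappa> i) x *\<^sub>R a i)"

lemma norm_cas_scaleR_le: "norm (cas k x *\<^sub>R a) \<le> 2 * norm a"
  unfolding norm_scaleR real_norm_def by (intro mult_right_mono abs_cas_le norm_ge_zero)

lemma summable_norm_cas:
  assumes "summable (\<lambda>i. norm (a i))" shows "summable (\<lambda>i. norm (cas (\<kappa> i) x *\<^sub>R a i))"
proof (rule summable_comparison_test')
  show "summable (\<lambda>i. 2 * norm (a i))" by (rule summable_mult[OF assms])
  show "norm (norm (cas (\<kappa> i) x *\<^sub>R a i)) \<le> 2 * norm (a i)" for i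
    using norm_cas_scaleR_le[of "\<kappa> i" x "a i"] by simp
qed

lemma summable_cas:
  fixes a :: "nat \<Rightarrow> 'b::euclidean_space"
  assumes "summable (\<lambda>i. norm (a i))" shows "summable (\<lambda>i. cas (\<kappa> i) x *\<^sub>R a i)"
  by (rule summable_norm_cancel[OF summable_norm_cas[OF assms]])

lemma norm_tser_le:
  assumes "summable (\<lambda>i. norm (a i))" shows "norm (tser \<kappa> a x) \<le> 2 * (\<Sum>i. norm (a i))"
proof -
  have "norm (tser \<kappa> a x) \<le> (\<Sum>i. norm (cas (\<kappa> i) x *\<^sub>R a i))"
    unfolding tser_def by (rule summable_norm[OF summable_norm_cas[OF assms]])
  also have "\<dots> \<le> (\<Sum>i. 2 * norm (a i))"
    by (rule suminf_le[OF norm_cas_scaleR_le summable_norm_cas[OF assms] summable_mult[OF assms]])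
  also have "\<dots> = 2 * (\<Sum>i. norm (a i))" by (rule suminf_mult[OF assms])
  finally show ?thesis .
qed

lemma tser_diff:
  assumes "summable (\<lambda>i. norm (a i))" "summable (\<lambda>i. norm (b i))"
  shows "tser \<kappa> a x - tser \<kappa> b x = tser \<kappa> (\<lambda>i. a i - b i) x"
  unfolding tser_def using suminf_diff[OF summable_cas[OF assms(1)] summable_cas[OF assms(2)]]
  by (simp add: scaleR_diff_right)

lemma tser_minus_tpoly_le:
  assumes "summable (\<lambda>i. norm (a i))"
  shows "norm (tser \<kappa> a x - tpoly \<kappa> a n x) \<le> 2 * (\<Sum>i. norm (a (i + n)))"
proof -
  have "tser \<kappa> a x - tpoly \<kappa> a n x = tser (\<lambda>i. \<kappa> (i + n)) (\<lambda>i. a (i + n)) x"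
    unfolding tser_def tpoly_def using suminf_minus_initial_segment[OF summable_cas[OF assms]] by simp
  then show ?thesis
    using norm_tser_le[OF summable_ignore_initial_segment[OF assms, of n], of "\<lambda>i. \<kappa> (i + n)" x] by simp
qed

lemma tail_tendsto_0:
  assumes "summable (\<lambda>i. norm (a i))" shows "(\<lambda>n. 2 * (\<Sum>i. norm (a (i + n)))) \<longlonglongrightarrow> 0"
  by (rule tendsto_mult_right_zero[OF suminf_exist_split2[OF assms]])

lemma uniform_limit_tpoly:
  assumes "summable (\<lambda>i. norm (a i))"
  shows "uniform_limit UNIV (\<lambda>n. tpoly \<kappa> a n) (tser \<kappa> a) sequentially"
proof (rule uniform_limitI)
  fix e :: real assume "e > 0"
  then have "eventually (\<lambda>n. 2 * (\<Sum>i. norm (a (i + n))) < e) sequentially"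
    by (rule order_tendstoD(2)[OF tail_tendsto_0[OF assms]])
  then show "eventually (\<lambda>n. \<forall>x\<in>UNIV. dist (tpoly \<kappa> a n x) (tser \<kappa> a x) < e) sequentially"
  proof eventually_elim
    fix n assume "2 * (\<Sum>i. norm (a (i + n))) < e"
    then show "\<forall>x\<in>UNIV. dist (tpoly \<kappa> a n x) (tser \<kappa> a x) < e"
      using tser_minus_tpoly_le[OF assms] by (auto simp: dist_norm norm_minus_commute intro: le_less_trans)
  qed
qed

lemma continuous_tser:
  assumes "summable (\<lambda>i. norm (a i))" shows "continuous_on UNIV (tser \<kappa> a)"
  by (rule uniform_limit_theorem[OF _ uniform_limit_tpoly[OF assms]])
    (simp_all add: continuous_tpoly)

lemma periodic_tser: "periodic (tser \<kappa> a)"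
  by (simp add: periodic_def tser_def cas_shift)

text \<open>Termwise differentiation along the line through \<open>x\<close>: the remainder of the
  differentiated series is bounded on the whole line by the tail of its norms.\<close>

lemma has_partial_tser:
  assumes a: "summable (\<lambda>i. norm (a i))" and b: "summable (\<lambda>i. norm (real_of_int (\<kappa> i $ j) *\<^sub>R a i))"
  shows "has_partial j (tser \<kappa> a) (tser (\<lambda>i. - \<kappa> i) (\<lambda>i. real_of_int (\<kappa> i $ j) *\<^sub>R a i))"
  unfolding has_partial_def
proof
  fix x :: "real^3"
  let ?e = "axis j 1 :: real^3" and ?b = "\<lambda>i. real_of_int (\<kappa> i $ j) *\<^sub>R a i" and ?\<mu> = "\<lambda>i. - \<kappa> i"
  have "\<exists>g. \<forall>s\<in>UNIV. (\<lambda>n. cas (\<kappa> n) (x + s *\<^sub>R ?e) *\<^sub>R a n) sums g s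
      \<and> (g has_derivative (\<lambda>h. h *\<^sub>R tser ?\<mu> ?b (x + s *\<^sub>R ?e))) (at s within UNIV)"
  proof (rule has_derivative_series[where x=0 and f'="\<lambda>n s h. h *\<^sub>R (cas (- \<kappa> n) (x + s *\<^sub>R ?e) *\<^sub>R ?b n)"])
    fix n and s :: real
    have "((\<lambda>s. cas (\<kappa> n) (x + s *\<^sub>R ?e)) has_real_derivative real_of_int (\<kappa> n $ j) * cas (- \<kappa> n) (x + s *\<^sub>R ?e)) (at s)"
      using has_partial_at[OF has_partial_cas[of j "\<kappa> n"], of x s] by (simp add: has_real_derivative_iff_has_vector_derivative)
    then have "((\<lambda>s. cas (\<kappa> n) (x + s *\<^sub>R ?e)) has_derivative (\<lambda>h. real_of_int (\<kappa> n $ j) * cas (- \<kappa> n) (x + s *\<^sub>R ?e) * h)) (at s)"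
      by (simp add: has_field_derivative_def)
    from has_derivative_scaleR_left[OF this, of "a n"]
    show "((\<lambda>s. cas (\<kappa> n) (x + s *\<^sub>R ?e) *\<^sub>R a n) has_derivative (\<lambda>h. h *\<^sub>R (cas (- \<kappa> n) (x + s *\<^sub>R ?e) *\<^sub>R ?b n))) (at s within UNIV)"
      by (simp add: mult_ac)
  next
    fix e :: real assume "e > 0"
    then have "eventually (\<lambda>n. 2 * (\<Sum>i. norm (?b (i + n))) < e) sequentially"
      by (rule order_tendstoD(2)[OF tail_tendsto_0[OF b]])
    then show "eventually (\<lambda>n. \<forall>s\<in>UNIV. \<forall>h. norm ((\<Sum>i<n. h *\<^sub>R (cas (- \<kappa> i) (x + s *\<^sub>R ?e) *\<^sub>R ?b i))
        - h *\<^sub>R tser ?\<mu> ?b (x + s *\<^sub>R ?e)) \<le> e * norm h) sequentially"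
    proof eventually_elim
      fix n assume n: "2 * (\<Sum>i. norm (?b (i + n))) < e"
      show "\<forall>s\<in>UNIV. \<forall>h. norm ((\<Sum>i<n. h *\<^sub>R (cas (- \<kappa> i) (x + s *\<^sub>R ?e) *\<^sub>R ?b i))
        - h *\<^sub>R tser ?\<mu> ?b (x + s *\<^sub>R ?e)) \<le> e * norm h"
      proof (intro ballI allI)
        fix s h :: real
        let ?y = "x + s *\<^sub>R ?e"
        have "(\<Sum>i<n. h *\<^sub>R (cas (- \<kappa> i) ?y *\<^sub>R ?b i)) - h *\<^sub>R tser ?\<mu> ?b ?y = h *\<^sub>R (tpoly ?\<mu> ?b n ?y - tser ?\<mu> ?b ?y)"
          by (simp only: tpoly_def scaleR_sum_right scaleR_diff_right)
        then have "norm ((\<Sum>i<n. h *\<^sub>R (cas (- \<kappa> i) ?y *\<^sub>R ?b i)) - h *\<^sub>R tser ?\<mu> ?b ?y)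
            = norm h * norm (tser ?\<mu> ?b ?y - tpoly ?\<mu> ?b n ?y)"
          by (simp only: norm_scaleR norm_minus_commute real_norm_def)
        also have "\<dots> \<le> norm h * e"
          by (intro mult_left_mono order_trans[OF tser_minus_tpoly_le[OF b] less_imp_le[OF n]]) simp
        finally show "norm ((\<Sum>i<n. h *\<^sub>R (cas (- \<kappa> i) ?y *\<^sub>R ?b i)) - h *\<^sub>R tser ?\<mu> ?b ?y) \<le> e * norm h"
          by (simp only: mult.commute)
      qed
    qed
  next
    show "(\<lambda>n. cas (\<kappa> n) (x + 0 *\<^sub>R ?e) *\<^sub>R a n) sums tser \<kappa> a (x + 0 *\<^sub>R ?e)"
      unfolding tser_def by (rule summable_sums[OF summable_cas[OF a]])
  qed auto
  then obtain g where g: "\<And>s. (\<lambda>n. cas (\<kappa> n) (x + s *\<^sub>R ?e) *\<^sub>R a n) sums g s"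
    "\<And>s. (g has_derivative (\<lambda>h. h *\<^sub>R tser ?\<mu> ?b (x + s *\<^sub>R ?e))) (at s)" by auto
  have "g = (\<lambda>s. tser \<kappa> a (x + s *\<^sub>R ?e))"
    unfolding tser_def using sums_unique[OF g(1)] by auto
  then show "((\<lambda>s. tser \<kappa> a (x + s *\<^sub>R ?e)) has_vector_derivative tser ?\<mu> ?b x) (at 0)"
    using g(2)[of 0] by (simp add: has_vector_derivative_def)
qed

text \<open>The truncations converge to \<open>f\<close> in the mean and to the series
  uniformly.\<close>

lemma AE_eq_tser_hat:
  assumes f: "L2 f" and s: "summable (\<lambda>i. norm (hat f (enum i)))"
  shows "AE x in torus. f x = tser enum (\<lambda>i. hat f (enum i)) x"
proof -
  let ?r = "tser enum (\<lambda>i. hat f (enum i))"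
  have r: "L2 ?r" by (rule L2_continuous[OF continuous_tser[OF s]])
  have "(\<lambda>n. n2 (\<lambda>x. f x - trunc n f x) + sqrt vol * (2 * (\<Sum>i. norm (hat f (enum (i + n)))))) \<longlonglongrightarrow> 0 + sqrt vol * 0"
    by (intro tendsto_add tendsto_mult tendsto_const trunc_tendsto[OF f] tail_tendsto_0[OF s])
  moreover have "n2 (\<lambda>x. f x - ?r x) \<le> n2 (\<lambda>x. f x - trunc n f x) + sqrt vol * (2 * (\<Sum>i. norm (hat f (enum (i + n)))))" for n
  proof -
    have "n2 (\<lambda>x. f x - ?r x) \<le> n2 (\<lambda>x. f x - trunc n f x) + n2 (\<lambda>x. trunc n f x - ?r x)"
      by (rule n2_triangle_diff[OF f _ r]) simp
    also have "n2 (\<lambda>x. trunc n f x - ?r x) \<le> sqrt vol * (2 * (\<Sum>i. norm (hat f (enum (i + n)))))"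
    proof (rule n2_le_bound)
      show "(\<lambda>x. trunc n f x - ?r x) \<in> borel_measurable torus"
        by (intro continuous_torus_measurable continuous_intros continuous_tpoly continuous_tser[OF s])
      show "AE x in torus. norm (trunc n f x - ?r x) \<le> 2 * (\<Sum>i. norm (hat f (enum (i + n))))"
        by (rule AE_I2) (simp only: norm_minus_commute[of "trunc n f _"] tser_minus_tpoly_le[OF s])
      show "0 \<le> 2 * (\<Sum>i. norm (hat f (enum (i + n))))"
        using summable_ignore_initial_segment[OF s, of n] by (intro mult_nonneg_nonneg suminf_nonneg) auto
    qed
    finally show ?thesis by simp
  qed
  ultimately have "n2 (\<lambda>x. f x - ?r x) \<le> 0" by (intro LIMSEQ_le_const[of _ 0]) auto
  then have "n2 (\<lambda>x. f x - ?r x) = 0" using n2_nonneg[of "\<lambda>x. f x - ?r x"] by linarith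
  then have "AE x in torus. f x - ?r x = 0" by (intro AE_eq_zero_if_n2_zero L2_diff f r)
  then show ?thesis by eventually_elim simp
qed

section \<open>Jointly continuous periodic functions\<close>

text \<open>Joint continuity lets compactness of the time interval times the closed cell deliver
  bounds and moduli of continuity that are uniform in \<open>x\<close>.\<close>

definition CP :: "real \<Rightarrow> (real \<Rightarrow> real^3 \<Rightarrow> 'b::real_normed_vector) \<Rightarrow> bool" where
  "CP T u \<longleftrightarrow> continuous_on ({0..T} \<times> UNIV) (\<lambda>p. u (fst p) (snd p)) \<and> (\<forall>t\<in>{0..T}. periodic (u t))"

lemma CP_continuous:
  assumes "CP T u" "t \<in> {0..T}" shows "continuous_on UNIV (u t)"
proof -
  have "continuous_on UNIV (\<lambda>x. u (fst (t, x)) (snd (t, x)))"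
    by (rule continuous_on_compose2[where g="\<lambda>p. u (fst p) (snd p)" and t="{0..T} \<times> UNIV"])
      (use assms in \<open>auto simp: CP_def intro!: continuous_intros\<close>)
  then show ?thesis by simp
qed

lemma CP_const: "CP T (\<lambda>t x. c)"
  by (simp add: CP_def periodic_def)

lemma CP_compose:
  assumes "CP T u" "continuous_on S f" "\<And>t x. t \<in> {0..T} \<Longrightarrow> u t x \<in> S"
  shows "CP T (\<lambda>t x. f (u t x))"
  unfolding CP_def
proof (intro conjI ballI)
  show "continuous_on ({0..T} \<times> UNIV) (\<lambda>p. f (u (fst p) (snd p)))"
    by (rule continuous_on_compose2[OF assms(2)]) (use assms in \<open>auto simp: CP_def\<close>)
qed (use assms(1) in \<open>simp add: CP_def periodic_def\<close>)

lemma CP_bounded_linear: "bounded_linear f \<Longrightarrow> CP T u \<Longrightarrow> CP T (\<lambda>t x. f (u t x))"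
  by (rule CP_compose[of _ _ UNIV]) (auto intro: linear_continuous_on)

lemma CP_bounded_bilinear:
  assumes "bounded_bilinear h" "CP T u" "CP T v" shows "CP T (\<lambda>t x. h (u t x) (v t x))"
  using assms(2,3) unfolding CP_def
  by (auto intro!: bounded_bilinear.continuous_on[OF assms(1)] simp: periodic_def)

lemma CP_add: "CP T u \<Longrightarrow> CP T v \<Longrightarrow> CP T (\<lambda>t x. u t x + v t x)"
  unfolding CP_def by (auto intro!: continuous_intros simp: periodic_def)

lemma CP_diff: "CP T u \<Longrightarrow> CP T v \<Longrightarrow> CP T (\<lambda>t x. u t x - v t x)"
  unfolding CP_def by (auto intro!: continuous_intros simp: periodic_def)

lemma CP_uminus: "CP T u \<Longrightarrow> CP T (\<lambda>t x. - u t x)"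
  unfolding CP_def by (auto intro!: continuous_intros simp: periodic_def)

lemma CP_sum: "(\<And>i. i \<in> I \<Longrightarrow> CP T (u i)) \<Longrightarrow> CP T (\<lambda>t x. \<Sum>i\<in>I. u i t x)"
  by (induction I rule: infinite_finite_induct) (auto intro: CP_const CP_add)

lemmas CP_inner = CP_bounded_bilinear[OF bounded_bilinear_inner]
  and CP_scaleR = CP_bounded_bilinear[OF bounded_bilinear_scaleR]
  and CP_nth = CP_bounded_linear[OF bounded_linear_vec_nth]

lemma CP_vec: 
  fixes u :: "'n::finite \<Rightarrow> real \<Rightarrow> real^3 \<Rightarrow> 'b::real_normed_vector"
  shows "(\<And>i. CP T (u i)) \<Longrightarrow> CP T (\<lambda>t x. \<chi> i. u i t x)"
  unfolding CP_def by (auto intro!: continuous_on_vec_lambda simp: periodic_def)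

definition closed_cell :: "(real^3) set" where "closed_cell = cbox (\<chi> i. - pi) (\<chi> i. pi)"

lemma cell_closed_cell: "x \<in> cell \<Longrightarrow> x \<in> closed_cell"
  using cell_subset by (auto simp: closed_cell_def)

lemma compact_time_cell: "compact ({0..T::real} \<times> closed_cell)"
  unfolding closed_cell_def by (intro compact_Times compact_Icc compact_cbox)

lemma CP_bounded:
  assumes "CP T u"
  obtains B where "B > 0" "\<And>t x. t \<in> {0..T} \<Longrightarrow> x \<in> cell \<Longrightarrow> norm (u t x) \<le> B"
proof -
  let ?f = "\<lambda>p. u (fst p) (snd p)"
  have "compact (?f ` ({0..T} \<times> closed_cell))"
    using assms unfolding CP_def
    by (intro compact_continuous_image compact_time_cell) (auto elim: continuous_on_subset)
  then obtain B where B: "B > 0" "\<And>y. y \<in> ?f ` ({0..T} \<times> closed_cell) \<Longrightarrow> norm y \<le> B"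
    using compact_imp_bounded bounded_pos by metis
  show ?thesis
  proof (rule that[OF B(1)])
    fix t x assume "t \<in> {0..T}" "x \<in> cell"
    then show "norm (u t x) \<le> B"
      by (intro B(2) image_eqI[where x="(t, x)"]) (auto simp: cell_closed_cell)
  qed
qed

lemma CP_uniform:
  assumes "CP T u" "e > 0"
  obtains d where "d > 0" "\<And>s t x. s \<in> {0..T} \<Longrightarrow> t \<in> {0..T} \<Longrightarrow> \<bar>s - t\<bar> < d \<Longrightarrow> x \<in> cell \<Longrightarrow> norm (u s x - u t x) < e"
proof -
  let ?f = "\<lambda>p. u (fst p) (snd p)"
  have "uniformly_continuous_on ({0..T} \<times> closed_cell) ?f"
    using assms(1) unfolding CP_def
    by (intro compact_uniformly_continuous compact_time_cell) (auto elim: continuous_on_subset)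
  then obtain d where d: "d > 0"
    "\<And>p p'. p \<in> {0..T} \<times> closed_cell \<Longrightarrow> p' \<in> {0..T} \<times> closed_cell \<Longrightarrow> dist p' p < d \<Longrightarrow> dist (?f p') (?f p) < e"
    using assms(2) unfolding uniformly_continuous_on_def by metis
  show ?thesis
  proof (rule that[OF d(1)])
    fix s t x assume "s \<in> {0..T}" "t \<in> {0..T}" "\<bar>s - t\<bar> < d" "x \<in> cell"
    then show "norm (u s x - u t x) < e"
      using d(2)[of "(t, x)" "(s, x)"] by (auto simp: cell_closed_cell dist_norm norm_Pair)
  qed
qed

lemma CP_L2: "CP T u \<Longrightarrow> t \<in> {0..T} \<Longrightarrow> L2 (u t)" for u :: "real \<Rightarrow> real^3 \<Rightarrow> 'b::euclidean_space"
  by (rule L2_continuous[OF CP_continuous])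

lemma CP_n2_bounded:
  fixes u :: "real \<Rightarrow> real^3 \<Rightarrow> 'b::euclidean_space"
  assumes "CP T u" obtains B where "B > 0" "\<And>t. t \<in> {0..T} \<Longrightarrow> n2 (u t) \<le> B"
proof -
  obtain B where B: "B > 0" "\<And>t x. t \<in> {0..T} \<Longrightarrow> x \<in> cell \<Longrightarrow> norm (u t x) \<le> B"
    using CP_bounded[OF assms] by metis
  show ?thesis
  proof (rule that)
    show "0 < sqrt vol * B" using vol_pos B(1) by simp
    show "n2 (u t) \<le> sqrt vol * B" if "t \<in> {0..T}" for t
      using B that by (intro n2_le_bound continuous_torus_measurable CP_continuous[OF assms that] AE_torus_I) auto
  qed
qed

lemma CP_n2_uniform:
  fixes u :: "real \<Rightarrow> real^3 \<Rightarrow> 'b::euclidean_space"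
  assumes "CP T u" "e > 0"
  obtains d where "d > 0" "\<And>s t. s \<in> {0..T} \<Longrightarrow> t \<in> {0..T} \<Longrightarrow> \<bar>s - t\<bar> < d \<Longrightarrow> n2 (\<lambda>x. u s x - u t x) \<le> e"
proof -
  have e: "e / sqrt vol > 0" using assms vol_pos by simp
  obtain d where d: "d > 0" "\<And>s t x. s \<in> {0..T} \<Longrightarrow> t \<in> {0..T} \<Longrightarrow> \<bar>s - t\<bar> < d \<Longrightarrow> x \<in> cell \<Longrightarrow> norm (u s x - u t x) < e / sqrt vol"
    using CP_uniform[OF assms(1) e] by metis
  show ?thesis
  proof (rule that[OF d(1)])
    fix s t assume st: "s \<in> {0..T}" "t \<in> {0..T}" "\<bar>s - t\<bar> < d"
    have "n2 (\<lambda>x. u s x - u t x) \<le> sqrt vol * (e / sqrt vol)"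
    proof (rule n2_le_bound)
      show "(\<lambda>x. u s x - u t x) \<in> borel_measurable torus"
        by (intro continuous_torus_measurable continuous_on_diff CP_continuous[OF assms(1)] st)
      show "AE x in torus. norm (u s x - u t x) \<le> e / sqrt vol"
        using d(2)[OF st] by (intro AE_torus_I) (auto intro: less_imp_le)
    qed (use e in simp)
    then show "n2 (\<lambda>x. u s x - u t x) \<le> e" using vol_pos by simp
  qed
qed

section \<open>Continuous representatives\<close>

text \<open>Built from coefficients, hence dependent on the class of \<open>f\<close> only; it is
  meaningful once the coefficients are absolutely summable.\<close>

definition rep :: "(real^3 \<Rightarrow> 'b::euclidean_space) \<Rightarrow> real^3 \<Rightarrow> 'b" where
  "rep f = tser enum (\<lambda>i. hat f (enum i))"

definition rep1 :: "3 \<Rightarrow> (real^3 \<Rightarrow> 'b::euclidean_space) \<Rightarrow> real^3 \<Rightarrow> 'b" where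
  "rep1 j f = tser (\<lambda>n. - enum n) (\<lambda>n. real_of_int (enum n $ j) *\<^sub>R hat f (enum n))"

text \<open>Two derivatives restore the frequency \<open>k\<close> and leave the factor
  \<open>- k_i k_j\<close>; its symmetry in \<open>i\<close> and \<open>j\<close> is the equality of
  mixed derivatives used in the energy identity.\<close>

definition rep2 :: "3 \<Rightarrow> 3 \<Rightarrow> (real^3 \<Rightarrow> 'b::euclidean_space) \<Rightarrow> real^3 \<Rightarrow> 'b" where
  "rep2 i j f = tser enum (\<lambda>n. (- real_of_int (enum n $ i) * real_of_int (enum n $ j)) *\<^sub>R hat f (enum n))"

lemma kpow1: "\<bar>real_of_int (k $ j)\<bar> \<le> kpow k (axis j 1)"
  unfolding kpow_axis by simp

lemma kpow2: "\<bar>- real_of_int (k $ i) * real_of_int (k $ j)\<bar> \<le> kpow k (axis i 1 + axis j 1)"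
  unfolding kpow_add kpow_axis by (simp add: abs_mult)

lemma summable_rep: "sob m f \<Longrightarrow> 2 \<le> m \<Longrightarrow> summable (\<lambda>n. norm (hat f (enum n)))"
  using summable_hat(1)[of m f 0 "\<lambda>_. 1"] by simp

lemma summable_rep1: "sob m f \<Longrightarrow> 3 \<le> m \<Longrightarrow> summable (\<lambda>n. norm (real_of_int (enum n $ j) *\<^sub>R hat f (enum n)))"
  by (rule summable_hat(1)[OF _ _ kpow1]) auto

lemma summable_rep2: "sob m f \<Longrightarrow> 4 \<le> m \<Longrightarrow>
    summable (\<lambda>n. norm ((- real_of_int (enum n $ i) * real_of_int (enum n $ j)) *\<^sub>R hat f (enum n)))"
  by (rule summable_hat(1)[OF _ _ kpow2]) (auto simp: mi_order_add)

lemma AE_rep: "sob m f \<Longrightarrow> 2 \<le> m \<Longrightarrow> AE x in torus. f x = rep f x"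
  unfolding rep_def by (rule AE_eq_tser_hat[OF sob_L2 summable_rep])

lemma continuous_rep: "sob m f \<Longrightarrow> 2 \<le> m \<Longrightarrow> continuous_on UNIV (rep f)"
  unfolding rep_def by (rule continuous_tser[OF summable_rep])

lemma continuous_rep1: "sob m f \<Longrightarrow> 3 \<le> m \<Longrightarrow> continuous_on UNIV (rep1 j f)"
  unfolding rep1_def by (rule continuous_tser[OF summable_rep1])

lemma continuous_rep2: "sob m f \<Longrightarrow> 4 \<le> m \<Longrightarrow> continuous_on UNIV (rep2 i j f)"
  unfolding rep2_def by (rule continuous_tser[OF summable_rep2])

lemma periodic_rep: "periodic (rep f)" "periodic (rep1 j f)" "periodic (rep2 i j f)"
  unfolding rep_def rep1_def rep2_def by (rule periodic_tser)+

lemma has_partial_rep: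
  assumes "sob m f" "3 \<le> m" shows "has_partial j (rep f) (rep1 j f)"
  unfolding rep_def rep1_def
  by (rule has_partial_tser[OF summable_rep[OF assms(1)] summable_rep1[OF assms]]) (use assms in simp)

lemma has_partial_rep1:
  assumes "sob m f" "4 \<le> m" shows "has_partial i (rep1 j f) (rep2 i j f)"
proof -
  have eq: "real_of_int ((- enum n) $ i) *\<^sub>R real_of_int (enum n $ j) *\<^sub>R hat f (enum n)
      = (- real_of_int (enum n $ i) * real_of_int (enum n $ j)) *\<^sub>R hat f (enum n)" for n by simp
  have "has_partial i (rep1 j f) (tser (\<lambda>n. - (- enum n)) (\<lambda>n. real_of_int ((- enum n) $ i) *\<^sub>R real_of_int (enum n $ j) *\<^sub>R hat f (enum n)))"
    unfolding rep1_def
  proof (rule has_partial_tser)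
    show "summable (\<lambda>n. norm (real_of_int (enum n $ j) *\<^sub>R hat f (enum n)))"
      by (rule summable_rep1[OF assms(1)]) (use assms in simp)
    show "summable (\<lambda>n. norm (real_of_int ((- enum n) $ i) *\<^sub>R real_of_int (enum n $ j) *\<^sub>R hat f (enum n)))"
      unfolding eq by (rule summable_rep2[OF assms])
  qed
  then show ?thesis unfolding eq rep2_def by simp
qed

lemma axis_neq_0 [simp]: "n \<noteq> 0 \<Longrightarrow> (axis j n :: nat^3) \<noteq> 0"
  by (simp add: axis_eq_0_iff)

lemma weak_deriv_rep1:
  assumes "sob m f" "3 \<le> m" shows "has_weak_deriv (axis j 1) f (rep1 j f)"
proof (rule has_weak_deriv_cong_AE)
  have s2: "2 \<le> m" using assms(2) by simp
  show "has_weak_deriv (axis j 1) (rep f) (rep1 j f)"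
    by (rule has_weak_deriv_classical[OF continuous_rep[OF assms(1) s2] periodic_rep(1) continuous_rep1[OF assms] has_partial_rep[OF assms]])
  show "L2 (rep f)" by (rule L2_continuous[OF continuous_rep[OF assms(1) s2]])
  show "L2 (rep1 j f)" by (rule L2_continuous[OF continuous_rep1[OF assms]])
  show "AE x in torus. rep f x = f x" using AE_rep[OF assms(1) s2] by eventually_elim simp
qed simp

lemma AE_rep1: "sob m f \<Longrightarrow> 3 \<le> m \<Longrightarrow> AE x in torus. wd j f x = rep1 j f x"
  by (rule wD_if_weak_deriv(3)[OF L2_continuous[OF continuous_rep1] weak_deriv_rep1]) simp_all

text \<open>Second weak derivatives are not defined by iterating first ones. Both sides are compared
  through Hartley coefficients, where iteration is multiplication by frequencies.\<close>

lemma AE_rep2: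
  assumes "sob m f" "4 \<le> m" shows "AE x in torus. wD (axis j 2) f x = rep2 j j f x"
proof (rule AE_eq_if_hat_eq)
  have s: "mi_order (axis j 2) \<le> m" and s3: "3 \<le> m" using assms(2) by auto
  show "L2 (wD (axis j 2) f)" by (rule sob_wD(1)[OF assms(1) s])
  show "L2 (rep2 j j f)" by (rule L2_continuous[OF continuous_rep2[OF assms]])
  have w: "has_weak_deriv (axis j 1) (rep1 j f) (rep2 j j f)"
    by (rule has_weak_deriv_classical[OF continuous_rep1[OF assms(1) s3] periodic_rep(2) continuous_rep2[OF assms] has_partial_rep1[OF assms]])
  fix k
  show "hat (wD (axis j 2) f) k = hat (rep2 j j f) k"
    unfolding hat_weak_deriv_2[OF sob_wD(2)[OF assms(1) s]] hat_weak_deriv_1[OF w] hat_weak_deriv_1[OF weak_deriv_rep1[OF assms(1) s3]]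
    by (simp add: power2_eq_square)
qed

lemma C_sob_sob: "C_sob T m u \<Longrightarrow> t \<in> {0..T} \<Longrightarrow> sob m (u t)"
  by (simp add: C_sob_def)

lemma C_sob_close:
  assumes "C_sob T m u" "t \<in> {0..T}" "e > 0"
  shows "\<exists>d>0. \<forall>r\<in>{0..T}. r \<noteq> t \<longrightarrow> \<bar>r - t\<bar> < d \<longrightarrow> sob_norm m (\<lambda>x. u r x - u t x) < e"
proof -
  have "((\<lambda>r. sob_norm m (\<lambda>x. u r x - u t x)) \<longlongrightarrow> 0) (at t within {0..T})"
    using assms by (simp add: C_sob_def)
  from this[unfolded Lim_within, rule_format, OF assms(3)]
  obtain d where d: "0 < d \<and> (\<forall>r\<in>{0..T}. 0 < dist r t \<and> dist r t < d \<longrightarrow> dist (sob_norm m (\<lambda>x. u r x - u t x)) 0 < e)" ..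
  show ?thesis
  proof (intro exI[of _ d] conjI ballI impI)
    fix r assume "r \<in> {0..T}" "r \<noteq> t" "\<bar>r - t\<bar> < d"
    then show "sob_norm m (\<lambda>x. u r x - u t x) < e"
      using d[THEN conjunct2, rule_format, of r] by (simp add: dist_real_def)
  qed (use d in simp)
qed

text \<open>Summability is part of the notion because the value of \<open>suminf\<close> on a
  divergent series carries no information.\<close>

definition hat_close :: "(nat \<Rightarrow> real) \<Rightarrow> (real^3 \<Rightarrow> 'b::euclidean_space) \<Rightarrow> (real^3 \<Rightarrow> 'b) \<Rightarrow> real \<Rightarrow> bool" where
  "hat_close c f g e \<longleftrightarrow> summable (\<lambda>i. norm (c i *\<^sub>R hat f (enum i) - c i *\<^sub>R hat g (enum i)))
    \<and> (\<Sum>i. norm (c i *\<^sub>R hat f (enum i) - c i *\<^sub>R hat g (enum i))) < e"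

lemma hat_series_close:
  assumes u: "C_sob T m u" "mi_order \<beta> + 2 \<le> m" "\<And>i. \<bar>c i\<bar> \<le> kpow (enum i) \<beta>"
    and t: "t \<in> {0..T}" and e: "e > 0"
  obtains d where "d > 0" "\<And>r. r \<in> {0..T} \<Longrightarrow> \<bar>r - t\<bar> < d \<Longrightarrow>
      hat_close c (u r) (u t) (e)"
proof -
  \<comment> \<open>The added 1 avoids a division by 0.\<close>
  have e': "e / (sobC + 1) > 0" using e sobC_nonneg by simp
  from C_sob_close[OF u(1) t e']
  obtain d where "0 < d \<and> (\<forall>r\<in>{0..T}. r \<noteq> t \<longrightarrow> \<bar>r - t\<bar> < d \<longrightarrow> sob_norm m (\<lambda>x. u r x - u t x) < e / (sobC + 1))" ..
  note d = this[THEN conjunct1] this[THEN conjunct2, rule_format]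
  show ?thesis
  proof (rule that[OF d(1)])
    fix r assume r: "r \<in> {0..T}" "\<bar>r - t\<bar> < d"
    show "hat_close c (u r) (u t) (e)"
    proof (cases "r = t")
      case True
      then show ?thesis using e by (simp add: hat_close_def)
    next
      case False
      note s = C_sob_sob[OF u(1) r(1)] C_sob_sob[OF u(1) t]
      have eq: "c i *\<^sub>R hat (u r) (enum i) - c i *\<^sub>R hat (u t) (enum i) = c i *\<^sub>R hat (\<lambda>x. u r x - u t x) (enum i)" for i
        by (simp add: hat_diff sob_L2[OF s(1)] sob_L2[OF s(2)] scaleR_diff_right)
      note sd = sob_diff(1)[OF s]
      have "(\<Sum>i. norm (c i *\<^sub>R hat (\<lambda>x. u r x - u t x) (enum i))) \<le> sobC * sob_norm m (\<lambda>x. u r x - u t x)"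
        by (rule summable_hat(2)[OF sd u(2,3)])
      also have "\<dots> \<le> sobC * (e / (sobC + 1))"
        by (intro mult_left_mono less_imp_le[OF d(2)] r False sobC_nonneg)
      also have "\<dots> < e" using e sobC_nonneg by (simp add: field_simps)
      finally show ?thesis unfolding hat_close_def eq using summable_hat(1)[OF sd u(2,3)] by simp
    qed
  qed
qed

text \<open>At a fixed time the series is continuous in space; a change of time alters it, uniformly
  in space, by at most twice the sum of the norms of the coefficient differences.\<close>

lemma CP_tser:
  assumes u: "C_sob T m u" "mi_order \<beta> + 2 \<le> m" "\<And>i. \<bar>c i\<bar> \<le> kpow (enum i) \<beta>"
  shows "CP T (\<lambda>t. tser \<kappa> (\<lambda>i. c i *\<^sub>R hat (u t) (enum i)))"
  unfolding CP_def
proof (intro conjI ballI periodic_tser)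
  let ?f = "\<lambda>t. tser \<kappa> (\<lambda>i. c i *\<^sub>R hat (u t) (enum i))"
  show "continuous_on ({0..T} \<times> UNIV) (\<lambda>p. ?f (fst p) (snd p))"
    unfolding continuous_on_iff
  proof (intro ballI allI impI)
    fix p :: "real \<times> (real^3)" and e :: real assume p: "p \<in> {0..T} \<times> UNIV" and e: "e > 0"
    obtain t x where tx: "p = (t, x)" "t \<in> {0..T}" using p by auto
    note sm = summable_hat(1)[OF C_sob_sob[OF u(1)] u(2,3)]
    have e4: "e / 4 > 0" using e by simp
    obtain d1 where d1: "d1 > 0" "\<And>r. r \<in> {0..T} \<Longrightarrow> \<bar>r - t\<bar> < d1 \<Longrightarrow>
        hat_close c (u r) (u t) (e / 4)"
      using hat_series_close[OF u tx(2) e4] by metis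
    obtain d2 where d2: "d2 > 0" "\<And>y. dist y x < d2 \<Longrightarrow> dist (?f t y) (?f t x) < e / 2"
      using continuous_tser[OF sm[OF tx(2)], of \<kappa>, unfolded continuous_on_iff, rule_format, OF UNIV_I half_gt_zero[OF e], of x]
      by auto
    show "\<exists>d>0. \<forall>p'\<in>{0..T} \<times> UNIV. dist p' p < d \<longrightarrow> dist (?f (fst p') (snd p')) (?f (fst p) (snd p)) < e"
    proof (intro exI[of _ "min d1 d2"] conjI ballI impI)
      fix p' :: "real \<times> (real^3)" assume p': "p' \<in> {0..T} \<times> UNIV" "dist p' p < min d1 d2"
      obtain r y where ry: "p' = (r, y)" "r \<in> {0..T}" using p' by auto
      have "dist r t \<le> dist p' p" "dist y x \<le> dist p' p"
        using dist_fst_le[of p' p] dist_snd_le[of p' p] by (simp_all add: tx ry)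
      then have close: "\<bar>r - t\<bar> < d1" "dist y x < d2" using p'(2) by (auto simp: dist_real_def)
      have "norm (?f r y - ?f t y) \<le> 2 * (\<Sum>i. norm (c i *\<^sub>R hat (u r) (enum i) - c i *\<^sub>R hat (u t) (enum i)))"
        unfolding tser_diff[OF sm[OF ry(2)] sm[OF tx(2)]]
        by (rule norm_tser_le) (use d1(2)[OF ry(2) close(1)] in \<open>simp add: hat_close_def\<close>)
      also have "\<dots> < 2 * (e / 4)" using d1(2)[OF ry(2) close(1)] by (simp add: hat_close_def)
      finally have "dist (?f r y) (?f t y) < e / 2" by (simp add: dist_norm)
      then have "dist (?f r y) (?f t x) < e"
        using d2(2)[OF close(2)] dist_triangle[of "?f r y" "?f t x" "?f t y"] by linarith
      then show "dist (?f (fst p') (snd p')) (?f (fst p) (snd p)) < e" by (simp add: tx ry)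
    qed (use d1 d2 in simp)
  qed
qed

text \<open>By the reverse triangle inequality the sum of norms is continuous in time, hence
  bounded. It is the source of gradient bounds uniform in time and in the truncation.\<close>

lemma hat_series_bounded:
  assumes u: "C_sob T m u" "mi_order \<beta> + 2 \<le> m" "\<And>i. \<bar>c i\<bar> \<le> kpow (enum i) \<beta>"
  obtains M where "M \<ge> 0" "\<And>t. t \<in> {0..T} \<Longrightarrow> (\<Sum>i. norm (c i *\<^sub>R hat (u t) (enum i))) \<le> M"
proof -
  let ?S = "\<lambda>t. \<Sum>i. norm (c i *\<^sub>R hat (u t) (enum i))"
  note sm = summable_hat(1)[OF C_sob_sob[OF u(1)] u(2,3)]
  have "continuous_on {0..T} ?S"
    unfolding continuous_on_iff
  proof (intro ballI allI impI)
    fix t e :: real assume t: "t \<in> {0..T}" and e: "e > 0"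
    obtain d where d: "d > 0" "\<And>r. r \<in> {0..T} \<Longrightarrow> \<bar>r - t\<bar> < d \<Longrightarrow>
        hat_close c (u r) (u t) (e)"
      using hat_series_close[OF u t e] by metis
    show "\<exists>d>0. \<forall>r\<in>{0..T}. dist r t < d \<longrightarrow> dist (?S r) (?S t) < e"
    proof (intro exI[of _ d] conjI ballI impI d(1))
      fix r assume r: "r \<in> {0..T}" "dist r t < d"
      then have dr: "summable (\<lambda>i. norm (c i *\<^sub>R hat (u r) (enum i) - c i *\<^sub>R hat (u t) (enum i)))"
        "(\<Sum>i. norm (c i *\<^sub>R hat (u r) (enum i) - c i *\<^sub>R hat (u t) (enum i))) < e"
        using d(2)[OF r(1)] by (simp_all add: dist_real_def hat_close_def)
      have sd: "summable (\<lambda>i. \<bar>norm (c i *\<^sub>R hat (u r) (enum i)) - norm (c i *\<^sub>R hat (u t) (enum i))\<bar>)"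
        by (rule summable_comparison_test'[OF dr(1)]) (simp only: real_norm_def abs_abs norm_triangle_ineq3)
      have "\<bar>?S r - ?S t\<bar> = \<bar>\<Sum>i. norm (c i *\<^sub>R hat (u r) (enum i)) - norm (c i *\<^sub>R hat (u t) (enum i))\<bar>"
        using suminf_diff[OF sm[OF r(1)] sm[OF t]] by simp
      also have "\<dots> \<le> (\<Sum>i. \<bar>norm (c i *\<^sub>R hat (u r) (enum i)) - norm (c i *\<^sub>R hat (u t) (enum i))\<bar>)"
        by (rule summable_rabs[OF sd])
      also have "\<dots> \<le> (\<Sum>i. norm (c i *\<^sub>R hat (u r) (enum i) - c i *\<^sub>R hat (u t) (enum i)))"
        by (rule suminf_le[OF norm_triangle_ineq3 sd dr(1)])
      finally show "dist (?S r) (?S t) < e" using dr(2) by (simp add: dist_real_def)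
    qed
  qed
  then have "bounded (?S ` {0..T})"
    by (intro compact_imp_bounded compact_continuous_image compact_Icc)
  from this[unfolded bounded_pos] obtain M where "0 < M \<and> (\<forall>y\<in>?S ` {0..T}. norm y \<le> M)" ..
  note M = this[THEN conjunct1] this[THEN conjunct2, rule_format]
  show ?thesis
  proof (rule that[of M])
    show "?S t \<le> M" if "t \<in> {0..T}" for t
      using M(2)[OF imageI[OF that]] unfolding real_norm_def by (rule abs_le_D1)
    show "0 \<le> M" using M(1) by (rule less_imp_le)
  qed
qed

lemma CP_rep:
  assumes "C_sob T m u" "2 \<le> m" shows "CP T (\<lambda>t. rep (u t))"
  using CP_tser[OF assms(1), of 0 "\<lambda>_. 1" enum] assms(2) by (simp add: rep_def[abs_def])

lemma CP_rep1:
  assumes "C_sob T m u" "3 \<le> m" shows "CP T (\<lambda>t. rep1 j (u t))"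
  unfolding rep1_def by (rule CP_tser[OF assms(1) _ kpow1]) (use assms(2) in simp)

lemma CP_rep2:
  assumes "C_sob T m u" "4 \<le> m" shows "CP T (\<lambda>t. rep2 i j (u t))"
  unfolding rep2_def by (rule CP_tser[OF assms(1) _ kpow2]) (use assms(2) in \<open>simp add: mi_order_add\<close>)

section \<open>Symmetric traceless matrices\<close>

lemma Sym0_iff: "A \<in> Sym0 \<longleftrightarrow> (\<forall>i j. A $ i $ j = A $ j $ i) \<and> (\<Sum>i\<in>UNIV. A $ i $ i) = 0"
  unfolding Sym0_def by (auto simp: transpose_def vec_eq_iff trace_def)

lemma subspace_Sym0: "subspace Sym0"
  unfolding subspace_def by (auto simp: Sym0_iff sum.distrib simp flip: sum_distrib_left)

lemma closed_Sym0: "closed Sym0" by (rule closed_subspace[OF subspace_Sym0])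

text \<open>The constraints are linear in the entries, so the coefficients inherit them; truncations
  of \<open>P\<close> thus become admissible test functions.\<close>

lemma hat_Sym0:
  assumes "L2 f" "AE x in torus. f x \<in> Sym0" shows "hat f k \<in> Sym0"
proof -
  have nth: "hat f k $ i $ j = hat (\<lambda>x. f x $ i $ j) k" for i j
    using assms(1) by (simp add: hat_nth)
  have "hat (\<lambda>x. f x $ i $ j) k = hat (\<lambda>x. f x $ j $ i) k" for i j
    by (rule hat_cong_AE) (use assms in \<open>auto simp: Sym0_iff elim!: eventually_mono\<close>)
  moreover have "(\<Sum>i\<in>UNIV. hat f k $ i $ i) = 0"
  proof -
    have "(\<Sum>i\<in>UNIV. hat f k $ i $ i) = hat (\<lambda>x. \<Sum>i\<in>UNIV. f x $ i $ i) k"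
      using assms(1) by (simp add: nth hat_sum)
    also have "\<dots> = hat (\<lambda>x. 0) k"
      by (rule hat_cong_AE) (use assms in \<open>auto simp: Sym0_iff elim!: eventually_mono\<close>)
    finally show ?thesis by (simp add: hat_def)
  qed
  ultimately show ?thesis by (auto simp: Sym0_iff nth)
qed

lemma tpoly_Sym0: "(\<And>i. a i \<in> Sym0) \<Longrightarrow> tpoly \<kappa> a n x \<in> Sym0"
  unfolding tpoly_def by (intro subspace_sum[OF subspace_Sym0] subspace_scale[OF subspace_Sym0])

lemma tser_Sym0:
  assumes "summable (\<lambda>i. norm (a i))" "\<And>i. a i \<in> Sym0" shows "tser \<kappa> a x \<in> Sym0"
proof (rule Lim_in_closed_set[OF closed_Sym0])
  show "(\<lambda>n. tpoly \<kappa> a n x) \<longlonglongrightarrow> tser \<kappa> a x"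
    unfolding tpoly_def tser_def using summable_LIMSEQ[OF summable_cas[OF assms(1)]] .
qed (use assms tpoly_Sym0 in \<open>auto intro!: always_eventually\<close>)

lemma rep_Sym0:
  assumes "sob m f" "2 \<le> m" "AE x in torus. f x \<in> Sym0" shows "rep f x \<in> Sym0"
  unfolding rep_def by (rule tser_Sym0[OF summable_rep[OF assms(1,2)]]) (rule hat_Sym0[OF sob_L2[OF assms(1)] assms(3)])

lemma rep1_Sym0:
  assumes "sob m f" "3 \<le> m" "AE x in torus. f x \<in> Sym0" shows "rep1 j f x \<in> Sym0"
  unfolding rep1_def
  by (rule tser_Sym0[OF summable_rep1[OF assms(1,2)]])
    (intro subspace_scale[OF subspace_Sym0] hat_Sym0[OF sob_L2[OF assms(1)] assms(3)])

lemma rep2_Sym0: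
  assumes "sob m f" "4 \<le> m" "AE x in torus. f x \<in> Sym0" shows "rep2 i j f x \<in> Sym0"
  unfolding rep2_def
  by (rule tser_Sym0[OF summable_rep2[OF assms(1,2)]])
    (intro subspace_scale[OF subspace_Sym0] hat_Sym0[OF sob_L2[OF assms(1)] assms(3)])

lemma Ck_on_continuous: "Ck_on k S f \<Longrightarrow> continuous_on S f"
proof (cases k)
  case (Suc n)
  assume "Ck_on k S f"
  then obtain f' where "\<forall>x\<in>S. (f has_derivative f' x) (at x within S)" using Suc by auto
  then show ?thesis by (intro has_derivative_continuous_on[of _ _ f']) auto
qed simp

lemma span_Sym0: "span {x - y | x y. x \<in> Sym0 \<and> y \<in> Sym0} = Sym0"
proof -
  have "{x - y | x y. x \<in> Sym0 \<and> y \<in> Sym0} = Sym0"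
  proof (intro set_eqI iffI)
    fix z assume "z \<in> Sym0"
    then show "z \<in> {x - y | x y. x \<in> Sym0 \<and> y \<in> Sym0}"
      using subspace_0[OF subspace_Sym0] by (intro CollectI exI[of _ z] exI[of _ 0]) simp
  qed (auto intro: subspace_diff[OF subspace_Sym0])
  then show ?thesis using span_eq_iff subspace_Sym0 by metis
qed

text \<open>Riesz representation in an orthonormal basis of \<open>Sym0\<close>. Two candidates in
  \<open>Sym0\<close> are separated by their own difference, which is an admissible direction;
  continuity comes from the directional derivatives along the basis, which \<open>Ck_on\<close>
  provides.\<close>

theorem grad_Sym0:
  assumes "Ck_on (Suc k) Sym0 F"
  shows "A \<in> Sym0 \<Longrightarrow> grad_Sym0 F A \<in> Sym0"
    and "A \<in> Sym0 \<Longrightarrow> (F has_derivative (\<lambda>H. grad_Sym0 F A \<bullet> H)) (at A within Sym0)"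
    and "continuous_on Sym0 (grad_Sym0 F)"
proof -
  obtain f' where f': "\<And>A. A \<in> Sym0 \<Longrightarrow> (F has_derivative f' A) (at A within Sym0)"
    and ck: "\<And>h. h \<in> Sym0 \<Longrightarrow> Ck_on k Sym0 (\<lambda>x. f' x h)"
    using assms unfolding Ck_on.simps span_Sym0 by auto
  obtain B :: "(real^3^3) set" where B: "B \<subseteq> Sym0" "pairwise orthogonal B" "\<And>b. b \<in> B \<Longrightarrow> norm b = 1"
    "independent B" "span B = Sym0"
    using orthonormal_basis_subspace[OF subspace_Sym0] by metis
  have fB: "finite B" using B(4) by (rule independent_imp_finite)
  define G where "G A = (\<Sum>b\<in>B. f' A b *\<^sub>R b)" for A
  have G_in: "G A \<in> Sym0" for A
    unfolding G_def using B(1) by (intro subspace_sum[OF subspace_Sym0] subspace_scale[OF subspace_Sym0]) auto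
  have G_inner: "G A \<bullet> H = f' A H" if A: "A \<in> Sym0" and H: "H \<in> Sym0" for A H
  proof -
    interpret L: bounded_linear "f' A" using has_derivative_bounded_linear[OF f'[OF A]] .
    have "(\<Sum>b\<in>B. (H \<bullet> b) *\<^sub>R b) = H"
      by (rule orthonormal_basis_expand[OF B(2,3) _ fB]) (use B(5) H in auto)
    then have "f' A H = f' A (\<Sum>b\<in>B. (H \<bullet> b) *\<^sub>R b)" by simp
    also have "\<dots> = (\<Sum>b\<in>B. (H \<bullet> b) * f' A b)" by (simp add: L.sum L.scaleR)
    finally show ?thesis by (simp add: G_def inner_sum_left inner_commute[of H] mult.commute)
  qed
  have G_der: "(F has_derivative (\<lambda>H. G A \<bullet> H)) (at A within Sym0)" if A: "A \<in> Sym0" for A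
    unfolding has_derivative_iff_norm
  proof (intro conjI bounded_linear_inner_right)
    have "((\<lambda>y. norm (F y - F A - f' A (y - A)) / norm (y - A)) \<longlongrightarrow> 0) (at A within Sym0)"
      using f'[OF A] unfolding has_derivative_iff_norm by blast
    moreover have "norm (F y - F A - f' A (y - A)) / norm (y - A) = norm (F y - F A - G A \<bullet> (y - A)) / norm (y - A)"
      if "y \<in> Sym0" for y
      using G_inner[OF A subspace_diff[OF subspace_Sym0 that A]] by simp
    ultimately show "((\<lambda>y. norm (F y - F A - G A \<bullet> (y - A)) / norm (y - A)) \<longlongrightarrow> 0) (at A within Sym0)"
      by (rule Lim_transform_within[OF _ zero_less_one]) auto
  qed
  have eq: "grad_Sym0 F A = G A" if A: "A \<in> Sym0" for A
    unfolding grad_Sym0_def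
  proof (rule the_equality)
    show "G A \<in> Sym0 \<and> (F has_derivative (\<lambda>H. G A \<bullet> H)) (at A within Sym0)"
      using G_in G_der[OF A] by simp
    fix G' assume G': "G' \<in> Sym0 \<and> (F has_derivative (\<lambda>H. G' \<bullet> H)) (at A within Sym0)"
    let ?H = "G' - G A"
    have H: "?H \<in> Sym0" using G' G_in by (intro subspace_diff[OF subspace_Sym0]) auto
    have *: "((\<lambda>s. F (A + s *\<^sub>R ?H)) has_real_derivative K \<bullet> ?H) (at 0)"
      if K: "(F has_derivative (\<lambda>H. K \<bullet> H)) (at A within Sym0)" for K
    proof -
      have "((\<lambda>s. A + s *\<^sub>R ?H) has_derivative (\<lambda>s. s *\<^sub>R ?H)) (at 0)"
        by (auto intro!: derivative_eq_intros)
      moreover have "(F has_derivative (\<lambda>H. K \<bullet> H)) (at (A + 0 *\<^sub>R ?H) within range (\<lambda>s. A + s *\<^sub>R ?H))"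
      proof -
        have "range (\<lambda>s. A + s *\<^sub>R ?H) \<subseteq> Sym0"
          using A H by (auto intro!: subspace_add[OF subspace_Sym0] subspace_scale[OF subspace_Sym0])
        then show ?thesis using has_derivative_subset[OF K] by simp
      qed
      ultimately have "((\<lambda>s. F (A + s *\<^sub>R ?H)) has_derivative (\<lambda>s. K \<bullet> (s *\<^sub>R ?H))) (at 0)"
        by (rule has_derivative_in_compose)
      then show ?thesis by (simp add: has_field_derivative_def mult.commute[of _ "K \<bullet> ?H"])
    qed
    have "G' \<bullet> ?H = G A \<bullet> ?H"
      using DERIV_unique[OF *[of G'] *[OF G_der[OF A]]] G' by blast
    then have "?H \<bullet> ?H = 0" by (simp add: inner_diff_left)
    then show "G' = G A" by simp
  qed
  show "A \<in> Sym0 \<Longrightarrow> grad_Sym0 F A \<in> Sym0" using eq G_in by simp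
  show "A \<in> Sym0 \<Longrightarrow> (F has_derivative (\<lambda>H. grad_Sym0 F A \<bullet> H)) (at A within Sym0)" using eq G_der by simp
  have "continuous_on Sym0 G"
    unfolding G_def using ck B(1) by (intro continuous_intros Ck_on_continuous) auto
  then show "continuous_on Sym0 (grad_Sym0 F)" using eq by (simp cong: continuous_on_cong)
qed

lemma segment_derivative_Sym0:
  assumes F: "Ck_on (Suc k) Sym0 F" and A: "A \<in> Sym0" and H: "H \<in> Sym0"
  shows "((\<lambda>s. F (A + s *\<^sub>R H)) has_real_derivative grad_Sym0 F (A + s *\<^sub>R H) \<bullet> H) (at s)"
proof -
  have "((\<lambda>s. A + s *\<^sub>R H) has_derivative (\<lambda>s. s *\<^sub>R H)) (at s)"
    by (auto intro!: derivative_eq_intros)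
  moreover have in_S: "A + r *\<^sub>R H \<in> Sym0" for r
    using A H by (auto intro!: subspace_add[OF subspace_Sym0] subspace_scale[OF subspace_Sym0])
  have "(F has_derivative (\<lambda>K. grad_Sym0 F (A + s *\<^sub>R H) \<bullet> K)) (at (A + s *\<^sub>R H) within range (\<lambda>s. A + s *\<^sub>R H))"
    by (rule has_derivative_subset[OF grad_Sym0(2)[OF F in_S]]) (use in_S in auto)
  ultimately have "((\<lambda>s. F (A + s *\<^sub>R H)) has_derivative (\<lambda>r. grad_Sym0 F (A + s *\<^sub>R H) \<bullet> (r *\<^sub>R H))) (at s)"
    by (rule has_derivative_in_compose)
  then show ?thesis by (simp add: has_field_derivative_def mult.commute[of _ "grad_Sym0 F (A + s *\<^sub>R H) \<bullet> H"])
qed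

text \<open>Mean value theorem along the segment, which stays in the compact convex set
  \<open>Sym0 \<inter> cball 0 M\<close>, where the gradient is uniformly continuous.\<close>

lemma uniform_Taylor_Sym0:
  assumes F: "Ck_on (Suc k) Sym0 F" and e: "e > 0"
  obtains d where "d > 0" "\<And>A B. A \<in> Sym0 \<Longrightarrow> B \<in> Sym0 \<Longrightarrow> norm A \<le> M \<Longrightarrow> norm B \<le> M \<Longrightarrow> norm (B - A) < d \<Longrightarrow>
     \<bar>F B - F A - grad_Sym0 F A \<bullet> (B - A)\<bar> \<le> e * norm (B - A)"
proof -
  let ?K = "Sym0 \<inter> cball 0 M" and ?G = "grad_Sym0 F"
  have "compact ?K" by (intro closed_Int_compact closed_Sym0 compact_cball)
  moreover have "continuous_on ?K ?G" by (rule continuous_on_subset[OF grad_Sym0(3)[OF F]]) simp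
  ultimately have "uniformly_continuous_on ?K ?G" by (intro compact_uniformly_continuous)
  then obtain d where d: "d > 0" "\<And>x y. x \<in> ?K \<Longrightarrow> y \<in> ?K \<Longrightarrow> dist y x < d \<Longrightarrow> dist (?G y) (?G x) < e"
    using e unfolding uniformly_continuous_on_def by metis
  have conv: "convex ?K" by (intro convex_Int convex_cball subspace_imp_convex subspace_Sym0)
  show ?thesis
  proof (rule that[OF d(1)])
    fix A B :: "real^3^3"
    assume AB: "A \<in> Sym0" "B \<in> Sym0" "norm A \<le> M" "norm B \<le> M" "norm (B - A) < d"
    let ?H = "B - A"
    have H: "?H \<in> Sym0" by (intro subspace_diff[OF subspace_Sym0] AB)
    define \<phi> where "\<phi> s = F (A + s *\<^sub>R ?H) - s * (?G A \<bullet> ?H)" for s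
    have der: "(\<phi> has_real_derivative (?G (A + s *\<^sub>R ?H) - ?G A) \<bullet> ?H) (at s)" for s
      unfolding \<phi>_def using segment_derivative_Sym0[OF F AB(1) H, of s]
      by (auto intro!: derivative_eq_intros simp: inner_diff_left)
    obtain s where s: "0 < s" "s < 1" "\<phi> 1 - \<phi> 0 = (1 - 0) * ((?G (A + s *\<^sub>R ?H) - ?G A) \<bullet> ?H)"
      using MVT2[of 0 1 \<phi> "\<lambda>s. (?G (A + s *\<^sub>R ?H) - ?G A) \<bullet> ?H"] der by auto
    have "A + s *\<^sub>R ?H = (1 - s) *\<^sub>R A + s *\<^sub>R B" by (simp add: algebra_simps)
    then have in_K: "A + s *\<^sub>R ?H \<in> ?K"
      using conv AB s by (auto simp: convex_alt intro: less_imp_le)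
    have "dist (A + s *\<^sub>R ?H) A = s * norm ?H" using s by (simp add: dist_norm)
    also have "\<dots> \<le> 1 * norm ?H" using s by (intro mult_right_mono) auto
    finally have "dist (A + s *\<^sub>R ?H) A < d" using AB(5) by simp
    then have "norm (?G (A + s *\<^sub>R ?H) - ?G A) < e"
      using d(2)[of A "A + s *\<^sub>R ?H"] in_K AB by (simp add: dist_norm)
    have "F B - F A - ?G A \<bullet> ?H = \<phi> 1 - \<phi> 0" by (simp add: \<phi>_def)
    also have "\<dots> = (?G (A + s *\<^sub>R ?H) - ?G A) \<bullet> ?H" using s by simp
    finally have "\<bar>F B - F A - ?G A \<bullet> ?H\<bar> \<le> norm (?G (A + s *\<^sub>R ?H) - ?G A) * norm ?H"
      by (simp add: Cauchy_Schwarz_ineq2)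
    also have "\<dots> \<le> e * norm ?H"
      using \<open>norm (?G (A + s *\<^sub>R ?H) - ?G A) < e\<close> by (intro mult_right_mono) auto
    finally show "\<bar>F B - F A - ?G A \<bullet> ?H\<bar> \<le> e * norm ?H" .
  qed
qed

section \<open>Signed measures on the cell\<close>

lemma sigma_algebra_cell: "sigma_algebra cell cell_sets"
proof -
  have "sigma_algebra (space (restrict_space borel cell)) cell_sets"
    unfolding cell_sets_def by (rule sets.sigma_algebra_axioms)
  then show ?thesis by (simp add: space_restrict_space)
qed

interpretation cs: sigma_algebra cell cell_sets by (rule sigma_algebra_cell)

lemma tensor_measure_empty:
  assumes "tensor_measure \<mu>" shows "\<mu> {} = 0"
proof -
  have "(\<lambda>n::nat. \<mu> {}) sums \<mu> (\<Union>n::nat. {})"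
    using assms[unfolded tensor_measure_def, rule_format, of "\<lambda>_. {}"] by (auto simp: disjoint_family_on_def)
  then have "(\<lambda>n::nat. \<mu> {}) \<longlonglongrightarrow> 0" using sums_summable summable_LIMSEQ_zero by blast
  then show ?thesis by (simp add: LIMSEQ_const_iff)
qed

lemma tensor_measure_Un:
  assumes \<mu>: "tensor_measure \<mu>" and A: "A \<in> cell_sets" and B: "B \<in> cell_sets" and "A \<inter> B = {}"
  shows "\<mu> (A \<union> B) = \<mu> A + \<mu> B"
proof -
  have r: "range (binaryset A B) \<subseteq> cell_sets" using A B by (auto simp: range_binaryset_eq)
  have d: "disjoint_family (binaryset A B)" using assms(4) by (auto simp: disjoint_family_on_def binaryset_def)
  have "(\<lambda>n. \<mu> (binaryset A B n)) sums \<mu> (\<Union>n. binaryset A B n)"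
    by (rule \<mu>[unfolded tensor_measure_def, rule_format, OF conjI[OF r d]])
  moreover have "(\<lambda>n. \<mu> (binaryset A B n)) sums (\<Sum>n\<in>{0, 1}. \<mu> (binaryset A B n))"
    by (rule sums_finite) (auto simp: binaryset_def tensor_measure_empty[OF \<mu>])
  ultimately show ?thesis using sums_unique2 by (fastforce simp: UN_binaryset_eq binaryset_def)
qed

lemma tensor_measure_inner:
  assumes "tensor_measure \<mu>" shows "tensor_measure (\<lambda>A. \<mu> A \<bullet> b)"
  unfolding tensor_measure_def
  by (intro allI impI bounded_linear.sums[OF bounded_linear_inner_left] assms[unfolded tensor_measure_def, rule_format])

lemma tensor_measure_uminus:
  fixes \<nu> :: "(real^3) set \<Rightarrow> real"
  assumes "tensor_measure \<nu>" shows "tensor_measure (\<lambda>A. - \<nu> A)"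
  unfolding tensor_measure_def
  by (intro allI impI sums_minus assms[unfolded tensor_measure_def, rule_format])

lemma ennreal_add_le: "ennreal (a + b) \<le> ennreal a + ennreal b"
proof -
  have "ennreal (a + b) \<le> ennreal (max 0 a + max 0 b)" by (rule ennreal_leI) auto
  also have "\<dots> = ennreal (max 0 a) + ennreal (max 0 b)" by (rule ennreal_plus) auto
  also have "\<dots> = ennreal a + ennreal b"
  proof -
    have "ennreal (max 0 c) = ennreal c" for c
      by (cases "0 \<le> c") (simp_all add: max_def ennreal_neg)
    then show ?thesis by simp
  qed
  finally show ?thesis .
qed

lemma ennreal_sum_le: "ennreal (\<Sum>i<n. x i) \<le> (\<Sum>i<n::nat. ennreal (x i))"
proof (induction n)
  case (Suc n)
  have "ennreal (\<Sum>i<Suc n. x i) \<le> ennreal (\<Sum>i<n. x i) + ennreal (x n)"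
    using ennreal_add_le by simp
  also have "\<dots> \<le> (\<Sum>i<n. ennreal (x i)) + ennreal (x n)" by (rule add_right_mono[OF Suc])
  finally show ?case by simp
qed simp

text \<open>The set function inside \<open>upper_variation\<close>, named separately because it has
  to be shown countably additive before \<open>emeasure\<close> of that measure is known.\<close>

definition uvar :: "((real^3) set \<Rightarrow> real) \<Rightarrow> (real^3) set \<Rightarrow> ennreal" where
  "uvar \<nu> A = (SUP B\<in>{B \<in> cell_sets. B \<subseteq> A}. ennreal (\<nu> B))"

lemma uvar_upper: "B \<in> cell_sets \<Longrightarrow> B \<subseteq> A \<Longrightarrow> ennreal (\<nu> B) \<le> uvar \<nu> A"
  unfolding uvar_def by (rule SUP_upper) simp

lemma uvar_least: "(\<And>B. B \<in> cell_sets \<Longrightarrow> B \<subseteq> A \<Longrightarrow> ennreal (\<nu> B) \<le> c) \<Longrightarrow> uvar \<nu> A \<le> c"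
  unfolding uvar_def by (rule SUP_least) simp

lemma uvar_mono: "A \<subseteq> B \<Longrightarrow> uvar \<nu> A \<le> uvar \<nu> B"
  by (rule uvar_least) (auto intro: uvar_upper)

lemma uvar_superadd:
  assumes \<nu>: "tensor_measure \<nu>" and AB: "A \<inter> B = {}"
  shows "uvar \<nu> A + uvar \<nu> B \<le> uvar \<nu> (A \<union> B)"
proof -
  have ne: "{B \<in> cell_sets. B \<subseteq> X} \<noteq> {}" for X by auto
  have "ennreal (\<nu> C) + ennreal (\<nu> D) \<le> uvar \<nu> (A \<union> B)"
    if C: "C \<in> cell_sets" "C \<subseteq> A" and D: "D \<in> cell_sets" "D \<subseteq> B" for C D
  proof -
    \<comment> \<open>Where the signed measure is negative the empty set is used instead;
      \<open>ennreal\<close> truncates such values to 0 anyway and is additive on nonnegative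
      ones.\<close>
    define C' where "C' = (if \<nu> C \<ge> 0 then C else {})"
    define D' where "D' = (if \<nu> D \<ge> 0 then D else {})"
    have C': "C' \<in> cell_sets" "C' \<subseteq> A" "0 \<le> \<nu> C'" "ennreal (\<nu> C) = ennreal (\<nu> C')"
      using C by (auto simp: C'_def tensor_measure_empty[OF \<nu>] ennreal_neg)
    have D': "D' \<in> cell_sets" "D' \<subseteq> B" "0 \<le> \<nu> D'" "ennreal (\<nu> D) = ennreal (\<nu> D')"
      using D by (auto simp: D'_def tensor_measure_empty[OF \<nu>] ennreal_neg)
    have dis: "C' \<inter> D' = {}" using AB C'(2) D'(2) by blast
    have "ennreal (\<nu> C) + ennreal (\<nu> D) = ennreal (\<nu> C' + \<nu> D')"
      using C'(3,4) D'(3,4) by simp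
    also have "\<dots> = ennreal (\<nu> (C' \<union> D'))"
      by (simp add: tensor_measure_Un[OF \<nu> C'(1) D'(1) dis])
    also have "\<dots> \<le> uvar \<nu> (A \<union> B)" using C' D' by (intro uvar_upper) auto
    finally show ?thesis .
  qed
  then have "(SUP C\<in>{C \<in> cell_sets. C \<subseteq> A}. ennreal (\<nu> C) + ennreal (\<nu> D)) \<le> uvar \<nu> (A \<union> B)"
    if "D \<in> cell_sets" "D \<subseteq> B" for D
    using that by (intro SUP_least) auto
  then have *: "uvar \<nu> A + ennreal (\<nu> D) \<le> uvar \<nu> (A \<union> B)" if "D \<in> cell_sets" "D \<subseteq> B" for D
    using that unfolding uvar_def[of _ A] by (simp add: ennreal_SUP_add_left[OF ne])
  have "(SUP D\<in>{D \<in> cell_sets. D \<subseteq> B}. uvar \<nu> A + ennreal (\<nu> D)) \<le> uvar \<nu> (A \<union> B)"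
    using * by (intro SUP_least) auto
  then show ?thesis unfolding uvar_def[of _ B] by (simp add: ennreal_SUP_add_right[OF ne])
qed

text \<open>One inequality is superadditivity on finite unions. For the other, a competitor
  \<open>B\<close> is cut along the sets \<open>A n\<close>, and countable additivity of the signed
  measure is applied to the pieces.\<close>

lemma uvar_countably_additive:
  assumes \<nu>: "tensor_measure \<nu>" shows "countably_additive cell_sets (uvar \<nu>)"
proof (rule countably_additiveI)
  fix A :: "nat \<Rightarrow> (real^3) set"
  assume A: "range A \<subseteq> cell_sets" "disjoint_family A"
  show "(\<Sum>n. uvar \<nu> (A n)) = uvar \<nu> (\<Union>n. A n)"
  proof (rule antisym)
    have fin: "(\<Sum>i<n. uvar \<nu> (A i)) \<le> uvar \<nu> (\<Union>i<n. A i)" for n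
    proof (induction n)
      case (Suc n)
      have "A i \<inter> A n = {}" if "i < n" for i
        using that by (intro disjoint_family_onD[OF A(2)]) auto
      then have dis: "(\<Union>i<n. A i) \<inter> A n = {}" by blast
      have "(\<Sum>i<Suc n. uvar \<nu> (A i)) \<le> uvar \<nu> (\<Union>i<n. A i) + uvar \<nu> (A n)"
        using add_right_mono[OF Suc] by simp
      also have "\<dots> \<le> uvar \<nu> ((\<Union>i<n. A i) \<union> A n)" by (rule uvar_superadd[OF \<nu> dis])
      also have "(\<Union>i<n. A i) \<union> A n = (\<Union>i<Suc n. A i)" by (auto simp: less_Suc_eq)
      finally show ?case .
    qed simp
    have "(\<Sum>i<n. uvar \<nu> (A i)) \<le> uvar \<nu> (\<Union>n. A n)" for n
      by (rule order_trans[OF fin uvar_mono]) auto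
    then show "(\<Sum>n. uvar \<nu> (A n)) \<le> uvar \<nu> (\<Union>n. A n)" by (rule suminf_le_const[OF summableI])
  next
    show "uvar \<nu> (\<Union>n. A n) \<le> (\<Sum>n. uvar \<nu> (A n))"
    proof (rule uvar_least)
      fix B assume B: "B \<in> cell_sets" "B \<subseteq> (\<Union>n. A n)"
      have r: "range (\<lambda>n. B \<inter> A n) \<subseteq> cell_sets" using A(1) B(1) by auto
      have d: "disjoint_family (\<lambda>n. B \<inter> A n)" using A(2) by (auto simp: disjoint_family_on_def)
      have u: "(\<Union>n. B \<inter> A n) = B" using B(2) by auto
      have "(\<lambda>n. \<nu> (B \<inter> A n)) sums \<nu> (\<Union>n. B \<inter> A n)"
        by (rule \<nu>[unfolded tensor_measure_def, rule_format, OF conjI[OF r d]])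
      then have "(\<lambda>n. ennreal (\<Sum>i<n. \<nu> (B \<inter> A i))) \<longlonglongrightarrow> ennreal (\<nu> B)"
        unfolding u sums_def by (rule tendsto_ennrealI)
      moreover have "ennreal (\<Sum>i<n. \<nu> (B \<inter> A i)) \<le> (\<Sum>n. uvar \<nu> (A n))" for n
      proof -
        have "ennreal (\<Sum>i<n. \<nu> (B \<inter> A i)) \<le> (\<Sum>i<n. ennreal (\<nu> (B \<inter> A i)))" by (rule ennreal_sum_le)
        also have "\<dots> \<le> (\<Sum>i<n. uvar \<nu> (A i))" using r by (intro sum_mono uvar_upper) auto
        also have "\<dots> \<le> (\<Sum>n. uvar \<nu> (A n))" by (rule sum_le_suminf) auto
        finally show ?thesis .
      qed
      ultimately show "ennreal (\<nu> B) \<le> (\<Sum>n. uvar \<nu> (A n))"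
        by (intro LIMSEQ_le_const2) auto
    qed
  qed
qed

lemma sets_upper_variation [simp]: "sets (upper_variation \<nu>) = cell_sets"
  unfolding upper_variation_def using cs.space_closed cs.sigma_sets_eq by (simp add: sets_measure_of)

lemma space_upper_variation [simp]: "space (upper_variation \<nu>) = cell"
  unfolding upper_variation_def using cs.space_closed by (simp add: space_measure_of)

lemma emeasure_upper_variation:
  assumes \<nu>: "tensor_measure \<nu>" and A: "A \<in> cell_sets"
  shows "emeasure (upper_variation \<nu>) A = uvar \<nu> A"
proof -
  have "positive cell_sets (uvar \<nu>)"
  proof -
    have "uvar \<nu> {} \<le> 0" by (rule uvar_least) (auto simp: tensor_measure_empty[OF \<nu>])
    then show ?thesis by (simp add: positive_def)
  qed
  then show ?thesis
    unfolding upper_variation_def uvar_def[symmetric]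
    by (rule emeasure_measure_of_sigma[OF sigma_algebra_cell _ uvar_countably_additive[OF \<nu>] A])
qed

lemma norm_le_tv_norm:
  assumes "B \<in> cell_sets" shows "ennreal (norm (\<mu> B)) \<le> tv_norm \<mu>"
proof -
  let ?P = "{B, cell - B}"
  have sub: "B \<subseteq> cell" using assms by (simp add: cell_sets_iff)
  have P: "finite ?P" "?P \<subseteq> cell_sets" "disjoint ?P" "\<Union>?P = cell"
    using assms sub by (auto simp: disjoint_def)
  have "ennreal (norm (\<mu> B)) \<le> (\<Sum>A\<in>?P. ennreal (norm (\<mu> A)))"
    by (rule member_le_sum) auto
  also have "\<dots> \<le> tv_norm \<mu>"
    unfolding tv_norm_def by (rule SUP_upper) (use P in simp)
  finally show ?thesis .
qed

lemma uvar_inner_le_tv_norm: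
  assumes "b \<in> Basis" shows "uvar (\<lambda>A. \<mu> A \<bullet> b) X \<le> tv_norm \<mu>" "uvar (\<lambda>A. - (\<mu> A \<bullet> b)) X \<le> tv_norm \<mu>"
proof -
  have le: "\<bar>\<mu> B \<bullet> b\<bar> \<le> norm (\<mu> B)" for B by (rule Basis_le_norm[OF assms])
  show "uvar (\<lambda>A. \<mu> A \<bullet> b) X \<le> tv_norm \<mu>"
  proof (rule uvar_least)
    fix B assume "B \<in> cell_sets"
    have "ennreal (\<mu> B \<bullet> b) \<le> ennreal (norm (\<mu> B))" using le[of B] by (intro ennreal_leI) linarith
    then show "ennreal (\<mu> B \<bullet> b) \<le> tv_norm \<mu>" using norm_le_tv_norm[OF \<open>B \<in> cell_sets\<close>] by (rule order_trans)
  qed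
  show "uvar (\<lambda>A. - (\<mu> A \<bullet> b)) X \<le> tv_norm \<mu>"
  proof (rule uvar_least)
    fix B assume "B \<in> cell_sets"
    have "ennreal (- (\<mu> B \<bullet> b)) \<le> ennreal (norm (\<mu> B))" using le[of B] by (intro ennreal_leI) linarith
    then show "ennreal (- (\<mu> B \<bullet> b)) \<le> tv_norm \<mu>" using norm_le_tv_norm[OF \<open>B \<in> cell_sets\<close>] by (rule order_trans)
  qed
qed

lemma cell_measure_upper_variation:
  assumes "tensor_measure \<nu>" "uvar \<nu> cell < \<infinity>" shows "cell_measure (upper_variation \<nu>)"
proof (intro cell_measure.intro finite_measureI cell_measure_axioms.intro)
  show "emeasure (upper_variation \<nu>) (space (upper_variation \<nu>)) \<noteq> \<infinity>"
    using assms(2) emeasure_upper_variation[OF assms(1), of cell] cs.top by simp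
qed simp

text \<open>A Hahn decomposition is avoided: for \<open>B\<close> inside \<open>A\<close> the value
  on \<open>B\<close> is the value on \<open>A\<close> minus that on \<open>A - B\<close>, and
  taking the supremum over \<open>B\<close> bounds the upper variation of \<nu> by that of its
  negative plus \<open>\<nu> A\<close>. Applied to \<nu> and to its negative this is an
  equality.\<close>

lemma Jordan_difference:
  assumes \<nu>: "tensor_measure \<nu>" and fin: "uvar \<nu> cell < \<infinity>" "uvar (\<lambda>A. - \<nu> A) cell < \<infinity>" and A: "A \<in> cell_sets"
  shows "measure (upper_variation \<nu>) A - measure (upper_variation (\<lambda>A. - \<nu> A)) A = \<nu> A"
proof -
  have half: "measure (upper_variation \<nu>) A \<le> measure (upper_variation (\<lambda>A. - \<nu> A)) A + \<nu> A"
    if \<nu>: "tensor_measure \<nu>" and fin: "uvar \<nu> cell < \<infinity>" "uvar (\<lambda>A. - \<nu> A) cell < \<infinity>" for \<nu>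
  proof -
    note m\<nu> = tensor_measure_uminus[OF \<nu>]
    interpret P: cell_measure "upper_variation \<nu>" by (rule cell_measure_upper_variation[OF \<nu> fin(1)])
    interpret N: cell_measure "upper_variation (\<lambda>A. - \<nu> A)" by (rule cell_measure_upper_variation[OF m\<nu> fin(2)])
    let ?N = "measure (upper_variation (\<lambda>A. - \<nu> A)) A"
    have N: "- \<nu> B \<le> ?N" if "B \<in> cell_sets" "B \<subseteq> A" for B
    proof -
      have "ennreal (- \<nu> B) \<le> uvar (\<lambda>A. - \<nu> A) A" using uvar_upper[OF that, of "\<lambda>A. - \<nu> A"] .
      also have "\<dots> = ennreal ?N" using emeasure_upper_variation[OF m\<nu> A] N.emeasure_eq_measure by simp
      finally show ?thesis by (cases "- \<nu> B \<le> 0") (auto simp: ennreal_le_iff intro: order_trans[OF _ measure_nonneg])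
    qed
    have "uvar \<nu> A \<le> ennreal (?N + \<nu> A)"
    proof (rule uvar_least)
      fix B assume B: "B \<in> cell_sets" "B \<subseteq> A"
      have "\<nu> A = \<nu> B + \<nu> (A - B)"
        using tensor_measure_Un[OF \<nu> B(1), of "A - B"] B A by (auto simp: Un_absorb1)
      moreover have "- \<nu> (A - B) \<le> ?N" using A B by (intro N) auto
      ultimately show "ennreal (\<nu> B) \<le> ennreal (?N + \<nu> A)" by (intro ennreal_leI) linarith
    qed
    moreover have "uvar \<nu> A = ennreal (measure (upper_variation \<nu>) A)"
      using emeasure_upper_variation[OF \<nu> A] P.emeasure_eq_measure by simp
    moreover have "0 \<le> ?N + \<nu> A" using N[OF A] by simp
    ultimately show ?thesis by (simp add: ennreal_le_iff)
  qed
  have "measure (upper_variation (\<lambda>A. - \<nu> A)) A \<le> measure (upper_variation (\<lambda>A. - (- \<nu> A))) A + - \<nu> A"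
    using half[OF tensor_measure_uminus[OF \<nu>] fin(2)] fin(1) by simp
  then show ?thesis using half[OF \<nu> fin] by simp
qed

lemma cell_measure_integral_le:
  fixes f :: "real^3 \<Rightarrow> real"
  assumes M: "cell_measure M" and f: "continuous_on UNIV f" "\<And>x. x \<in> cell \<Longrightarrow> \<bar>f x\<bar> \<le> S"
  shows "\<bar>\<integral>x. f x \<partial>M\<bar> \<le> S * measure M cell"
proof -
  interpret cell_measure M by fact
  have "\<bar>\<integral>x. f x \<partial>M\<bar> \<le> (\<integral>x. \<bar>f x\<bar> \<partial>M)" by (rule integral_abs_bound)
  also have "\<dots> \<le> (\<integral>x. S \<partial>M)"
    by (intro integral_mono continuous_integrable continuous_intros f) (auto simp: space_M f)
  finally show ?thesis by (simp add: space_M mult.commute)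
qed

text \<open>Each component contributes two variations, both of mass at most
  \<open>tv_norm \<mu>\<close>; hence twice the dimension.\<close>

lemma pairing_bound:
  fixes \<mu> :: "(real^3) set \<Rightarrow> 'b::euclidean_space"
  assumes \<mu>: "tensor_measure \<mu>" and fin: "tv_norm \<mu> < \<infinity>"
    and f: "continuous_on UNIV f" "\<And>x. x \<in> cell \<Longrightarrow> norm (f x) \<le> S"
  shows "\<bar>pairing \<mu> f\<bar> \<le> 2 * real DIM('b) * S * enn2real (tv_norm \<mu>)"
proof -
  let ?t = "enn2real (tv_norm \<mu>)"
  have t: "tv_norm \<mu> = ennreal ?t" using fin by (simp add: less_top)
  have "0 \<in> cell" by (auto simp: cell_def)
  then have S0: "0 \<le> S" using f(2)[of 0] norm_ge_zero order_trans by blast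
  have *: "\<bar>\<integral>x. f x \<bullet> b \<partial>upper_variation \<nu>\<bar> \<le> S * ?t"
    if b: "b \<in> Basis" and \<nu>: "tensor_measure \<nu>" and le: "uvar \<nu> cell \<le> tv_norm \<mu>" for b \<nu>
  proof -
    have cm: "cell_measure (upper_variation \<nu>)"
      by (rule cell_measure_upper_variation[OF \<nu> le_less_trans[OF le fin]])
    interpret cell_measure "upper_variation \<nu>" by (rule cm)
    have bnd: "\<bar>f x \<bullet> b\<bar> \<le> S" if "x \<in> cell" for x
      using Basis_le_norm[OF b, of "f x"] f(2)[OF that] by linarith
    have "ennreal (measure (upper_variation \<nu>) cell) \<le> ennreal ?t"
      using emeasure_upper_variation[OF \<nu>, of cell] cs.top le t emeasure_eq_measure[of cell] by simp
    then have m: "measure (upper_variation \<nu>) cell \<le> ?t" by (simp add: ennreal_le_iff)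
    have "\<bar>\<integral>x. f x \<bullet> b \<partial>upper_variation \<nu>\<bar> \<le> S * measure (upper_variation \<nu>) cell"
      by (rule cell_measure_integral_le[OF cm _ bnd]) (intro continuous_intros f(1))
    also have "\<dots> \<le> S * ?t" by (rule mult_left_mono[OF m S0])
    finally show ?thesis .
  qed
  have "\<bar>pairing \<mu> f\<bar> \<le> (\<Sum>b\<in>(Basis::'b set). \<bar>signed_integral (\<lambda>A. \<mu> A \<bullet> b) (\<lambda>x. f x \<bullet> b)\<bar>)"
    unfolding pairing_def by (rule sum_abs)
  also have "\<dots> \<le> (\<Sum>b\<in>(Basis::'b set). 2 * (S * ?t))"
  proof (rule sum_mono)
    fix b :: 'b assume b: "b \<in> Basis"
    note \<nu> = tensor_measure_inner[OF \<mu>, of b]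
    show "\<bar>signed_integral (\<lambda>A. \<mu> A \<bullet> b) (\<lambda>x. f x \<bullet> b)\<bar> \<le> 2 * (S * ?t)"
      using *[OF b \<nu> uvar_inner_le_tv_norm(1)[OF b]] *[OF b tensor_measure_uminus[OF \<nu>] uvar_inner_le_tv_norm(2)[OF b]]
      unfolding signed_integral_def by linarith
  qed
  also have "\<dots> = 2 * real DIM('b) * S * ?t" by simp
  finally show ?thesis .
qed

text \<open>Vanishing pairings make the upper variations of a component and of its negative agree on
  all Hartley functions, hence everywhere; the component is their difference.\<close>

lemma tensor_measure_zero:
  fixes \<mu> :: "(real^3) set \<Rightarrow> 'b::euclidean_space"
  assumes \<mu>: "tensor_measure \<mu>" and fin: "tv_norm \<mu> < \<infinity>"
    and zero: "\<And>k b. b \<in> Basis \<Longrightarrow> pairing \<mu> (\<lambda>x. cas k x *\<^sub>R b) = 0"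
    and A: "A \<in> cell_sets"
  shows "\<mu> A = 0"
proof (rule euclidean_eqI)
  fix b :: 'b assume b: "b \<in> Basis"
  let ?\<nu> = "\<lambda>A. \<mu> A \<bullet> b"
  note \<nu> = tensor_measure_inner[OF \<mu>, of b]
  note fin1 = le_less_trans[OF uvar_inner_le_tv_norm(1)[OF b] fin] and fin2 = le_less_trans[OF uvar_inner_le_tv_norm(2)[OF b] fin]
  have "upper_variation ?\<nu> = upper_variation (\<lambda>A. - ?\<nu> A)"
  proof (rule cell_measure_eqI[OF cell_measure_upper_variation[OF \<nu> fin1] cell_measure_upper_variation[OF tensor_measure_uminus[OF \<nu>] fin2]])
    fix k
    have "pairing \<mu> (\<lambda>x. cas k x *\<^sub>R b) = (\<Sum>b'\<in>Basis. if b' = b then signed_integral ?\<nu> (cas k) else 0)"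
      unfolding pairing_def
    proof (rule sum.cong[OF refl])
      fix b' :: 'b assume b': "b' \<in> Basis"
      show "signed_integral (\<lambda>A. \<mu> A \<bullet> b') (\<lambda>x. cas k x *\<^sub>R b \<bullet> b') = (if b' = b then signed_integral ?\<nu> (cas k) else 0)"
        using b b' by (simp add: inner_Basis signed_integral_def)
    qed
    also have "\<dots> = signed_integral ?\<nu> (cas k)" using b by simp
    finally show "(\<integral>x. cas k x \<partial>upper_variation ?\<nu>) = (\<integral>x. cas k x \<partial>upper_variation (\<lambda>A. - ?\<nu> A))"
      using zero[OF b, of k] by (simp add: signed_integral_def)
  qed
  then have "?\<nu> A = 0" using Jordan_difference[OF \<nu> fin1 fin2 A] by simp
  then show "\<mu> A \<bullet> b = 0 \<bullet> b" by simp
qed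

section \<open>Time integrals\<close>

text \<open>\<open>nn_integral\<close> is a supremum over simple functions below the integrand, that
  is, a lower integral when measurability is missing, and lower integrals are superadditive. It is
  applied to total variations of the defect measures, whose measurability in time is not part of
  \<open>Linf_measure\<close>.\<close>

lemma nn_integral_superadditive:
  "(\<integral>\<^sup>+x. f x \<partial>M) + (\<integral>\<^sup>+x. g x \<partial>M) \<le> (\<integral>\<^sup>+x. f x + g x \<partial>M)"
proof -
  let ?S = "\<lambda>f. {h. simple_function M h \<and> h \<le> f}"
  have ne: "?S f \<noteq> {}" for f :: "'a \<Rightarrow> ennreal"
  proof -
    have "(\<lambda>_. 0) \<in> ?S f" by (simp add: le_fun_def)
    then show ?thesis by blast
  qed
  have two: "integral\<^sup>S M u + integral\<^sup>S M w \<le> (\<integral>\<^sup>+x. f x + g x \<partial>M)" if "u \<in> ?S f" "w \<in> ?S g" for u w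
  proof -
    have s: "simple_function M u" "simple_function M w" using that by auto
    have "integral\<^sup>S M u + integral\<^sup>S M w = integral\<^sup>S M (\<lambda>x. u x + w x)"
      by (rule simple_integral_add[symmetric]) (use s in auto)
    also have "\<dots> = (\<integral>\<^sup>+x. u x + w x \<partial>M)"
      by (rule nn_integral_eq_simple_integral[symmetric]) (intro simple_function_add s)
    also have "\<dots> \<le> (\<integral>\<^sup>+x. f x + g x \<partial>M)"
      using that by (intro nn_integral_mono add_mono) (auto simp: le_fun_def)
    finally show ?thesis .
  qed
  have one: "(\<integral>\<^sup>+x. f x \<partial>M) + integral\<^sup>S M w \<le> (\<integral>\<^sup>+x. f x + g x \<partial>M)" if "w \<in> ?S g" for w
  proof -
    have "(SUP u\<in>?S f. integral\<^sup>S M u + integral\<^sup>S M w) \<le> (\<integral>\<^sup>+x. f x + g x \<partial>M)"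
      by (rule SUP_least) (rule two[OF _ that])
    then show ?thesis unfolding nn_integral_def[of M f] by (simp only: ennreal_SUP_add_left[OF ne])
  qed
  have "(SUP w\<in>?S g. (\<integral>\<^sup>+x. f x \<partial>M) + integral\<^sup>S M w) \<le> (\<integral>\<^sup>+x. f x + g x \<partial>M)"
    by (rule SUP_least) (rule one)
  then show ?thesis unfolding nn_integral_def[of M g] by (simp only: ennreal_SUP_add_right[OF ne])
qed

lemma AE_neq_real: "AE t in lebesgue. t \<noteq> (c::real)"
proof -
  have "{c} \<in> null_sets lebesgue" by (simp add: negligible_iff_null_sets[symmetric])
  from AE_not_in[OF this] show ?thesis by simp
qed

lemma nn_integral_interval_superadditive:
  fixes f :: "real \<Rightarrow> ennreal"
  assumes "a \<le> b" "b \<le> c"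
  shows "(\<integral>\<^sup>+t. f t \<partial>lebesgue_on {a..b}) + (\<integral>\<^sup>+t. f t \<partial>lebesgue_on {b..c}) \<le> (\<integral>\<^sup>+t. f t \<partial>lebesgue_on {a..c})"
proof -
  have r: "(\<integral>\<^sup>+t. f t \<partial>lebesgue_on {x..y}) = (\<integral>\<^sup>+t. f t * indicator {x..y} t \<partial>lebesgue)" for x y
    by (rule nn_integral_restrict_space) simp
  \<comment> \<open>Removing the common end point from the second interval makes the two indicators
    disjoint.\<close>
  have "(\<integral>\<^sup>+t. f t * indicator {b..c} t \<partial>lebesgue) = (\<integral>\<^sup>+t. f t * indicator {b<..c} t \<partial>lebesgue)"
    using AE_neq_real[of b] by (intro nn_integral_cong_AE) (auto elim!: eventually_mono simp: indicator_def)
  then have "(\<integral>\<^sup>+t. f t \<partial>lebesgue_on {a..b}) + (\<integral>\<^sup>+t. f t \<partial>lebesgue_on {b..c})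
      \<le> (\<integral>\<^sup>+t. f t * indicator {a..b} t + f t * indicator {b<..c} t \<partial>lebesgue)"
    unfolding r by (simp only: nn_integral_superadditive)
  also have "\<dots> = (\<integral>\<^sup>+t. f t * indicator {a..c} t \<partial>lebesgue)"
    using assms by (intro nn_integral_cong) (auto simp: indicator_def)
  finally show ?thesis unfolding r .
qed

text \<open>The end points of the time interval are null sets.\<close>

lemma AE_time_mono:
  assumes "AE t in lebesgue_on {0<..<T::real}. P t" "\<tau> \<le> T" "0 \<le> \<sigma>"
  shows "AE t in lebesgue_on {\<sigma>..\<tau>}. P t"
proof -
  have "AE t in lebesgue. t \<in> {0<..<T} \<longrightarrow> P t" using assms(1) by (simp add: AE_restrict_space_iff)
  moreover have "AE t in lebesgue. t \<noteq> (0::real)" "AE t in lebesgue. t \<noteq> T" by (rule AE_neq_real)+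
  ultimately have "AE t in lebesgue. t \<in> {\<sigma>..\<tau>} \<longrightarrow> P t"
    by eventually_elim (use assms in auto)
  then show ?thesis by (simp add: AE_restrict_space_iff)
qed

lemma AE_time_open:
  assumes "AE t in lebesgue_on {0..T::real}. P t" shows "AE t in lebesgue_on {0<..<T}. P t"
proof -
  have "AE t in lebesgue. t \<in> {0..T} \<longrightarrow> P t" using assms by (simp add: AE_restrict_space_iff)
  then have "AE t in lebesgue. t \<in> {0<..<T} \<longrightarrow> P t" by eventually_elim auto
  then show ?thesis by (simp add: AE_restrict_space_iff)
qed

lemma measurable_time_mono:
  fixes f :: "real \<Rightarrow> 'b::euclidean_space"
  assumes "f \<in> borel_measurable (lebesgue_on {0<..<T})" "\<tau> \<le> T" "0 \<le> \<sigma>"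
  shows "f \<in> borel_measurable (lebesgue_on {\<sigma>..\<tau>})"
proof -
  have "(\<lambda>t. if t \<in> {0<..<T} then f t else 0) \<in> borel_measurable lebesgue"
    using assms(1) by (subst borel_measurable_if) simp_all
  moreover have "AE t in lebesgue. t \<noteq> (0::real)" "AE t in lebesgue. t \<noteq> T" by (rule AE_neq_real)+
  then have "AE t in lebesgue. (if t \<in> {0<..<T} then f t else 0) = (if t \<in> {0..T} then f t else 0)"
    by eventually_elim auto
  ultimately have "(\<lambda>t. if t \<in> {0..T} then f t else 0) \<in> borel_measurable lebesgue"
    by (rule borel_measurable_AE)
  then have "f \<in> borel_measurable (lebesgue_on {0..T})" by (subst (asm) borel_measurable_if) simp_all
  then show ?thesis by (rule measurable_restrict_mono) (use assms in auto)
qed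

text \<open>On a uniform partition finer than the \<open>d\<close> of \<open>key\<close>,
  superadditivity collects the masses while the errors add up to \<open>e * \<tau>\<close>.\<close>

lemma partition_estimate:
  fixes f :: "real \<Rightarrow> real"
  assumes m0: "\<And>a b. 0 \<le> m a b"
    and super: "\<And>a b. 0 \<le> a \<Longrightarrow> a \<le> b \<Longrightarrow> b \<le> T \<Longrightarrow> m 0 a + m a b \<le> m 0 b"
    and key: "\<And>e. e > 0 \<Longrightarrow> \<exists>d>0. \<forall>a b. 0 \<le> a \<longrightarrow> a \<le> b \<longrightarrow> b \<le> T \<longrightarrow> b - a < d \<longrightarrow> f b - f a \<le> m a b + e * (b - a)"
    and \<tau>: "0 \<le> \<tau>" "\<tau> \<le> T"
  shows "f \<tau> - f 0 \<le> m 0 \<tau>"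
proof (rule field_le_epsilon)
  fix e' :: real assume e': "e' > 0"
  define e where "e = e' / (\<tau> + 1)"
  have e: "e > 0" using e' \<tau> by (simp add: e_def)
  from key[OF e] obtain d where d: "0 < d \<and> (\<forall>a b. 0 \<le> a \<longrightarrow> a \<le> b \<longrightarrow> b \<le> T \<longrightarrow> b - a < d \<longrightarrow> f b - f a \<le> m a b + e * (b - a))" ..
  obtain n :: nat where n: "\<tau> / d < real n" using reals_Archimedean2 by blast
  have n0: "0 < real n" using n \<tau> d by (smt (verit) divide_nonneg_pos)
  define h where "h = \<tau> / real n"
  have h: "0 \<le> h" "h < d" using n n0 \<tau> d by (auto simp: h_def field_simps)
  have nh: "real n * h = \<tau>" using n0 by (simp add: h_def)
  have ind: "i \<le> n \<Longrightarrow> f (real i * h) - f 0 \<le> m 0 (real i * h) + e * (real i * h)" for i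
  proof (induction i)
    case 0
    then show ?case using m0 by simp
  next
    case (Suc i)
    have "real (Suc i) * h \<le> real n * h" using Suc.prems h by (intro mult_right_mono) auto
    then have le: "real (Suc i) * h \<le> T" using nh \<tau> by simp
    have step: "real i * h \<le> real (Suc i) * h" "real (Suc i) * h - real i * h = h" "0 \<le> real i * h"
      using h by (auto simp: algebra_simps)
    have "f (real (Suc i) * h) - f (real i * h) \<le> m (real i * h) (real (Suc i) * h) + e * h"
      using d[THEN conjunct2, rule_format, OF step(3,1) le] step(2) h by simp
    moreover have "m 0 (real i * h) + m (real i * h) (real (Suc i) * h) \<le> m 0 (real (Suc i) * h)"
      by (rule super[OF step(3,1) le])
    moreover have "e * (real (Suc i) * h) = e * (real i * h) + e * h" by (simp add: algebra_simps)
    ultimately show ?case using Suc by linarith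
  qed
  have "f \<tau> - f 0 \<le> m 0 \<tau> + e * \<tau>" using ind[of n] nh by simp
  also have "e * \<tau> \<le> e'" using e' \<tau> by (simp add: e_def field_simps)
  finally show "f \<tau> - f 0 \<le> m 0 \<tau> + e'" by simp
qed

lemma integral_power_interval:
  assumes "0 \<le> \<tau>" shows "(\<integral>t. t ^ n \<partial>lebesgue_on {0..\<tau>}) = \<tau> ^ Suc n / real (Suc n)"
    and "integrable (lebesgue_on {0..\<tau>}) (\<lambda>t. t ^ n)"
proof -
  show i: "integrable (lebesgue_on {0..\<tau>}) (\<lambda>t. t ^ n)"
    by (rule continuous_imp_integrable_real) (intro continuous_intros)
  have "((\<lambda>t. t ^ n) has_integral \<tau> ^ Suc n / real (Suc n) - 0 ^ Suc n / real (Suc n)) {0..\<tau>}"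
  proof (rule fundamental_theorem_of_calculus[OF assms])
    fix t :: real assume "t \<in> {0..\<tau>}"
    have "((\<lambda>t. t ^ Suc n / real (Suc n)) has_real_derivative t ^ n) (at t within {0..\<tau>})"
      by (rule derivative_eq_intros refl | simp)+
    then show "((\<lambda>t. t ^ Suc n / real (Suc n)) has_vector_derivative t ^ n) (at t within {0..\<tau>})"
      by (simp add: has_real_derivative_iff_has_vector_derivative)
  qed
  then show "(\<integral>t. t ^ n \<partial>lebesgue_on {0..\<tau>}) = \<tau> ^ Suc n / real (Suc n)"
    using lebesgue_integral_eq_integral[OF i] by (simp add: integral_unique)
qed

text \<open>\<open>D\<close> is only bounded and measurable, so the integral inequality is iterated
  instead of being differentiated; the iterates bound \<open>D\<close> by terms of an exponential
  series, which tend to 0.\<close>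

lemma Gronwall_zero:
  fixes D :: "real \<Rightarrow> real"
  assumes meas: "D \<in> borel_measurable (lebesgue_on {0<..<T})" and bd: "AE t in lebesgue_on {0<..<T}. \<bar>D t\<bar> \<le> C"
    and K: "0 \<le> K" and le: "\<And>\<tau>. 0 \<le> \<tau> \<Longrightarrow> \<tau> \<le> T \<Longrightarrow> D \<tau> \<le> K * (\<integral>t. D t \<partial>lebesgue_on {0..\<tau>})"
    and \<tau>: "0 \<le> \<tau>" "\<tau> \<le> T"
  shows "D \<tau> \<le> 0"
proof -
  define C' where "C' = max C 0"
  have int: "integrable (lebesgue_on {0..\<tau>}) D" if "0 \<le> \<tau>" "\<tau> \<le> T" for \<tau>
  proof (rule finite_measure.integrable_const_bound)
    show "finite_measure (lebesgue_on {0..\<tau>})" by (rule finite_measure_lebesgue_on) simp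
    show "AE t in lebesgue_on {0..\<tau>}. norm (D t) \<le> C"
      using AE_time_mono[OF bd that(2), of 0] by simp
    show "D \<in> borel_measurable (lebesgue_on {0..\<tau>})" by (rule measurable_time_mono[OF meas that(2)]) simp
  qed
  have pow: "D \<tau> \<le> K * C' * (K ^ n * \<tau> ^ Suc n / fact (Suc n))" if "0 \<le> \<tau>" "\<tau> \<le> T" for n \<tau>
    using that
  proof (induction n arbitrary: \<tau>)
    case 0
    have "(\<integral>t. D t \<partial>lebesgue_on {0..\<tau>}) \<le> (\<integral>t. C' * t ^ 0 \<partial>lebesgue_on {0..\<tau>})"
    proof (rule integral_mono_AE[OF int[OF 0]])
      show "integrable (lebesgue_on {0..\<tau>}) (\<lambda>t. C' * t ^ 0)"
        by (intro integrable_mult_right integral_power_interval(2) 0)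
      show "AE t in lebesgue_on {0..\<tau>}. D t \<le> C' * t ^ 0"
        using AE_time_mono[OF bd 0(2), of 0] by (auto elim!: eventually_mono simp: C'_def)
    qed
    also have "\<dots> = C' * (\<tau> ^ Suc 0 / real (Suc 0))" using integral_power_interval(1)[OF 0(1), of 0] by simp
    finally have "K * (\<integral>t. D t \<partial>lebesgue_on {0..\<tau>}) \<le> K * (C' * (\<tau> ^ Suc 0 / real (Suc 0)))"
      by (rule mult_left_mono[OF _ K])
    then show ?case using le[OF 0] by simp
  next
    case (Suc n)
    let ?c = "K * C' * (K ^ n / fact (Suc n))"
    have "(\<integral>t. D t \<partial>lebesgue_on {0..\<tau>}) \<le> (\<integral>t. ?c * t ^ Suc n \<partial>lebesgue_on {0..\<tau>})"
    proof (rule integral_mono_AE[OF int[OF Suc.prems]])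
      show "integrable (lebesgue_on {0..\<tau>}) (\<lambda>t. ?c * t ^ Suc n)"
        by (intro integrable_mult_right integral_power_interval(2) Suc.prems)
      show "AE t in lebesgue_on {0..\<tau>}. D t \<le> ?c * t ^ Suc n"
        using Suc by (intro AE_I2) (auto simp: algebra_simps)
    qed
    also have "\<dots> = ?c * (\<tau> ^ Suc (Suc n) / real (Suc (Suc n)))"
      using integral_power_interval(1)[OF Suc.prems(1), of "Suc n"] by simp
    finally have "K * (\<integral>t. D t \<partial>lebesgue_on {0..\<tau>}) \<le> K * (?c * (\<tau> ^ Suc (Suc n) / real (Suc (Suc n))))"
      by (rule mult_left_mono[OF _ K])
    also have "\<dots> = K * C' * (K ^ Suc n * \<tau> ^ Suc (Suc n) / fact (Suc (Suc n)))"
      by (simp add: fact_Suc[of "Suc n"] field_simps del: fact_Suc of_nat_Suc)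
    finally show ?case using le[OF Suc.prems] by linarith
  qed
  have lim: "(\<lambda>n. K * C' * (K ^ n * \<tau> ^ Suc n / fact (Suc n))) \<longlonglongrightarrow> 0"
  proof -
    have "(\<lambda>n. inverse (fact n) * (K * \<tau>) ^ n) \<longlonglongrightarrow> 0" by (rule summable_LIMSEQ_zero[OF summable_exp])
    then have "(\<lambda>n. C' * (inverse (fact (Suc n)) * (K * \<tau>) ^ Suc n)) \<longlonglongrightarrow> 0"
      by (intro tendsto_mult_right_zero LIMSEQ_Suc)
    moreover have "C' * (inverse (fact (Suc n)) * (K * \<tau>) ^ Suc n) = K * C' * (K ^ n * \<tau> ^ Suc n / fact (Suc n))" for n
      by (simp only: power_mult_distrib divide_inverse power_Suc mult_ac)
    ultimately show ?thesis by simp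
  qed
  show ?thesis by (rule LIMSEQ_le_const[OF lim]) (use pow[OF \<tau>] in blast)
qed

abbreviation tint :: "real \<Rightarrow> real \<Rightarrow> (real \<Rightarrow> 'b::euclidean_space) \<Rightarrow> 'b" where
  "tint a b f \<equiv> (\<integral>t. f t \<partial>lebesgue_on {a..b})"

lemma tint_split:
  fixes f :: "real \<Rightarrow> 'b::euclidean_space"
  assumes "integrable (lebesgue_on {a..c}) f" "a \<le> b" "b \<le> c"
  shows "tint a b f + tint b c f = tint a c f"
proof -
  have i: "integrable (lebesgue_on {a..b}) f" "integrable (lebesgue_on {b..c}) f"
    by (rule integrable_subinterval[OF assms(1)]; use assms in simp)+
  have "integral {a..b} f + integral {b..c} f = integral {a..c} f"
    by (rule Henstock_Kurzweil_Integration.integral_combine[OF assms(2,3) integrable_on_lebesgue_on[OF assms(1)]]) simp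
  then show ?thesis
    using lebesgue_integral_eq_integral[OF assms(1)] lebesgue_integral_eq_integral[OF i(1)] lebesgue_integral_eq_integral[OF i(2)]
    by simp
qed

lemma continuous_tint:
  fixes f :: "real \<Rightarrow> 'b::euclidean_space"
  assumes "continuous_on {0..T} f" "0 \<le> a" "b \<le> T" shows "integrable (lebesgue_on {a..b}) f"
  by (rule continuous_imp_integrable_real[OF continuous_on_subset[OF assms(1)]]) (use assms in auto)

lemma measure_interval: "a \<le> b \<Longrightarrow> measure (lebesgue_on {a..b}) {a..b::real} = b - a"
  by (simp add: measure_restrict_space)

lemma tint_const: "a \<le> b \<Longrightarrow> tint a b (\<lambda>_. c) = (b - a) *\<^sub>R c"
  by (simp add: measure_interval)

lemma tint_close:
  fixes f :: "real \<Rightarrow> real"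
  assumes i: "integrable (lebesgue_on {a..b}) f" and ab: "a \<le> b" and le: "\<And>t. t \<in> {a..b} \<Longrightarrow> \<bar>f t - c\<bar> \<le> e"
  shows "\<bar>tint a b f - (b - a) * c\<bar> \<le> e * (b - a)"
proof -
  have cc: "integrable (lebesgue_on {a..b}) (\<lambda>_. x)" for x :: real
    by (rule continuous_imp_integrable_real) (rule continuous_on_const)
  have "tint a b f - (b - a) * c = tint a b (\<lambda>t. f t - c)"
    using i cc ab by (simp add: measure_interval)
  then have "\<bar>tint a b f - (b - a) * c\<bar> \<le> tint a b (\<lambda>t. \<bar>f t - c\<bar>)"
    by (simp only: integral_abs_bound)
  also have "\<dots> \<le> tint a b (\<lambda>t. e)"
    by (rule integral_mono) (use i cc le in \<open>auto intro!: integrable_abs Bochner_Integration.integrable_diff\<close>)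
  also have "\<dots> = e * (b - a)" using tint_const[OF ab, of e] by simp
  finally show ?thesis .
qed

lemma tint_bound:
  fixes f :: "real \<Rightarrow> real"
  assumes "integrable (lebesgue_on {a..b}) f" "a \<le> b" "\<And>t. t \<in> {a..b} \<Longrightarrow> \<bar>f t\<bar> \<le> e"
  shows "\<bar>tint a b f\<bar> \<le> e * (b - a)"
  using tint_close[OF assms(1,2), of 0 e] assms(3) by simp

lemma tint_cong: "(\<And>t. t \<in> {a..b} \<Longrightarrow> f t = g t) \<Longrightarrow> tint a b f = tint a b g"
  by (rule Bochner_Integration.integral_cong) auto

section \<open>Curves that are continuous in the mean\<close>

text \<open>A uniform modulus of continuity into \<open>L2\<close>. Being weaker than
  \<open>CP\<close>, it also covers curves whose values are fixed only up to null sets at each time,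
  such as the pressure and the functions \<open>wD\<close>.\<close>

definition CL :: "real \<Rightarrow> (real \<Rightarrow> real^3 \<Rightarrow> 'b::euclidean_space) \<Rightarrow> bool" where
  "CL T w \<longleftrightarrow> (\<forall>t\<in>{0..T}. L2 (w t)) \<and>
    (\<forall>e>0. \<exists>d>0. \<forall>s\<in>{0..T}. \<forall>t\<in>{0..T}. \<bar>s - t\<bar> < d \<longrightarrow> n2 (\<lambda>x. w s x - w t x) \<le> e)"

lemma CL_L2: "CL T w \<Longrightarrow> t \<in> {0..T} \<Longrightarrow> L2 (w t)" by (simp add: CL_def)

lemma CL_uniform:
  assumes "CL T w" "e > 0"
  obtains d where "d > 0" "\<And>s t. s \<in> {0..T} \<Longrightarrow> t \<in> {0..T} \<Longrightarrow> \<bar>s - t\<bar> < d \<Longrightarrow> n2 (\<lambda>x. w s x - w t x) \<le> e"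
proof -
  from assms(1)[unfolded CL_def, THEN conjunct2, rule_format, OF assms(2)]
  obtain d where "0 < d \<and> (\<forall>s\<in>{0..T}. \<forall>t\<in>{0..T}. \<bar>s - t\<bar> < d \<longrightarrow> n2 (\<lambda>x. w s x - w t x) \<le> e)" ..
  note d = this[THEN conjunct1] this[THEN conjunct2, rule_format]
  show ?thesis by (rule that[OF d])
qed

lemma CL_I:
  assumes "\<And>t. t \<in> {0..T} \<Longrightarrow> L2 (w t)"
    and "\<And>e. e > 0 \<Longrightarrow> \<exists>d>0. \<forall>s\<in>{0..T}. \<forall>t\<in>{0..T}. \<bar>s - t\<bar> < d \<longrightarrow> n2 (\<lambda>x. w s x - w t x) \<le> e"
  shows "CL T w"
  using assms by (simp add: CL_def)

lemma CL_CP: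
  fixes u :: "real \<Rightarrow> real^3 \<Rightarrow> 'b::euclidean_space"
  assumes "CP T u" shows "CL T u"
proof (rule CL_I)
  fix e :: real assume e: "e > 0"
  obtain d where d: "d > 0" "\<And>s t. s \<in> {0..T} \<Longrightarrow> t \<in> {0..T} \<Longrightarrow> \<bar>s - t\<bar> < d \<Longrightarrow> n2 (\<lambda>x. u s x - u t x) \<le> e"
    by (rule CP_n2_uniform[OF assms e], rule that)
  show "\<exists>d>0. \<forall>s\<in>{0..T}. \<forall>t\<in>{0..T}. \<bar>s - t\<bar> < d \<longrightarrow> n2 (\<lambda>x. u s x - u t x) \<le> e"
    using d by (intro exI[of _ d]) simp
qed (rule CP_L2[OF assms])

lemma CL_dominated:
  assumes u: "CL T u" and L: "\<And>t. t \<in> {0..T} \<Longrightarrow> L2 (w t)"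
    and le: "\<And>s t. s \<in> {0..T} \<Longrightarrow> t \<in> {0..T} \<Longrightarrow> n2 (\<lambda>x. w s x - w t x) \<le> C * n2 (\<lambda>x. u s x - u t x)"
    and C: "0 \<le> C"
  shows "CL T w"
proof (rule CL_I[OF L])
  fix e :: real assume "e > 0"
  then have e: "e / (C + 1) > 0" using C by simp
  obtain d where d: "d > 0" "\<And>s t. s \<in> {0..T} \<Longrightarrow> t \<in> {0..T} \<Longrightarrow> \<bar>s - t\<bar> < d \<Longrightarrow> n2 (\<lambda>x. u s x - u t x) \<le> e / (C + 1)"
    by (rule CL_uniform[OF u e], rule that)
  show "\<exists>d>0. \<forall>s\<in>{0..T}. \<forall>t\<in>{0..T}. \<bar>s - t\<bar> < d \<longrightarrow> n2 (\<lambda>x. w s x - w t x) \<le> e"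
  proof (intro exI[of _ d] conjI ballI impI d(1))
    fix s t assume st: "s \<in> {0..T}" "t \<in> {0..T}" "\<bar>s - t\<bar> < d"
    have "n2 (\<lambda>x. w s x - w t x) \<le> C * n2 (\<lambda>x. u s x - u t x)" by (rule le[OF st(1,2)])
    also have "\<dots> \<le> C * (e / (C + 1))" by (rule mult_left_mono[OF d(2)[OF st] C])
    also have "\<dots> \<le> e" using C \<open>e > 0\<close> by (simp add: field_simps)
    finally show "n2 (\<lambda>x. w s x - w t x) \<le> e" .
  qed
qed

lemma CL_cong_AE:
  assumes u: "CL T u" and ae: "\<And>t. t \<in> {0..T} \<Longrightarrow> AE x in torus. u t x = w t x"
  shows "CL T w"
proof (rule CL_dominated[OF u, of _ 1])
  show L: "L2 (w t)" if "t \<in> {0..T}" for t by (rule L2_cong_AE[OF CL_L2[OF u that] ae[OF that]])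
  fix s t assume st: "s \<in> {0..T}" "t \<in> {0..T}"
  have "n2 (\<lambda>x. u s x - u t x) = n2 (\<lambda>x. w s x - w t x)"
  proof (rule n2_cong_AE)
    show "AE x in torus. u s x - u t x = w s x - w t x"
      using ae[OF st(1)] ae[OF st(2)] by eventually_elim simp
  qed (intro L2_diff CL_L2[OF u] st)
  then show "n2 (\<lambda>x. w s x - w t x) \<le> 1 * n2 (\<lambda>x. u s x - u t x)" by simp
qed simp

lemma CL_add:
  assumes u: "CL T u" and w: "CL T w" shows "CL T (\<lambda>t x. u t x + w t x)"
proof (rule CL_I)
  fix e :: real assume "e > 0"
  then have e: "e / 2 > 0" by simp
  obtain d1 where d1: "d1 > 0" "\<And>s t. s \<in> {0..T} \<Longrightarrow> t \<in> {0..T} \<Longrightarrow> \<bar>s - t\<bar> < d1 \<Longrightarrow> n2 (\<lambda>x. u s x - u t x) \<le> e / 2"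
    by (rule CL_uniform[OF u e], rule that)
  obtain d2 where d2: "d2 > 0" "\<And>s t. s \<in> {0..T} \<Longrightarrow> t \<in> {0..T} \<Longrightarrow> \<bar>s - t\<bar> < d2 \<Longrightarrow> n2 (\<lambda>x. w s x - w t x) \<le> e / 2"
    by (rule CL_uniform[OF w e], rule that)
  show "\<exists>d>0. \<forall>s\<in>{0..T}. \<forall>t\<in>{0..T}. \<bar>s - t\<bar> < d \<longrightarrow> n2 (\<lambda>x. u s x + w s x - (u t x + w t x)) \<le> e"
  proof (intro exI[of _ "min d1 d2"] conjI ballI impI)
    fix s t assume st: "s \<in> {0..T}" "t \<in> {0..T}" "\<bar>s - t\<bar> < min d1 d2"
    have "n2 (\<lambda>x. u s x + w s x - (u t x + w t x)) = n2 (\<lambda>x. (u s x - u t x) + (w s x - w t x))"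
      by (simp add: algebra_simps)
    also have "\<dots> \<le> n2 (\<lambda>x. u s x - u t x) + n2 (\<lambda>x. w s x - w t x)"
      by (intro n2_triangle L2_diff CL_L2[OF u] CL_L2[OF w] st)
    also have "\<dots> \<le> e / 2 + e / 2" by (intro add_mono d1(2) d2(2)) (use st in auto)
    finally show "n2 (\<lambda>x. u s x + w s x - (u t x + w t x)) \<le> e" by simp
  qed (use d1 d2 in simp)
qed (intro L2_add CL_L2[OF u] CL_L2[OF w])

lemma CL_uminus: "CL T u \<Longrightarrow> CL T (\<lambda>t x. - u t x)"
proof (rule CL_dominated[of _ u _ 1])
  fix s t :: real
  have "n2 (\<lambda>x. - u s x - - u t x) = n2 (\<lambda>x. u t x - u s x)" by (simp add: algebra_simps)
  then show "n2 (\<lambda>x. - u s x - - u t x) \<le> 1 * n2 (\<lambda>x. u s x - u t x)"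
    by (simp add: n2_minus_commute[of "u t"])
qed (auto intro!: L2_uminus CL_L2[of T u])

lemma CL_diff: "CL T u \<Longrightarrow> CL T w \<Longrightarrow> CL T (\<lambda>t x. u t x - w t x)"
  using CL_add[OF _ CL_uminus] by (simp only: diff_conv_add_uminus)

lemma CL_const: "L2 f \<Longrightarrow> CL T (\<lambda>t. f)"
proof (rule CL_I)
  fix e :: real assume "e > 0"
  moreover have "n2 (\<lambda>x. f x - f x) = 0" by (simp add: n2_def ip_def)
  ultimately show "\<exists>d>0. \<forall>s\<in>{0..T}. \<forall>t\<in>{0..T}. \<bar>s - t\<bar> < d \<longrightarrow> n2 (\<lambda>x. f x - f x) \<le> e"
    by (intro exI[of _ 1]) simp
qed

lemma n2_reverse_triangle: "L2 f \<Longrightarrow> L2 g \<Longrightarrow> \<bar>n2 f - n2 g\<bar> \<le> n2 (\<lambda>x. f x - g x)"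
  using n2_triangle[of "\<lambda>x. f x - g x" g] n2_triangle[of "\<lambda>x. g x - f x" f] n2_minus_commute[of f g] by simp

lemma CL_n2_continuous:
  assumes "CL T w" shows "continuous_on {0..T} (\<lambda>t. n2 (w t))"
  unfolding continuous_on_iff
proof (intro ballI allI impI)
  fix t e :: real assume t: "t \<in> {0..T}" and "e > 0"
  then have e: "e / 2 > 0" by simp
  obtain d where d: "d > 0" "\<And>s t. s \<in> {0..T} \<Longrightarrow> t \<in> {0..T} \<Longrightarrow> \<bar>s - t\<bar> < d \<Longrightarrow> n2 (\<lambda>x. w s x - w t x) \<le> e / 2"
    by (rule CL_uniform[OF assms e], rule that)
  show "\<exists>d>0. \<forall>s\<in>{0..T}. dist s t < d \<longrightarrow> dist (n2 (w s)) (n2 (w t)) < e"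
  proof (intro exI[of _ d] conjI ballI impI d(1))
    fix s assume s: "s \<in> {0..T}" "dist s t < d"
    have "\<bar>n2 (w s) - n2 (w t)\<bar> \<le> n2 (\<lambda>x. w s x - w t x)"
      by (intro n2_reverse_triangle CL_L2[OF assms] s t)
    also have "\<dots> \<le> e / 2" by (rule d(2)[OF s(1) t]) (use s in \<open>simp add: dist_real_def\<close>)
    finally show "dist (n2 (w s)) (n2 (w t)) < e" using \<open>e > 0\<close> by (simp add: dist_real_def)
  qed
qed

lemma CL_bounded:
  assumes "CL T w" obtains B where "B > 0" "\<And>t. t \<in> {0..T} \<Longrightarrow> n2 (w t) \<le> B"
proof -
  have "bounded ((\<lambda>t. n2 (w t)) ` {0..T})"
    by (intro compact_imp_bounded compact_continuous_image CL_n2_continuous assms compact_Icc)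
  from this[unfolded bounded_pos] obtain B where "0 < B \<and> (\<forall>y\<in>(\<lambda>t. n2 (w t)) ` {0..T}. norm y \<le> B)" ..
  note B = this[THEN conjunct1] this[THEN conjunct2, rule_format]
  show ?thesis
  proof (rule that[OF B(1)])
    show "n2 (w t) \<le> B" if "t \<in> {0..T}" for t using B(2)[OF imageI[OF that]] by simp
  qed
qed

lemma ip_diff_bound:
  assumes "L2 f" "L2 g" "L2 f'" "L2 g'"
  shows "\<bar>ip f g - ip f' g'\<bar> \<le> n2 (\<lambda>x. f x - f' x) * n2 g + n2 f' * n2 (\<lambda>x. g x - g' x)"
proof -
  have "ip f g - ip f' g' = ip (\<lambda>x. f x - f' x) g + ip f' (\<lambda>x. g x - g' x)"
    using assms by (simp add: ip_diff_left ip_diff_right)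
  then show ?thesis
    using ip_Cauchy_Schwarz[OF L2_diff[OF assms(1,3)] assms(2)] ip_Cauchy_Schwarz[OF assms(3) L2_diff[OF assms(2,4)]]
    by linarith
qed

lemma CL_ip_close:
  assumes u: "CL T u" and w: "CL T w" and e: "e > 0"
  obtains d where "d > 0" "\<And>a s t. a \<in> {0..T} \<Longrightarrow> s \<in> {0..T} \<Longrightarrow> t \<in> {0..T} \<Longrightarrow> \<bar>s - a\<bar> < d \<Longrightarrow> \<bar>t - a\<bar> < d \<Longrightarrow>
     \<bar>ip (u s) (w t) - ip (u a) (w a)\<bar> \<le> e"
proof -
  obtain B1 where B1: "B1 > 0" "\<And>t. t \<in> {0..T} \<Longrightarrow> n2 (u t) \<le> B1" by (rule CL_bounded[OF u], rule that)
  obtain B2 where B2: "B2 > 0" "\<And>t. t \<in> {0..T} \<Longrightarrow> n2 (w t) \<le> B2" by (rule CL_bounded[OF w], rule that)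
  have e1: "e / (2 * B2) > 0" and e2: "e / (2 * B1) > 0" using e B1 B2 by simp_all
  obtain d1 where d1: "d1 > 0" "\<And>s t. s \<in> {0..T} \<Longrightarrow> t \<in> {0..T} \<Longrightarrow> \<bar>s - t\<bar> < d1 \<Longrightarrow> n2 (\<lambda>x. u s x - u t x) \<le> e / (2 * B2)"
    by (rule CL_uniform[OF u e1], rule that)
  obtain d2 where d2: "d2 > 0" "\<And>s t. s \<in> {0..T} \<Longrightarrow> t \<in> {0..T} \<Longrightarrow> \<bar>s - t\<bar> < d2 \<Longrightarrow> n2 (\<lambda>x. w s x - w t x) \<le> e / (2 * B1)"
    by (rule CL_uniform[OF w e2], rule that)
  show ?thesis
  proof (rule that[of "min d1 d2"])
    fix a s t assume ast: "a \<in> {0..T}" "s \<in> {0..T}" "t \<in> {0..T}" "\<bar>s - a\<bar> < min d1 d2" "\<bar>t - a\<bar> < min d1 d2"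
    have "\<bar>ip (u s) (w t) - ip (u a) (w a)\<bar> \<le> n2 (\<lambda>x. u s x - u a x) * n2 (w t) + n2 (u a) * n2 (\<lambda>x. w t x - w a x)"
      by (intro ip_diff_bound CL_L2[OF u] CL_L2[OF w] ast)
    also have "\<dots> \<le> e / (2 * B2) * B2 + B1 * (e / (2 * B1))"
      by (intro add_mono mult_mono d1(2) d2(2) B1(2) B2(2)) (use ast B1 B2 e in auto)
    also have "\<dots> = e" using B1 B2 by simp
    finally show "\<bar>ip (u s) (w t) - ip (u a) (w a)\<bar> \<le> e" .
  qed (use d1 d2 in simp)
qed

lemma CL_ip_continuous:
  assumes "CL T u" "CL T w" shows "continuous_on {0..T} (\<lambda>t. ip (u t) (w t))"
  unfolding continuous_on_iff
proof (intro ballI allI impI)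
  fix t e :: real assume t: "t \<in> {0..T}" and "e > 0"
  then have e: "e / 2 > 0" by simp
  obtain d where d: "d > 0" "\<And>a s t. a \<in> {0..T} \<Longrightarrow> s \<in> {0..T} \<Longrightarrow> t \<in> {0..T} \<Longrightarrow> \<bar>s - a\<bar> < d \<Longrightarrow> \<bar>t - a\<bar> < d \<Longrightarrow>
     \<bar>ip (u s) (w t) - ip (u a) (w a)\<bar> \<le> e / 2"
    by (rule CL_ip_close[OF assms e], rule that)
  show "\<exists>d>0. \<forall>s\<in>{0..T}. dist s t < d \<longrightarrow> dist (ip (u s) (w s)) (ip (u t) (w t)) < e"
  proof (intro exI[of _ d] conjI ballI impI d(1))
    fix s assume s: "s \<in> {0..T}" "dist s t < d"
    have "\<bar>ip (u s) (w s) - ip (u t) (w t)\<bar> \<le> e / 2" by (rule d(2)) (use s t in \<open>auto simp: dist_real_def\<close>)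
    then show "dist (ip (u s) (w s)) (ip (u t) (w t)) < e" using \<open>e > 0\<close> by (simp add: dist_real_def)
  qed
qed

text \<open>The second factor is frozen at one time of the interval, as test functions constant in
  time require.\<close>

lemma CL_ip_tint_close:
  assumes "CL T u" "CL T w" "e > 0"
  obtains d where "d > 0" "\<And>a b c. 0 \<le> a \<Longrightarrow> a \<le> b \<Longrightarrow> b \<le> T \<Longrightarrow> b - a < d \<Longrightarrow> c \<in> {a..b} \<Longrightarrow>
     \<bar>tint a b (\<lambda>t. ip (u t) (w c)) - (b - a) * ip (u a) (w a)\<bar> \<le> e * (b - a)"
proof -
  obtain d where d: "d > 0" "\<And>a s t. a \<in> {0..T} \<Longrightarrow> s \<in> {0..T} \<Longrightarrow> t \<in> {0..T} \<Longrightarrow> \<bar>s - a\<bar> < d \<Longrightarrow> \<bar>t - a\<bar> < d \<Longrightarrow>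
     \<bar>ip (u s) (w t) - ip (u a) (w a)\<bar> \<le> e"
    by (rule CL_ip_close[OF assms], rule that)
  show ?thesis
  proof (rule that[OF d(1)])
    fix a b c assume *: "0 \<le> a" "a \<le> b" "b \<le> T" "b - a < d" "c \<in> {a..b}"
    have c: "c \<in> {0..T}" using * by auto
    have "integrable (lebesgue_on {a..b}) (\<lambda>t. ip (u t) (w c))"
      by (rule continuous_tint[OF CL_ip_continuous[OF assms(1) CL_const[OF CL_L2[OF assms(2) c]]] *(1,3)])
    then show "\<bar>tint a b (\<lambda>t. ip (u t) (w c)) - (b - a) * ip (u a) (w a)\<bar> \<le> e * (b - a)"
      by (rule tint_close[OF _ *(2)]) (rule d(2), use * in auto)
  qed
qed

lemma ip_tpoly_expand:
  fixes f :: "real^3 \<Rightarrow> 'b::euclidean_space"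
  assumes "L2 f"
  shows "ip f (tpoly \<kappa> c n) = (\<Sum>i<n. \<Sum>b\<in>Basis. (c i \<bullet> b) * ip f (\<lambda>x. cas (\<kappa> i) x *\<^sub>R b))"
proof -
  have one: "ip f (\<lambda>x. cas k x *\<^sub>R a) = (\<Sum>b\<in>Basis. (a \<bullet> b) * ip f (\<lambda>x. cas k x *\<^sub>R b))" for k and a :: 'b
  proof -
    have "(\<lambda>x. cas k x *\<^sub>R a) = (\<lambda>x. \<Sum>b\<in>Basis. (a \<bullet> b) *\<^sub>R (cas k x *\<^sub>R b))"
    proof
      fix x
      have "cas k x *\<^sub>R a = cas k x *\<^sub>R (\<Sum>b\<in>Basis. (a \<bullet> b) *\<^sub>R b)" by (simp add: euclidean_representation)
      also have "\<dots> = (\<Sum>b\<in>Basis. (a \<bullet> b) *\<^sub>R (cas k x *\<^sub>R b))"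
        by (simp add: scaleR_sum_right mult.commute)
      finally show "cas k x *\<^sub>R a = (\<Sum>b\<in>Basis. (a \<bullet> b) *\<^sub>R (cas k x *\<^sub>R b))" .
    qed
    then have "ip f (\<lambda>x. cas k x *\<^sub>R a) = ip f (\<lambda>x. \<Sum>b\<in>Basis. (a \<bullet> b) *\<^sub>R (cas k x *\<^sub>R b))" by (simp only:)
    also have "\<dots> = (\<Sum>b\<in>Basis. ip f (\<lambda>x. (a \<bullet> b) *\<^sub>R (cas k x *\<^sub>R b)))"
      by (rule ip_sum_right[OF _ assms]) (intro L2_scaleR L2_cas L2_const)
    finally show ?thesis by (simp only: ip_scale_right)
  qed
  have "ip f (tpoly \<kappa> c n) = (\<Sum>i<n. ip f (\<lambda>x. cas (\<kappa> i) x *\<^sub>R c i))"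
    unfolding tpoly_def by (rule ip_sum_right[OF _ assms]) (intro L2_cas L2_const)
  also have "\<dots> = (\<Sum>i<n. \<Sum>b\<in>Basis. (c i \<bullet> b) * ip f (\<lambda>x. cas (\<kappa> i) x *\<^sub>R b))"
    by (intro sum.cong refl one)
  finally show ?thesis .
qed

lemma tint_ip_trunc_tendsto:
  fixes w :: "real \<Rightarrow> real^3 \<Rightarrow> 'b::euclidean_space"
  assumes w: "CL T w" and ab: "0 \<le> a" "a \<le> b" "b \<le> T" and \<psi>: "L2 \<psi>"
  shows "(\<lambda>n. tint a b (\<lambda>t. ip (w t) (trunc n \<psi>))) \<longlonglongrightarrow> tint a b (\<lambda>t. ip (w t) \<psi>)"
proof -
  have int: "integrable (lebesgue_on {a..b}) (\<lambda>t. ip (w t) \<psi>)" if "L2 \<psi>" for \<psi>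
    by (rule continuous_tint[OF CL_ip_continuous[OF w CL_const[OF that]] ab(1,3)])
  obtain B where B: "B > 0" "\<And>t. t \<in> {0..T} \<Longrightarrow> n2 (w t) \<le> B" by (rule CL_bounded[OF w], rule that)
  have Ltr: "L2 (trunc n \<psi>)" for n by (rule L2_tpoly)
  have lim: "(\<lambda>n. B * n2 (\<lambda>x. \<psi> x - trunc n \<psi> x) * (b - a)) \<longlonglongrightarrow> 0"
    by (intro tendsto_mult_left_zero tendsto_mult_right_zero trunc_tendsto \<psi>)
  have "norm (tint a b (\<lambda>t. ip (w t) (trunc n \<psi>)) - tint a b (\<lambda>t. ip (w t) \<psi>)) \<le> B * n2 (\<lambda>x. \<psi> x - trunc n \<psi> x) * (b - a)" for n
  proof -
    have Ld: "L2 (\<lambda>x. trunc n \<psi> x - \<psi> x)" by (intro L2_diff Ltr \<psi>)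
    have "tint a b (\<lambda>t. ip (w t) (trunc n \<psi>)) - tint a b (\<lambda>t. ip (w t) \<psi>) = tint a b (\<lambda>t. ip (w t) (trunc n \<psi>) - ip (w t) \<psi>)"
      by (rule Bochner_Integration.integral_diff[symmetric]) (intro int Ltr \<psi>)+
    also have "\<dots> = tint a b (\<lambda>t. ip (w t) (\<lambda>x. trunc n \<psi> x - \<psi> x))"
      by (rule tint_cong) (rule ip_diff_right[symmetric], use ab CL_L2[OF w] Ltr \<psi> in auto)
    finally show ?thesis
      unfolding real_norm_def
    proof (simp only:, intro tint_bound int Ld ab)
      fix t assume t: "t \<in> {a..b}"
      then have t': "t \<in> {0..T}" using ab by auto
      have "\<bar>ip (w t) (\<lambda>x. trunc n \<psi> x - \<psi> x)\<bar> \<le> n2 (w t) * n2 (\<lambda>x. trunc n \<psi> x - \<psi> x)"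
        by (intro ip_Cauchy_Schwarz CL_L2[OF w t'] Ld)
      also have "\<dots> \<le> B * n2 (\<lambda>x. trunc n \<psi> x - \<psi> x)" by (intro mult_right_mono B(2)[OF t'] n2_nonneg)
      finally show "\<bar>ip (w t) (\<lambda>x. trunc n \<psi> x - \<psi> x)\<bar> \<le> B * n2 (\<lambda>x. \<psi> x - trunc n \<psi> x)"
        by (simp only: n2_minus_commute[of "trunc n \<psi>"])
    qed
  qed
  then have "(\<lambda>n. tint a b (\<lambda>t. ip (w t) (trunc n \<psi>)) - tint a b (\<lambda>t. ip (w t) \<psi>)) \<longlonglongrightarrow> 0"
    by (intro Lim_null_comparison[OF always_eventually lim] allI)
  then show ?thesis by (rule LIM_zero_cancel)
qed

text \<open>Linearity extends the identity from modes to Hartley polynomials and truncation extends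
  it to \<open>L2\<close>; boundedness of \<open>w\<close> in \<open>L2\<close> lets the limit pass
  through the time integral.\<close>

lemma weak_increment_density:
  fixes f :: "real^3 \<Rightarrow> 'b::euclidean_space"
  assumes f: "L2 f" and w: "CL T w" and ab: "0 \<le> a" "a \<le> b" "b \<le> T"
    and modes: "\<And>k c. c \<in> Basis \<Longrightarrow> ip f (\<lambda>x. cas k x *\<^sub>R c) = tint a b (\<lambda>t. ip (w t) (\<lambda>x. cas k x *\<^sub>R c))"
    and \<psi>: "L2 \<psi>"
  shows "ip f \<psi> = tint a b (\<lambda>t. ip (w t) \<psi>)"
proof -
  have int: "integrable (lebesgue_on {a..b}) (\<lambda>t. ip (w t) \<psi>)" if "L2 \<psi>" for \<psi>
    by (rule continuous_tint[OF CL_ip_continuous[OF w CL_const[OF that]] ab(1,3)])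
  have Lc: "L2 (\<lambda>x. cas k x *\<^sub>R c)" for k and c :: 'b by (intro L2_cas L2_const)
  have tr: "ip f (trunc n \<psi>) = tint a b (\<lambda>t. ip (w t) (trunc n \<psi>))" for n
  proof -
    let ?c = "\<lambda>i b. hat \<psi> (enum i) \<bullet> b" and ?e = "\<lambda>i b. (\<lambda>x. cas (enum i) x *\<^sub>R b)"
    have "tint a b (\<lambda>t. ip (w t) (trunc n \<psi>)) = tint a b (\<lambda>t. \<Sum>i<n. \<Sum>b\<in>Basis. ?c i b * ip (w t) (?e i b))"
      by (rule tint_cong) (rule ip_tpoly_expand, rule CL_L2[OF w], use ab in auto)
    also have "\<dots> = (\<Sum>i<n. \<Sum>c\<in>Basis. ?c i c * tint a b (\<lambda>t. ip (w t) (?e i c)))"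
    proof -
      have i1: "integrable (lebesgue_on {a..b}) (\<lambda>t. ?c i c * ip (w t) (?e i c))" for i c
        by (intro integrable_mult_right int Lc)
      have "tint a b (\<lambda>t. \<Sum>i<n. \<Sum>b\<in>Basis. ?c i b * ip (w t) (?e i b)) = (\<Sum>i<n. tint a b (\<lambda>t. \<Sum>b\<in>Basis. ?c i b * ip (w t) (?e i b)))"
        by (rule Bochner_Integration.integral_sum) (intro Bochner_Integration.integrable_sum i1)
      also have "\<dots> = (\<Sum>i<n. \<Sum>c\<in>Basis. tint a b (\<lambda>t. ?c i c * ip (w t) (?e i c)))"
        by (intro sum.cong refl Bochner_Integration.integral_sum i1)
      finally show ?thesis by simp
    qed
    also have "\<dots> = (\<Sum>i<n. \<Sum>c\<in>Basis. ?c i c * ip f (?e i c))"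
      by (intro sum.cong refl arg_cong2[where f="(*)"] modes[symmetric])
    also have "\<dots> = ip f (trunc n \<psi>)" by (rule ip_tpoly_expand[OF f, symmetric])
    finally show ?thesis by simp
  qed
  have "(\<lambda>n. ip f (trunc n \<psi>)) \<longlonglongrightarrow> tint a b (\<lambda>t. ip (w t) \<psi>)"
    unfolding tr by (rule tint_ip_trunc_tendsto[OF w ab \<psi>])
  then show ?thesis using ip_trunc_tendsto[OF \<psi> f] LIMSEQ_unique by blast
qed

section \<open>Weak time derivatives\<close>

lemma mi_order_eq_0: "mi_order \<alpha> \<le> 0 \<longleftrightarrow> \<alpha> = 0"
  by (auto simp: mi_order_def vec_eq_iff)

lemma sob_0: "sob 0 f \<longleftrightarrow> L2 f"
  unfolding sob_def mi_order_eq_0 using has_weak_deriv_0[of f] by auto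

lemma sob_inner_0: "sob_inner 0 f g = ip f g"
  unfolding sob_inner_def mi_order_eq_0 by (simp add: wD_def ip_def)

lemma sob_norm_0: "sob_norm 0 f = n2 f"
  by (simp add: sob_norm_def sob_inner_0 n2_def)

lemma measurable_open_interval:
  fixes f :: "real \<Rightarrow> real"
  assumes "continuous_on {0..T} f" shows "f \<in> borel_measurable (lebesgue_on {0<..<T})" "integrable (lebesgue_on {0<..<T}) f"
proof -
  have i: "integrable (lebesgue_on {0..T}) f" by (rule continuous_tint[OF assms]) auto
  then have "set_integrable lebesgue {0..T} f" by (simp add: set_integrable_def integrable_restrict_space)
  then have "set_integrable lebesgue {0<..<T} f" by (rule set_integrable_subset) auto
  then show j: "integrable (lebesgue_on {0<..<T}) f" by (simp add: set_integrable_def integrable_restrict_space)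
  show "f \<in> borel_measurable (lebesgue_on {0<..<T})" by (rule borel_measurable_integrable[OF j])
qed

lemma L1_sob_0_CL:
  assumes "CL T w" shows "L1_sob T 0 w"
  unfolding L1_sob_def sob_0 sob_inner_0 sob_norm_0
proof (intro conjI allI impI)
  show "AE t in lebesgue_on {0<..<T}. L2 (w t)" by (rule AE_I2) (use CL_L2[OF assms] in auto)
  show "(\<lambda>t. ip (w t) \<psi>) \<in> borel_measurable (lebesgue_on {0<..<T})" if "L2 \<psi>" for \<psi>
    by (rule measurable_open_interval(1)[OF CL_ip_continuous[OF assms CL_const[OF that]]])
  show "integrable (lebesgue_on {0<..<T}) (\<lambda>t. n2 (w t))"
    by (rule measurable_open_interval(2)[OF CL_n2_continuous[OF assms]])
qed

lemma test_fun_CP: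
  fixes \<phi> :: "real \<Rightarrow> real^3 \<Rightarrow> 'b::euclidean_space"
  assumes T: "T > 0" and \<phi>: "test_fun T \<phi>"
  shows "CP T \<phi>" "CP T (pd_t T \<phi>)"
    "t \<in> {0..T} \<Longrightarrow> ((\<lambda>r. \<phi> r x) has_vector_derivative pd_t T \<phi> t x) (at t within {0..T})"
proof -
  let ?S = "{0..T} \<times> (UNIV :: (real^3) set)" and ?\<Phi> = "\<lambda>(t, x). \<phi> t x"
  have per: "\<phi> t (x + (2 * pi) *\<^sub>R axis k 1) = \<phi> t x" if "t \<in> {0..T}" for t x k
    using \<phi> that by (simp add: test_fun_def periodic_def)
  have "Ck_on 0 ?S ?\<Phi>" "Ck_on (Suc 0) ?S ?\<Phi>" using \<phi> by (simp_all only: test_fun_def smooth_on_def)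
  then have cont: "continuous_on ?S ?\<Phi>" by simp
  obtain f' where der: "\<And>p. p \<in> ?S \<Longrightarrow> (?\<Phi> has_derivative f' p) (at p within ?S)"
    and f'c: "\<And>h. h \<in> span {x - y | x y. x \<in> ?S \<and> y \<in> ?S} \<Longrightarrow> continuous_on ?S (\<lambda>p. f' p h)"
    using \<open>Ck_on (Suc 0) ?S ?\<Phi>\<close> unfolding Ck_on.simps by auto
  \<comment> \<open>\<open>Ck_on\<close> gives continuity of the derivative only along the span of
    differences; \<open>T > 0\<close> puts the time direction there.\<close>
  have "(T, 0) \<in> {x - y | x y. x \<in> ?S \<and> y \<in> ?S}"
    using T by (intro CollectI exI[of _ "(T, 0)"] exI[of _ "(0, 0)"]) auto
  then have "(1 / T) *\<^sub>R (T, 0) \<in> span {x - y | x y. x \<in> ?S \<and> y \<in> ?S}" by (intro span_scale span_base)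
  then have dir: "(1, 0) \<in> span {x - y | x y. x \<in> ?S \<and> y \<in> ?S}" using T by simp
  have vd: "((\<lambda>r. \<phi> r x) has_vector_derivative f' (t, x) (1, 0)) (at t within {0..T})" if t: "t \<in> {0..T}" for t x
  proof -
    interpret f': bounded_linear "f' (t, x)" by (rule has_derivative_bounded_linear[OF der]) (use t in simp)
    have "((\<lambda>r. (r, x)) has_derivative (\<lambda>r. (r, 0))) (at t within {0..T})"
      by (intro has_derivative_Pair has_derivative_ident has_derivative_const)
    moreover have "(?\<Phi> has_derivative f' (t, x)) (at (t, x) within (\<lambda>r. (r, x)) ` {0..T})"
      by (rule has_derivative_subset[OF der]) (use t in auto)
    ultimately have "((\<lambda>r. ?\<Phi> (r, x)) has_derivative (\<lambda>r. f' (t, x) (r, 0))) (at t within {0..T})"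
      by (rule has_derivative_in_compose)
    moreover have "(\<lambda>r. f' (t, x) (r, 0)) = (\<lambda>r. r *\<^sub>R f' (t, x) (1, 0))"
    proof
      fix r show "f' (t, x) (r, 0) = r *\<^sub>R f' (t, x) (1, 0)" using f'.scaleR[of r "(1, 0)"] by simp
    qed
    ultimately show ?thesis by (simp only: has_vector_derivative_def prod.case)
  qed
  have eq: "pd_t T \<phi> t x = f' (t, x) (1, 0)" if t: "t \<in> {0..T}" for t x
    unfolding pd_t_def by (rule vector_derivative_within_closed_interval[OF T t vd[OF t]])
  show "t \<in> {0..T} \<Longrightarrow> ((\<lambda>r. \<phi> r x) has_vector_derivative pd_t T \<phi> t x) (at t within {0..T})"
    using vd eq by simp
  show "CP T \<phi>" using cont per by (simp add: CP_def periodic_def case_prod_beta')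
  show "CP T (pd_t T \<phi>)"
    unfolding CP_def
  proof (intro conjI ballI)
    show "continuous_on ?S (\<lambda>p. pd_t T \<phi> (fst p) (snd p))"
      using f'c[OF dir] by (rule continuous_on_eq) (auto simp: eq)
    fix t assume t: "t \<in> {0..T}"
    show "periodic (pd_t T \<phi> t)"
      unfolding periodic_def
    proof (intro allI)
      fix x k
      let ?y = "x + (2 * pi) *\<^sub>R axis k 1 :: real^3"
      have "((\<lambda>r. \<phi> r ?y) has_vector_derivative f' (t, x) (1, 0)) (at t within {0..T})"
        by (rule has_vector_derivative_transform[OF t _ vd[OF t]]) (simp add: per)
      then have "pd_t T \<phi> t ?y = f' (t, x) (1, 0)"
        unfolding pd_t_def by (rule vector_derivative_within_closed_interval[OF T t])
      then show "pd_t T \<phi> t ?y = pd_t T \<phi> t x" by (simp add: eq[OF t])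
    qed
  qed
qed

text \<open>\<open>u\<close> has a time derivative only in the sense of \<open>incr\<close>. The
  product is therefore expanded on short intervals, the increment of \<open>u\<close> being tested
  with \<open>p\<close> at the left end, and the errors are summed over a partition.\<close>

lemma time_product_rule:
  fixes u w :: "real \<Rightarrow> real^3 \<Rightarrow> 'b::euclidean_space"
  assumes T: "T > 0" and u: "CL T u" and w: "CL T w"
    and incr: "\<And>a b \<psi>. 0 \<le> a \<Longrightarrow> a \<le> b \<Longrightarrow> b \<le> T \<Longrightarrow> L2 \<psi> \<Longrightarrow> ip (\<lambda>x. u b x - u a x) \<psi> = tint a b (\<lambda>t. ip (w t) \<psi>)"
    and p: "CP T p" and q: "CP T q"
    and pq: "\<And>t x. t \<in> {0..T} \<Longrightarrow> ((\<lambda>r. p r x) has_vector_derivative q t x) (at t within {0..T})"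
  shows "ip (u T) (p T) - ip (u 0) (p 0) = tint 0 T (\<lambda>t. ip (u t) (q t) + ip (w t) (p t))"
proof -
  note pL = CL_CP[OF p] and qL = CL_CP[OF q]
  let ?Y = "\<lambda>t. ip (u t) (p t)" and ?Z = "\<lambda>t. ip (u t) (q t) + ip (w t) (p t)"
  have Zc: "continuous_on {0..T} ?Z" by (intro continuous_intros CL_ip_continuous u w pL qL)
  have key: "\<exists>d>0. \<forall>a b. 0 \<le> a \<longrightarrow> a \<le> b \<longrightarrow> b \<le> T \<longrightarrow> b - a < d \<longrightarrow> \<bar>?Y b - ?Y a - tint a b ?Z\<bar> \<le> e * (b - a)"
    if "e > 0" for e
  proof -
    obtain B where B: "B > 0" "\<And>t. t \<in> {0..T} \<Longrightarrow> n2 (u t) \<le> B" by (rule CL_bounded[OF u], rule that)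
    \<comment> \<open>Five errors \<open>t1\<close> to \<open>t5\<close> share \<open>e\<close>;
      \<open>e2\<close> is scaled so that the bound \<open>B\<close> of \<open>u\<close> and the
      factor \<open>sqrt vol\<close> turn it into \<open>e1\<close>.\<close>
    define e1 where "e1 = e / 5"
    define e2 where "e2 = e / (5 * (B * sqrt vol))"
    have e1: "e1 > 0" and e2: "e2 > 0" using \<open>e > 0\<close> B(1) vol_pos by (simp_all add: e1_def e2_def)
    obtain d1 where d1: "d1 > 0" "\<And>a s t. a \<in> {0..T} \<Longrightarrow> s \<in> {0..T} \<Longrightarrow> t \<in> {0..T} \<Longrightarrow> \<bar>s - a\<bar> < d1 \<Longrightarrow> \<bar>t - a\<bar> < d1 \<Longrightarrow>
       \<bar>ip (u s) (q t) - ip (u a) (q a)\<bar> \<le> e1" by (rule CL_ip_close[OF u qL e1], rule that)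
    obtain d2 where d2: "d2 > 0" "\<And>a s t. a \<in> {0..T} \<Longrightarrow> s \<in> {0..T} \<Longrightarrow> t \<in> {0..T} \<Longrightarrow> \<bar>s - a\<bar> < d2 \<Longrightarrow> \<bar>t - a\<bar> < d2 \<Longrightarrow>
       \<bar>ip (w s) (p t) - ip (w a) (p a)\<bar> \<le> e1" by (rule CL_ip_close[OF w pL e1], rule that)
    obtain d3 where d3: "d3 > 0" "\<And>s t x. s \<in> {0..T} \<Longrightarrow> t \<in> {0..T} \<Longrightarrow> \<bar>s - t\<bar> < d3 \<Longrightarrow> x \<in> cell \<Longrightarrow> norm (q s x - q t x) < e2"
      by (rule CP_uniform[OF q e2], rule that)
    show ?thesis
    proof (intro exI[of _ "min d1 (min d2 d3)"] conjI allI impI)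
      fix a b assume ab: "0 \<le> a" "a \<le> b" "b \<le> T" "b - a < min d1 (min d2 d3)"
      let ?h = "b - a"
      have a: "a \<in> {0..T}" and b: "b \<in> {0..T}" using ab by auto
      note L = CL_L2[OF u a] CL_L2[OF u b] CL_L2[OF w a] CL_L2[OF pL a] CL_L2[OF pL b] CL_L2[OF qL a]
      have i1: "integrable (lebesgue_on {a..b}) (\<lambda>t. ip (u t) (q t))"
        by (rule continuous_tint[OF CL_ip_continuous[OF u qL] ab(1,3)])
      have i2: "integrable (lebesgue_on {a..b}) (\<lambda>t. ip (w t) (p t))"
        by (rule continuous_tint[OF CL_ip_continuous[OF w pL] ab(1,3)])
      have i3: "integrable (lebesgue_on {a..b}) (\<lambda>t. ip (w t) (p a))"
        by (rule continuous_tint[OF CL_ip_continuous[OF w CL_const[OF L(4)]] ab(1,3)])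
      have t1: "\<bar>tint a b (\<lambda>t. ip (u t) (q t)) - ?h * ip (u a) (q a)\<bar> \<le> e1 * ?h"
        by (rule tint_close[OF i1 ab(2)]) (rule d1(2), use ab in auto)
      have t2: "\<bar>tint a b (\<lambda>t. ip (w t) (p t)) - ?h * ip (w a) (p a)\<bar> \<le> e1 * ?h"
        by (rule tint_close[OF i2 ab(2)]) (rule d2(2), use ab in auto)
      have t3: "\<bar>tint a b (\<lambda>t. ip (w t) (p a)) - ?h * ip (w a) (p a)\<bar> \<le> e1 * ?h"
        by (rule tint_close[OF i3 ab(2)]) (rule d2(2), use ab in auto)
      have "\<bar>ip (u b) (q a) - ip (u a) (q a)\<bar> \<le> e1" by (rule d1(2)) (use ab in auto)
      then have "?h * \<bar>ip (u b) (q a) - ip (u a) (q a)\<bar> \<le> ?h * e1" using ab(2) by (intro mult_left_mono) auto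
      then have t4: "\<bar>?h * ip (u b) (q a) - ?h * ip (u a) (q a)\<bar> \<le> e1 * ?h"
        using ab(2) by (simp add: right_diff_distrib[symmetric] abs_mult mult.commute)
      \<comment> \<open>First-order expansion of \<open>p\<close> in time with a remainder uniform
        in \<open>x\<close>.\<close>
      have mv: "norm (p b x - p a x - ?h *\<^sub>R q a x) \<le> e2 * ?h" if x: "x \<in> cell" for x
      proof -
        have "norm ((p b x - b *\<^sub>R q a x) - (p a x - a *\<^sub>R q a x)) \<le> e2 * norm (b - a)"
        proof (rule differentiable_bound[where S="{a..b}" and f="\<lambda>s. p s x - s *\<^sub>R q a x" and f'="\<lambda>s r. r *\<^sub>R (q s x - q a x)"])
          fix s assume s: "s \<in> {a..b}"
          then have s': "s \<in> {0..T}" using ab by auto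
          have "((\<lambda>r. p r x) has_vector_derivative q s x) (at s within {a..b})"
            by (rule has_vector_derivative_within_subset[OF pq[OF s']]) (use ab in auto)
          then have "((\<lambda>r. p r x - r *\<^sub>R q a x) has_vector_derivative q s x - q a x) (at s within {a..b})"
            by (auto intro!: derivative_eq_intros simp: has_vector_derivative_def scaleR_diff_right)
          then show "((\<lambda>s. p s x - s *\<^sub>R q a x) has_derivative (\<lambda>r. r *\<^sub>R (q s x - q a x))) (at s within {a..b})"
            by (simp add: has_vector_derivative_def)
          have le: "norm (q s x - q a x) \<le> e2"
            by (rule less_imp_le[OF d3(2)[OF s' a _ x]]) (use s ab in auto)
          show "onorm (\<lambda>r. r *\<^sub>R (q s x - q a x)) \<le> e2"
            by (rule onorm_le) (use le in \<open>simp add: mult.commute[of e2] mult_left_mono\<close>)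
        qed (use ab in auto)
        moreover have "(p b x - b *\<^sub>R q a x) - (p a x - a *\<^sub>R q a x) = p b x - p a x - ?h *\<^sub>R q a x"
          by (simp add: algebra_simps)
        ultimately show ?thesis using ab(2) by simp
      qed
      let ?r = "\<lambda>x. p b x - p a x - ?h *\<^sub>R q a x"
      have rL: "L2 ?r" by (intro L2_diff L2_scaleR L)
      have "n2 ?r \<le> sqrt vol * (e2 * ?h)"
        by (rule n2_le_bound[OF L2_measurable[OF rL] AE_torus_I[OF mv]]) (use e2 ab in auto)
      then have "n2 (u b) * n2 ?r \<le> B * (sqrt vol * (e2 * ?h))"
        using B(1) by (intro mult_mono B(2)[OF b]) auto
      also have "\<dots> = e1 * ?h" using B(1) vol_pos by (simp add: e1_def e2_def)
      finally have t5: "\<bar>ip (u b) ?r\<bar> \<le> e1 * ?h" using ip_Cauchy_Schwarz[OF L(2) rL] by linarith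
      have e5: "ip (u b) ?r = ip (u b) (p b) - ip (u b) (p a) - ?h * ip (u b) (q a)"
        using L by (simp add: ip_diff_right ip_scale_right)
      have inc: "ip (u b) (p a) - ip (u a) (p a) = tint a b (\<lambda>t. ip (w t) (p a))"
        using incr[OF ab(1-3) L(4)] L by (simp add: ip_diff_left)
      have Zs: "tint a b ?Z = tint a b (\<lambda>t. ip (u t) (q t)) + tint a b (\<lambda>t. ip (w t) (p t))"
        by (rule Bochner_Integration.integral_add[OF i1 i2])
      have "e1 * ?h + e1 * ?h + e1 * ?h + e1 * ?h + e1 * ?h = e * ?h" by (simp add: e1_def)
      then show "\<bar>?Y b - ?Y a - tint a b ?Z\<bar> \<le> e * ?h"
        using t1 t2 t3 t4 t5 e5 inc Zs by linarith
    qed (use d1 d2 d3 in simp)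
  qed
  define f where "f t = ?Y t - tint 0 t ?Z" for t
  have fd: "f b - f a = ?Y b - ?Y a - tint a b ?Z" if ab: "0 \<le> a" "a \<le> b" "b \<le> T" for a b
    using tint_split[OF continuous_tint[OF Zc order_refl ab(3)] ab(1,2)] by (simp add: f_def)
  \<comment> \<open>\<open>partition_estimate\<close> is one-sided; using it with mass 0 for
    \<open>f\<close> and, through the sign \<open>c\<close>, for its negative shows that
    \<open>f\<close> has the same value at both ends.\<close>
  have close: "\<exists>d>0. \<forall>a b. 0 \<le> a \<longrightarrow> a \<le> b \<longrightarrow> b \<le> T \<longrightarrow> b - a < d \<longrightarrow> c * f b - c * f a \<le> 0 + e * (b - a)"
    if e: "e > 0" and c: "\<bar>c\<bar> = 1" for e c
  proof -
    from key[OF e] obtain d where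
      "0 < d \<and> (\<forall>a b. 0 \<le> a \<longrightarrow> a \<le> b \<longrightarrow> b \<le> T \<longrightarrow> b - a < d \<longrightarrow> \<bar>?Y b - ?Y a - tint a b ?Z\<bar> \<le> e * (b - a))" ..
    note d = this[THEN conjunct1] this[THEN conjunct2, rule_format]
    show ?thesis
    proof (intro exI[of _ d] conjI allI impI d(1))
      fix a b assume ab: "0 \<le> a" "a \<le> b" "b \<le> T" "b - a < d"
      have "\<bar>f b - f a\<bar> \<le> e * (b - a)" using d(2)[OF ab] fd[OF ab(1-3)] by simp
      moreover have "c * f b - c * f a \<le> \<bar>c * (f b - f a)\<bar>" by (simp add: right_diff_distrib)
      ultimately show "c * f b - c * f a \<le> 0 + e * (b - a)" using c by (simp add: abs_mult)
    qed
  qed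
  have "1 * f T - 1 * f 0 \<le> 0"
    by (rule partition_estimate[where f="\<lambda>t. 1 * f t" and m="\<lambda>_ _. 0" and T=T, OF _ _ close]) (use T in auto)
  moreover have "-1 * f T - -1 * f 0 \<le> 0"
    by (rule partition_estimate[where f="\<lambda>t. -1 * f t" and m="\<lambda>_ _. 0" and T=T, OF _ _ close]) (use T in auto)
  ultimately have "f T = f 0" by simp
  moreover have "tint 0 0 ?Z = 0"
  proof -
    have "continuous_on {0..0} ?Z" by (rule continuous_on_subset[OF Zc]) (use T in auto)
    then show ?thesis
      using tint_split[OF continuous_imp_integrable_real, of 0 0 ?Z 0] by simp
  qed
  ultimately show ?thesis by (simp add: f_def)
qed

text \<open>The product rule with a test function vanishing near both ends; vector values are
  reduced to scalars by pairing with a constant \<open>c\<close>.\<close>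

lemma has_weak_time_deriv_I:
  fixes u w :: "real \<Rightarrow> real^3 \<Rightarrow> 'b::euclidean_space"
  assumes T: "T > 0" and u: "CL T u" and w: "CL T w"
    and incr: "\<And>a b \<psi>. 0 \<le> a \<Longrightarrow> a \<le> b \<Longrightarrow> b \<le> T \<Longrightarrow> L2 \<psi> \<Longrightarrow> ip (\<lambda>x. u b x - u a x) \<psi> = tint a b (\<lambda>t. ip (w t) \<psi>)"
  shows "has_weak_time_deriv T u w"
  unfolding has_weak_time_deriv_def
proof (intro conjI allI impI L1_sob_0_CL w)
  fix \<phi> :: "real \<Rightarrow> real^3 \<Rightarrow> real"
  assume asm: "test_fun T \<phi> \<and> (\<exists>\<epsilon>>0. \<forall>t\<in>{0..T}. t < \<epsilon> \<or> T - \<epsilon> < t \<longrightarrow> (\<forall>x. \<phi> t x = 0))"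
  note \<phi> = asm[THEN conjunct1]
  from asm[THEN conjunct2] obtain \<epsilon> where "0 < \<epsilon> \<and> (\<forall>t\<in>{0..T}. t < \<epsilon> \<or> T - \<epsilon> < t \<longrightarrow> (\<forall>x. \<phi> t x = 0))" ..
  note \<epsilon> = this[THEN conjunct1] this[THEN conjunct2, rule_format]
  have zero: "\<phi> 0 x = 0" "\<phi> T x = 0" for x using \<epsilon> T by auto
  note cp = test_fun_CP[OF T \<phi>]
  have sc: "CP T (\<lambda>t x. f t x *\<^sub>R c)" if "CP T f" for f :: "real \<Rightarrow> real^3 \<Rightarrow> real" and c :: 'b
    by (rule CP_bounded_linear[OF bounded_linear_scaleR_left that])
  have comp: "(\<integral>x. f t x *\<^sub>R y t x \<partial>torus) \<bullet> c = ip (y t) (\<lambda>x. f t x *\<^sub>R c)"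
    if "CP T f" "CL T y" "t \<in> {0..T}" for f y t and c :: 'b
  proof -
    have "integrable torus (\<lambda>x. f t x *\<^sub>R y t x)"
      by (intro L2_integrable L2_continuous_scaleR CP_continuous[OF that(1,3)] CL_L2[OF that(2,3)])
    then show ?thesis by (simp add: ip_def flip: integral_inner_left)
  qed
  have int: "integrable (lebesgue_on {0..T}) (\<lambda>t. \<integral>x. f t x *\<^sub>R y t x \<partial>torus)" if f: "CP T f" and y: "CL T y"
    for f and y :: "real \<Rightarrow> real^3 \<Rightarrow> 'b"
  proof (rule continuous_tint)
    show "continuous_on {0..T} (\<lambda>t. \<integral>x. f t x *\<^sub>R y t x \<partial>torus)"
    proof (rule continuous_on_componentwise[THEN iffD2], rule ballI)
      fix c :: 'b
      have "continuous_on {0..T} (\<lambda>t. ip (y t) (\<lambda>x. f t x *\<^sub>R c))"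
        by (rule CL_ip_continuous[OF y CL_CP[OF sc[OF f]]])
      then show "continuous_on {0..T} (\<lambda>t. (\<integral>x. f t x *\<^sub>R y t x \<partial>torus) \<bullet> c)"
        by (rule continuous_on_eq) (simp add: comp[OF f y])
    qed
  qed auto
  let ?A = "\<integral>t. (\<integral>x. pd_t T \<phi> t x *\<^sub>R u t x \<partial>torus) \<partial>lebesgue_on {0..T}"
  let ?B = "\<integral>t. (\<integral>x. \<phi> t x *\<^sub>R w t x \<partial>torus) \<partial>lebesgue_on {0..T}"
  have "(?A + ?B) \<bullet> c = 0" for c
  proof -
    let ?p = "\<lambda>t x. \<phi> t x *\<^sub>R c" and ?q = "\<lambda>t x. pd_t T \<phi> t x *\<^sub>R c"
    have "ip (u T) (?p T) - ip (u 0) (?p 0) = tint 0 T (\<lambda>t. ip (u t) (?q t) + ip (w t) (?p t))"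
    proof (rule time_product_rule[OF T u w incr sc[OF cp(1)] sc[OF cp(2)]])
      show "((\<lambda>r. ?p r x) has_vector_derivative ?q t x) (at t within {0..T})" if "t \<in> {0..T}" for t x
        by (rule bounded_linear.has_vector_derivative[OF bounded_linear_scaleR_left cp(3)[OF that]])
    qed
    then have z: "tint 0 T (\<lambda>t. ip (u t) (?q t) + ip (w t) (?p t)) = 0" by (simp add: zero ip_def)
    have i1: "integrable (lebesgue_on {0..T}) (\<lambda>t. ip (u t) (?q t))"
      by (rule continuous_tint[OF CL_ip_continuous[OF u CL_CP[OF sc[OF cp(2)]]]]) auto
    have i2: "integrable (lebesgue_on {0..T}) (\<lambda>t. ip (w t) (?p t))"
      by (rule continuous_tint[OF CL_ip_continuous[OF w CL_CP[OF sc[OF cp(1)]]]]) auto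
    note i = i1 i2
    have "?A \<bullet> c = tint 0 T (\<lambda>t. (\<integral>x. pd_t T \<phi> t x *\<^sub>R u t x \<partial>torus) \<bullet> c)"
      by (rule integral_inner_left[symmetric]) (rule int[OF cp(2) u])
    also have "\<dots> = tint 0 T (\<lambda>t. ip (u t) (?q t))" by (rule tint_cong) (rule comp[OF cp(2) u])
    finally have A: "?A \<bullet> c = tint 0 T (\<lambda>t. ip (u t) (?q t))" .
    have "?B \<bullet> c = tint 0 T (\<lambda>t. (\<integral>x. \<phi> t x *\<^sub>R w t x \<partial>torus) \<bullet> c)"
      by (rule integral_inner_left[symmetric]) (rule int[OF cp(1) w])
    also have "\<dots> = tint 0 T (\<lambda>t. ip (w t) (?p t))" by (rule tint_cong) (rule comp[OF cp(1) w])
    finally have B: "?B \<bullet> c = tint 0 T (\<lambda>t. ip (w t) (?p t))" .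
    show ?thesis using z unfolding inner_add_left A B by (simp add: Bochner_Integration.integral_add[OF i])
  qed
  from this[of "?A + ?B"] have "?A + ?B = 0" by simp
  then show "?A = - ?B" by (simp add: eq_neg_iff_add_eq_0)
qed

section \<open>Integration by parts\<close>

text \<open>The derivative is an argument so that product rules return the integrands of
  integrations by parts explicitly.\<close>

definition C1p :: "3 \<Rightarrow> (real^3 \<Rightarrow> 'b::euclidean_space) \<Rightarrow> (real^3 \<Rightarrow> 'b) \<Rightarrow> bool" where
  "C1p k f f' \<longleftrightarrow> continuous_on UNIV f \<and> periodic f \<and> continuous_on UNIV f' \<and> has_partial k f f'"

lemma C1p_continuous: "C1p k f f' \<Longrightarrow> continuous_on UNIV f" "C1p k f f' \<Longrightarrow> continuous_on UNIV f'"
  by (simp_all add: C1p_def)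

lemma C1p_integral: "C1p k f f' \<Longrightarrow> (\<integral>x. f' x \<partial>torus) = 0"
  unfolding C1p_def by (elim conjE) (rule torus_integral_partial)

lemma C1p_bilinear:
  assumes h: "bounded_bilinear h" and f: "C1p k f f'" and g: "C1p k g g'"
  shows "C1p k (\<lambda>x. h (f x) (g x)) (\<lambda>x. h (f x) (g' x) + h (f' x) (g x))"
  unfolding C1p_def has_partial_def
proof (intro conjI allI continuous_intros bounded_bilinear.continuous_on[OF h] C1p_continuous[OF f] C1p_continuous[OF g])
  show "periodic (\<lambda>x. h (f x) (g x))" using f g by (simp add: C1p_def periodic_def)
  fix x
  have "((\<lambda>s. f (x + s *\<^sub>R axis k 1)) has_vector_derivative f' x) (at 0)"
    "((\<lambda>s. g (x + s *\<^sub>R axis k 1)) has_vector_derivative g' x) (at 0)"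
    using f g by (simp_all add: C1p_def has_partial_def)
  from bounded_bilinear.has_vector_derivative[OF h this]
  show "((\<lambda>s. h (f (x + s *\<^sub>R axis k 1)) (g (x + s *\<^sub>R axis k 1))) has_vector_derivative h (f x) (g' x) + h (f' x) (g x)) (at 0)"
    by simp
qed

lemma C1p_linear:
  assumes h: "bounded_linear h" and f: "C1p k f f'" shows "C1p k (\<lambda>x. h (f x)) (\<lambda>x. h (f' x))"
  unfolding C1p_def has_partial_def
proof (intro conjI allI bounded_linear.continuous_on[OF h] C1p_continuous[OF f])
  show "periodic (\<lambda>x. h (f x))" using f by (simp add: C1p_def periodic_def)
  fix x
  have "((\<lambda>s. f (x + s *\<^sub>R axis k 1)) has_vector_derivative f' x) (at 0)"
    using f by (simp add: C1p_def has_partial_def)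
  from bounded_linear.has_vector_derivative[OF h this]
  show "((\<lambda>s. h (f (x + s *\<^sub>R axis k 1))) has_vector_derivative h (f' x)) (at 0)" .
qed

lemma C1p_const: "C1p k (\<lambda>x. c) (\<lambda>x. 0)"
  by (simp add: C1p_def has_partial_def periodic_def)

lemmas C1p_nth = C1p_linear[OF bounded_linear_vec_nth]
  and C1p_inner = C1p_bilinear[OF bounded_bilinear_inner]
  and C1p_mult = C1p_bilinear[OF bounded_bilinear_mult]

lemma C1p_tpoly: "C1p k (tpoly \<kappa> a n) (pd k (tpoly \<kappa> a n))"
  unfolding C1p_def
  by (intro conjI continuous_tpoly periodic_tpoly has_partial_if_differentiable tpoly_differentiable)
    (simp add: pd_tpoly continuous_tpoly)

lemma integral_torus_cong_AE:
  fixes f g :: "real^3 \<Rightarrow> 'b::euclidean_space"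
  assumes "AE x in torus. f x = g x" "continuous_on UNIV g" shows "(\<integral>x. f x \<partial>torus) = (\<integral>x. g x \<partial>torus)"
proof -
  have g: "g \<in> borel_measurable torus" by (rule continuous_torus_measurable[OF assms(2)])
  have ae: "AE x in torus. g x = f x" using assms(1) by eventually_elim simp
  show ?thesis by (rule integral_cong_AE[OF torus_measurable_cong_AE[OF g ae] g assms(1)])
qed

text \<open>The derivatives of V_k (U \<bullet> \<Psi>) in direction k integrate to 0, and the terms
  in which \<open>V\<close> is differentiated add up to the divergence, which is 0
  pointwise.\<close>

lemma transport_by_parts:
  fixes U \<Psi> :: "real^3 \<Rightarrow> 'b::euclidean_space" and V :: "real^3 \<Rightarrow> real^3"
  assumes V: "\<And>k. C1p k V (V' k)" and div: "\<And>x. (\<Sum>k\<in>UNIV. V' k x $ k) = 0"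
    and U: "\<And>k. C1p k U (U' k)" and \<Psi>: "\<And>k. C1p k \<Psi> (\<Psi>' k)"
  shows "(\<integral>x. (\<Sum>k\<in>UNIV. V x $ k * (U x \<bullet> \<Psi>' k x)) \<partial>torus) = - ip (\<lambda>x. \<Sum>k\<in>UNIV. V x $ k *\<^sub>R U' k x) \<Psi>"
proof -
  note c = C1p_continuous
  have cV: "continuous_on UNIV (\<lambda>x. V x $ k)" for k by (rule c(1)[OF C1p_nth[OF V]])
  note cs = cV c(1)[OF U] c(2)[OF U] c(1)[OF \<Psi>] c(2)[OF \<Psi>]
  have p: "C1p k (\<lambda>x. V x $ k * (U x \<bullet> \<Psi> x))
      (\<lambda>x. V x $ k * (U x \<bullet> \<Psi>' k x + U' k x \<bullet> \<Psi> x) + V' k x $ k * (U x \<bullet> \<Psi> x))" for k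
    by (rule C1p_mult[OF C1p_nth[OF V] C1p_inner[OF U \<Psi>]])
  have "(\<integral>x. (\<Sum>k\<in>UNIV. V x $ k * (U x \<bullet> \<Psi>' k x + U' k x \<bullet> \<Psi> x) + V' k x $ k * (U x \<bullet> \<Psi> x)) \<partial>torus) = 0"
    by (subst Bochner_Integration.integral_sum)
      (simp_all add: continuous_torus_integrable[OF c(2)[OF p]] C1p_integral[OF p])
  moreover have "(\<Sum>k\<in>UNIV. V x $ k * (U x \<bullet> \<Psi>' k x + U' k x \<bullet> \<Psi> x) + V' k x $ k * (U x \<bullet> \<Psi> x))
      = (\<Sum>k\<in>UNIV. V x $ k * (U x \<bullet> \<Psi>' k x)) + (\<Sum>k\<in>UNIV. V x $ k *\<^sub>R U' k x) \<bullet> \<Psi> x" for x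
  proof -
    have "(\<Sum>k\<in>UNIV. V x $ k * (U x \<bullet> \<Psi>' k x + U' k x \<bullet> \<Psi> x) + V' k x $ k * (U x \<bullet> \<Psi> x))
      = (\<Sum>k\<in>UNIV. V x $ k * (U x \<bullet> \<Psi>' k x)) + (\<Sum>k\<in>UNIV. V x $ k *\<^sub>R U' k x) \<bullet> \<Psi> x
        + (\<Sum>k\<in>UNIV. V' k x $ k) * (U x \<bullet> \<Psi> x)"
      by (simp add: sum.distrib distrib_left inner_sum_left sum_distrib_right)
    then show ?thesis by (simp add: div)
  qed
  ultimately have "(\<integral>x. (\<Sum>k\<in>UNIV. V x $ k * (U x \<bullet> \<Psi>' k x)) + (\<Sum>k\<in>UNIV. V x $ k *\<^sub>R U' k x) \<bullet> \<Psi> x \<partial>torus) = 0"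
    by simp
  moreover have "integrable torus (\<lambda>x. \<Sum>k\<in>UNIV. V x $ k * (U x \<bullet> \<Psi>' k x))"
    "integrable torus (\<lambda>x. (\<Sum>k\<in>UNIV. V x $ k *\<^sub>R U' k x) \<bullet> \<Psi> x)"
    by (intro continuous_torus_integrable continuous_intros cs)+
  ultimately show ?thesis unfolding ip_def by simp
qed

lemma inner_tensor3: "(\<chi> i j k. A k $ i $ j) \<bullet> (\<chi> i j k. B k $ i $ j) = (\<Sum>k\<in>UNIV. (A k :: real^3^3) \<bullet> B k)"
proof -
  have "(\<chi> i j k. A k $ i $ j) \<bullet> (\<chi> i j k. B k $ i $ j)
      = (\<Sum>i\<in>UNIV. \<Sum>j\<in>UNIV. \<Sum>k\<in>UNIV. A k $ i $ j * B k $ i $ j)" by (simp add: inner_vec_def)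
  also have "\<dots> = (\<Sum>i\<in>UNIV. \<Sum>k\<in>UNIV. \<Sum>j\<in>UNIV. A k $ i $ j * B k $ i $ j)"
    by (intro sum.cong refl sum.swap)
  also have "\<dots> = (\<Sum>k\<in>UNIV. \<Sum>i\<in>UNIV. \<Sum>j\<in>UNIV. A k $ i $ j * B k $ i $ j)" by (rule sum.swap)
  finally show ?thesis by (simp add: inner_vec_def)
qed

lemma inner_tensor2: "(\<chi> i k. A k $ i) \<bullet> (\<chi> i k. B k $ i) = (\<Sum>k\<in>UNIV. (A k :: real^3) \<bullet> B k)"
proof -
  have "(\<chi> i k. A k $ i) \<bullet> (\<chi> i k. B k $ i) = (\<Sum>i\<in>UNIV. \<Sum>k\<in>UNIV. A k $ i * B k $ i)"
    by (simp add: inner_vec_def)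
  also have "\<dots> = (\<Sum>k\<in>UNIV. \<Sum>i\<in>UNIV. A k $ i * B k $ i)" by (rule sum.swap)
  finally show ?thesis by (simp add: inner_vec_def)
qed

lemma inner_tensor_vv: "tensor_vv a a \<bullet> grad_v \<psi> x = (\<Sum>k\<in>UNIV. a $ k * (a \<bullet> pd k \<psi> x))"
proof -
  have "tensor_vv a a = (\<chi> i k. (a $ k *\<^sub>R a) $ i)" by (simp add: tensor_vv_def)
  then show ?thesis unfolding grad_v_def by (simp only: inner_tensor2 inner_scaleR_left)
qed

lemma inner_tensor_vm: "tensor_vm a B \<bullet> grad_m \<psi> x = (\<Sum>k\<in>UNIV. a $ k * (B \<bullet> pd k \<psi> x))"
proof -
  have "tensor_vm a B = (\<chi> i j k. (a $ k *\<^sub>R B) $ i $ j)" by (simp add: tensor_vm_def)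
  then show ?thesis unfolding grad_m_def by (simp only: inner_tensor3 inner_scaleR_left)
qed

lemma norm_grad_v_le:
  assumes "\<And>k. norm (pd k \<psi> x) \<le> M" shows "norm (grad_v \<psi> x) \<le> 3 * M"
proof (rule power2_le_imp_le)
  have M: "0 \<le> M" by (rule order_trans[OF norm_ge_zero assms])
  have "(norm (grad_v \<psi> x))\<^sup>2 = (\<Sum>k\<in>UNIV. (norm (pd k \<psi> x))\<^sup>2)"
    unfolding power2_norm_eq_inner grad_v_def inner_tensor2 ..
  also have "\<dots> \<le> (\<Sum>k\<in>(UNIV::3 set). M\<^sup>2)" by (intro sum_mono power_mono assms) simp
  \<comment> \<open>Three equal squares give the factor \<open>sqrt 3\<close>, rounded up to
    3.\<close>
  also have "\<dots> \<le> (3 * M)\<^sup>2" by (simp add: power_mult_distrib)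
  finally show "(norm (grad_v \<psi> x))\<^sup>2 \<le> (3 * M)\<^sup>2" .
  show "0 \<le> 3 * M" using M by simp
qed

lemma norm_grad_m_le:
  assumes "\<And>k. norm (pd k \<psi> x) \<le> M" shows "norm (grad_m \<psi> x) \<le> 3 * M"
proof (rule power2_le_imp_le)
  have M: "0 \<le> M" by (rule order_trans[OF norm_ge_zero assms])
  have "(norm (grad_m \<psi> x))\<^sup>2 = (\<Sum>k\<in>UNIV. (norm (pd k \<psi> x))\<^sup>2)"
    unfolding power2_norm_eq_inner grad_m_def inner_tensor3 ..
  also have "\<dots> \<le> (\<Sum>k\<in>(UNIV::3 set). M\<^sup>2)" by (intro sum_mono power_mono assms) simp
  also have "\<dots> \<le> (3 * M)\<^sup>2" by (simp add: power_mult_distrib)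
  finally show "(norm (grad_m \<psi> x))\<^sup>2 \<le> (3 * M)\<^sup>2" .
  show "0 \<le> 3 * M" using M by simp
qed

lemma continuous_grad_v_tpoly: "continuous_on UNIV (grad_v (tpoly \<kappa> a n))"
  unfolding grad_v_def pd_tpoly by (intro continuous_intros continuous_on_vec_lambda continuous_tpoly)

lemma continuous_grad_m_tpoly: "continuous_on UNIV (grad_m (tpoly \<kappa> a n))"
  unfolding grad_m_def pd_tpoly by (intro continuous_intros continuous_on_vec_lambda continuous_tpoly)

lemma periodic_grad_tpoly: "periodic (grad_v (tpoly \<kappa> b n))" "periodic (grad_m (tpoly \<kappa> c n))"
  unfolding periodic_def grad_v_def grad_m_def pd_tpoly
  by (simp_all add: periodic_tpoly[unfolded periodic_def, rule_format])

lemma pd_t_const: "T > 0 \<Longrightarrow> t \<in> {0..T} \<Longrightarrow> pd_t T (\<lambda>t. \<psi>) t x = 0"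
  unfolding pd_t_def
  by (rule vector_derivative_within_closed_interval) (auto intro: has_vector_derivative_const)

section \<open>Pairing with time-dependent measures\<close>

text \<open>The measurable pairing is bounded by the total variation, and \<open>N\<close> is a
  majorant of the latter. In the application \<open>N\<close> is the sum of both total variations,
  so that one mass controls both defects.\<close>

lemma tint_pairing_bound:
  fixes R :: "real \<Rightarrow> (real^3) set \<Rightarrow> 'b::euclidean_space"
  assumes R: "Linf_measure T R" and ab: "0 \<le> a" "a \<le> b" "b \<le> T"
    and \<psi>: "continuous_on UNIV \<psi>" "periodic \<psi>" "\<And>x. x \<in> cell \<Longrightarrow> norm (\<psi> x) \<le> S" and S: "S > 0"
    and N: "\<And>t. tv_norm (R t) \<le> N t" and fin: "(\<integral>\<^sup>+t. N t \<partial>lebesgue_on {a..b}) < \<infinity>"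
  shows "\<bar>tint a b (\<lambda>t. pairing (R t) \<psi>)\<bar> \<le> 2 * real DIM('b) * S * enn2real (\<integral>\<^sup>+t. N t \<partial>lebesgue_on {a..b})"
    and "integrable (lebesgue_on {a..b}) (\<lambda>t. pairing (R t) \<psi>)"
    and "tint a b (\<lambda>t. \<bar>pairing (R t) \<psi>\<bar>) \<le> 2 * real DIM('b) * S * enn2real (\<integral>\<^sup>+t. N t \<partial>lebesgue_on {a..b})"
proof -
  let ?K = "2 * real DIM('b) * S" and ?f = "\<lambda>t. pairing (R t) \<psi>" and ?L = "lebesgue_on {a..b}"
  have K: "?K > 0" using S by simp
  have meas: "?f \<in> borel_measurable ?L"
    by (rule measurable_time_mono[OF _ ab(3,1)]) (use R \<psi> in \<open>simp add: Linf_measure_def\<close>)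
  obtain C where C: "AE t in lebesgue_on {0<..<T}. tv_norm (R t) \<le> ennreal C"
    using R by (auto simp: Linf_measure_def)
  have "AE t in lebesgue_on {0<..<T}. tensor_measure (R t)" using R by (simp add: Linf_measure_def)
  with C have "AE t in lebesgue_on {0<..<T}. tensor_measure (R t) \<and> tv_norm (R t) \<le> ennreal C" by eventually_elim simp
  from AE_time_mono[OF this ab(3,1)]
  have ae: "AE t in ?L. \<bar>?f t\<bar> \<le> ?K * enn2real (tv_norm (R t)) \<and> tv_norm (R t) \<le> ennreal C"
  proof eventually_elim
    fix t assume t: "tensor_measure (R t) \<and> tv_norm (R t) \<le> ennreal C"
    then have "tv_norm (R t) < \<infinity>" by (auto intro: le_less_trans)
    with t show "\<bar>?f t\<bar> \<le> ?K * enn2real (tv_norm (R t)) \<and> tv_norm (R t) \<le> ennreal C"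
      using pairing_bound[of "R t" \<psi> S] \<psi> by simp
  qed
  show int: "integrable ?L ?f"
  proof (rule finite_measure.integrable_const_bound[OF finite_measure_lebesgue_on _ meas])
    show "AE t in ?L. norm (?f t) \<le> ?K * max 0 C"
      using ae
    proof eventually_elim
      fix t assume t: "\<bar>?f t\<bar> \<le> ?K * enn2real (tv_norm (R t)) \<and> tv_norm (R t) \<le> ennreal C"
      then have "enn2real (tv_norm (R t)) \<le> enn2real (ennreal C)" by (intro enn2real_mono) auto
      also have "\<dots> \<le> max 0 C" by (cases "0 \<le> C") (simp_all add: ennreal_neg)
      finally have "?K * enn2real (tv_norm (R t)) \<le> ?K * max 0 C" using K by (intro mult_left_mono) auto
      with t[THEN conjunct1] show "norm (?f t) \<le> ?K * max 0 C" unfolding real_norm_def by (rule order_trans)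
    qed
  qed simp
  have "(\<integral>\<^sup>+t. ennreal (\<bar>?f t\<bar> / ?K) \<partial>?L) \<le> (\<integral>\<^sup>+t. N t \<partial>?L)"
  proof (rule nn_integral_mono_AE)
    show "AE t in ?L. ennreal (\<bar>?f t\<bar> / ?K) \<le> N t"
      using ae
    proof eventually_elim
      fix t assume t: "\<bar>?f t\<bar> \<le> ?K * enn2real (tv_norm (R t)) \<and> tv_norm (R t) \<le> ennreal C"
      then have fin: "tv_norm (R t) < \<infinity>" by (auto intro: le_less_trans)
      \<comment> \<open>Dividing the measurable side by the constant leaves the lower integral of
        \<open>N\<close> untouched.\<close>
      have "\<bar>?f t\<bar> / ?K \<le> enn2real (tv_norm (R t))"
        using t K by (simp add: pos_divide_le_eq mult.commute)
      then have "ennreal (\<bar>?f t\<bar> / ?K) \<le> ennreal (enn2real (tv_norm (R t)))" by (rule ennreal_leI)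
      also have "\<dots> = tv_norm (R t)" using fin by simp
      also have "\<dots> \<le> N t" by (rule N)
      finally show "ennreal (\<bar>?f t\<bar> / ?K) \<le> N t" .
    qed
  qed
  moreover have "(\<integral>\<^sup>+t. ennreal (\<bar>?f t\<bar> / ?K) \<partial>?L) = ennreal (tint a b (\<lambda>t. \<bar>?f t\<bar> / ?K))"
    by (rule nn_integral_eq_integral) (use int K in auto)
  ultimately have "ennreal (tint a b (\<lambda>t. \<bar>?f t\<bar> / ?K)) \<le> ennreal (enn2real (\<integral>\<^sup>+t. N t \<partial>?L))"
    using fin by simp
  then have "tint a b (\<lambda>t. \<bar>?f t\<bar> / ?K) \<le> enn2real (\<integral>\<^sup>+t. N t \<partial>?L)" by (simp add: ennreal_le_iff)
  then show "tint a b (\<lambda>t. \<bar>?f t\<bar>) \<le> ?K * enn2real (\<integral>\<^sup>+t. N t \<partial>?L)"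
    using K by (simp add: pos_divide_le_eq mult.commute)
  then show "\<bar>tint a b ?f\<bar> \<le> ?K * enn2real (\<integral>\<^sup>+t. N t \<partial>?L)"
    using integral_abs_bound[of ?L ?f] by linarith
qed

section \<open>Spatial identities\<close>

definition conv :: "(real^3 \<Rightarrow> real^3) \<Rightarrow> (3 \<Rightarrow> real^3 \<Rightarrow> 'b::euclidean_space) \<Rightarrow> real^3 \<Rightarrow> 'b" where
  "conv V U' x = (\<Sum>k\<in>UNIV. V x $ k *\<^sub>R U' k x)"

text \<open>The row divergence of \<nabla>Q \<odot> \<nabla>Q after the product rule;
  \<open>Q'' j i\<close> is the derivative of \<open>Q' i\<close> in direction
  \<open>j\<close>.\<close>

definition stress_div :: "(3 \<Rightarrow> real^3 \<Rightarrow> real^3^3) \<Rightarrow> (3 \<Rightarrow> 3 \<Rightarrow> real^3 \<Rightarrow> real^3^3) \<Rightarrow> real^3 \<Rightarrow> real^3" where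
  "stress_div Q' Q'' x = (\<chi> i. \<Sum>j\<in>UNIV. Q'' j i x \<bullet> Q' j x + Q' i x \<bullet> Q'' j j x)"

definition lap :: "(3 \<Rightarrow> 3 \<Rightarrow> real^3 \<Rightarrow> real^3^3) \<Rightarrow> real^3 \<Rightarrow> real^3^3" where
  "lap Q'' x = (\<Sum>k\<in>UNIV. Q'' k k x)"

lemma continuous_conv:
  "continuous_on UNIV V \<Longrightarrow> (\<And>k. continuous_on UNIV (U' k)) \<Longrightarrow> continuous_on UNIV (conv V U')"
  unfolding conv_def by (intro continuous_intros)

lemma continuous_stress_div:
  "(\<And>k. continuous_on UNIV (Q' k)) \<Longrightarrow> (\<And>j k. continuous_on UNIV (Q'' j k)) \<Longrightarrow> continuous_on UNIV (stress_div Q' Q'')"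
  unfolding stress_div_def by (intro continuous_intros continuous_on_vec_lambda)

lemma continuous_lap: "(\<And>j k. continuous_on UNIV (Q'' j k)) \<Longrightarrow> continuous_on UNIV (lap Q'')"
  unfolding lap_def by (intro continuous_intros)

lemma conv_by_parts:
  fixes U \<Psi> :: "real^3 \<Rightarrow> 'b::euclidean_space" and V :: "real^3 \<Rightarrow> real^3"
  assumes V: "\<And>k. C1p k V (V' k)" and div: "\<And>x. (\<Sum>k\<in>UNIV. V' k x $ k) = 0"
    and U: "\<And>k. C1p k U (U' k)" and \<Psi>: "\<And>k. C1p k \<Psi> (\<Psi>' k)"
  shows "(\<integral>x. (\<Sum>k\<in>UNIV. V x $ k * (U x \<bullet> \<Psi>' k x)) \<partial>torus) = - ip (conv V U') \<Psi>"
proof -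
  have "conv V U' = (\<lambda>x. \<Sum>k\<in>UNIV. V x $ k *\<^sub>R U' k x)" by (rule ext) (simp add: conv_def)
  then show ?thesis using transport_by_parts[OF V div U \<Psi>] by simp
qed

text \<open>Integration by parts with \<Psi> = U equates the quantity with its own negative:
  transport by a divergence-free field is skew-symmetric.\<close>

lemma ip_conv_self:
  fixes U :: "real^3 \<Rightarrow> 'b::euclidean_space"
  assumes V: "\<And>k. C1p k V (V' k)" and div: "\<And>x. (\<Sum>k\<in>UNIV. V' k x $ k) = 0"
    and U: "\<And>k. C1p k U (U' k)"
  shows "ip (conv V U') U = 0"
proof -
  have "(\<integral>x. (\<Sum>k\<in>UNIV. V x $ k * (U x \<bullet> U' k x)) \<partial>torus) = ip (conv V U') U"
    by (simp add: ip_def conv_def inner_sum_left inner_commute[of "U _"])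
  with conv_by_parts[OF V div U U] show ?thesis by simp
qed

lemma lap_by_parts:
  assumes Q': "\<And>k. C1p k (Q' k) (Q'' k k)" and \<Psi>: "\<And>k. C1p k \<Psi> (\<Psi>' k)"
  shows "(\<integral>x. (\<Sum>k\<in>UNIV. Q' k x \<bullet> \<Psi>' k x) \<partial>torus) = - ip (lap Q'') \<Psi>"
proof -
  note c = C1p_continuous[OF Q'] C1p_continuous[OF \<Psi>]
  have "(\<integral>x. (\<Sum>k\<in>UNIV. Q' k x \<bullet> \<Psi>' k x + Q'' k k x \<bullet> \<Psi> x) \<partial>torus) = 0"
    by (subst Bochner_Integration.integral_sum)
      (simp_all add: continuous_torus_integrable[OF C1p_continuous(2)[OF C1p_inner[OF Q' \<Psi>]]] C1p_integral[OF C1p_inner[OF Q' \<Psi>]])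
  moreover have "(\<Sum>k\<in>UNIV. Q' k x \<bullet> \<Psi>' k x + Q'' k k x \<bullet> \<Psi> x) = (\<Sum>k\<in>UNIV. Q' k x \<bullet> \<Psi>' k x) + lap Q'' x \<bullet> \<Psi> x" for x
    by (simp add: sum.distrib lap_def inner_sum_left)
  moreover have "integrable torus (\<lambda>x. \<Sum>k\<in>UNIV. Q' k x \<bullet> \<Psi>' k x)" "integrable torus (\<lambda>x. lap Q'' x \<bullet> \<Psi> x)"
    unfolding lap_def by (intro continuous_torus_integrable continuous_intros c)+
  ultimately show ?thesis unfolding ip_def by simp
qed

lemma stress_by_parts:
  assumes Q': "\<And>j k. C1p j (Q' k) (Q'' j k)" and \<psi>: "\<And>k. C1p k \<psi> (pd k \<psi>)"
  shows "(\<integral>x. (\<chi> i j. Q' i x \<bullet> Q' j x) \<bullet> grad_v \<psi> x \<partial>torus) = - ip (stress_div Q' Q'') \<psi>"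
proof -
  note c = C1p_continuous[OF Q'] C1p_continuous[OF \<psi>]
  have cn: "continuous_on UNIV (\<lambda>x. \<psi> x $ i)" "continuous_on UNIV (\<lambda>x. pd j \<psi> x $ i)" for i j
    by (intro continuous_intros c)+
  let ?I = "\<lambda>i j x. (Q' i x \<bullet> Q' j x) * pd j \<psi> x $ i + (Q' i x \<bullet> Q'' j j x + Q'' j i x \<bullet> Q' j x) * \<psi> x $ i"
  have p: "C1p j (\<lambda>x. (Q' i x \<bullet> Q' j x) * \<psi> x $ i) (?I i j)" for i j
    by (rule C1p_mult[OF C1p_inner[OF Q' Q'] C1p_nth[OF \<psi>]])
  have "(\<integral>x. (\<Sum>i\<in>UNIV. \<Sum>j\<in>UNIV. ?I i j x) \<partial>torus) = (\<Sum>i\<in>UNIV. \<integral>x. (\<Sum>j\<in>UNIV. ?I i j x) \<partial>torus)"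
    by (rule Bochner_Integration.integral_sum)
      (intro Bochner_Integration.integrable_sum continuous_torus_integrable[OF C1p_continuous(2)[OF p]])
  also have "\<dots> = (\<Sum>i\<in>UNIV. \<Sum>j\<in>UNIV. \<integral>x. ?I i j x \<partial>torus)"
    by (intro sum.cong refl Bochner_Integration.integral_sum continuous_torus_integrable[OF C1p_continuous(2)[OF p]])
  also have "\<dots> = 0" by (simp add: C1p_integral[OF p])
  finally have z: "(\<integral>x. (\<Sum>i\<in>UNIV. \<Sum>j\<in>UNIV. ?I i j x) \<partial>torus) = 0" .
  have "(\<Sum>i\<in>UNIV. \<Sum>j\<in>UNIV. ?I i j x) = (\<chi> i j. Q' i x \<bullet> Q' j x) \<bullet> grad_v \<psi> x + stress_div Q' Q'' x \<bullet> \<psi> x" for x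
    by (simp add: sum.distrib stress_div_def grad_v_def inner_vec_def[where 'b=3] sum_distrib_right distrib_right add_ac)
  with z have z': "(\<integral>x. (\<chi> i j. Q' i x \<bullet> Q' j x) \<bullet> grad_v \<psi> x + stress_div Q' Q'' x \<bullet> \<psi> x \<partial>torus) = 0" by simp
  have "integrable torus (\<lambda>x. (\<chi> i j. Q' i x \<bullet> Q' j x) \<bullet> grad_v \<psi> x)"
    unfolding grad_v_def by (intro continuous_torus_integrable continuous_intros continuous_on_vec_lambda c cn)
  moreover have "integrable torus (\<lambda>x. stress_div Q' Q'' x \<bullet> \<psi> x)"
    by (intro continuous_torus_integrable continuous_intros continuous_stress_div c)
  ultimately show ?thesis using z' unfolding ip_def by simp
qed

text \<open>\<open>F\<close> is differentiable within \<open>Sym0\<close> only; since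
  \<open>Q\<close> maps the coordinate line into \<open>Sym0\<close>, the derivative within the
  image of that line suffices for the chain rule.\<close>

lemma C1p_compose_Sym0:
  assumes F: "Ck_on (Suc n) Sym0 F" and Q: "C1p k Q Q'" and S: "\<And>x. Q x \<in> Sym0"
  shows "C1p k (\<lambda>x. F (Q x)) (\<lambda>x. grad_Sym0 F (Q x) \<bullet> Q' x)"
  unfolding C1p_def has_partial_def
proof (intro conjI allI)
  note cQ = C1p_continuous[OF Q]
  show "continuous_on UNIV (\<lambda>x. F (Q x))"
    by (rule continuous_on_compose2[OF Ck_on_continuous[OF F] cQ(1)]) (use S in auto)
  show "periodic (\<lambda>x. F (Q x))" using Q by (simp add: C1p_def periodic_def)
  have "continuous_on UNIV (\<lambda>x. grad_Sym0 F (Q x))"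
    by (rule continuous_on_compose2[OF grad_Sym0(3)[OF F] cQ(1)]) (use S in auto)
  then show "continuous_on UNIV (\<lambda>x. grad_Sym0 F (Q x) \<bullet> Q' x)" by (intro continuous_on_inner cQ)
  fix x
  let ?l = "\<lambda>s. Q (x + s *\<^sub>R axis k 1)"
  have l: "(?l has_derivative (\<lambda>s. s *\<^sub>R Q' x)) (at 0)"
    using Q by (simp add: C1p_def has_partial_def has_vector_derivative_def)
  have "(F has_derivative (\<lambda>H. grad_Sym0 F (Q x) \<bullet> H)) (at (?l 0) within range ?l)"
    using has_derivative_subset[OF grad_Sym0(2)[OF F S[of x]], of "range ?l"] S by auto
  from diff_chain_within[OF l this]
  have "((\<lambda>s. F (?l s)) has_derivative (\<lambda>s. grad_Sym0 F (Q x) \<bullet> (s *\<^sub>R Q' x))) (at 0)" by (simp add: o_def)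
  then show "((\<lambda>s. F (?l s)) has_vector_derivative grad_Sym0 F (Q x) \<bullet> Q' x) (at 0)"
    by (simp add: has_vector_derivative_def)
qed

text \<open>
  The time derivative of the energy vanishes once \<open>\<partial>\<^sub>t V = - g\<close>, \<open>\<partial>\<^sub>t P = - h\<close>, \<open>\<partial>\<^sub>t Q = w\<close> are inserted.
\<close>

lemma energy_cancellation:
  assumes V: "\<And>k. C1p k V (V' k)" and div: "\<And>x. (\<Sum>k\<in>UNIV. V' k x $ k) = 0"
    and P: "\<And>k. C1p k P (P' k)" and Q: "\<And>k. C1p k Q (Q' k)" and Q': "\<And>j k. C1p j (Q' k) (Q'' j k)"
    and sym: "\<And>j k. Q'' j k = Q'' k j" and F: "Ck_on (Suc n) Sym0 F" and S: "\<And>x. Q x \<in> Sym0"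
  defines "g \<equiv> \<lambda>x. conv V V' x + stress_div Q' Q'' x"
    and "h \<equiv> \<lambda>x. conv V P' x + grad_Sym0 F (Q x) - lap Q'' x"
    and "w \<equiv> \<lambda>x. P x - conv V Q' x"
  shows "- ip g V - ip h P - ip w (lap Q'') + ip w (\<lambda>x. grad_Sym0 F (Q x)) = 0" and "ip w Q = ip Q P"
proof -
  let ?G = "\<lambda>x. grad_Sym0 F (Q x)"
  note c = C1p_continuous[OF V] C1p_continuous[OF P] C1p_continuous[OF Q] C1p_continuous[OF Q']
  have cG: "continuous_on UNIV ?G"
    by (rule continuous_on_compose2[OF grad_Sym0(3)[OF F] c(5)]) (use S in auto)
  note L = L2_continuous[OF continuous_conv[OF c(1,2)]] L2_continuous[OF continuous_conv[OF c(1,4)]] L2_continuous[OF continuous_conv[OF c(1,6)]]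
    L2_continuous[OF continuous_stress_div[OF c(7,8)]] L2_continuous[OF continuous_lap[OF c(8)]] L2_continuous[OF cG]
    L2_continuous[OF c(1)] L2_continuous[OF c(3)] L2_continuous[OF c(5)]
  have z: "ip (conv V V') V = 0" "ip (conv V P') P = 0" "ip (conv V Q') Q = 0"
    by (rule ip_conv_self[OF V div V], rule ip_conv_self[OF V div P], rule ip_conv_self[OF V div Q])
  \<comment> \<open>Integration by parts of \<open>F (Q x)\<close> against the constant 1: the
    transport of the potential has integral 0.\<close>
  have "(\<integral>x. (\<Sum>k\<in>UNIV. V x $ k * (F (Q x) \<bullet> 0)) \<partial>torus)
      = - ip (conv V (\<lambda>k x. ?G x \<bullet> Q' k x)) (\<lambda>x. 1)"
    by (rule conv_by_parts[OF V div C1p_compose_Sym0[OF F Q S] C1p_const])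
  then have G: "ip (conv V Q') ?G = 0"
    by (simp add: ip_def conv_def inner_sum_left inner_commute[of "grad_Sym0 F _"])
  have s0: "ip (conv V (\<lambda>k. Q'' k j)) (Q' j) = 0" for j by (rule ip_conv_self[OF V div Q'])
  have Lc: "L2 (conv V (\<lambda>k. Q'' k j))" "L2 (Q' j)" for j by (intro L2_continuous continuous_conv c)+
  \<comment> \<open>The identity behind the cancellation: the stress divergence tested with
    \<open>V\<close> is the transport of |\<nabla>Q|^2 / 2, whose integral vanishes by
    \<open>s0\<close>, plus the transport of \<open>Q\<close> tested with the Laplacian.\<close>
  have "stress_div Q' Q'' x \<bullet> V x = (\<Sum>j\<in>UNIV. conv V (\<lambda>k. Q'' k j) x \<bullet> Q' j x) + conv V Q' x \<bullet> lap Q'' x" for x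
  proof -
    have 1: "(\<Sum>i\<in>UNIV. \<Sum>j\<in>UNIV. (Q'' j i x \<bullet> Q' j x) * V x $ i) = (\<Sum>j\<in>UNIV. conv V (\<lambda>k. Q'' k j) x \<bullet> Q' j x)"
    proof -
      \<comment> \<open>Equality of mixed derivatives turns derivatives of \<open>Q' i\<close> in
        direction \<open>j\<close> into the transport of \<open>Q' j\<close>.\<close>
      have e: "(\<lambda>k. Q'' k j) = Q'' j" for j by (rule ext) (rule sym)
      show ?thesis unfolding e by (subst sum.swap) (simp add: conv_def inner_sum_left mult.commute)
    qed
    have 2: "(\<Sum>i\<in>UNIV. \<Sum>j\<in>UNIV. (Q' i x \<bullet> Q'' j j x) * V x $ i) = conv V Q' x \<bullet> lap Q'' x"
      unfolding conv_def lap_def inner_sum_left inner_scaleR_left inner_sum_right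
      by (subst sum.swap) (simp add: mult.commute sum_distrib_left)
    show ?thesis unfolding 1[symmetric] 2[symmetric]
      by (simp add: stress_div_def inner_vec_def[where 'b=3] sum_distrib_right distrib_right sum.distrib)
  qed
  then have "ip (stress_div Q' Q'') V = (\<integral>x. (\<Sum>j\<in>UNIV. conv V (\<lambda>k. Q'' k j) x \<bullet> Q' j x) + conv V Q' x \<bullet> lap Q'' x \<partial>torus)"
    by (simp add: ip_def)
  also have "\<dots> = (\<Sum>j\<in>UNIV. ip (conv V (\<lambda>k. Q'' k j)) (Q' j)) + ip (conv V Q') (lap Q'')"
    unfolding ip_def
    by (subst Bochner_Integration.integral_add)
      (simp_all add: L2_inner_integrable Lc L Bochner_Integration.integral_sum)
  finally have st: "ip (stress_div Q' Q'') V = ip (conv V Q') (lap Q'')" by (simp add: s0)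
  show "ip w Q = ip Q P"
    unfolding w_def by (simp add: ip_diff_left L z ip_commute[of P Q])
  have "ip g V = ip (conv V Q') (lap Q'')"
    unfolding g_def by (simp add: ip_add_left L z st)
  moreover have "ip h P = ip ?G P - ip (lap Q'') P"
    unfolding h_def by (simp add: ip_add_left ip_diff_left L z)
  moreover have "ip w (lap Q'') = ip P (lap Q'') - ip (conv V Q') (lap Q'')"
    unfolding w_def by (simp add: ip_diff_left L)
  moreover have "ip w ?G = ip P ?G" unfolding w_def by (simp add: ip_diff_left L G)
  ultimately show "- ip g V - ip h P - ip w (lap Q'') + ip w ?G = 0"
    by (simp add: ip_commute[of P])
qed

section \<open>Negligible increments\<close>

text \<open>In the application \<open>m a b\<close> is the total mass of the defect measures on \<open>[a, b]\<close>.\<close>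

definition negl :: "real \<Rightarrow> (real \<Rightarrow> real \<Rightarrow> real) \<Rightarrow> real \<Rightarrow> (real \<Rightarrow> real \<Rightarrow> real) \<Rightarrow> bool" where
  "negl T m K r \<longleftrightarrow> (\<forall>e>0. \<exists>d>0. \<forall>a b. 0 \<le> a \<longrightarrow> a \<le> b \<longrightarrow> b \<le> T \<longrightarrow> b - a < d \<longrightarrow> \<bar>r a b\<bar> \<le> K * m a b + e * (b - a))"

lemma neglI:
  assumes "\<And>e. e > 0 \<Longrightarrow> \<exists>d>0. \<forall>a b. 0 \<le> a \<longrightarrow> a \<le> b \<longrightarrow> b \<le> T \<longrightarrow> b - a < d \<longrightarrow> \<bar>r a b\<bar> \<le> K * m a b + e * (b - a)"
  shows "negl T m K r"
  using assms by (simp add: negl_def)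

lemma neglD:
  assumes "negl T m K r" "e > 0"
  obtains d where "d > 0" "\<And>a b. 0 \<le> a \<Longrightarrow> a \<le> b \<Longrightarrow> b \<le> T \<Longrightarrow> b - a < d \<Longrightarrow> \<bar>r a b\<bar> \<le> K * m a b + e * (b - a)"
proof -
  from assms obtain d where
    "d > 0 \<and> (\<forall>a b. 0 \<le> a \<longrightarrow> a \<le> b \<longrightarrow> b \<le> T \<longrightarrow> b - a < d \<longrightarrow> \<bar>r a b\<bar> \<le> K * m a b + e * (b - a))"
    unfolding negl_def by blast
  note d = this[THEN conjunct1] this[THEN conjunct2, rule_format]
  show ?thesis by (rule that[OF d])
qed

lemma negl_add:
  assumes "negl T m K r" "negl T m L r'" shows "negl T m (K + L) (\<lambda>a b. r a b + r' a b)"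
proof (rule neglI)
  fix e :: real assume "e > 0"
  then have e: "e / 2 > 0" by simp
  obtain d where d: "d > 0" "\<And>a b. 0 \<le> a \<Longrightarrow> a \<le> b \<Longrightarrow> b \<le> T \<Longrightarrow> b - a < d \<Longrightarrow> \<bar>r a b\<bar> \<le> K * m a b + e / 2 * (b - a)"
    by (rule neglD[OF assms(1) e], rule that)
  obtain d' where d': "d' > 0" "\<And>a b. 0 \<le> a \<Longrightarrow> a \<le> b \<Longrightarrow> b \<le> T \<Longrightarrow> b - a < d' \<Longrightarrow> \<bar>r' a b\<bar> \<le> L * m a b + e / 2 * (b - a)"
    by (rule neglD[OF assms(2) e], rule that)
  show "\<exists>d>0. \<forall>a b. 0 \<le> a \<longrightarrow> a \<le> b \<longrightarrow> b \<le> T \<longrightarrow> b - a < d \<longrightarrow> \<bar>r a b + r' a b\<bar> \<le> (K + L) * m a b + e * (b - a)"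
  proof (intro exI[of _ "min d d'"] conjI allI impI)
    show "0 < min d d'" using d(1) d'(1) by simp
    fix a b :: real assume ab: "0 \<le> a" "a \<le> b" "b \<le> T" "b - a < min d d'"
    then have "\<bar>r a b\<bar> \<le> K * m a b + e / 2 * (b - a)" "\<bar>r' a b\<bar> \<le> L * m a b + e / 2 * (b - a)"
      by (intro d(2) d'(2); simp)+
    then show "\<bar>r a b + r' a b\<bar> \<le> (K + L) * m a b + e * (b - a)" by (simp add: distrib_right)
  qed
qed

lemma negl_scale:
  assumes "negl T m K r" shows "negl T m (\<bar>c\<bar> * K) (\<lambda>a b. c * r a b)"
proof (rule neglI)
  fix e :: real assume "e > 0"
  then have e: "e / (\<bar>c\<bar> + 1) > 0" by simp
  obtain d where d: "d > 0" "\<And>a b. 0 \<le> a \<Longrightarrow> a \<le> b \<Longrightarrow> b \<le> T \<Longrightarrow> b - a < d \<Longrightarrow> \<bar>r a b\<bar> \<le> K * m a b + e / (\<bar>c\<bar> + 1) * (b - a)"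
    by (rule neglD[OF assms e], rule that)
  show "\<exists>d>0. \<forall>a b. 0 \<le> a \<longrightarrow> a \<le> b \<longrightarrow> b \<le> T \<longrightarrow> b - a < d \<longrightarrow> \<bar>c * r a b\<bar> \<le> \<bar>c\<bar> * K * m a b + e * (b - a)"
  proof (intro exI[of _ d] conjI allI impI d(1))
    fix a b :: real assume ab: "0 \<le> a" "a \<le> b" "b \<le> T" "b - a < d"
    have "\<bar>c * r a b\<bar> \<le> \<bar>c\<bar> * (K * m a b + e / (\<bar>c\<bar> + 1) * (b - a))"
      unfolding abs_mult by (intro mult_left_mono d(2)[OF ab]) simp
    also have "\<bar>c\<bar> * (e / (\<bar>c\<bar> + 1)) \<le> e" using \<open>e > 0\<close> by (simp add: field_simps)
    then have "\<bar>c\<bar> * (e / (\<bar>c\<bar> + 1)) * (b - a) \<le> e * (b - a)" using ab by (intro mult_right_mono) auto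
    then have "\<bar>c\<bar> * (K * m a b + e / (\<bar>c\<bar> + 1) * (b - a)) \<le> \<bar>c\<bar> * K * m a b + e * (b - a)"
      by (simp add: distrib_left mult.assoc)
    finally show "\<bar>c * r a b\<bar> \<le> \<bar>c\<bar> * K * m a b + e * (b - a)" .
  qed
qed

lemma negl_cong:
  assumes "negl T m K r" "\<And>a b. 0 \<le> a \<Longrightarrow> a \<le> b \<Longrightarrow> b \<le> T \<Longrightarrow> r a b = r' a b" shows "negl T m K r'"
  using assms unfolding negl_def by (metis (no_types, lifting))

lemma negl_tint_ip:
  assumes u: "CL T u" and w: "CL T w"
  shows "negl T m 0 (\<lambda>a b. tint a b (\<lambda>t. ip (u t) (w t)) - (b - a) * ip (u a) (w a))"
proof (rule neglI)
  fix e :: real assume e: "e > 0"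
  obtain d where d: "d > 0" "\<And>a s t. a \<in> {0..T} \<Longrightarrow> s \<in> {0..T} \<Longrightarrow> t \<in> {0..T} \<Longrightarrow> \<bar>s - a\<bar> < d \<Longrightarrow> \<bar>t - a\<bar> < d \<Longrightarrow>
     \<bar>ip (u s) (w t) - ip (u a) (w a)\<bar> \<le> e"
    by (rule CL_ip_close[OF u w e], rule that)
  show "\<exists>d>0. \<forall>a b. 0 \<le> a \<longrightarrow> a \<le> b \<longrightarrow> b \<le> T \<longrightarrow> b - a < d \<longrightarrow>
      \<bar>tint a b (\<lambda>t. ip (u t) (w t)) - (b - a) * ip (u a) (w a)\<bar> \<le> 0 * m a b + e * (b - a)"
  proof (intro exI[of _ d] conjI allI impI d(1))
    fix a b :: real assume ab: "0 \<le> a" "a \<le> b" "b \<le> T" "b - a < d"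
    have "\<bar>tint a b (\<lambda>t. ip (u t) (w t)) - (b - a) * ip (u a) (w a)\<bar> \<le> e * (b - a)"
      by (rule tint_close[OF continuous_tint[OF CL_ip_continuous[OF u w] ab(1,3)] ab(2)], rule d(2))
        (use ab in auto)
    then show "\<bar>tint a b (\<lambda>t. ip (u t) (w t)) - (b - a) * ip (u a) (w a)\<bar> \<le> 0 * m a b + e * (b - a)" by simp
  qed
qed

text \<open>The freezing time may depend on the interval; the two end points are the choices made
  below.\<close>

lemma negl_tint_ip_frozen:
  assumes u: "CL T u" and w: "CL T w" and c: "\<And>a b. a \<le> b \<Longrightarrow> c a b \<in> {a..b}"
    and r: "\<And>a b. 0 \<le> a \<Longrightarrow> a \<le> b \<Longrightarrow> b \<le> T \<Longrightarrow> \<bar>r a b - tint a b (\<lambda>t. ip (u t) (w (c a b)))\<bar> \<le> K * m a b"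
  shows "negl T m K (\<lambda>a b. r a b - (b - a) * ip (u a) (w a))"
proof (rule neglI)
  fix e :: real assume e: "e > 0"
  obtain d where d: "d > 0" "\<And>a b c. 0 \<le> a \<Longrightarrow> a \<le> b \<Longrightarrow> b \<le> T \<Longrightarrow> b - a < d \<Longrightarrow> c \<in> {a..b} \<Longrightarrow>
     \<bar>tint a b (\<lambda>t. ip (u t) (w c)) - (b - a) * ip (u a) (w a)\<bar> \<le> e * (b - a)"
    by (rule CL_ip_tint_close[OF u w e], rule that)
  show "\<exists>d>0. \<forall>a b. 0 \<le> a \<longrightarrow> a \<le> b \<longrightarrow> b \<le> T \<longrightarrow> b - a < d \<longrightarrow>
      \<bar>r a b - (b - a) * ip (u a) (w a)\<bar> \<le> K * m a b + e * (b - a)"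
  proof (intro exI[of _ d] conjI allI impI d(1))
    fix a b :: real assume ab: "0 \<le> a" "a \<le> b" "b \<le> T" "b - a < d"
    from d(2)[OF ab c[OF ab(2)]] r[OF ab(1-3)]
    show "\<bar>r a b - (b - a) * ip (u a) (w a)\<bar> \<le> K * m a b + e * (b - a)" by linarith
  qed
qed

text \<open>
  Averaging the increment tested with the endpoint values \<open>u a\<close> and \<open>u b\<close> gives the increment of
  \<open>\<parallel>u\<parallel>\<^sup>2 / 2\<close> without differentiating \<open>u\<close> in time.
\<close>

lemma negl_square:
  assumes u: "CL T u" and g: "CL T g"
    and inc: "\<And>a b c. 0 \<le> a \<Longrightarrow> a \<le> b \<Longrightarrow> b \<le> T \<Longrightarrow> c \<in> {0..T} \<Longrightarrow>
      \<bar>ip (\<lambda>x. u b x - u a x) (u c) - tint a b (\<lambda>t. ip (g t) (u c))\<bar> \<le> K * m a b"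
  shows "negl T m K (\<lambda>a b. (ip (u b) (u b) - ip (u a) (u a)) / 2 - (b - a) * ip (g a) (u a))"
proof -
  have "negl T m K (\<lambda>a b. ip (\<lambda>x. u b x - u a x) (u a) - (b - a) * ip (g a) (u a))"
    by (rule negl_tint_ip_frozen[OF g u, where c = "\<lambda>a b. a"]) (auto intro!: inc)
  moreover have "negl T m K (\<lambda>a b. ip (\<lambda>x. u b x - u a x) (u b) - (b - a) * ip (g a) (u a))"
    by (rule negl_tint_ip_frozen[OF g u, where c = "\<lambda>a b. b"]) (auto intro!: inc)
  ultimately have "negl T m (\<bar>1/2\<bar> * (K + K)) (\<lambda>a b. 1/2 * ((ip (\<lambda>x. u b x - u a x) (u a) - (b - a) * ip (g a) (u a))
      + (ip (\<lambda>x. u b x - u a x) (u b) - (b - a) * ip (g a) (u a))))"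
    by (intro negl_scale negl_add)
  then have n: "negl T m K (\<lambda>a b. 1/2 * ((ip (\<lambda>x. u b x - u a x) (u a) - (b - a) * ip (g a) (u a))
      + (ip (\<lambda>x. u b x - u a x) (u b) - (b - a) * ip (g a) (u a))))" by simp
  show ?thesis
  proof (rule negl_cong[OF n])
    fix a b :: real assume "0 \<le> a" "a \<le> b" "b \<le> T"
    then have "L2 (u a)" "L2 (u b)" using u by (auto intro: CL_L2)
    then show "1/2 * ((ip (\<lambda>x. u b x - u a x) (u a) - (b - a) * ip (g a) (u a))
      + (ip (\<lambda>x. u b x - u a x) (u b) - (b - a) * ip (g a) (u a)))
      = (ip (u b) (u b) - ip (u a) (u a)) / 2 - (b - a) * ip (g a) (u a)"
      by (simp add: ip_diff_left ip_commute[of "u a" "u b"])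
  qed
qed

section \<open>Regular dissipative solutions\<close>

lemma hat_rep:
  assumes "sob m f" "2 \<le> m" shows "hat (rep f) k = hat f k"
  by (rule hat_cong_AE[symmetric, OF sob_L2[OF assms(1)] AE_rep[OF assms]])

text \<open>A partial sum of norms never exceeds the sum of the differentiated series, which is
  bounded in time; hence a bound independent of \<open>n\<close>.\<close>

lemma trunc_grad_bounded:
  fixes u :: "real \<Rightarrow> real^3 \<Rightarrow> 'b::euclidean_space"
  assumes u: "C_sob T m u" and m: "3 \<le> m"
  obtains M where "M > 0" "\<And>t n k x. t \<in> {0..T} \<Longrightarrow> norm (pd k (trunc n (u t)) x) \<le> M"
proof -
  have "\<exists>M\<ge>0. \<forall>t\<in>{0..T}. (\<Sum>i. norm (real_of_int (enum i $ k) *\<^sub>R hat (u t) (enum i))) \<le> M" for k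
    by (rule hat_series_bounded[OF u, of "axis k 1" "\<lambda>i. real_of_int (enum i $ k)"]) (use m kpow1 in \<open>auto simp: numeral_eq_Suc\<close>)
  then have "\<exists>M. \<forall>k. M k \<ge> 0 \<and> (\<forall>t\<in>{0..T}. (\<Sum>i. norm (real_of_int (enum i $ k) *\<^sub>R hat (u t) (enum i))) \<le> M k)"
    by (intro choice allI)
  then obtain M where "\<forall>k. M k \<ge> 0 \<and> (\<forall>t\<in>{0..T}. (\<Sum>i. norm (real_of_int (enum i $ k) *\<^sub>R hat (u t) (enum i))) \<le> M k)" ..
  note M = this[rule_format, THEN conjunct1] this[rule_format, THEN conjunct2, rule_format]
  show ?thesis
  \<comment> \<open>The summand 1 only makes the bound positive.\<close>
  proof (rule that[of "2 * (\<Sum>k\<in>UNIV. M k) + 1"])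
    show "0 < 2 * (\<Sum>k\<in>UNIV. M k) + 1" using sum_nonneg[of UNIV M] M(1) by simp
    fix t n k x assume t: "t \<in> {0..T}"
    let ?a = "\<lambda>i. real_of_int (enum i $ k) *\<^sub>R hat (u t) (enum i)"
    have "norm (pd k (trunc n (u t)) x) \<le> (\<Sum>i<n. norm (cas (- enum i) x *\<^sub>R ?a i))"
      unfolding pd_tpoly tpoly_def by (rule norm_sum)
    also have "\<dots> \<le> (\<Sum>i<n. 2 * norm (?a i))" by (intro sum_mono norm_cas_scaleR_le)
    also have "\<dots> = 2 * (\<Sum>i<n. norm (?a i))" by (simp add: sum_distrib_left)
    also have "(\<Sum>i<n. norm (?a i)) \<le> (\<Sum>i. norm (?a i))"
      by (rule sum_le_suminf[OF summable_rep1[OF C_sob_sob[OF u t] m]]) auto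
    also have "\<dots> \<le> M k" by (rule M(2)[OF t])
    also have "M k \<le> (\<Sum>k\<in>UNIV. M k)" by (rule member_le_sum) (use M(1) in auto)
    finally show "norm (pd k (trunc n (u t)) x) \<le> 2 * (\<Sum>k\<in>UNIV. M k) + 1" by simp
  qed
qed

text \<open>The limit is taken in the inequality, where the pairing with the measures has already
  been replaced by its bound \<open>C\<close>; convergence of the gradients of the truncations is
  not involved.\<close>

lemma increment_limit:
  assumes f: "L2 f" and g: "CL T g" and ab: "0 \<le> a" "a \<le> b" "b \<le> T" and \<psi>: "L2 \<psi>"
    and le: "\<And>n. \<bar>ip f (trunc n \<psi>) - tint a b (\<lambda>t. ip (g t) (trunc n \<psi>))\<bar> \<le> C"
  shows "\<bar>ip f \<psi> - tint a b (\<lambda>t. ip (g t) \<psi>)\<bar> \<le> C"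
  by (rule LIMSEQ_le_const2[OF tendsto_rabs[OF tendsto_diff[OF ip_trunc_tendsto[OF \<psi> f] tint_ip_trunc_tendsto[OF g ab \<psi>]]]])
    (use le in auto)

text \<open>The weak equations start at time 0; the increment over \<open>[a, b]\<close> is the
  difference of two of them.\<close>

lemma increment_from_origin:
  fixes p q :: "real \<Rightarrow> real"
  assumes eq: "\<And>\<tau>. \<tau> \<in> {0..T} \<Longrightarrow> f \<tau> - f 0 = tint 0 \<tau> p + tint 0 \<tau> q"
    and p: "continuous_on {0..T} p" and ab: "0 \<le> a" "a \<le> b" "b \<le> T"
    and q: "integrable (lebesgue_on {0..b}) q"
  shows "f b - f a = tint a b p + tint a b q"
proof -
  from tint_split[OF q ab(1,2)] tint_split[OF continuous_tint[OF p order_refl ab(3)] ab(1,2)]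
    eq[of a] eq[of b] ab show ?thesis by simp
qed

lemma ip_uminus_left: "ip (\<lambda>x. - f x) g = - ip f g"
  by (simp add: ip_def)

lemma C1p_rep: "sob m f \<Longrightarrow> 3 \<le> m \<Longrightarrow> C1p k (rep f) (rep1 k f)"
  unfolding C1p_def by (auto intro: continuous_rep continuous_rep1 has_partial_rep periodic_rep)

lemma C1p_rep1: "sob m f \<Longrightarrow> 4 \<le> m \<Longrightarrow> C1p j (rep1 k f) (rep2 j k f)"
  unfolding C1p_def by (auto intro: continuous_rep1 continuous_rep2 has_partial_rep1 periodic_rep)

section \<open>A regular dissipative solution and its continuous representatives\<close>

locale regular_dissipative =
  fixes s :: nat and F :: "real^3^3 \<Rightarrow> real" and \<Lambda> T :: real
    and v :: "real \<Rightarrow> real^3 \<Rightarrow> real^3"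
    and P Q :: "real \<Rightarrow> real^3 \<Rightarrow> real^3^3"
    and D :: "real \<Rightarrow> real"
    and R1 :: "real \<Rightarrow> (real^3) set \<Rightarrow> real^3^3"
    and R2 :: "real \<Rightarrow> (real^3) set \<Rightarrow> real^3^3^3"
  assumes s: "s \<ge> 3" and F: "Ck_on (Suc s) Sym0 F" and T: "T > 0"
    and sol: "dissipative_solution T F \<Lambda> v P Q D R1 R2" and reg: "regular T s v P Q"
begin

lemmas sol_parts = sol[unfolded dissipative_solution_def Let_def, THEN conjunct2, THEN conjunct2, THEN conjunct2, THEN conjunct2]
lemmas R1 = sol_parts[THEN conjunct2, THEN conjunct1]
  and R2 = sol_parts[THEN conjunct2, THEN conjunct2, THEN conjunct1]
  and D = sol_parts[THEN conjunct2, THEN conjunct2, THEN conjunct2, THEN conjunct1]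
  and D_nonneg = sol_parts[THEN conjunct2, THEN conjunct2, THEN conjunct2, THEN conjunct2, THEN conjunct1]
lemmas sol_time = sol_parts[THEN conjunct2, THEN conjunct2, THEN conjunct2, THEN conjunct2, THEN conjunct2, THEN conjunct1, THEN bspec]
lemmas sol_defect = sol_parts[THEN conjunct2, THEN conjunct2, THEN conjunct2, THEN conjunct2, THEN conjunct2, THEN conjunct2]
lemmas sol_div = sol_time[THEN conjunct1, THEN spec, THEN mp]
  and sol_v = sol_time[THEN conjunct2, THEN conjunct1, THEN spec, THEN mp]
  and sol_Q = sol_time[THEN conjunct2, THEN conjunct2, THEN conjunct1, THEN spec, THEN mp]
  and sol_P = sol_time[THEN conjunct2, THEN conjunct2, THEN conjunct2, THEN conjunct1, THEN spec, THEN mp]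
  and sol_energy = sol_time[THEN conjunct2, THEN conjunct2, THEN conjunct2, THEN conjunct2]

lemma Csob: "C_sob T s v" "C_sob T s P" "C_sob T (s + 1) Q"
  using reg by (simp_all add: regular_def)

lemma Sym0_AE: assumes "t \<in> {0..T}" shows "AE x in torus. P t x \<in> Sym0" "AE x in torus. Q t x \<in> Sym0"
proof -
  have "AE x in torus. P t x \<in> Sym0 \<and> Q t x \<in> Sym0" using reg assms by (simp add: regular_def)
  then show "AE x in torus. P t x \<in> Sym0" "AE x in torus. Q t x \<in> Sym0" by (auto elim: AE_mp)
qed

lemma sob_t: assumes "t \<in> {0..T}" shows "sob s (v t)" "sob s (P t)" "sob (s + 1) (Q t)"
  using C_sob_sob[OF Csob(1) assms] C_sob_sob[OF Csob(2) assms] C_sob_sob[OF Csob(3) assms] .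

lemma s_le: "2 \<le> s" "3 \<le> s" "2 \<le> s + 1" "3 \<le> s + 1" "4 \<le> s + 1" using s by auto

abbreviation "vr t \<equiv> rep (v t)"
abbreviation "Pr t \<equiv> rep (P t)"
abbreviation "Qr t \<equiv> rep (Q t)"
abbreviation "vr' t k \<equiv> rep1 k (v t)"
abbreviation "Pr' t k \<equiv> rep1 k (P t)"
abbreviation "Qr' t k \<equiv> rep1 k (Q t)"
abbreviation "Qr'' t j k \<equiv> rep2 j k (Q t)"
abbreviation "Gr t x \<equiv> grad_Sym0 F (Qr t x)"

lemma AE_reps:
  assumes "t \<in> {0..T}"
  shows "AE x in torus. v t x = vr t x" "AE x in torus. P t x = Pr t x" "AE x in torus. Q t x = Qr t x"
    "AE x in torus. wd k (v t) x = vr' t k x" "AE x in torus. wd k (P t) x = Pr' t k x"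
    "AE x in torus. wd k (Q t) x = Qr' t k x" "AE x in torus. wD (axis k 2) (Q t) x = Qr'' t k k x"
  by (rule AE_rep AE_rep1 AE_rep2; (rule sob_t[OF assms] s_le))+

lemma C1p_reps:
  assumes t: "t \<in> {0..T}"
  shows "C1p k (vr t) (vr' t k)" "C1p k (Pr t) (Pr' t k)" "C1p k (Qr t) (Qr' t k)" "C1p j (Qr' t k) (Qr'' t j k)"
  by (rule C1p_rep C1p_rep1; (rule sob_t[OF t] s_le))+

lemma CP_reps:
  "CP T (\<lambda>t. vr t)" "CP T (\<lambda>t. Pr t)" "CP T (\<lambda>t. Qr t)" "CP T (\<lambda>t. vr' t k)" "CP T (\<lambda>t. Pr' t k)" "CP T (\<lambda>t. Qr' t k)"
  "CP T (\<lambda>t. Qr'' t j k)"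
  by (rule CP_rep CP_rep1 CP_rep2; (rule Csob s_le))+

lemma Sym0_reps:
  assumes t: "t \<in> {0..T}"
  shows "Pr t x \<in> Sym0" "Qr t x \<in> Sym0" "Pr' t k x \<in> Sym0" "Qr' t k x \<in> Sym0" "Qr'' t j k x \<in> Sym0"
    "Gr t x \<in> Sym0"
proof -
  show "Pr t x \<in> Sym0" "Qr t x \<in> Sym0" "Pr' t k x \<in> Sym0" "Qr' t k x \<in> Sym0" "Qr'' t j k x \<in> Sym0"
    by (rule rep_Sym0 rep1_Sym0 rep2_Sym0; (rule sob_t[OF t] s_le Sym0_AE[OF t]))+
  then show "Gr t x \<in> Sym0" by (intro grad_Sym0(1)[OF F])
qed

lemma CP_Gr: "CP T Gr"
  by (rule CP_compose[OF CP_reps(3) grad_Sym0(3)[OF F]]) (rule Sym0_reps(2))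

text \<open>The right-hand sides of the equations for \<open>v\<close>, \<open>P\<close>, \<open>Q\<close>; in the first one the pressure is missing.\<close>

definition "vt t x = - conv (vr t) (vr' t) x - stress_div (Qr' t) (Qr'' t) x"
definition "Pt t x = lap (Qr'' t) x - conv (vr t) (Pr' t) x - Gr t x"
definition "Qt t x = Pr t x - conv (vr t) (Qr' t) x"

lemma CP_lap: "CP T (\<lambda>t. lap (Qr'' t))"
  unfolding lap_def by (intro CP_sum CP_reps)

lemma CP_rates: "CP T vt" "CP T Pt" "CP T Qt"
  unfolding vt_def[abs_def] Pt_def[abs_def] Qt_def[abs_def] conv_def stress_div_def
  by (intro CP_diff CP_uminus CP_sum CP_scaleR CP_nth CP_vec CP_add CP_inner CP_reps CP_lap CP_Gr)+

section \<open>The mass of the defect measures\<close>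

definition "mass a b = enn2real (\<integral>\<^sup>+t. tv_norm (R1 t) + tv_norm (R2 t) \<partial>lebesgue_on {a..b})"

lemma mass_nonneg: "0 \<le> mass a b" by (simp add: mass_def)

text \<open>The domination of the defects concerns intervals starting at 0; superadditivity of the
  lower integral carries finiteness over to \<open>[a, b]\<close>. Finiteness matters because
  \<open>enn2real\<close> sends an infinite value to 0.\<close>

lemma mass_finite:
  assumes "0 \<le> a" "a \<le> b" "b \<le> T"
  shows "(\<integral>\<^sup>+t. tv_norm (R1 t) + tv_norm (R2 t) \<partial>lebesgue_on {a..b}) < \<infinity>"
proof -
  let ?N = "\<lambda>t. tv_norm (R1 t) + tv_norm (R2 t)"
  have b: "(\<integral>\<^sup>+t. ?N t \<partial>lebesgue_on {0..b}) < \<infinity>"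
    using sol_defect assms by (force intro: le_less_trans[OF _ ennreal_less_top])
  have "(\<integral>\<^sup>+t. ?N t \<partial>lebesgue_on {a..b}) \<le> (\<integral>\<^sup>+t. ?N t \<partial>lebesgue_on {0..a}) + (\<integral>\<^sup>+t. ?N t \<partial>lebesgue_on {a..b})" by simp
  also have "\<dots> \<le> (\<integral>\<^sup>+t. ?N t \<partial>lebesgue_on {0..b})"
    by (rule nn_integral_interval_superadditive) (use assms in auto)
  finally show ?thesis using b by (rule le_less_trans)
qed

lemma mass_superadditive:
  assumes "0 \<le> a" "a \<le> b" "b \<le> T" shows "mass 0 a + mass a b \<le> mass 0 b"
proof -
  have "enn2real ((\<integral>\<^sup>+t. tv_norm (R1 t) + tv_norm (R2 t) \<partial>lebesgue_on {0..a}) + (\<integral>\<^sup>+t. tv_norm (R1 t) + tv_norm (R2 t) \<partial>lebesgue_on {a..b})) \<le> mass 0 b"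
    unfolding mass_def
    by (rule enn2real_mono[OF nn_integral_interval_superadditive]) (use assms mass_finite[of 0 b] in auto)
  then show ?thesis using mass_finite[of 0 a] mass_finite[of a b] assms
    by (simp add: mass_def enn2real_plus)
qed

text \<open>The sign of \<open>D\<close> makes its integral nonnegative, so that leaving
  \<open>ennreal\<close> loses nothing.\<close>

lemma mass_le:
  obtains c where "c > 0" "\<And>\<tau>. \<tau> \<in> {0..T} \<Longrightarrow> mass 0 \<tau> \<le> c * tint 0 \<tau> D"
proof -
  from sol_defect obtain c where c: "c > 0 \<and> (\<forall>\<tau>\<in>{0..T}. (\<integral>\<^sup>+t. tv_norm (R1 t) + tv_norm (R2 t) \<partial>lebesgue_on {0..\<tau>})
      \<le> ennreal (c * tint 0 \<tau> D))" ..
  have "mass 0 \<tau> \<le> c * tint 0 \<tau> D" if \<tau>: "\<tau> \<in> {0..T}" for \<tau>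
  proof -
    have "AE t in lebesgue_on {0..\<tau>}. 0 \<le> D t"
      by (rule AE_time_mono[OF D_nonneg]) (use \<tau> in auto)
    then have "0 \<le> tint 0 \<tau> D" by (rule Bochner_Integration.integral_nonneg_AE)
    then have "enn2real (ennreal (c * tint 0 \<tau> D)) = c * tint 0 \<tau> D" using c by simp
    moreover have "mass 0 \<tau> \<le> enn2real (ennreal (c * tint 0 \<tau> D))"
      unfolding mass_def by (rule enn2real_mono) (use c \<tau> in auto)
    ultimately show ?thesis by simp
  qed
  then show ?thesis using c that by blast
qed

text \<open>54 is 2 times 9 times 3 and 162 is 2 times 27 times 3: two variations per tensor
  component, and the factor 3 of \<open>norm_grad_v_le\<close> and
  \<open>norm_grad_m_le\<close>.\<close>

lemma pairing_bounds:
  assumes ab: "0 \<le> a" "a \<le> b" "b \<le> T" and M: "M > 0"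
  shows "(\<And>x k. norm (pd k (tpoly \<kappa> c n) x) \<le> M) \<Longrightarrow>
      \<bar>tint a b (\<lambda>t. pairing (R1 t) (grad_v (tpoly \<kappa> c n)))\<bar> \<le> 54 * M * mass a b"
    "(\<And>x k. norm (pd k (tpoly \<kappa> c' n) x) \<le> M) \<Longrightarrow>
      \<bar>tint a b (\<lambda>t. pairing (R2 t) (grad_m (tpoly \<kappa> c' n)))\<bar> \<le> 162 * M * mass a b"
    "integrable (lebesgue_on {a..b}) (\<lambda>t. pairing (R1 t) (grad_v (tpoly \<kappa> c n)))"
    "integrable (lebesgue_on {a..b}) (\<lambda>t. pairing (R2 t) (grad_m (tpoly \<kappa> c' n)))"
proof -
  note fin = mass_finite[OF ab]
  note b1 = tint_pairing_bound[OF R1 ab continuous_grad_v_tpoly periodic_grad_tpoly(1) _ _ _ fin]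
  note b2 = tint_pairing_bound[OF R2 ab continuous_grad_m_tpoly periodic_grad_tpoly(2) _ _ _ fin]
  have le: "tv_norm (R1 t) \<le> tv_norm (R1 t) + tv_norm (R2 t)" "tv_norm (R2 t) \<le> tv_norm (R1 t) + tv_norm (R2 t)" for t
    by simp_all
  show "\<bar>tint a b (\<lambda>t. pairing (R1 t) (grad_v (tpoly \<kappa> c n)))\<bar> \<le> 54 * M * mass a b"
    if "\<And>x k. norm (pd k (tpoly \<kappa> c n) x) \<le> M"
    using b1(1)[OF norm_grad_v_le[OF that] _ le(1)] M by (simp add: mass_def)
  show "\<bar>tint a b (\<lambda>t. pairing (R2 t) (grad_m (tpoly \<kappa> c' n)))\<bar> \<le> 162 * M * mass a b"
    if "\<And>x k. norm (pd k (tpoly \<kappa> c' n) x) \<le> M"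
    using b2(1)[OF norm_grad_m_le[OF that] _ le(2)] M by (simp add: mass_def)
  obtain B where B: "B > 0" "\<And>x. x \<in> cell \<Longrightarrow> norm (grad_v (tpoly \<kappa> c n) x) \<le> B"
    by (rule bounded_on_cell[OF continuous_grad_v_tpoly], rule that)
  show "integrable (lebesgue_on {a..b}) (\<lambda>t. pairing (R1 t) (grad_v (tpoly \<kappa> c n)))"
    by (rule b1(2)[OF B(2,1) le(1)])
  obtain B' where B': "B' > 0" "\<And>x. x \<in> cell \<Longrightarrow> norm (grad_m (tpoly \<kappa> c' n) x) \<le> B'"
    by (rule bounded_on_cell[OF continuous_grad_m_tpoly], rule that)
  show "integrable (lebesgue_on {a..b}) (\<lambda>t. pairing (R2 t) (grad_m (tpoly \<kappa> c' n)))"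
    by (rule b2(2)[OF B'(2,1) le(2)])
qed

section \<open>The weak equations tested with Hartley polynomials\<close>

lemma ip_reps:
  assumes t: "t \<in> {0..T}"
  shows "L2 \<psi> \<Longrightarrow> (\<integral>x. v t x \<bullet> \<psi> x \<partial>torus) = ip (vr t) \<psi>"
    and "L2 \<phi> \<Longrightarrow> (\<integral>x. P t x \<bullet> \<phi> x \<partial>torus) = ip (Pr t) \<phi>"
    and "L2 \<phi> \<Longrightarrow> (\<integral>x. Q t x \<bullet> \<phi> x \<partial>torus) = ip (Qr t) \<phi>"
  using ip_cong_AE[OF sob_L2[OF sob_t(1)[OF t]] _ AE_reps(1)[OF t], of \<psi> \<psi>]
    ip_cong_AE[OF sob_L2[OF sob_t(2)[OF t]] _ AE_reps(2)[OF t], of \<phi> \<phi>]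
    ip_cong_AE[OF sob_L2[OF sob_t(3)[OF t]] _ AE_reps(3)[OF t], of \<phi> \<phi>]
  by (simp_all add: ip_def)

text \<open>Incompressibility means that each coefficient is orthogonal to its frequency. In this
  form it passes to the representative and to every truncation, which makes truncated velocities
  admissible test functions.\<close>

lemma div_zero:
  assumes t: "t \<in> {0..T}"
  shows "freq k \<bullet> hat (v t) k = 0" "(\<Sum>k\<in>UNIV. vr' t k x $ k) = 0" "div_v (trunc n (v t)) x = 0"
proof -
  note L = sob_L2[OF sob_t(1)[OF t]]
  show z: "freq k \<bullet> hat (v t) k = 0" for k
  proof -
    \<comment> \<open>The gradient of \<open>cas (- k)\<close> is a multiple of
      \<open>cas k\<close>, so this test isolates the mode \<open>k\<close>.\<close>
    have g: "grad_s (cas (- k)) = (\<lambda>x. cas k x *\<^sub>R (- freq k))"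
      using pd_cas[of _ 1 "- k"] by (auto simp: fun_eq_iff grad_s_def vec_eq_iff)
    have "(\<integral>x. v t x \<bullet> grad_s (cas (- k)) x \<partial>torus) = 0" by (rule sol_div[OF t torus_smooth_cas])
    then have "ip (v t) (\<lambda>x. cas k x *\<^sub>R (- freq k)) = 0" by (simp add: g ip_def)
    then have "hat (v t) k \<bullet> (- freq k) = 0" using hat_inner[OF L, of k "- freq k"] by simp
    then show ?thesis by (simp add: inner_commute)
  qed
  have fz: "(\<Sum>j\<in>UNIV. real_of_int (k $ j) * hat (v t) k $ j) = 0" for k
    using z[of k] by (simp add: inner_vec_def)
  show "div_v (trunc n (v t)) x = 0"
  proof -
    have "div_v (trunc n (v t)) x = (\<Sum>j\<in>UNIV. \<Sum>i<n. cas (- enum i) x * (real_of_int (enum i $ j) * hat (v t) (enum i) $ j))"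
      by (simp add: div_v_def pd_tpoly tpoly_def mult.assoc)
    also have "\<dots> = (\<Sum>i<n. cas (- enum i) x * (\<Sum>j\<in>UNIV. real_of_int (enum i $ j) * hat (v t) (enum i) $ j))"
      by (subst sum.swap) (simp add: sum_distrib_left)
    finally show ?thesis by (simp add: fz)
  qed
  let ?a = "\<lambda>j i. real_of_int (enum i $ j) *\<^sub>R hat (v t) (enum i)"
  have sm: "(\<lambda>i. cas (- enum i) x * ?a j i $ j) sums (vr' t j x $ j)" for j
  proof -
    have "summable (\<lambda>i. cas (- enum i) x *\<^sub>R ?a j i)"
      by (rule summable_cas[OF summable_rep1[OF sob_t(1)[OF t] s_le(2)]])
    then have "(\<lambda>i. cas (- enum i) x *\<^sub>R ?a j i) sums vr' t j x"
      unfolding rep1_def tser_def by (rule summable_sums)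
    from bounded_linear.sums[OF bounded_linear_vec_nth[of j] this] show ?thesis by (simp add: mult.assoc)
  qed
  have "(\<lambda>i. \<Sum>j\<in>UNIV. cas (- enum i) x * ?a j i $ j) sums (\<Sum>j\<in>UNIV. vr' t j x $ j)"
    by (intro sums_sum sm)
  moreover have "(\<Sum>j\<in>UNIV. cas (- enum i) x * ?a j i $ j) = 0" for i
    using fz[of "enum i"] by (simp flip: sum_distrib_left)
  ultimately show "(\<Sum>k\<in>UNIV. vr' t k x $ k) = 0" using sums_unique2[OF sums_zero] by simp
qed

lemma continuous_reps:
  assumes t: "t \<in> {0..T}"
  shows "continuous_on UNIV (vr t)" "continuous_on UNIV (Pr t)" "continuous_on UNIV (Qr t)"
    "continuous_on UNIV (vr' t k)" "continuous_on UNIV (Pr' t k)" "continuous_on UNIV (Qr' t k)" "continuous_on UNIV (Qr'' t j k)"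
    "continuous_on UNIV (Gr t)"
  using CP_continuous[OF _ t] CP_reps CP_Gr by blast+

lemma L2_reps:
  assumes t: "t \<in> {0..T}"
  shows "L2 (conv (vr t) (vr' t))" "L2 (conv (vr t) (Pr' t))" "L2 (conv (vr t) (Qr' t))"
    "L2 (stress_div (Qr' t) (Qr'' t))" "L2 (lap (Qr'' t))" "L2 (Gr t)" "L2 (vr t)" "L2 (Pr t)" "L2 (Qr t)" "L2 (Qr' t k)"
  by (intro L2_continuous continuous_conv continuous_stress_div continuous_lap continuous_reps[OF t])+

text \<open>All regular terms integrate by parts onto \<open>vt\<close>, and only the defect remains
  as a pairing. No pressure appears because the polynomial is divergence free.\<close>

lemma v_increment:
  assumes ab: "0 \<le> a" "a \<le> b" "b \<le> T" and div: "\<And>x. div_v (tpoly \<kappa> c n) x = 0"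
  shows "ip (\<lambda>x. vr b x - vr a x) (tpoly \<kappa> c n)
    = tint a b (\<lambda>t. ip (vt t) (tpoly \<kappa> c n)) + tint a b (\<lambda>t. pairing (R1 t) (grad_v (tpoly \<kappa> c n)))"
proof -
  let ?\<psi> = "tpoly \<kappa> c n"
  note c\<psi> = C1p_tpoly[of _ \<kappa> c n] and cc = C1p_continuous[OF C1p_tpoly[of _ \<kappa> c n]]
  have int: "(\<integral>x. v t x \<bullet> pd_t T (\<lambda>t. ?\<psi>) t x + tensor_vv (v t x) (v t x) \<bullet> grad_v ?\<psi> x
      + grad_odot (Q t) x \<bullet> grad_v ?\<psi> x \<partial>torus) = ip (vt t) ?\<psi>" if t: "t \<in> {0..T}" for t
  proof -
    note co = continuous_reps[OF t]
    let ?A = "\<lambda>x. \<Sum>k\<in>UNIV. vr t x $ k * (vr t x \<bullet> pd k ?\<psi> x)"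
    let ?B = "\<lambda>x. (\<chi> i j. Qr' t i x \<bullet> Qr' t j x) \<bullet> grad_v ?\<psi> x"
    have cA: "continuous_on UNIV ?A" by (intro continuous_intros co cc)
    have cB: "continuous_on UNIV ?B"
      by (intro continuous_on_inner continuous_on_vec_lambda co continuous_grad_v_tpoly)
    have "AE x in torus. \<forall>k. wd k (Q t) x = Qr' t k x" unfolding AE_all_countable by (rule allI) (rule AE_reps(6)[OF t])
    with AE_reps(1)[OF t] have "AE x in torus. v t x \<bullet> pd_t T (\<lambda>t. ?\<psi>) t x + tensor_vv (v t x) (v t x) \<bullet> grad_v ?\<psi> x
      + grad_odot (Q t) x \<bullet> grad_v ?\<psi> x = ?A x + ?B x"
      by eventually_elim (simp add: pd_t_const[OF T t] inner_tensor_vv grad_odot_def)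
    then have "(\<integral>x. v t x \<bullet> pd_t T (\<lambda>t. ?\<psi>) t x + tensor_vv (v t x) (v t x) \<bullet> grad_v ?\<psi> x
      + grad_odot (Q t) x \<bullet> grad_v ?\<psi> x \<partial>torus) = (\<integral>x. ?A x + ?B x \<partial>torus)"
      by (rule integral_torus_cong_AE) (intro continuous_on_add cA cB)
    also have "\<dots> = (\<integral>x. ?A x \<partial>torus) + (\<integral>x. ?B x \<partial>torus)"
      by (intro Bochner_Integration.integral_add continuous_torus_integrable cA cB)
    also have "(\<integral>x. ?A x \<partial>torus) = - ip (conv (vr t) (vr' t)) ?\<psi>"
      by (rule conv_by_parts[OF C1p_reps(1)[OF t] div_zero(2)[OF t] C1p_reps(1)[OF t] c\<psi>])
    also have "(\<integral>x. ?B x \<partial>torus) = - ip (stress_div (Qr' t) (Qr'' t)) ?\<psi>"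
      by (rule stress_by_parts[OF C1p_reps(4)[OF t] c\<psi>])
    also have "- ip (conv (vr t) (vr' t)) ?\<psi> + - ip (stress_div (Qr' t) (Qr'' t)) ?\<psi> = ip (vt t) ?\<psi>"
      unfolding vt_def[abs_def] by (simp add: ip_diff_left ip_uminus_left L2_reps[OF t])
    finally show ?thesis .
  qed
  have "ip (vr \<tau>) ?\<psi> - ip (vr 0) ?\<psi> = tint 0 \<tau> (\<lambda>t. ip (vt t) ?\<psi>) + tint 0 \<tau> (\<lambda>t. pairing (R1 t) (grad_v ?\<psi>))"
    if \<tau>: "\<tau> \<in> {0..T}" for \<tau>
  proof -
    have 0: "0 \<in> {0..T}" using T by simp
    have "test_fun T (\<lambda>t. ?\<psi>) \<and> (\<forall>t\<in>{0..T}. \<forall>x. div_v ?\<psi> x = 0)" using div test_fun_tpoly by blast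
    from sol_v[OF \<tau> this]
    have "ip (vr \<tau>) ?\<psi> - ip (vr 0) ?\<psi>
      = tint 0 \<tau> (\<lambda>t. \<integral>x. v t x \<bullet> pd_t T (\<lambda>t. ?\<psi>) t x + tensor_vv (v t x) (v t x) \<bullet> grad_v ?\<psi> x
      + grad_odot (Q t) x \<bullet> grad_v ?\<psi> x \<partial>torus) + tint 0 \<tau> (\<lambda>t. pairing (R1 t) (grad_v ?\<psi>))"
      by (simp only: ip_reps(1)[OF \<tau> L2_tpoly] ip_reps(1)[OF 0 L2_tpoly])
    also have "tint 0 \<tau> (\<lambda>t. \<integral>x. v t x \<bullet> pd_t T (\<lambda>t. ?\<psi>) t x + tensor_vv (v t x) (v t x) \<bullet> grad_v ?\<psi> x
      + grad_odot (Q t) x \<bullet> grad_v ?\<psi> x \<partial>torus) = tint 0 \<tau> (\<lambda>t. ip (vt t) ?\<psi>)"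
      by (rule tint_cong) (use \<tau> in \<open>auto intro!: int\<close>)
    finally show ?thesis .
  qed
  from increment_from_origin[OF this CL_ip_continuous[OF CL_CP[OF CP_rates(1)] CL_const[OF L2_tpoly]] ab pairing_bounds(3)[OF _ _ _ zero_less_one]]
  have "ip (vr b) ?\<psi> - ip (vr a) ?\<psi> = tint a b (\<lambda>t. ip (vt t) ?\<psi>) + tint a b (\<lambda>t. pairing (R1 t) (grad_v ?\<psi>))"
    using ab by simp
  then show ?thesis using ab by (simp add: ip_diff_left L2_reps)
qed

text \<open>As for the velocity; no trace multiplier appears because the polynomial takes values in
  \<open>Sym0\<close>.\<close>

lemma P_increment:
  assumes ab: "0 \<le> a" "a \<le> b" "b \<le> T" and S: "\<And>i. c i \<in> Sym0"
  shows "ip (\<lambda>x. Pr b x - Pr a x) (tpoly \<kappa> c n)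
    = tint a b (\<lambda>t. ip (Pt t) (tpoly \<kappa> c n)) + tint a b (\<lambda>t. pairing (R2 t) (grad_m (tpoly \<kappa> c n)))"
proof -
  let ?\<psi> = "tpoly \<kappa> c n"
  note c\<psi> = C1p_tpoly[of _ \<kappa> c n] and cc = C1p_continuous[OF C1p_tpoly[of _ \<kappa> c n]]
  have int: "(\<integral>x. P t x \<bullet> pd_t T (\<lambda>t. ?\<psi>) t x + tensor_vm (v t x) (P t x) \<bullet> grad_m ?\<psi> x
      - grad_Sym0 F (Q t x) \<bullet> ?\<psi> x - wgrad_m (Q t) x \<bullet> grad_m ?\<psi> x \<partial>torus) = ip (Pt t) ?\<psi>" if t: "t \<in> {0..T}" for t
  proof -
    note co = continuous_reps[OF t]
    let ?A = "\<lambda>x. \<Sum>k\<in>UNIV. vr t x $ k * (Pr t x \<bullet> pd k ?\<psi> x)"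
    let ?B = "\<lambda>x. \<Sum>k\<in>UNIV. Qr' t k x \<bullet> pd k ?\<psi> x"
    let ?C = "\<lambda>x. Gr t x \<bullet> ?\<psi> x"
    have cA: "continuous_on UNIV ?A" and cB: "continuous_on UNIV ?B" and cC: "continuous_on UNIV ?C"
      by (intro continuous_intros co cc)+
    have "AE x in torus. \<forall>k. wd k (Q t) x = Qr' t k x" unfolding AE_all_countable by (rule allI) (rule AE_reps(6)[OF t])
    with AE_reps(1,2,3)[OF t] have "AE x in torus. P t x \<bullet> pd_t T (\<lambda>t. ?\<psi>) t x + tensor_vm (v t x) (P t x) \<bullet> grad_m ?\<psi> x
      - grad_Sym0 F (Q t x) \<bullet> ?\<psi> x - wgrad_m (Q t) x \<bullet> grad_m ?\<psi> x = ?A x - ?C x - ?B x"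
      by eventually_elim (simp add: pd_t_const[OF T t] inner_tensor_vm wgrad_m_def, simp add: grad_m_def inner_tensor3)
    then have "(\<integral>x. P t x \<bullet> pd_t T (\<lambda>t. ?\<psi>) t x + tensor_vm (v t x) (P t x) \<bullet> grad_m ?\<psi> x
      - grad_Sym0 F (Q t x) \<bullet> ?\<psi> x - wgrad_m (Q t) x \<bullet> grad_m ?\<psi> x \<partial>torus) = (\<integral>x. ?A x - ?C x - ?B x \<partial>torus)"
      by (rule integral_torus_cong_AE) (intro continuous_on_diff cA cB cC)
    also have "\<dots> = (\<integral>x. ?A x \<partial>torus) - (\<integral>x. ?C x \<partial>torus) - (\<integral>x. ?B x \<partial>torus)"
      by (simp add: continuous_torus_integrable cA cB cC)
    also have "(\<integral>x. ?A x \<partial>torus) = - ip (conv (vr t) (Pr' t)) ?\<psi>"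
      by (rule conv_by_parts[OF C1p_reps(1)[OF t] div_zero(2)[OF t] C1p_reps(2)[OF t] c\<psi>])
    also have "(\<integral>x. ?B x \<partial>torus) = - ip (lap (Qr'' t)) ?\<psi>"
      by (rule lap_by_parts[of "Qr' t" "Qr'' t" ?\<psi> "\<lambda>k. pd k ?\<psi>", OF C1p_reps(4)[OF t] c\<psi>])
    also have "(\<integral>x. ?C x \<partial>torus) = ip (Gr t) ?\<psi>" by (simp add: ip_def)
    also have "- ip (conv (vr t) (Pr' t)) ?\<psi> - ip (Gr t) ?\<psi> - - ip (lap (Qr'' t)) ?\<psi> = ip (Pt t) ?\<psi>"
      unfolding Pt_def[abs_def] by (simp add: ip_diff_left L2_reps[OF t])
    finally show ?thesis .
  qed
  have "ip (Pr \<tau>) ?\<psi> - ip (Pr 0) ?\<psi> = tint 0 \<tau> (\<lambda>t. ip (Pt t) ?\<psi>) + tint 0 \<tau> (\<lambda>t. pairing (R2 t) (grad_m ?\<psi>))"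
    if \<tau>: "\<tau> \<in> {0..T}" for \<tau>
  proof -
    have 0: "0 \<in> {0..T}" using T by simp
    have "test_fun T (\<lambda>t. ?\<psi>) \<and> (\<forall>t\<in>{0..T}. \<forall>x. ?\<psi> x \<in> Sym0)" by (intro conjI ballI allI test_fun_tpoly tpoly_Sym0 S)
    from sol_P[OF \<tau> this]
    have "ip (Pr \<tau>) ?\<psi> - ip (Pr 0) ?\<psi>
      = tint 0 \<tau> (\<lambda>t. \<integral>x. P t x \<bullet> pd_t T (\<lambda>t. ?\<psi>) t x + tensor_vm (v t x) (P t x) \<bullet> grad_m ?\<psi> x
      - grad_Sym0 F (Q t x) \<bullet> ?\<psi> x - wgrad_m (Q t) x \<bullet> grad_m ?\<psi> x \<partial>torus) + tint 0 \<tau> (\<lambda>t. pairing (R2 t) (grad_m ?\<psi>))"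
      by (simp only: ip_reps(2)[OF \<tau> L2_tpoly] ip_reps(2)[OF 0 L2_tpoly])
    also have "tint 0 \<tau> (\<lambda>t. \<integral>x. P t x \<bullet> pd_t T (\<lambda>t. ?\<psi>) t x + tensor_vm (v t x) (P t x) \<bullet> grad_m ?\<psi> x
      - grad_Sym0 F (Q t x) \<bullet> ?\<psi> x - wgrad_m (Q t) x \<bullet> grad_m ?\<psi> x \<partial>torus) = tint 0 \<tau> (\<lambda>t. ip (Pt t) ?\<psi>)"
      by (rule tint_cong) (use \<tau> in \<open>auto intro!: int\<close>)
    finally show ?thesis .
  qed
  from increment_from_origin[OF this CL_ip_continuous[OF CL_CP[OF CP_rates(2)] CL_const[OF L2_tpoly]] ab pairing_bounds(4)[OF _ _ _ zero_less_one]]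
  have "ip (Pr b) ?\<psi> - ip (Pr a) ?\<psi> = tint a b (\<lambda>t. ip (Pt t) ?\<psi>) + tint a b (\<lambda>t. pairing (R2 t) (grad_m ?\<psi>))"
    using ab by simp
  then show ?thesis using ab by (simp add: ip_diff_left L2_reps)
qed

lemma Q_increment_tpoly:
  assumes ab: "0 \<le> a" "a \<le> b" "b \<le> T"
  shows "ip (\<lambda>x. Qr b x - Qr a x) (tpoly \<kappa> c n) = tint a b (\<lambda>t. ip (Qt t) (tpoly \<kappa> c n))"
proof -
  let ?\<psi> = "tpoly \<kappa> c n"
  note c\<psi> = C1p_tpoly[of _ \<kappa> c n] and cc = C1p_continuous[OF C1p_tpoly[of _ \<kappa> c n]]
  have int: "(\<integral>x. Q t x \<bullet> pd_t T (\<lambda>t. ?\<psi>) t x + tensor_vm (v t x) (Q t x) \<bullet> grad_m ?\<psi> x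
      + P t x \<bullet> ?\<psi> x \<partial>torus) = ip (Qt t) ?\<psi>" if t: "t \<in> {0..T}" for t
  proof -
    note co = continuous_reps[OF t]
    let ?A = "\<lambda>x. \<Sum>k\<in>UNIV. vr t x $ k * (Qr t x \<bullet> pd k ?\<psi> x)"
    let ?C = "\<lambda>x. Pr t x \<bullet> ?\<psi> x"
    have cA: "continuous_on UNIV ?A" and cC: "continuous_on UNIV ?C"
      by (intro continuous_intros co cc)+
    from AE_reps(1,2,3)[OF t] have "AE x in torus. Q t x \<bullet> pd_t T (\<lambda>t. ?\<psi>) t x + tensor_vm (v t x) (Q t x) \<bullet> grad_m ?\<psi> x
      + P t x \<bullet> ?\<psi> x = ?A x + ?C x"
      by eventually_elim (simp add: pd_t_const[OF T t] inner_tensor_vm)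
    then have "(\<integral>x. Q t x \<bullet> pd_t T (\<lambda>t. ?\<psi>) t x + tensor_vm (v t x) (Q t x) \<bullet> grad_m ?\<psi> x
      + P t x \<bullet> ?\<psi> x \<partial>torus) = (\<integral>x. ?A x + ?C x \<partial>torus)"
      by (rule integral_torus_cong_AE) (intro continuous_on_add cA cC)
    also have "\<dots> = (\<integral>x. ?A x \<partial>torus) + (\<integral>x. ?C x \<partial>torus)"
      by (simp add: continuous_torus_integrable cA cC)
    also have "(\<integral>x. ?A x \<partial>torus) = - ip (conv (vr t) (Qr' t)) ?\<psi>"
      by (rule conv_by_parts[OF C1p_reps(1)[OF t] div_zero(2)[OF t] C1p_reps(3)[OF t] c\<psi>])
    also have "(\<integral>x. ?C x \<partial>torus) = ip (Pr t) ?\<psi>" by (simp add: ip_def)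
    also have "- ip (conv (vr t) (Qr' t)) ?\<psi> + ip (Pr t) ?\<psi> = ip (Qt t) ?\<psi>"
      unfolding Qt_def[abs_def] by (simp add: ip_diff_left L2_reps[OF t])
    finally show ?thesis .
  qed
  have "ip (Qr \<tau>) ?\<psi> - ip (Qr 0) ?\<psi> = tint 0 \<tau> (\<lambda>t. ip (Qt t) ?\<psi>) + tint 0 \<tau> (\<lambda>t. 0)"
    if \<tau>: "\<tau> \<in> {0..T}" for \<tau>
  proof -
    have 0: "0 \<in> {0..T}" using T by simp
    have "ip (Qr \<tau>) ?\<psi> - ip (Qr 0) ?\<psi>
      = tint 0 \<tau> (\<lambda>t. \<integral>x. Q t x \<bullet> pd_t T (\<lambda>t. ?\<psi>) t x + tensor_vm (v t x) (Q t x) \<bullet> grad_m ?\<psi> x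
      + P t x \<bullet> ?\<psi> x \<partial>torus)"
      using sol_Q[OF \<tau> test_fun_tpoly] by (simp only: ip_reps(3)[OF \<tau> L2_tpoly] ip_reps(3)[OF 0 L2_tpoly])
    also have "\<dots> = tint 0 \<tau> (\<lambda>t. ip (Qt t) ?\<psi>)"
      by (rule tint_cong) (use \<tau> in \<open>auto intro!: int\<close>)
    finally show ?thesis by simp
  qed
  from increment_from_origin[OF this CL_ip_continuous[OF CL_CP[OF CP_rates(3)] CL_const[OF L2_tpoly]] ab]
  have "ip (Qr b) ?\<psi> - ip (Qr a) ?\<psi> = tint a b (\<lambda>t. ip (Qt t) ?\<psi>)"
    using ab by simp
  then show ?thesis using ab by (simp add: ip_diff_left L2_reps)
qed

text \<open>The equation for \<open>Q\<close> carries no defect measure and puts no constraint on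
  the test function, so it extends to all of \<open>L2\<close>. This admits the Laplacian, the
  gradient of \<open>F\<close> and the increment itself as tests.\<close>

lemma Q_increment:
  assumes ab: "0 \<le> a" "a \<le> b" "b \<le> T" and \<psi>: "L2 \<psi>"
  shows "ip (\<lambda>x. Qr b x - Qr a x) \<psi> = tint a b (\<lambda>t. ip (Qt t) \<psi>)"
  by (rule weak_increment_density[OF _ CL_CP[OF CP_rates(3)] ab _ \<psi>])
    (use ab in \<open>simp_all add: L2_reps cas_scale_eq_tpoly Q_increment_tpoly\<close>)

section \<open>Increments of the energy terms on short intervals\<close>

lemma trunc_rep: assumes "t \<in> {0..T}" shows "trunc n (vr t) = trunc n (v t)" "trunc n (Pr t) = trunc n (P t)"
  by (simp_all add: hat_rep[OF sob_t(1)[OF assms] s_le(1)] hat_rep[OF sob_t(2)[OF assms] s_le(1)])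

text \<open>The tests are truncations of the velocity at a fixed time \<open>c\<close>; one gradient
  bound serves all \<open>c\<close> and all truncations, so the defect costs a fixed multiple of the
  mass.\<close>

lemma kinetic_negligible:
  obtains K where "0 \<le> K" "negl T mass K (\<lambda>a b. (ip (vr b) (vr b) - ip (vr a) (vr a)) / 2 - (b - a) * ip (vt a) (vr a))"
proof -
  obtain M where M: "M > 0" "\<And>t n k x. t \<in> {0..T} \<Longrightarrow> norm (pd k (trunc n (v t)) x) \<le> M"
    by (rule trunc_grad_bounded[OF Csob(1) s_le(2)], rule that)
  have "\<bar>ip (\<lambda>x. vr b x - vr a x) (vr c) - tint a b (\<lambda>t. ip (vt t) (vr c))\<bar> \<le> 54 * M * mass a b"
    if ab: "0 \<le> a" "a \<le> b" "b \<le> T" and c: "c \<in> {0..T}" for a b c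
  proof (rule increment_limit[OF _ CL_CP[OF CP_rates(1)] ab L2_reps(7)[OF c]])
    show "L2 (\<lambda>x. vr b x - vr a x)" using ab by (intro L2_diff L2_reps) auto
    fix n
    show "\<bar>ip (\<lambda>x. vr b x - vr a x) (trunc n (vr c)) - tint a b (\<lambda>t. ip (vt t) (trunc n (vr c)))\<bar> \<le> 54 * M * mass a b"
      unfolding trunc_rep[OF c] v_increment[OF ab div_zero(3)[OF c]]
      using pairing_bounds(1)[OF ab M(1) M(2)[OF c]] by simp
  qed
  from negl_square[OF CL_CP[OF CP_reps(1)] CL_CP[OF CP_rates(1)] this] M(1) show ?thesis
    by (intro that[of "54 * M"]) auto
qed

text \<open>As for the kinetic energy; the truncations are admissible because the coefficients of
  \<open>P\<close> lie in \<open>Sym0\<close>.\<close>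

lemma momentum_negligible:
  obtains K where "0 \<le> K" "negl T mass K (\<lambda>a b. (ip (Pr b) (Pr b) - ip (Pr a) (Pr a)) / 2 - (b - a) * ip (Pt a) (Pr a))"
proof -
  obtain M where M: "M > 0" "\<And>t n k x. t \<in> {0..T} \<Longrightarrow> norm (pd k (trunc n (P t)) x) \<le> M"
    by (rule trunc_grad_bounded[OF Csob(2) s_le(2)], rule that)
  have "\<bar>ip (\<lambda>x. Pr b x - Pr a x) (Pr c) - tint a b (\<lambda>t. ip (Pt t) (Pr c))\<bar> \<le> 162 * M * mass a b"
    if ab: "0 \<le> a" "a \<le> b" "b \<le> T" and c: "c \<in> {0..T}" for a b c
  proof (rule increment_limit[OF _ CL_CP[OF CP_rates(2)] ab L2_reps(8)[OF c]])
    show "L2 (\<lambda>x. Pr b x - Pr a x)" using ab by (intro L2_diff L2_reps) auto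
    fix n
    show "\<bar>ip (\<lambda>x. Pr b x - Pr a x) (trunc n (Pr c)) - tint a b (\<lambda>t. ip (Pt t) (trunc n (Pr c)))\<bar> \<le> 162 * M * mass a b"
      unfolding trunc_rep[OF c] P_increment[OF ab hat_Sym0[OF sob_L2[OF sob_t(2)[OF c]] Sym0_AE(1)[OF c]]]
      using pairing_bounds(2)[OF ab M(1) M(2)[OF c]] by simp
  qed
  from negl_square[OF CL_CP[OF CP_reps(2)] CL_CP[OF CP_rates(2)] this] M(1) show ?thesis
    by (intro that[of "162 * M"]) auto
qed

text \<open>The mass term in the name is the contribution \<Lambda>|Q|^2 to the energy; the mass of
  the defect measures enters with factor 0.\<close>

lemma mass_term_negligible:
  "negl T mass 0 (\<lambda>a b. (ip (Qr b) (Qr b) - ip (Qr a) (Qr a)) / 2 - (b - a) * ip (Qt a) (Qr a))"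
  by (rule negl_square[OF CL_CP[OF CP_reps(3)] CL_CP[OF CP_rates(3)]]) (simp add: Q_increment L2_reps)

lemma gradient_pairing:
  assumes t: "t \<in> {0..T}" and r: "r \<in> {0..T}"
  shows "(\<Sum>k\<in>UNIV. ip (Qr' t k) (Qr' r k)) = - ip (lap (Qr'' t)) (Qr r)"
proof -
  have "(\<integral>x. (\<Sum>k\<in>UNIV. Qr' t k x \<bullet> Qr' r k x) \<partial>torus) = (\<Sum>k\<in>UNIV. ip (Qr' t k) (Qr' r k))"
    unfolding ip_def by (intro Bochner_Integration.integral_sum L2_inner_integrable L2_reps t r)
  then show ?thesis using lap_by_parts[of "Qr' t" "Qr'' t" "Qr r" "Qr' r", OF C1p_reps(4)[OF t] C1p_reps(3)[OF r]] by simp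
qed

text \<open>The increment of \<open>Q\<close> is tested with its Laplacian at both end points. By
  \<open>gradient_pairing\<close> the average of the two results is minus half the increment of the
  integral of |\<nabla>Q|^2.\<close>

lemma elastic_negligible:
  "negl T mass 0 (\<lambda>a b. ((\<Sum>k\<in>UNIV. ip (Qr' b k) (Qr' b k)) - (\<Sum>k\<in>UNIV. ip (Qr' a k) (Qr' a k))) / 2
     - (b - a) * - ip (Qt a) (lap (Qr'' a)))"
proof -
  have L: "negl T mass 0 (\<lambda>a b. ip (\<lambda>x. Qr b x - Qr a x) (lap (Qr'' (c a b))) - (b - a) * ip (Qt a) (lap (Qr'' a)))"
    if "\<And>a b. a \<le> b \<Longrightarrow> c a b \<in> {a..b}" for c
  proof (rule negl_tint_ip_frozen[OF CL_CP[OF CP_rates(3)] CL_CP[OF CP_lap] that])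
    fix a b :: real assume ab: "0 \<le> a" "a \<le> b" "b \<le> T"
    with that[OF ab(2)] have "c a b \<in> {0..T}" by auto
    then show "\<bar>ip (\<lambda>x. Qr b x - Qr a x) (lap (Qr'' (c a b))) - tint a b (\<lambda>t. ip (Qt t) (lap (Qr'' (c a b))))\<bar> \<le> 0 * mass a b"
      by (simp add: Q_increment[OF ab] L2_reps)
  qed
  have "negl T mass (\<bar>- 1/2\<bar> * (0 + 0)) (\<lambda>a b. - 1/2 * ((ip (\<lambda>x. Qr b x - Qr a x) (lap (Qr'' a)) - (b - a) * ip (Qt a) (lap (Qr'' a)))
      + (ip (\<lambda>x. Qr b x - Qr a x) (lap (Qr'' b)) - (b - a) * ip (Qt a) (lap (Qr'' a)))))"
    by (intro negl_scale negl_add L[of "\<lambda>a b. a"] L[of "\<lambda>a b. b"]) auto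
  then have n: "negl T mass 0 (\<lambda>a b. - 1/2 * ((ip (\<lambda>x. Qr b x - Qr a x) (lap (Qr'' a)) - (b - a) * ip (Qt a) (lap (Qr'' a)))
      + (ip (\<lambda>x. Qr b x - Qr a x) (lap (Qr'' b)) - (b - a) * ip (Qt a) (lap (Qr'' a)))))" by simp
  show ?thesis
  proof (rule negl_cong[OF n])
    fix a b :: real assume "0 \<le> a" "a \<le> b" "b \<le> T"
    then have t: "a \<in> {0..T}" "b \<in> {0..T}" by auto
    have "(\<Sum>k\<in>UNIV. ip (Qr' a k) (Qr' b k)) = (\<Sum>k\<in>UNIV. ip (Qr' b k) (Qr' a k))" by (simp add: ip_commute)
    \<comment> \<open>Symmetry of the gradient pairing cancels the two mixed terms.\<close>
    then have "ip (Qr b) (lap (Qr'' a)) = ip (Qr a) (lap (Qr'' b))"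
      unfolding gradient_pairing[OF t] gradient_pairing[OF t(2,1)] by (simp add: ip_commute)
    moreover have "ip (\<lambda>x. Qr b x - Qr a x) (lap (Qr'' c)) = ip (Qr b) (lap (Qr'' c)) - ip (Qr a) (lap (Qr'' c))"
      if "c \<in> {0..T}" for c by (rule ip_diff_left; rule L2_reps[OF t(1)] L2_reps[OF t(2)] L2_reps[OF that])
    note this[OF t(1)] this[OF t(2)]
    ultimately show "- 1/2 * ((ip (\<lambda>x. Qr b x - Qr a x) (lap (Qr'' a)) - (b - a) * ip (Qt a) (lap (Qr'' a)))
      + (ip (\<lambda>x. Qr b x - Qr a x) (lap (Qr'' b)) - (b - a) * ip (Qt a) (lap (Qr'' a))))
      = ((\<Sum>k\<in>UNIV. ip (Qr' b k) (Qr' b k)) - (\<Sum>k\<in>UNIV. ip (Qr' a k) (Qr' a k))) / 2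
        - (b - a) * - ip (Qt a) (lap (Qr'' a))"
      unfolding gradient_pairing[OF t(1,1)] gradient_pairing[OF t(2,2)]
      by (simp add: ip_commute[of "lap _"] field_simps)
  qed
qed

text \<open>Testing the increment with itself leaves one factor of its norm to be cancelled. Growth
  linear in \<open>b - a\<close> is what makes the Taylor remainder of the potential
  negligible.\<close>

lemma Q_Lipschitz:
  obtains B where "B > 0" "\<And>a b. 0 \<le> a \<Longrightarrow> a \<le> b \<Longrightarrow> b \<le> T \<Longrightarrow> n2 (\<lambda>x. Qr b x - Qr a x) \<le> B * (b - a)"
proof -
  obtain B where B: "B > 0" "\<And>t. t \<in> {0..T} \<Longrightarrow> n2 (Qt t) \<le> B"
    by (rule CP_n2_bounded[OF CP_rates(3)], rule that)
  show ?thesis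
  proof (rule that[OF B(1)])
    fix a b :: real assume ab: "0 \<le> a" "a \<le> b" "b \<le> T"
    let ?d = "\<lambda>x. Qr b x - Qr a x"
    have L: "L2 ?d" using ab by (intro L2_diff L2_reps) auto
    have "(n2 ?d)\<^sup>2 = tint a b (\<lambda>t. ip (Qt t) ?d)" unfolding n2_power2 by (rule Q_increment[OF ab L])
    also have "\<dots> \<le> \<bar>tint a b (\<lambda>t. ip (Qt t) ?d)\<bar>" by simp
    also have "\<dots> \<le> (B * n2 ?d) * (b - a)"
    proof (rule tint_bound[OF continuous_tint[OF CL_ip_continuous[OF CL_CP[OF CP_rates(3)] CL_const[OF L]] ab(1,3)] ab(2)])
      fix t assume "t \<in> {a..b}"
      then have t: "t \<in> {0..T}" using ab by auto
      have "\<bar>ip (Qt t) ?d\<bar> \<le> n2 (Qt t) * n2 ?d" by (rule ip_Cauchy_Schwarz[OF CP_L2[OF CP_rates(3) t] L])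
      also have "\<dots> \<le> B * n2 ?d" by (intro mult_right_mono B(2) t) simp
      finally show "\<bar>ip (Qt t) ?d\<bar> \<le> B * n2 ?d" .
    qed
    finally have *: "n2 ?d * n2 ?d \<le> n2 ?d * (B * (b - a))" by (simp add: power2_eq_square mult_ac)
    show "n2 ?d \<le> B * (b - a)"
    proof (cases "n2 ?d = 0")
      case True then show ?thesis using B(1) ab by simp
    next
      case False
      then have "n2 ?d > 0" using n2_nonneg[of ?d] by linarith
      with * show ?thesis by (simp only: mult_le_cancel_left_pos)
    qed
  qed
qed

text \<open>\<open>F\<close> is not quadratic, so averaging over the end points is replaced by a
  first-order Taylor expansion at time \<open>a\<close>, whose remainder is small relative to the
  increment of \<open>Q\<close>.\<close>

lemma potential_negligible:
  "negl T mass 0 (\<lambda>a b. ((\<integral>x. F (Qr b x) \<partial>torus) - (\<integral>x. F (Qr a x) \<partial>torus)) - (b - a) * ip (Qt a) (Gr a))"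
proof -
  have lin: "negl T mass 0 (\<lambda>a b. ip (\<lambda>x. Qr b x - Qr a x) (Gr a) - (b - a) * ip (Qt a) (Gr a))"
    by (rule negl_tint_ip_frozen[OF CL_CP[OF CP_rates(3)] CL_CP[OF CP_Gr], where c = "\<lambda>a b. a"])
      (simp_all add: Q_increment L2_reps)
  obtain B where B: "B > 0" "\<And>a b. 0 \<le> a \<Longrightarrow> a \<le> b \<Longrightarrow> b \<le> T \<Longrightarrow> n2 (\<lambda>x. Qr b x - Qr a x) \<le> B * (b - a)"
    by (rule Q_Lipschitz, rule that)
  obtain M where M: "M > 0" "\<And>t x. t \<in> {0..T} \<Longrightarrow> x \<in> cell \<Longrightarrow> norm (Qr t x) \<le> M"
    by (rule CP_bounded[OF CP_reps(3)], rule that)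
  have rem: "negl T mass 0 (\<lambda>a b. (\<integral>x. F (Qr b x) \<partial>torus) - (\<integral>x. F (Qr a x) \<partial>torus) - ip (\<lambda>x. Qr b x - Qr a x) (Gr a))"
  proof (rule neglI)
    fix e :: real assume e: "e > 0"
    \<comment> \<open>\<open>B\<close> is the Lipschitz constant of \<open>Q\<close> in
      \<open>L2\<close>, and \<open>sqrt vol\<close> bounds the L1 norm by the L2 norm.\<close>
    let ?e = "e / (sqrt vol * B)"
    have vB: "sqrt vol * B > 0" using vol_pos B(1) by simp
    have e': "?e > 0" using e vB by simp
    obtain d where d: "d > 0" "\<And>A B. A \<in> Sym0 \<Longrightarrow> B \<in> Sym0 \<Longrightarrow> norm A \<le> M \<Longrightarrow> norm B \<le> M \<Longrightarrow> norm (B - A) < d \<Longrightarrow>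
       \<bar>F B - F A - grad_Sym0 F A \<bullet> (B - A)\<bar> \<le> ?e * norm (B - A)"
      by (rule uniform_Taylor_Sym0[OF F e', of M], rule that)
    obtain d' where d': "d' > 0" "\<And>s t x. s \<in> {0..T} \<Longrightarrow> t \<in> {0..T} \<Longrightarrow> \<bar>s - t\<bar> < d' \<Longrightarrow> x \<in> cell \<Longrightarrow> norm (Qr s x - Qr t x) < d"
      by (rule CP_uniform[OF CP_reps(3) d(1)], rule that)
    show "\<exists>d>0. \<forall>a b. 0 \<le> a \<longrightarrow> a \<le> b \<longrightarrow> b \<le> T \<longrightarrow> b - a < d \<longrightarrow>
      \<bar>(\<integral>x. F (Qr b x) \<partial>torus) - (\<integral>x. F (Qr a x) \<partial>torus) - ip (\<lambda>x. Qr b x - Qr a x) (Gr a)\<bar> \<le> 0 * mass a b + e * (b - a)"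
    proof (intro exI[of _ d'] conjI allI impI d'(1))
      fix a b :: real assume ab: "0 \<le> a" "a \<le> b" "b \<le> T" "b - a < d'"
      then have t: "a \<in> {0..T}" "b \<in> {0..T}" by auto
      let ?d = "\<lambda>x. Qr b x - Qr a x"
      have cF: "continuous_on UNIV (\<lambda>x. F (Qr t x))" if "t \<in> {0..T}" for t
        by (rule C1p_continuous(1)[OF C1p_compose_Sym0[OF F C1p_reps(3)[OF that] Sym0_reps(2)[OF that]]])
      note co = cF[OF t(1)] cF[OF t(2)] continuous_reps(3)[OF t(1)] continuous_reps(3)[OF t(2)] continuous_reps(8)[OF t(1)]
      have i: "integrable torus (\<lambda>x. F (Qr b x))" "integrable torus (\<lambda>x. F (Qr a x))" "integrable torus (\<lambda>x. ?d x \<bullet> Gr a x)"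
        by (intro continuous_torus_integrable continuous_intros co)+
      let ?R = "\<lambda>x. F (Qr b x) - F (Qr a x) - ?d x \<bullet> Gr a x"
      have cR: "continuous_on UNIV ?R" and cd: "continuous_on UNIV (\<lambda>x. norm (?d x))" by (intro continuous_intros co)+
      have "(\<integral>x. F (Qr b x) \<partial>torus) - (\<integral>x. F (Qr a x) \<partial>torus) - ip ?d (Gr a) = (\<integral>x. ?R x \<partial>torus)"
        using i by (simp add: ip_def)
      moreover have "\<bar>\<integral>x. ?R x \<partial>torus\<bar> \<le> (\<integral>x. \<bar>?R x\<bar> \<partial>torus)" by (rule integral_abs_bound)
      moreover have "(\<integral>x. \<bar>?R x\<bar> \<partial>torus) \<le> (\<integral>x. ?e * norm (?d x) \<partial>torus)"
      proof (rule integral_mono_AE)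
        show "integrable torus (\<lambda>x. \<bar>?R x\<bar>)" "integrable torus (\<lambda>x. ?e * norm (?d x))"
          by (intro continuous_torus_integrable continuous_intros cR cd)+
        show "AE x in torus. \<bar>?R x\<bar> \<le> ?e * norm (?d x)"
        proof (rule AE_torus_I)
          fix x assume x: "x \<in> cell"
          have "norm (?d x) < d" by (rule d'(2)[OF t(2,1) _ x]) (use ab in simp)
          from d(2)[OF Sym0_reps(2)[OF t(1)] Sym0_reps(2)[OF t(2)] M(2)[OF t(1) x] M(2)[OF t(2) x] this]
          show "\<bar>?R x\<bar> \<le> ?e * norm (?d x)" by (simp add: inner_commute)
        qed
      qed
      moreover have "(\<integral>x. norm (?d x) \<partial>torus) \<le> sqrt vol * n2 ?d"
      proof -
        have "\<bar>ip (\<lambda>x. norm (?d x)) (\<lambda>x. 1)\<bar> \<le> n2 (\<lambda>x. norm (?d x)) * n2 (\<lambda>x. 1::real)"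
          by (rule ip_Cauchy_Schwarz[OF L2_continuous[OF cd] L2_const])
        moreover have "n2 (\<lambda>x. norm (?d x)) = n2 ?d" by (simp add: n2_def ip_self)
        moreover have "n2 (\<lambda>x::real^3. 1::real) = sqrt vol" by (simp add: n2_def ip_def)
        ultimately show ?thesis by (simp add: ip_def mult.commute)
      qed
      then have "(\<integral>x. ?e * norm (?d x) \<partial>torus) \<le> ?e * (sqrt vol * n2 ?d)"
        unfolding integral_mult_right_zero by (rule mult_left_mono) (use e' in simp)
      moreover have "?e * (sqrt vol * n2 ?d) \<le> ?e * (sqrt vol * (B * (b - a)))"
        using B(2)[OF ab(1-3)] e' vol_pos by (intro mult_left_mono) auto
      moreover have "?e * (sqrt vol * (B * (b - a))) = e * (b - a)"
      proof -
        have "?e * (sqrt vol * (B * (b - a))) = ?e * (sqrt vol * B) * (b - a)" by (simp only: mult.assoc)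
        also have "e / X * X = e" if "X > 0" for X using that by simp
        note this[OF vB]
        finally show ?thesis .
      qed
      ultimately show "\<bar>(\<integral>x. F (Qr b x) \<partial>torus) - (\<integral>x. F (Qr a x) \<partial>torus) - ip ?d (Gr a)\<bar> \<le> 0 * mass a b + e * (b - a)"
        by linarith
    qed
  qed
  have "negl T mass (0 + 0) (\<lambda>a b. ((\<integral>x. F (Qr b x) \<partial>torus) - (\<integral>x. F (Qr a x) \<partial>torus) - ip (\<lambda>x. Qr b x - Qr a x) (Gr a))
    + (ip (\<lambda>x. Qr b x - Qr a x) (Gr a) - (b - a) * ip (Qt a) (Gr a)))"
    by (rule negl_add[OF rem lin])
  from negl_cong[OF this[unfolded add_0_left]] show ?thesis by simp
qed

text \<open>Written with the representatives and split so that each summand has its own increment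
  lemma.\<close>

definition "energy t = ip (vr t) (vr t) / 2 + ip (Pr t) (Pr t) / 2 + (\<Sum>k\<in>UNIV. ip (Qr' t k) (Qr' t k)) / 2
  + (\<integral>x. F (Qr t x) \<partial>torus) + \<Lambda> * ip (Qr t) (Qr t)"

lemma total_energy_eq:
  assumes t: "t \<in> {0..T}"
  shows "total_energy (\<lambda>A. F A + \<Lambda> * (norm A)\<^sup>2) (v t) (P t) (Q t) = energy t"
proof -
  note co = continuous_reps[OF t]
  have cF: "continuous_on UNIV (\<lambda>x. F (Qr t x))"
    by (rule C1p_continuous(1)[OF C1p_compose_Sym0[OF F C1p_reps(3)[OF t] Sym0_reps(2)[OF t]]])
  let ?g = "\<lambda>x. vr t x \<bullet> vr t x / 2 + Pr t x \<bullet> Pr t x / 2 + (\<Sum>k\<in>UNIV. Qr' t k x \<bullet> Qr' t k x) / 2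
    + (F (Qr t x) + \<Lambda> * (Qr t x \<bullet> Qr t x))"
  have "AE x in torus. \<forall>k. wd k (Q t) x = Qr' t k x" unfolding AE_all_countable by (rule allI) (rule AE_reps(6)[OF t])
  with AE_reps(1,2,3)[OF t]
  have "AE x in torus. (norm (v t x))\<^sup>2 / 2 + (norm (P t x))\<^sup>2 / 2 + (norm (wgrad_m (Q t) x))\<^sup>2 / 2
      + (F (Q t x) + \<Lambda> * (norm (Q t x))\<^sup>2) = ?g x"
    by eventually_elim (simp add: power2_norm_eq_inner wgrad_m_def inner_tensor3)
  then have "total_energy (\<lambda>A. F A + \<Lambda> * (norm A)\<^sup>2) (v t) (P t) (Q t) = (\<integral>x. ?g x \<partial>torus)"
    unfolding total_energy_def by (rule integral_torus_cong_AE) (intro continuous_intros co cF; simp)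
  also have "\<dots> = energy t"
    unfolding energy_def ip_def
    by (simp add: continuous_torus_integrable cF L2_inner_integrable L2_reps[OF t])
  finally show ?thesis .
qed

text \<open>The terms of order \<open>b - a\<close> add up to 0 by
  \<open>energy_cancellation\<close> for the fields and rates at time \<open>a\<close>. The work
  term with factor 2\<Lambda> is the rate of \<Lambda>|Q|^2, since transport drops out of the
  pairing of \<open>Qt\<close> with \<open>Q\<close>.\<close>

lemma energy_negligible:
  obtains K where "0 \<le> K" "negl T mass K (\<lambda>a b. energy b - energy a - 2 * \<Lambda> * tint a b (\<lambda>t. ip (Qr t) (Pr t)))"
proof -
  obtain K1 where K1: "0 \<le> K1" "negl T mass K1 (\<lambda>a b. (ip (vr b) (vr b) - ip (vr a) (vr a)) / 2 - (b - a) * ip (vt a) (vr a))"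
    by (rule kinetic_negligible, rule that)
  obtain K2 where K2: "0 \<le> K2" "negl T mass K2 (\<lambda>a b. (ip (Pr b) (Pr b) - ip (Pr a) (Pr a)) / 2 - (b - a) * ip (Pt a) (Pr a))"
    by (rule momentum_negligible, rule that)
  note all = negl_add[OF negl_add[OF negl_add[OF negl_add[OF negl_add[OF K1(2) K2(2)] elastic_negligible] potential_negligible]
    negl_scale[OF mass_term_negligible, of "2 * \<Lambda>"]] negl_scale[OF negl_tint_ip[OF CL_CP[OF CP_reps(3)] CL_CP[OF CP_reps(2)]], of mass "- 2 * \<Lambda>"]]
  show ?thesis
  proof (rule that[of "K1 + K2 + 0 + 0 + \<bar>2 * \<Lambda>\<bar> * 0 + \<bar>- 2 * \<Lambda>\<bar> * 0"])
    show "0 \<le> K1 + K2 + 0 + 0 + \<bar>2 * \<Lambda>\<bar> * 0 + \<bar>- 2 * \<Lambda>\<bar> * 0" using K1 K2 by simp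
    show "negl T mass (K1 + K2 + 0 + 0 + \<bar>2 * \<Lambda>\<bar> * 0 + \<bar>- 2 * \<Lambda>\<bar> * 0)
      (\<lambda>a b. energy b - energy a - 2 * \<Lambda> * tint a b (\<lambda>t. ip (Qr t) (Pr t)))"
    proof (rule negl_cong[OF all])
      fix a b :: real assume ab: "0 \<le> a" "a \<le> b" "b \<le> T"
      then have a: "a \<in> {0..T}" by simp
      have sym: "Qr'' a j k = Qr'' a k j" for j k by (simp add: rep2_def fun_eq_iff mult.commute[of "real_of_int (_ $ j)"])
      note ec = energy_cancellation[of "vr a" "vr' a" "Pr a" "Pr' a" "Qr a" "Qr' a" "Qr'' a",
        OF C1p_reps(1)[OF a] div_zero(2)[OF a] C1p_reps(2)[OF a] C1p_reps(3)[OF a] C1p_reps(4)[OF a] sym F Sym0_reps(2)[OF a]]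
      have v: "ip (vt a) (vr a) = - ip (\<lambda>x. conv (vr a) (vr' a) x + stress_div (Qr' a) (Qr'' a) x) (vr a)"
        unfolding ip_uminus_left[symmetric] vt_def[abs_def] by simp
      have p: "ip (Pt a) (Pr a) = - ip (\<lambda>x. conv (vr a) (Pr' a) x + Gr a x - lap (Qr'' a) x) (Pr a)"
        unfolding ip_uminus_left[symmetric] Pt_def[abs_def] by (simp add: algebra_simps)
      have z: "ip (vt a) (vr a) + ip (Pt a) (Pr a) - ip (Qt a) (lap (Qr'' a)) + ip (Qt a) (Gr a) = 0"
        and q: "ip (Qt a) (Qr a) = ip (Qr a) (Pr a)"
        using ec unfolding v p Qt_def[abs_def] by simp_all
      have z': "(b - a) * ip (vt a) (vr a) + (b - a) * ip (Pt a) (Pr a) - (b - a) * ip (Qt a) (lap (Qr'' a)) + (b - a) * ip (Qt a) (Gr a) = 0"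
        using arg_cong[OF z, of "\<lambda>r. (b - a) * r"] by (simp add: distrib_left right_diff_distrib)
      show "(ip (vr b) (vr b) - ip (vr a) (vr a)) / 2 - (b - a) * ip (vt a) (vr a)
        + ((ip (Pr b) (Pr b) - ip (Pr a) (Pr a)) / 2 - (b - a) * ip (Pt a) (Pr a))
        + (((\<Sum>k\<in>UNIV. ip (Qr' b k) (Qr' b k)) - (\<Sum>k\<in>UNIV. ip (Qr' a k) (Qr' a k))) / 2 - (b - a) * - ip (Qt a) (lap (Qr'' a)))
        + ((\<integral>x. F (Qr b x) \<partial>torus) - (\<integral>x. F (Qr a x) \<partial>torus) - (b - a) * ip (Qt a) (Gr a))
        + 2 * \<Lambda> * ((ip (Qr b) (Qr b) - ip (Qr a) (Qr a)) / 2 - (b - a) * ip (Qt a) (Qr a))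
        + - 2 * \<Lambda> * (tint a b (\<lambda>t. ip (Qr t) (Pr t)) - (b - a) * ip (Qr a) (Pr a))
        = energy b - energy a - 2 * \<Lambda> * tint a b (\<lambda>t. ip (Qr t) (Pr t))"
        unfolding energy_def q using z' by (simp add: algebra_simps diff_divide_distrib)
    qed
  qed
qed

text \<open>Valid at every time, as the energy balance is; differences of \<open>D\<close> over
  arbitrary intervals are needed below.\<close>

lemma D_eq:
  assumes t: "t \<in> {0..T}"
  shows "D t = - (energy t - energy 0 - 2 * \<Lambda> * tint 0 t (\<lambda>r. ip (Qr r) (Pr r)))"
proof -
  have 0: "0 \<in> {0..T}" using T by simp
  have "(\<integral>x. Q r x \<bullet> P r x \<partial>torus) = ip (Qr r) (Pr r)" if r: "r \<in> {0..T}" for r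
    using ip_cong_AE[OF sob_L2[OF sob_t(3)[OF r]] sob_L2[OF sob_t(2)[OF r]] AE_reps(3)[OF r] AE_reps(2)[OF r]] by (simp add: ip_def)
  then have "tint 0 t (\<lambda>r. \<integral>x. Q r x \<bullet> P r x \<partial>torus) = tint 0 t (\<lambda>r. ip (Qr r) (Pr r))"
    by (intro tint_cong) (use t in auto)
  with sol_energy[OF t] show ?thesis by (simp add: total_energy_eq[OF t] total_energy_eq[OF 0])
qed

theorem D_le_0:
  assumes \<tau>: "\<tau> \<in> {0..T}" shows "D \<tau> \<le> 0"
proof -
  obtain K where K: "0 \<le> K" "negl T mass K (\<lambda>a b. energy b - energy a - 2 * \<Lambda> * tint a b (\<lambda>t. ip (Qr t) (Pr t)))"
    by (rule energy_negligible, rule that)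
  obtain c where c: "c > 0" "\<And>\<tau>. \<tau> \<in> {0..T} \<Longrightarrow> mass 0 \<tau> \<le> c * tint 0 \<tau> D"
    by (rule mass_le, rule that)
  note cont = continuous_tint[OF CL_ip_continuous[OF CL_CP[OF CP_reps(3)] CL_CP[OF CP_reps(2)]]]
  have diff: "D b - D a = - (energy b - energy a - 2 * \<Lambda> * tint a b (\<lambda>t. ip (Qr t) (Pr t)))"
    if ab: "0 \<le> a" "a \<le> b" "b \<le> T" for a b
    using tint_split[OF cont[OF order_refl ab(3)] ab(1,2)] ab
    by (simp add: D_eq algebra_simps flip: distrib_left)
  have "D \<tau> - D 0 \<le> K * mass 0 \<tau>" if "0 \<le> \<tau>" "\<tau> \<le> T" for \<tau>
  proof (rule partition_estimate[of "\<lambda>a b. K * mass a b" T D \<tau>, OF _ _ _ that])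
    show "0 \<le> K * mass a b" for a b using K(1) mass_nonneg by simp
    show "K * mass 0 a + K * mass a b \<le> K * mass 0 b" if "0 \<le> a" "a \<le> b" "b \<le> T" for a b
      using mult_left_mono[OF mass_superadditive[OF that] K(1)] by (simp add: distrib_left)
    fix e :: real assume e: "e > 0"
    obtain d where d: "d > 0" "\<And>a b. 0 \<le> a \<Longrightarrow> a \<le> b \<Longrightarrow> b \<le> T \<Longrightarrow> b - a < d \<Longrightarrow>
      \<bar>energy b - energy a - 2 * \<Lambda> * tint a b (\<lambda>t. ip (Qr t) (Pr t))\<bar> \<le> K * mass a b + e * (b - a)"
      by (rule neglD[OF K(2) e], rule that)
    show "\<exists>d>0. \<forall>a b. 0 \<le> a \<longrightarrow> a \<le> b \<longrightarrow> b \<le> T \<longrightarrow> b - a < d \<longrightarrow> D b - D a \<le> K * mass a b + e * (b - a)"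
    proof (intro exI[of _ d] conjI allI impI d(1))
      fix a b :: real assume ab: "0 \<le> a" "a \<le> b" "b \<le> T" "b - a < d"
      show "D b - D a \<le> K * mass a b + e * (b - a)" using d(2)[OF ab] unfolding diff[OF ab(1-3)] by linarith
    qed
  qed
  \<comment> \<open>At time 0 the energy increment and the time integral vanish, so the balance
    itself fixes the initial value.\<close>
  moreover have "D 0 = 0" using D_eq[of 0] T tint_split[OF cont[OF order_refl], of 0 0] by simp
  ultimately have le: "D \<tau> \<le> (K * c) * tint 0 \<tau> D" if "0 \<le> \<tau>" "\<tau> \<le> T" for \<tau>
    using that mult_left_mono[OF c(2)[of \<tau>] K(1)] by (fastforce simp: mult.assoc)
  obtain C where C: "AE t in lebesgue_on {0<..<T}. \<bar>D t\<bar> \<le> C" using D by (auto simp: Linf_def)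
  show ?thesis
    by (rule Gronwall_zero[OF _ C _ le]) (use D K c(1) \<tau> in \<open>auto simp: Linf_def\<close>)
qed

end

section \<open>The pressure\<close>

lemma enum_surj: obtains i where "k = enum i"
  using bij_enum by (metis bij_pointE)

text \<open>Unordered summation over all frequencies, so that the sum can be reindexed by
  negation.\<close>

lemma Parseval_has_sum:
  fixes f g :: "real^3 \<Rightarrow> real"
  assumes f: "L2 f" and g: "L2 g"
  shows "((\<lambda>k. hat f k * hat g k) has_sum (ip f g / vol)) UNIV"
proof -
  let ?t = "\<lambda>i. hat f (enum i) * hat g (enum i)"
  have "(\<lambda>n. ip f (trunc n g) / vol) \<longlonglongrightarrow> ip f g / vol"
    by (intro tendsto_divide ip_trunc_tendsto f g tendsto_const) (use vol_pos in simp)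
  moreover have "ip f (trunc n g) / vol = (\<Sum>i<n. ?t i)" for n
    using vol_pos by (simp add: ip_tpoly[OF f])
  ultimately have "?t sums (ip f g / vol)" by (simp add: sums_def)
  moreover have "summable (\<lambda>i. norm (?t i))"
  proof (rule summable_comparison_test'[OF summable_add[OF Bessel_summable[OF f] Bessel_summable[OF g]]])
    fix n
    have "2 * (\<bar>hat f (enum n)\<bar> * \<bar>hat g (enum n)\<bar>) \<le> \<bar>hat f (enum n)\<bar>\<^sup>2 + \<bar>hat g (enum n)\<bar>\<^sup>2"
      using sum_squares_bound[of "\<bar>hat f (enum n)\<bar>" "\<bar>hat g (enum n)\<bar>"] by (simp add: mult.assoc)
    moreover have "0 \<le> \<bar>hat f (enum n)\<bar> * \<bar>hat g (enum n)\<bar>" by simp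
    ultimately show "norm (norm (?t n)) \<le> (norm (hat f (enum n)))\<^sup>2 + (norm (hat g (enum n)))\<^sup>2"
      by (simp only: real_norm_def abs_mult abs_abs)
  qed
  ultimately have "(?t has_sum (ip f g / vol)) UNIV" by (rule norm_summable_imp_has_sum[rotated])
  then show ?thesis using has_sum_reindex_bij_betw[OF bij_enum, of "\<lambda>k. hat f k * hat g k"] by simp
qed

text \<open>Parseval turns both sides of the weak formulation into frequency sums that coincide
  after reindexing by negation.\<close>

lemma has_weak_deriv_if_hat:
  fixes f g :: "real^3 \<Rightarrow> real"
  assumes f: "L2 f" and g: "L2 g" and eq: "\<And>k. hat g k = - real_of_int (k $ j) * hat f (- k)"
  shows "has_weak_deriv (axis j 1) f g"
  unfolding has_weak_deriv_def pd_multi_axis_1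
proof (intro allI impI)
  fix \<phi> :: "real^3 \<Rightarrow> real" assume \<phi>: "torus_smooth \<phi>"
  note \<phi>' = torus_smooth_pd[OF \<phi>, of j]
  have L: "L2 \<phi>" "L2 (pd j \<phi>)" by (intro L2_continuous torus_smooth_continuous \<phi> \<phi>')+
  have h: "hat (pd j \<phi>) k = - real_of_int (k $ j) * hat \<phi> (- k)" for k
    using hat_weak_deriv_1[OF has_weak_deriv_classical[OF torus_smooth_continuous[OF \<phi>] torus_smooth_periodic[OF \<phi>]
      torus_smooth_continuous[OF \<phi>'] torus_smooth_has_partial[OF \<phi>]]] by simp
  have "((\<lambda>k. hat (pd j \<phi>) k * hat f k) has_sum (ip (pd j \<phi>) f / vol)) UNIV" by (rule Parseval_has_sum[OF L(2) f])
  moreover have "((\<lambda>k. - (hat \<phi> (- k) * hat g (- k))) has_sum (- (ip \<phi> g / vol))) UNIV"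
  proof (rule has_sum_uminusI)
    have "bij (uminus :: int^3 \<Rightarrow> int^3)" by (rule bij_uminus)
    from has_sum_reindex_bij_betw[OF this, of "\<lambda>k. hat \<phi> k * hat g k" "ip \<phi> g / vol"] Parseval_has_sum[OF L(1) g]
    show "((\<lambda>k. hat \<phi> (- k) * hat g (- k)) has_sum (ip \<phi> g / vol)) UNIV" by simp
  qed
  moreover have "- (hat \<phi> (- k) * hat g (- k)) = hat (pd j \<phi>) k * hat f k" for k by (simp add: h eq)
  ultimately have "ip (pd j \<phi>) f / vol = - (ip \<phi> g / vol)" by (simp add: has_sum_unique)
  then have "ip (pd j \<phi>) f / vol = (- ip \<phi> g) / vol" by simp
  then have "ip (pd j \<phi>) f = - ip \<phi> g" using vol_pos divide_cancel_right[of _ vol] by (metis less_irrefl)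
  then show "(\<integral>x. pd j \<phi> x *\<^sub>R f x \<partial>torus) = (- 1) ^ mi_order (axis j 1) *\<^sub>R (\<integral>x. \<phi> x *\<^sub>R g x \<partial>torus)"
    by (simp add: ip_def)
qed

text \<open>Domination by the coefficients of an \<open>L2\<close> function, rearranged by the
  injection \<sigma>, gives the square summability that \<open>Riesz_Fischer\<close> asks
  for.\<close>

lemma L2_with_hat:
  fixes a :: "int^3 \<Rightarrow> 'b::euclidean_space"
  assumes w: "L2 w" and \<sigma>: "inj \<sigma>" and le: "\<And>k. norm (a k) \<le> norm (hat w (\<sigma> k))"
  shows "\<exists>f. L2 f \<and> (\<forall>k. hat f k = a k)"
proof -
  have sm: "summable (\<lambda>i. (norm (a (enum i)))\<^sup>2)"
  proof (rule summableI_nonneg_bounded)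
    fix n
    have "(\<Sum>i<n. (norm (a (enum i)))\<^sup>2) \<le> (\<Sum>i<n. (norm (hat w (\<sigma> (enum i))))\<^sup>2)"
      by (intro sum_mono power_mono le) simp
    also have "\<dots> = (\<Sum>k\<in>(\<lambda>i. \<sigma> (enum i)) ` {..<n}. (norm (hat w k))\<^sup>2)"
      by (subst sum.reindex) (auto simp: inj_on_def injD[OF \<sigma>] dest: injD[OF \<sigma>])
    also have "\<dots> \<le> ip w w / vol" by (rule Bessel[OF w]) simp
    finally show "(\<Sum>i<n. (norm (a (enum i)))\<^sup>2) \<le> ip w w / vol" .
  qed simp
  obtain f where f: "L2 f" "\<And>i. hat f (enum i) = a (enum i)"
    by (rule Riesz_Fischer[OF sm], rule that)
  have "hat f k = a k" for k by (rule enum_surj[of k]) (simp add: f(2))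
  with f(1) show ?thesis by blast
qed

text \<open>
  In the Hartley basis \<open>\<partial>\<^sub>j\<close> maps the coefficient at \<open>- k\<close> to the one at \<open>k\<close>; the pressure is the
  solution of \<open>\<Delta> p = div w\<close>, and the zero mode is \<open>0\<close> because of \<open>x / 0 = 0\<close>.
\<close>

definition pressure :: "(real^3 \<Rightarrow> real^3) \<Rightarrow> real^3 \<Rightarrow> real" where
  "pressure w = (SOME p. L2 p \<and> (\<forall>k. hat p k = (freq k \<bullet> hat w (- k)) / (norm (freq k))\<^sup>2))"

text \<open>The projection of \<open>w\<close> onto gradients. The sign is positive because the
  minus of \<open>hat_weak_deriv_1\<close> meets the one of \<open>freq (- k)\<close>.\<close>

definition pressure_grad :: "(real^3 \<Rightarrow> real^3) \<Rightarrow> 3 \<Rightarrow> real^3 \<Rightarrow> real" where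
  "pressure_grad w j = (SOME q. L2 q \<and> (\<forall>k. hat q k = real_of_int (k $ j) * ((freq k \<bullet> hat w k) / (norm (freq k))\<^sup>2)))"

lemma pressure_coefficient_le:
  "\<bar>(freq k \<bullet> a) / (norm (freq k))\<^sup>2\<bar> \<le> norm a"
  "\<bar>real_of_int (k $ j) * ((freq k \<bullet> a) / (norm (freq k))\<^sup>2)\<bar> \<le> norm a"
proof -
  show 2: "\<bar>real_of_int (k $ j) * ((freq k \<bullet> a) / (norm (freq k))\<^sup>2)\<bar> \<le> norm a" for j
  proof (cases "k = 0")
    case False
    then have n: "norm (freq k) > 0" by simp
    have "\<bar>freq k $ j\<bar> * \<bar>freq k \<bullet> a\<bar> \<le> norm (freq k) * (norm (freq k) * norm a)"
      by (intro mult_mono component_le_norm_cart Cauchy_Schwarz_ineq2) auto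
    then show ?thesis using n by (simp add: abs_mult pos_divide_le_eq power2_eq_square mult_ac)
  qed simp
  show "\<bar>(freq k \<bullet> a) / (norm (freq k))\<^sup>2\<bar> \<le> norm a"
  proof (cases "k = 0")
    case False
    \<comment> \<open>A nonzero integer frequency has a component of modulus at least 1, so the
      bound with that factor implies the one without it.\<close>
    then obtain i where "k $ i \<noteq> 0" by (auto simp: vec_eq_iff)
    then have "1 \<le> \<bar>real_of_int (k $ i)\<bar>" by simp
    then have "1 * \<bar>(freq k \<bullet> a) / (norm (freq k))\<^sup>2\<bar> \<le> \<bar>real_of_int (k $ i)\<bar> * \<bar>(freq k \<bullet> a) / (norm (freq k))\<^sup>2\<bar>"
      by (rule mult_right_mono) simp
    with 2[of i] show ?thesis by (simp only: abs_mult mult_1)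
  qed simp
qed

lemma pressure:
  assumes w: "L2 w"
  shows "L2 (pressure w)" "hat (pressure w) k = (freq k \<bullet> hat w (- k)) / (norm (freq k))\<^sup>2"
    "L2 (pressure_grad w j)" "hat (pressure_grad w j) k = real_of_int (k $ j) * ((freq k \<bullet> hat w k) / (norm (freq k))\<^sup>2)"
proof -
  have "\<exists>p. L2 p \<and> (\<forall>k. hat p k = (freq k \<bullet> hat w (- k)) / (norm (freq k))\<^sup>2)"
    by (rule L2_with_hat[OF w, of uminus]) (simp, simp only: real_norm_def pressure_coefficient_le(1))
  from someI_ex[OF this, folded pressure_def]
  show "L2 (pressure w)" "hat (pressure w) k = (freq k \<bullet> hat w (- k)) / (norm (freq k))\<^sup>2" by blast+
  have "\<exists>q. L2 q \<and> (\<forall>k. hat q k = real_of_int (k $ j) * ((freq k \<bullet> hat w k) / (norm (freq k))\<^sup>2))"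
    by (rule L2_with_hat[OF w, of "\<lambda>k. k"]) (simp, simp only: real_norm_def pressure_coefficient_le(2))
  from someI_ex[OF this, folded pressure_grad_def]
  show "L2 (pressure_grad w j)" "hat (pressure_grad w j) k = real_of_int (k $ j) * ((freq k \<bullet> hat w k) / (norm (freq k))\<^sup>2)" by blast+
qed

lemma pressure_weak_deriv:
  assumes w: "L2 w" shows "has_weak_deriv (axis j 1) (pressure w) (pressure_grad w j)"
  by (rule has_weak_deriv_if_hat) (simp_all add: pressure[OF w])

text \<open>On coefficients both maps are linear and do not increase norms, up to negating
  frequencies. Parseval makes them contractions of \<open>L2\<close>, whichever representatives are
  chosen at the single times.\<close>

lemma CL_pressure:
  assumes w: "CL T w" shows "CL T (\<lambda>t. pressure (w t))" "CL T (\<lambda>t. pressure_grad (w t) j)"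
proof -
  note L = CL_L2[OF w]
  show "CL T (\<lambda>t. pressure (w t))"
  proof (rule CL_dominated[OF w, of _ 1])
    fix r t assume r: "r \<in> {0..T}" and t: "t \<in> {0..T}"
    show "n2 (\<lambda>x. pressure (w r) x - pressure (w t) x) \<le> 1 * n2 (\<lambda>x. w r x - w t x)"
    proof (rule n2_le_if_hat_le[where \<sigma> = uminus])
      show "norm (hat (\<lambda>x. pressure (w r) x - pressure (w t) x) k) \<le> 1 * norm (hat (\<lambda>x. w r x - w t x) (- k))" for k
        using pressure_coefficient_le(1)[of k "hat (w r) (- k) - hat (w t) (- k)"]
        by (simp only: hat_diff pressure L r t inner_diff_right diff_divide_distrib real_norm_def mult_1)
    qed (auto intro!: L2_diff pressure L r t)
  qed (auto intro!: pressure L)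
  show "CL T (\<lambda>t. pressure_grad (w t) j)"
  proof (rule CL_dominated[OF w, of _ 1])
    fix r t assume r: "r \<in> {0..T}" and t: "t \<in> {0..T}"
    show "n2 (\<lambda>x. pressure_grad (w r) j x - pressure_grad (w t) j x) \<le> 1 * n2 (\<lambda>x. w r x - w t x)"
    proof (rule n2_le_if_hat_le[where \<sigma> = "\<lambda>k. k"])
      show "norm (hat (\<lambda>x. pressure_grad (w r) j x - pressure_grad (w t) j x) k) \<le> 1 * norm (hat (\<lambda>x. w r x - w t x) k)" for k
        using pressure_coefficient_le(2)[of k j "hat (w r) k - hat (w t) k"]
        by (simp only: hat_diff pressure L r t inner_diff_right diff_divide_distrib right_diff_distrib real_norm_def mult_1)
    qed (auto intro!: L2_diff pressure L r t)
  qed (auto intro!: pressure L)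
qed

lemma CL_scaleR_const:
  fixes u :: "real \<Rightarrow> real^3 \<Rightarrow> real" and c :: "'b::euclidean_space"
  assumes u: "CL T u" shows "CL T (\<lambda>t x. u t x *\<^sub>R c)"
proof (rule CL_dominated[OF u, of _ "norm c"])
  have L: "L2 (\<lambda>x. u t x *\<^sub>R c)" if "t \<in> {0..T}" for t
  proof -
    have "integrable torus (\<lambda>x. (norm c)\<^sup>2 * (norm (u t x))\<^sup>2)"
      by (rule integrable_mult_right[OF L2_power2[OF CL_L2[OF u that]]])
    moreover have "(\<lambda>x. u t x *\<^sub>R c) \<in> borel_measurable torus"
      using L2_measurable[OF CL_L2[OF u that]] by (intro borel_measurable_scaleR) auto
    ultimately show ?thesis by (simp add: L2_def power_mult_distrib mult.commute)
  qed
  then show "L2 (\<lambda>x. u t x *\<^sub>R c)" if "t \<in> {0..T}" for t using that by blast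
  fix r t assume "r \<in> {0..T}" "t \<in> {0..T}"
  have "ip (\<lambda>x. u r x *\<^sub>R c - u t x *\<^sub>R c) (\<lambda>x. u r x *\<^sub>R c - u t x *\<^sub>R c)
      = (norm c)\<^sup>2 * ip (\<lambda>x. u r x - u t x) (\<lambda>x. u r x - u t x)"
    unfolding ip_self by (simp add: power_mult_distrib mult.commute flip: scaleR_diff_left)
  then show "n2 (\<lambda>x. u r x *\<^sub>R c - u t x *\<^sub>R c) \<le> norm c * n2 (\<lambda>x. u r x - u t x)"
    by (simp add: n2_def real_sqrt_mult)
qed simp

lemma CL_sum: "finite I \<Longrightarrow> (\<And>i. i \<in> I \<Longrightarrow> CL T (u i)) \<Longrightarrow> CL T (\<lambda>t x. \<Sum>i\<in>I. u i t x)"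
  by (induction I rule: finite_induct) (auto intro: CL_add CL_const[OF L2_const])

lemma mi_order_le_1: "mi_order \<alpha> \<le> 1 \<longleftrightarrow> \<alpha> = 0 \<or> (\<exists>j. \<alpha> = axis j 1)"
proof
  assume le: "mi_order \<alpha> \<le> 1"
  show "\<alpha> = 0 \<or> (\<exists>j. \<alpha> = axis j 1)"
  proof (cases "\<alpha> = 0")
    case False
    then obtain j where j: "\<alpha> $ j \<noteq> 0" by (auto simp: vec_eq_iff)
    have "mi_order \<alpha> = \<alpha> $ j + (\<Sum>i\<in>UNIV - {j}. \<alpha> $ i)" unfolding mi_order_def by (rule sum.remove) auto
    with le j have "\<alpha> $ j = 1" "(\<Sum>i\<in>UNIV - {j}. \<alpha> $ i) = 0" by linarith+
    then have "\<alpha> = axis j 1" by (auto simp: vec_eq_iff axis_def)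
    then show ?thesis by blast
  qed simp
qed auto

lemma L1_sob_CL:
  fixes u :: "real \<Rightarrow> real^3 \<Rightarrow> 'b::euclidean_space"
  assumes sob: "\<And>t. t \<in> {0..T} \<Longrightarrow> sob m (u t)" and cl: "\<And>\<alpha>. mi_order \<alpha> \<le> m \<Longrightarrow> CL T (\<lambda>t. wD \<alpha> (u t))"
  shows "L1_sob T m u"
  unfolding L1_sob_def
proof (intro conjI allI impI)
  show "AE t in lebesgue_on {0<..<T}. sob m (u t)" by (rule AE_I2) (auto intro!: sob)
  show "(\<lambda>t. sob_inner m (u t) \<psi>) \<in> borel_measurable (lebesgue_on {0<..<T})" if \<psi>: "sob m \<psi>" for \<psi>
    unfolding sob_inner_def ip_def[symmetric]
    by (rule measurable_open_interval(1), rule continuous_on_sum, rule CL_ip_continuous[OF cl CL_const])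
      (use sob_wD(1)[OF \<psi>] in auto)
  show "integrable (lebesgue_on {0<..<T}) (\<lambda>t. sob_norm m (u t))"
    unfolding sob_norm_def sob_inner_def ip_def[symmetric]
    by (rule measurable_open_interval(2), rule continuous_on_real_sqrt, rule continuous_on_sum, rule CL_ip_continuous[OF cl cl]) auto
qed

lemma L1_sob_pressure:
  assumes w: "CL T w" shows "L1_sob T 1 (\<lambda>t. pressure (w t))"
proof (rule L1_sob_CL)
  note L = CL_L2[OF w]
  show "sob 1 (pressure (w t))" if "t \<in> {0..T}" for t
    unfolding sob_def mi_order_le_1
    using pressure(1)[OF L[OF that]] pressure(3)[OF L[OF that]] pressure_weak_deriv[OF L[OF that]] has_weak_deriv_0 by blast
  show "CL T (\<lambda>t. wD \<alpha> (pressure (w t)))" if "mi_order \<alpha> \<le> 1" for \<alpha>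
    using that unfolding mi_order_le_1
  proof (elim disjE exE)
    assume "\<alpha> = 0" then show ?thesis using CL_pressure(1)[OF w] by (simp add: wD_def)
  next
    fix j assume \<alpha>: "\<alpha> = axis j 1"
    show ?thesis unfolding \<alpha>
    proof (rule CL_cong_AE[OF CL_pressure(2)[OF w, of j]])
      fix t assume "t \<in> {0..T}"
      from wD_if_weak_deriv(3)[OF pressure(3)[OF L[OF this]] pressure_weak_deriv[OF L[OF this]] axis_neq_0]
      have "AE x in torus. wd j (pressure (w t)) x = pressure_grad (w t) j x" by simp
      then show "AE x in torus. pressure_grad (w t) j x = wd j (pressure (w t)) x" by eventually_elim simp
    qed
  qed
qed

text \<open>Passes from the continuous representatives to the given fields and from classical rates
  to those formed with \<open>wD\<close>; the increments need to be checked on modes only.\<close>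

lemma has_weak_time_deriv_cong_AE:
  fixes u w u' w' :: "real \<Rightarrow> real^3 \<Rightarrow> 'b::euclidean_space"
  assumes T: "T > 0" and u: "CL T u" and w: "CL T w"
    and uu: "\<And>t. t \<in> {0..T} \<Longrightarrow> AE x in torus. u t x = u' t x" and ww: "\<And>t. t \<in> {0..T} \<Longrightarrow> AE x in torus. w t x = w' t x"
    and incr: "\<And>a b k c. 0 \<le> a \<Longrightarrow> a \<le> b \<Longrightarrow> b \<le> T \<Longrightarrow>
      ip (\<lambda>x. u b x - u a x) (\<lambda>x. cas k x *\<^sub>R c) = tint a b (\<lambda>t. ip (w t) (\<lambda>x. cas k x *\<^sub>R c))"
  shows "has_weak_time_deriv T u' w'"
proof (rule has_weak_time_deriv_I[OF T CL_cong_AE[OF u uu] CL_cong_AE[OF w ww]])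
  fix a b :: real and \<psi> :: "real^3 \<Rightarrow> 'b" assume ab: "0 \<le> a" "a \<le> b" "b \<le> T" and \<psi>: "L2 \<psi>"
  then have a: "a \<in> {0..T}" and b: "b \<in> {0..T}" by auto
  have L: "L2 (\<lambda>x. u b x - u a x)" by (intro L2_diff CL_L2[OF u] a b)
  have ae: "AE x in torus. u b x - u a x = u' b x - u' a x" using uu[OF a] uu[OF b] by eventually_elim simp
  have "ip (\<lambda>x. u' b x - u' a x) \<psi> = ip (\<lambda>x. u b x - u a x) \<psi>"
    using ip_cong_AE[OF L \<psi> ae, of \<psi>] by simp
  also have "\<dots> = tint a b (\<lambda>t. ip (w t) \<psi>)"
    by (rule weak_increment_density[OF L w ab incr[OF ab] \<psi>])
  also have "\<dots> = tint a b (\<lambda>t. ip (w' t) \<psi>)"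
  proof (rule tint_cong)
    fix t assume "t \<in> {a..b}"
    then have t: "t \<in> {0..T}" using ab by auto
    show "ip (w t) \<psi> = ip (w' t) \<psi>" using ip_cong_AE[OF CL_L2[OF w t] \<psi> ww[OF t], of \<psi>] by simp
  qed
  finally show "ip (\<lambda>x. u' b x - u' a x) \<psi> = tint a b (\<lambda>t. ip (w' t) \<psi>)" .
qed assumption+

section \<open>Vanishing of the defects and the equations without them\<close>

context regular_dissipative
begin

theorem D_zero: "AE t in lebesgue_on {0<..<T}. D t = 0"
proof -
  have "AE t in lebesgue_on {0<..<T}. D t \<le> 0" by (rule AE_I2) (auto intro: D_le_0)
  with D_nonneg show ?thesis by eventually_elim simp
qed

lemma mass_zero: "mass 0 T = 0"
proof -
  obtain c where c: "c > 0" "\<And>\<tau>. \<tau> \<in> {0..T} \<Longrightarrow> mass 0 \<tau> \<le> c * tint 0 \<tau> D"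
    by (rule mass_le, rule that)
  have "AE t in lebesgue_on {0..T}. D t = 0" by (rule AE_time_mono[OF D_zero]) auto
  then have "tint 0 T D = 0" by (rule integral_eq_zero_AE)
  then have "mass 0 T \<le> 0" using c(2)[of T] T by simp
  with mass_nonneg[of 0 T] show ?thesis by simp
qed

text \<open>A vanishing lower integral of a function not known to be measurable does not make it 0
  almost everywhere, so the conclusion is drawn for the measurable pairing with one fixed
  \<psi>.\<close>

lemma pairing_zero:
  fixes R :: "real \<Rightarrow> (real^3) set \<Rightarrow> 'b::euclidean_space"
  assumes R: "Linf_measure T R" and le: "\<And>t. tv_norm (R t) \<le> tv_norm (R1 t) + tv_norm (R2 t)"
    and \<psi>: "continuous_on UNIV \<psi>" "periodic \<psi>"
  shows "AE t in lebesgue_on {0<..<T}. pairing (R t) \<psi> = 0"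
proof -
  obtain B where B: "B > 0" "\<And>x. x \<in> cell \<Longrightarrow> norm (\<psi> x) \<le> B" by (rule bounded_on_cell[OF \<psi>(1)], rule that)
  note b = tint_pairing_bound[OF R order_refl less_imp_le[OF T] order_refl \<psi> B(2,1) le mass_finite[OF order_refl less_imp_le[OF T] order_refl]]
  have "tint 0 T (\<lambda>t. \<bar>pairing (R t) \<psi>\<bar>) \<le> 0" using b(3) mass_zero by (simp add: mass_def)
  then have "tint 0 T (\<lambda>t. \<bar>pairing (R t) \<psi>\<bar>) = 0" by (intro antisym Bochner_Integration.integral_nonneg) auto
  then have "AE t in lebesgue_on {0..T}. \<bar>pairing (R t) \<psi>\<bar> = 0"
    using integral_nonneg_eq_0_iff_AE[of "lebesgue_on {0..T}" "\<lambda>t. \<bar>pairing (R t) \<psi>\<bar>"] b(2) by simp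
  then show ?thesis using AE_time_open by simp
qed

text \<open>Countably many modes yield a single null set of times outside which all pairings vanish,
  and Hartley functions determine the measure.\<close>

lemma defect_measure_zero:
  fixes R :: "real \<Rightarrow> (real^3) set \<Rightarrow> 'b::euclidean_space"
  assumes R: "Linf_measure T R" and le: "\<And>t. tv_norm (R t) \<le> tv_norm (R1 t) + tv_norm (R2 t)"
  shows "AE t in lebesgue_on {0<..<T}. \<forall>A\<in>cell_sets. R t A = 0"
proof -
  have "AE t in lebesgue_on {0<..<T}. \<forall>i. \<forall>b\<in>Basis. pairing (R t) (\<lambda>x. cas (enum i) x *\<^sub>R b) = 0"
    unfolding AE_all_countable
  proof (intro allI AE_finite_allI finite_Basis)
    fix i and b :: 'b
    show "AE t in lebesgue_on {0<..<T}. pairing (R t) (\<lambda>x. cas (enum i) x *\<^sub>R b) = 0"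
      unfolding cas_scale_eq_tpoly by (rule pairing_zero[OF R le continuous_tpoly periodic_tpoly])
  qed
  moreover have "AE t in lebesgue_on {0<..<T}. tensor_measure (R t)" using R by (simp add: Linf_measure_def)
  moreover obtain C where "AE t in lebesgue_on {0<..<T}. tv_norm (R t) \<le> ennreal C" using R by (auto simp: Linf_measure_def)
  ultimately show ?thesis
  proof eventually_elim
    fix t assume z: "\<forall>i. \<forall>b\<in>Basis. pairing (R t) (\<lambda>x. cas (enum i) x *\<^sub>R b) = 0"
      and tm: "tensor_measure (R t)" and fin: "tv_norm (R t) \<le> ennreal C"
    have "tv_norm (R t) < \<infinity>" using fin by (rule le_less_trans) simp
    moreover have "pairing (R t) (\<lambda>x. cas k x *\<^sub>R b) = 0" if "b \<in> Basis" for k b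
      by (rule enum_surj[of k]) (use z that in simp)
    ultimately show "\<forall>A\<in>cell_sets. R t A = 0" using tensor_measure_zero[OF tm] by blast
  qed
qed

lemma tint_pairing_zero:
  assumes "0 \<le> a" "b \<le> T"
  shows "tint a b (\<lambda>t. pairing (R1 t) (grad_v (tpoly \<kappa> c n))) = 0" "tint a b (\<lambda>t. pairing (R2 t) (grad_m (tpoly \<kappa> c' n))) = 0"
  by (rule integral_eq_zero_AE, rule AE_time_mono[OF _ assms(2,1)],
      rule pairing_zero, rule R1 R2, simp, rule continuous_grad_v_tpoly continuous_grad_m_tpoly, rule periodic_grad_tpoly)+

text \<open>The Leray projection of \<open>vt\<close>: the gradient part, invisible to
  divergence-free tests, is removed.\<close>

definition "vp t x = vt t x - (\<chi> j. pressure_grad (vt t) j x)"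

lemma CL_vp: "CL T vp"
proof -
  have "CL T (\<lambda>t x. \<Sum>j\<in>UNIV. pressure_grad (vt t) j x *\<^sub>R (axis j 1 :: real^3))"
    by (intro CL_sum finite CL_scaleR_const CL_pressure CL_CP[OF CP_rates(1)])
  moreover have "(\<Sum>j\<in>UNIV. r j *\<^sub>R (axis j 1 :: real^3)) = (\<chi> j. r j)" for r :: "3 \<Rightarrow> real"
    by (simp add: vec_eq_iff axis_def if_distrib cong: if_cong)
  ultimately show ?thesis
    unfolding vp_def[abs_def] by (intro CL_diff CL_CP[OF CP_rates(1)]) simp
qed

lemma hat_vp:
  assumes t: "t \<in> {0..T}"
  shows "hat (vp t) k = hat (vt t) k - ((freq k \<bullet> hat (vt t) k) / (norm (freq k))\<^sup>2) *\<^sub>R freq k"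
proof -
  note L = CP_L2[OF CP_rates(1) t]
  have Lp: "L2 (vp t)" by (rule CL_L2[OF CL_vp t])
  have "hat (vp t) k $ j = (hat (vt t) k - ((freq k \<bullet> hat (vt t) k) / (norm (freq k))\<^sup>2) *\<^sub>R freq k) $ j" for j
  proof -
    have "hat (vp t) k $ j = hat (\<lambda>x. vt t x $ j - pressure_grad (vt t) j x) k"
      unfolding hat_nth[OF Lp, symmetric] by (simp add: vp_def)
    then show ?thesis by (simp add: hat_diff hat_nth L L2_nth pressure(3,4)[OF L] mult.commute)
  qed
  then show ?thesis by (simp add: vec_eq_iff)
qed

text \<open>Only divergence-free modes may be tested. Replacing \<open>c\<close> by its component
  \<open>c0\<close> orthogonal to the frequency changes neither side, because the coefficients of
  the velocity increment and of \<open>vp\<close> are orthogonal to the frequency as well.\<close>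

lemma v_modes:
  assumes ab: "0 \<le> a" "a \<le> b" "b \<le> T"
  shows "ip (\<lambda>x. vr b x - vr a x) (\<lambda>x. cas k x *\<^sub>R c) = tint a b (\<lambda>t. ip (vp t) (\<lambda>x. cas k x *\<^sub>R c))"
proof -
  from ab have a: "a \<in> {0..T}" and b: "b \<in> {0..T}" by auto
  \<comment> \<open>For \<open>k = 0\<close> the quotient is 0 by convention and
    \<open>c0 = c\<close>: constant fields are divergence free.\<close>
  define c0 where "c0 = c - ((freq k \<bullet> c) / (norm (freq k))\<^sup>2) *\<^sub>R freq k"
  have ort: "freq k \<bullet> c0 = 0"
    by (cases "k = 0") (simp_all add: c0_def inner_diff_right flip: power2_norm_eq_inner)
  have ip_hat: "ip f (\<lambda>x. cas k x *\<^sub>R d) = vol * (hat f k \<bullet> d)" if "L2 f" for f :: "real^3 \<Rightarrow> real^3" and d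
    using vol_pos by (simp add: hat_inner[OF that])
  have red: "ip f (\<lambda>x. cas k x *\<^sub>R c) = ip f (\<lambda>x. cas k x *\<^sub>R c0)" if "L2 f" "freq k \<bullet> hat f k = 0" for f :: "real^3 \<Rightarrow> real^3"
    using that by (simp add: ip_hat c0_def inner_diff_right inner_commute)
  have hv: "freq k \<bullet> hat (vr t) k = 0" if "t \<in> {0..T}" for t
    using div_zero(1)[OF that] by (simp add: hat_rep[OF sob_t(1)[OF that] s_le(1)])
  have hp: "freq k \<bullet> hat (vp t) k = 0" if "t \<in> {0..T}" for t
    by (cases "k = 0") (simp_all add: hat_vp[OF that] inner_diff_right flip: power2_norm_eq_inner)
  have Ld: "L2 (\<lambda>x. vr b x - vr a x)" by (intro L2_diff L2_reps a b)
  have "freq k \<bullet> hat (\<lambda>x. vr b x - vr a x) k = 0"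
    by (simp only: hat_diff[OF L2_reps(7)[OF b] L2_reps(7)[OF a]] inner_diff_right hv[OF a] hv[OF b])
  then have "ip (\<lambda>x. vr b x - vr a x) (\<lambda>x. cas k x *\<^sub>R c) = ip (\<lambda>x. vr b x - vr a x) (\<lambda>x. cas k x *\<^sub>R c0)"
    by (rule red[OF Ld])
  also have "\<dots> = tint a b (\<lambda>t. ip (vt t) (\<lambda>x. cas k x *\<^sub>R c0))"
  proof -
    have "div_v (tpoly (\<lambda>_. k) (\<lambda>_. c0) 1) x = 0" for x
    proof -
      have "div_v (tpoly (\<lambda>_. k) (\<lambda>_. c0) 1) x = cas (- k) x * (freq k \<bullet> c0)"
        by (simp add: div_v_def pd_tpoly tpoly_def inner_vec_def sum_distrib_left mult.assoc)
      then show ?thesis by (simp add: ort)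
    qed
    from v_increment[OF ab this] show ?thesis unfolding cas_scale_eq_tpoly by (simp add: tint_pairing_zero[OF ab(1,3)])
  qed
  also have "\<dots> = tint a b (\<lambda>t. ip (vp t) (\<lambda>x. cas k x *\<^sub>R c))"
  proof (rule tint_cong)
    fix t assume "t \<in> {a..b}"
    then have t: "t \<in> {0..T}" using ab by auto
    show "ip (vt t) (\<lambda>x. cas k x *\<^sub>R c0) = ip (vp t) (\<lambda>x. cas k x *\<^sub>R c)"
      unfolding red[OF CL_L2[OF CL_vp t] hp[OF t]] ip_hat[OF CL_L2[OF CL_vp t]] ip_hat[OF CP_L2[OF CP_rates(1) t]] hat_vp[OF t]
      by (simp add: inner_diff_left ort)
  qed
  finally show ?thesis .
qed

lemma Sym0_mem:
  assumes t: "t \<in> {0..T}" shows "Pt t x \<in> Sym0"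
  unfolding Pt_def conv_def lap_def
  by (intro subspace_diff subspace_sum subspace_scale subspace_Sym0 Sym0_reps t)

text \<open>Tests are restricted to \<open>Sym0\<close>, but the part of \<open>c\<close> orthogonal
  to \<open>Sym0\<close> pairs to 0 with both sides, whose values lie in \<open>Sym0\<close>. The
  equation thus holds against all matrices, with trace multiplier 0.\<close>

lemma P_modes:
  assumes ab: "0 \<le> a" "a \<le> b" "b \<le> T"
  shows "ip (\<lambda>x. Pr b x - Pr a x) (\<lambda>x. cas k x *\<^sub>R c) = tint a b (\<lambda>t. ip (Pt t) (\<lambda>x. cas k x *\<^sub>R c))"
proof -
  from ab have a: "a \<in> {0..T}" and b: "b \<in> {0..T}" by auto
  obtain c0 c1 where c0: "c0 \<in> span Sym0" and c1: "\<And>w. w \<in> span Sym0 \<Longrightarrow> orthogonal c1 w" and c: "c = c0 + c1"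
    by (rule orthogonal_subspace_decomp_exists[of Sym0 c], rule that)
  have sp: "span Sym0 = Sym0" using subspace_Sym0 by (simp add: span_eq_iff)
  have red: "ip f (\<lambda>x. cas k x *\<^sub>R c) = ip f (\<lambda>x. cas k x *\<^sub>R c0)" if "\<And>x. f x \<in> Sym0" for f
  proof -
    have "f x \<bullet> (cas k x *\<^sub>R c) = f x \<bullet> (cas k x *\<^sub>R c0)" for x
      using c1[of "f x"] that[of x] sp by (simp add: c inner_add_right orthogonal_def inner_commute)
    then show ?thesis by (simp only: ip_def)
  qed
  have "ip (\<lambda>x. Pr b x - Pr a x) (\<lambda>x. cas k x *\<^sub>R c) = ip (\<lambda>x. Pr b x - Pr a x) (\<lambda>x. cas k x *\<^sub>R c0)"
    by (rule red) (intro subspace_diff subspace_Sym0 Sym0_reps a b)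
  also have "\<dots> = tint a b (\<lambda>t. ip (Pt t) (\<lambda>x. cas k x *\<^sub>R c0))"
    using P_increment[OF ab, of "\<lambda>_. c0" "\<lambda>_. k" 1] c0 sp unfolding cas_scale_eq_tpoly
    by (simp add: tint_pairing_zero[OF ab(1,3)])
  also have "\<dots> = tint a b (\<lambda>t. ip (Pt t) (\<lambda>x. cas k x *\<^sub>R c))"
    by (rule tint_cong, rule red[symmetric], rule Sym0_mem) (use ab in auto)
  finally show ?thesis .
qed

section \<open>The equations almost everywhere\<close>

lemma AE_transport:
  assumes t: "t \<in> {0..T}"
  shows "AE x in torus. transport (v t) (v t) x = conv (vr t) (vr' t) x"
    "AE x in torus. transport (v t) (P t) x = conv (vr t) (Pr' t) x"
    "AE x in torus. transport (v t) (Q t) x = conv (vr t) (Qr' t) x"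
proof -
  have "AE x in torus. \<forall>k. wd k (v t) x = vr' t k x" unfolding AE_all_countable by (rule allI) (rule AE_reps(4)[OF t])
  with AE_reps(1)[OF t] show "AE x in torus. transport (v t) (v t) x = conv (vr t) (vr' t) x"
    by eventually_elim (simp add: transport_def conv_def)
  have "AE x in torus. \<forall>k. wd k (P t) x = Pr' t k x" unfolding AE_all_countable by (rule allI) (rule AE_reps(5)[OF t])
  with AE_reps(1)[OF t] show "AE x in torus. transport (v t) (P t) x = conv (vr t) (Pr' t) x"
    by eventually_elim (simp add: transport_def conv_def)
  have "AE x in torus. \<forall>k. wd k (Q t) x = Qr' t k x" unfolding AE_all_countable by (rule allI) (rule AE_reps(6)[OF t])
  with AE_reps(1)[OF t] show "AE x in torus. transport (v t) (Q t) x = conv (vr t) (Qr' t) x"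
    by eventually_elim (simp add: transport_def conv_def)
qed

text \<open>Each entry of the stress has a continuously differentiable representative, whose
  classical derivative is the weak one.\<close>

lemma AE_stress:
  assumes t: "t \<in> {0..T}"
  shows "AE x in torus. wdiv_m (grad_odot (Q t)) x = stress_div (Qr' t) (Qr'' t) x"
proof -
  let ?d = "\<lambda>i j x. Qr' t i x \<bullet> Qr'' t j j x + Qr'' t j i x \<bullet> Qr' t j x"
  have "AE x in torus. wd j (\<lambda>y. grad_odot (Q t) y $ i $ j) x = ?d i j x" for i j
  proof -
    have p: "C1p j (\<lambda>x. Qr' t i x \<bullet> Qr' t j x) (?d i j)" by (rule C1p_inner[OF C1p_reps(4)[OF t] C1p_reps(4)[OF t]])
    note c = C1p_continuous[OF p]
    from AE_reps(6)[OF t, of i] AE_reps(6)[OF t, of j]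
    have ae: "AE x in torus. Qr' t i x \<bullet> Qr' t j x = grad_odot (Q t) x $ i $ j"
      by eventually_elim (simp add: grad_odot_def)
    have "has_weak_deriv (axis j 1) (\<lambda>x. Qr' t i x \<bullet> Qr' t j x) (?d i j)"
      by (rule has_weak_deriv_classical[OF c(1) _ c(2)]) (use p in \<open>simp_all add: C1p_def\<close>)
    from has_weak_deriv_cong_AE[OF L2_continuous[OF c(1)] L2_continuous[OF c(2)] ae _ this]
    have "has_weak_deriv (axis j 1) (\<lambda>y. grad_odot (Q t) y $ i $ j) (?d i j)" by simp
    from wD_if_weak_deriv(3)[OF L2_continuous[OF c(2)] this axis_neq_0] show ?thesis by simp
  qed
  then have "AE x in torus. \<forall>i j. wd j (\<lambda>y. grad_odot (Q t) y $ i $ j) x = ?d i j x"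
    unfolding AE_all_countable by blast
  then show ?thesis
    by eventually_elim (simp add: wdiv_m_def stress_div_def add.commute)
qed

theorem strong: "strong_solution T F s v P Q"
  unfolding strong_solution_def
proof (intro conjI exI)
  let ?p = "\<lambda>t. pressure (vt t)"
  \<comment> \<open>The time derivatives are defined by solving the equations for them in terms of
    the given fields; the content is that they are the weak time derivatives.\<close>
  let ?v' = "\<lambda>t x. - transport (v t) (v t) x - wgrad_s (?p t) x - wdiv_m (grad_odot (Q t)) x"
  let ?P' = "\<lambda>t x. wlaplace (Q t) x - transport (v t) (P t) x - grad_Sym0 F (Q t x)"
  let ?Q' = "\<lambda>t x. P t x - transport (v t) (Q t) x"
  show "regular T s v P Q" by (rule reg)
  show "has_weak_time_deriv T v ?v'"
  proof (rule has_weak_time_deriv_cong_AE[OF T CL_CP[OF CP_reps(1)] CL_vp _ _ v_modes])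
    fix t assume t: "t \<in> {0..T}"
    show "AE x in torus. vr t x = v t x" using AE_reps(1)[OF t] by eventually_elim simp
    note L = CP_L2[OF CP_rates(1) t]
    have "AE x in torus. wd j (?p t) x = pressure_grad (vt t) j x" for j
      using wD_if_weak_deriv(3)[OF pressure(3)[OF L] pressure_weak_deriv[OF L] axis_neq_0] by simp
    then have "AE x in torus. \<forall>j. wd j (?p t) x = pressure_grad (vt t) j x" unfolding AE_all_countable by blast
    with AE_transport(1)[OF t] AE_stress[OF t] show "AE x in torus. vp t x = ?v' t x"
      by eventually_elim (simp add: vp_def vt_def wgrad_s_def)
  qed
  show "has_weak_time_deriv T P ?P'"
  proof (rule has_weak_time_deriv_cong_AE[OF T CL_CP[OF CP_reps(2)] CL_CP[OF CP_rates(2)] _ _ P_modes])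
    fix t assume t: "t \<in> {0..T}"
    show "AE x in torus. Pr t x = P t x" using AE_reps(2)[OF t] by eventually_elim simp
    have "AE x in torus. \<forall>k. wD (axis k 2) (Q t) x = Qr'' t k k x" unfolding AE_all_countable by (rule allI) (rule AE_reps(7)[OF t])
    with AE_transport(2)[OF t] AE_reps(3)[OF t] show "AE x in torus. Pt t x = ?P' t x"
      by eventually_elim (simp add: Pt_def wlaplace_def lap_def)
  qed
  show "has_weak_time_deriv T Q ?Q'"
  proof (rule has_weak_time_deriv_cong_AE[OF T CL_CP[OF CP_reps(3)] CL_CP[OF CP_rates(3)]])
    fix t assume t: "t \<in> {0..T}"
    show "AE x in torus. Qr t x = Q t x" using AE_reps(3)[OF t] by eventually_elim simp
    from AE_transport(3)[OF t] AE_reps(2)[OF t] show "AE x in torus. Qt t x = ?Q' t x"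
      by eventually_elim (simp add: Qt_def)
  qed (rule Q_increment, auto)
  show "L1_sob T 1 ?p" by (rule L1_sob_pressure[OF CL_CP[OF CP_rates(1)]])
  \<comment> \<open>The multiplier is 0: by \<open>Sym0_mem\<close> the right-hand side without it
    is already symmetric and traceless.\<close>
  show "L1_sob T 0 (\<lambda>t x. 0 :: real)" by (rule L1_sob_0_CL[OF CL_const[OF L2_const]])
  show "AE t in lebesgue_on {0<..<T}. AE x in torus. wdiv_v (v t) x = 0 \<and>
      ?v' t x + transport (v t) (v t) x + wgrad_s (?p t) x = - wdiv_m (grad_odot (Q t)) x \<and>
      ?Q' t x + transport (v t) (Q t) x = P t x \<and>
      ?P' t x + transport (v t) (P t) x = - grad_Sym0 F (Q t x) + wlaplace (Q t) x - 0 *\<^sub>R mat 1"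
  proof (rule AE_I2)
    fix t assume "t \<in> space (lebesgue_on {0<..<T})"
    then have t: "t \<in> {0..T}" by simp
    have "AE x in torus. \<forall>k. wd k (v t) x = vr' t k x" unfolding AE_all_countable by (rule allI) (rule AE_reps(4)[OF t])
    then show "AE x in torus. wdiv_v (v t) x = 0 \<and>
      ?v' t x + transport (v t) (v t) x + wgrad_s (?p t) x = - wdiv_m (grad_odot (Q t)) x \<and>
      ?Q' t x + transport (v t) (Q t) x = P t x \<and>
      ?P' t x + transport (v t) (P t) x = - grad_Sym0 F (Q t x) + wlaplace (Q t) x - 0 *\<^sub>R mat 1"
      by eventually_elim (simp add: wdiv_v_def div_zero(2)[OF t])
  qed
qed

end

theorem corollary4p3:
  fixes s :: nat and F :: "real^3^3 \<Rightarrow> real" and \<Lambda> C q T :: real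
    and v :: "real \<Rightarrow> real^3 \<Rightarrow> real^3"
    and P Q :: "real \<Rightarrow> real^3 \<Rightarrow> real^3^3"
    and D :: "real \<Rightarrow> real"
    and R1 :: "real \<Rightarrow> (real^3) set \<Rightarrow> real^3^3"
    and R2 :: "real \<Rightarrow> (real^3) set \<Rightarrow> real^3^3^3"
  assumes s: "s \<ge> 3"
    and F_smooth: "Ck_on (s + 1) Sym0 F"
    and isotropy: "\<And>A R. A \<in> Sym0 \<Longrightarrow> orthogonal_matrix R \<Longrightarrow> F A = F (R ** A ** transpose R)"
    and Lambda: "\<Lambda> \<ge> 0"
    and G_convex: "strictly_convex_on Sym0 (\<lambda>A. F A + \<Lambda> * (norm A)\<^sup>2)"
    and G_nonneg: "\<And>A. A \<in> Sym0 \<Longrightarrow> 0 \<le> F A + \<Lambda> * (norm A)\<^sup>2"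
    and C: "C > 0" and q: "q < 5"
    and growth: "\<And>A. A \<in> Sym0 \<Longrightarrow> norm (grad_Sym0 F A) \<le> C * (1 + norm A powr q)"
    and T: "T > 0"
    and sol: "dissipative_solution T F \<Lambda> v P Q D R1 R2"
    and reg: "regular T s v P Q"
  shows "strong_solution T F s v P Q \<and>
    (AE t in lebesgue_on {0<..<T}. D t = 0) \<and>
    (AE t in lebesgue_on {0<..<T}. \<forall>A\<in>cell_sets. R1 t A = 0) \<and>
    (AE t in lebesgue_on {0<..<T}. \<forall>A\<in>cell_sets. R2 t A = 0)"
proof -
  interpret regular_dissipative s F \<Lambda> T v P Q D R1 R2
    using s F_smooth T sol reg by unfold_locales simp_all
  show ?thesis
    by (intro conjI strong D_zero defect_measure_zero[OF R1] defect_measure_zero[OF R2]) simp_all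
qed

end
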